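(* Let $k\ge 0$ be an integer, $\ell\in\{k,k-1\}$ and $\boldsymbol f\in L^2(\Omega;\mathbb R^d)$. The mixed finite element method: find $(\boldsymbol u_h,\boldsymbol\lambda_h,p_h)\in\mathring{\mathbb V}^{\mathrm{div}}_{k,\ell}\times\mathring\Lambda_k\times(\mathbb P_\ell(\mathcal T_h)/\mathbb R)$ such that $$(\mathrm{dev}\,\mathrm{grad}_w(\boldsymbol u_h,\boldsymbol\lambda_h),\mathrm{dev}\,\mathrm{grad}_w(\boldsymbol v_h,\boldsymbol\mu_h))+(\mathrm{div}\,\boldsymbol v_h,p_h)=(\boldsymbol f,\boldsymbol v_h),\qquad(\mathrm{div}\,\boldsymbol u_h,q_h)=0$$ for all $\boldsymbol v_h\in\mathring{\mathbb V}^{\mathrm{div}}_{k,\ell}$, $\boldsymbol\mu_h\in\mathring\Lambda_k$, $q_h\in\mathbb P_\ell(\mathcal T_h)/\mathbb R$, is well-posed, with a unique solution. Let $\boldsymbol\sigma_h:=\mathrm{dev}\,\mathrm{grad}_w(\boldsymbol u_h,\boldsymbol\lambda_h)$. Then $\boldsymbol\sigma_h\in\Sigma_k^{\mathrm{tn}}$ and $\boldsymbol u_h\in\mathring{\mathbb V}^{\mathrm{div}}_{k,\ell}\cap\ker(\mathrm{div})$ satisfy $$(\boldsymbol\sigma_h,\boldsymbol\tau_h)+(\mathrm{div}_w\boldsymbol\tau_h,\boldsymbol u_h)_{0,h}=0\quad\forall\,\boldsymbol\tau_h\in\Sigma_k^{\mathrm{tn}},\qquad(\mathrm{div}_w\boldsymbol\sigma_h,\boldsymbol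 v_h)_{0,h}=-(\boldsymbol f,\boldsymbol v_h)\quad\forall\,\boldsymbol v_h\in\mathring{\mathbb V}^{\mathrm{div}}_{k,\ell}\cap\ker(\mathrm{div}).$$
   Context: Setting. $\Omega\subset\mathbb R^d$ ($d\ge 2$) is a bounded polytope and $\mathcal T_h$ is a simplicial mesh of $\Omega$ from a shape-regular family. $\mathcal F_h$ (resp. $\mathring{\mathcal F}_h$) is the set of all (resp. interior) faces. Each face $F$ carries a fixed unit normal $\boldsymbol n_F$ (outward to $\Omega$ if $F\subset\partial\Omega$). The jump $[\![v]\!]$ on an interior face is the trace from the element for which $\boldsymbol n_F$ is outward minus the trace from the other element. In integrals over $F$, $\boldsymbol n=\boldsymbol n_F$; in integrals over $\partial T$, $\boldsymbol n$ is the outward unit normal of $T$. $\Pi_F\boldsymbol v=\boldsymbol v-(\boldsymbol v\cdot\boldsymbol n_F)\boldsymbol n_F$, identified with its coordinates in $\mathbb R^{d-1}$ in an orthonormal basis of the tangent space of $F$. $\mathbb T$ is the space of traceless $d\times d$ real matrices. The divergence of matrix fields is row-wise; $(\cdot,\cdot)_D$ is the $L^2(D)$ inner product ($D$ omitted if $D=\Omega$). $\mathbb P_k(D)$: polynomials of degree $\le k$; $\mathbb H_k(D)$: homogeneous polynomials of degree $k$; $\mathbb P_{-1}=\mathbb H_{-1}=\{0\}$. $\mathbb P_\ell(\mathcal T_h)$: piecewise polynomials (discontinuous); $V/\mathbb R=\{q\in V:\int_\Omega q\,\mathrm dx=0\}$. Velocity space: $\mathbb V^{\mathrm{div}}_{k,\ell}(T)=\mathbb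 P_k(T;\mathbb R^d)+\mathbb H_\ell(T)\boldsymbol x$ and $\mathring{\mathbb V}^{\mathrm{div}}_{k,\ell}=\{\boldsymbol v\in H(\mathrm{div},\Omega):\boldsymbol v|_T\in\mathbb V^{\mathrm{div}}_{k,\ell}(T)\ \forall T\in\mathcal T_h,\ \boldsymbol v\cdot\boldsymbol n=0\text{ on }\partial\Omega\}$. $\ker(\mathrm{div})$ denotes the divergence-free fields. Facial multipliers: $\mathring\Lambda_k=\mathbb P_k(\mathring{\mathcal F}_h;\mathbb R^{d-1})=\prod_{F\in\mathring{\mathcal F}_h}\mathbb P_k(F;\mathbb R^{d-1})$ (tangential vector polynomials on interior faces, extended by zero to boundary faces). Stress spaces: $\Sigma_k^{-1}(\mathbb T)=\prod_{T\in\mathcal T_h}\mathbb P_k(T;\mathbb T)$ and $\Sigma_k^{\mathrm{tn}}=\{\boldsymbol\tau\in\Sigma_k^{-1}(\mathbb T):[\![\Pi_F\boldsymbol\tau\boldsymbol n]\!]=0\ \forall F\in\mathring{\mathcal F}_h\}$. Weak operators: for $\boldsymbol\tau\in\Sigma_k^{\mathrm{tn}}$, $(\mathrm{div}_w\boldsymbol\tau,\boldsymbol v)_{0,h}=\sum_{T\in\mathcal T_h}(\mathrm{div}\,\boldsymbol\tau,\boldsymbol v)_T-\sum_{F\in\mathring{\mathcal F}_h}([\![\boldsymbol n^{\intercal}\boldsymbol\tau\boldsymbol n]\!],\boldsymbol n\cdot\boldsymbol v)_F$; and $\mathrm{dev}\,\mathrm{grad}_w(\boldsymbol v,\boldsymbol\mu)\in\Sigma_k^{-1}(\mathbb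 T)$ is defined on each $T\in\mathcal T_h$ by $(\mathrm{dev}\,\mathrm{grad}_w(\boldsymbol v,\boldsymbol\mu),\boldsymbol\tau)_T=-(\boldsymbol v,\mathrm{div}\,\boldsymbol\tau)_T+(\boldsymbol n\cdot\boldsymbol v,\boldsymbol n^{\intercal}\boldsymbol\tau\boldsymbol n)_{\partial T}+(\boldsymbol\mu,\Pi_F\boldsymbol\tau\boldsymbol n)_{\partial T}$ for all $\boldsymbol\tau\in\mathbb P_k(T;\mathbb T)$. *)

theory Defs
  imports "HOL-Analysis.Analysis"
begin

section \<open>Domain, meshes, faces and normals\<close>

text \<open>A bounded polytope in the finite element sense: a bounded domain, not necessarily convex,
  whose closure is a finite union of convex polytopes.  The condition on the interior of the
  closure excludes slits.\<close>

definition polytopal_domain :: "(real^'n) set \<Rightarrow> bool" where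
  "polytopal_domain \<Omega> \<longleftrightarrow>
     open \<Omega> \<and> connected \<Omega> \<and> \<Omega> \<noteq> {} \<and> bounded \<Omega> \<and> interior (closure \<Omega>) = \<Omega> \<and>
     (\<exists>\<P>. finite \<P> \<and> (\<forall>P\<in>\<P>. polytope P) \<and> closure \<Omega> = \<Union>\<P>)"

text \<open>Elements and faces are closed sets.\<close>

definition simplicial_mesh :: "(real^'n) set \<Rightarrow> (real^'n) set set \<Rightarrow> bool" where
  "simplicial_mesh \<Omega> Th \<longleftrightarrow>
     triangulation Th \<and> (\<forall>T\<in>Th. int CARD('n) simplex T) \<and> \<Union>Th = closure \<Omega>"

definition inradius :: "(real^'n) set \<Rightarrow> real" where
  "inradius T = Sup {r. \<exists>c. cball c r \<subseteq> T}"

definition shape_regular_family :: "(real^'n) set \<Rightarrow> (real^'n) set set set \<Rightarrow> bool" where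
  "shape_regular_family \<Omega> \<M> \<longleftrightarrow>
     (\<forall>Th\<in>\<M>. simplicial_mesh \<Omega> Th) \<and>
     (\<exists>\<rho>. \<forall>Th\<in>\<M>. \<forall>T\<in>Th. diameter T \<le> \<rho> * inradius T)"

definition mesh_faces :: "(real^'n) set set \<Rightarrow> (real^'n) set set" where
  "mesh_faces Th = {F. \<exists>T\<in>Th. F facet_of T}"

definition boundary_faces :: "(real^'n) set \<Rightarrow> (real^'n) set set \<Rightarrow> (real^'n) set set" where
  "boundary_faces \<Omega> Th = {F \<in> mesh_faces Th. F \<subseteq> frontier \<Omega>}"

definition interior_faces :: "(real^'n) set \<Rightarrow> (real^'n) set set \<Rightarrow> (real^'n) set set" where
  "interior_faces \<Omega> Th = mesh_faces Th - boundary_faces \<Omega> Th"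

text \<open>The outward unit normal of the full-dimensional simplex \<open>T\<close> on its facet \<open>F\<close>;
  the condition implies orthogonality to \<open>F\<close> (take \<open>y\<close> in \<open>F\<close>).\<close>

definition outward_normal :: "(real^'n) set \<Rightarrow> (real^'n) set \<Rightarrow> real^'n" where
  "outward_normal T F = (THE n. norm n = 1 \<and> (\<forall>x\<in>F. \<forall>y\<in>T. n \<bullet> (y - x) \<le> 0))"

definition face_normals ::
    "(real^'n) set \<Rightarrow> (real^'n) set set \<Rightarrow> ((real^'n) set \<Rightarrow> real^'n) \<Rightarrow> bool" where
  "face_normals \<Omega> Th nF \<longleftrightarrow>
     (\<forall>F\<in>mesh_faces Th. norm (nF F) = 1 \<and> (\<forall>x\<in>F. \<forall>y\<in>F. nF F \<bullet> (y - x) = 0)) \<and>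
     (\<forall>F\<in>boundary_faces \<Omega> Th. \<forall>T\<in>Th. F facet_of T \<longrightarrow> nF F = outward_normal T F)"

definition plus_elem ::
    "(real^'n) set set \<Rightarrow> ((real^'n) set \<Rightarrow> real^'n) \<Rightarrow> (real^'n) set \<Rightarrow> (real^'n) set" where
  "plus_elem Th nF F = (THE T. T \<in> Th \<and> F facet_of T \<and> outward_normal T F = nF F)"

definition minus_elem ::
    "(real^'n) set set \<Rightarrow> ((real^'n) set \<Rightarrow> real^'n) \<Rightarrow> (real^'n) set \<Rightarrow> (real^'n) set" where
  "minus_elem Th nF F = (THE T. T \<in> Th \<and> F facet_of T \<and> outward_normal T F = - nF F)"

text \<open>A field on the mesh is a family \<open>v\<close> with one function \<open>v T\<close> for each element \<open>T\<close>.  Members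
  of the discrete spaces below vanish outside \<open>T\<close> and for every \<open>T\<close> not in the mesh, so that
  equality of families is equality of fields.  As \<open>T\<close> is closed, the trace of \<open>v T\<close> on a facet is
  just \<open>v T\<close> itself.\<close>

definition jump ::
    "(real^'n) set set \<Rightarrow> ((real^'n) set \<Rightarrow> real^'n) \<Rightarrow> ((real^'n) set \<Rightarrow> real^'n \<Rightarrow> 'b::minus)
      \<Rightarrow> (real^'n) set \<Rightarrow> real^'n \<Rightarrow> 'b" where
  "jump Th nF g F x = g (plus_elem Th nF F) x - g (minus_elem Th nF F) x"

definition tangential :: "real^'n \<Rightarrow> real^'n \<Rightarrow> real^'n" where
  "tangential n v = v - (v \<bullet> n) *\<^sub>R n"


section \<open>Integrals\<close>

text \<open>Integral of \<open>g\<close> over the flat face \<open>F\<close> with unit normal \<open>n\<close> with respect to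
  surface measure.  By Fubini this is the Lebesgue integral over the prism of height 1 with
  base \<open>F\<close> of the extension of \<open>g\<close> that is constant in the normal direction
  (\<open>closest_point (affine hull F)\<close> is the orthogonal projection onto the plane of \<open>F\<close>).\<close>

definition face_integral :: "(real^'n) set \<Rightarrow> real^'n \<Rightarrow> (real^'n \<Rightarrow> real) \<Rightarrow> real" where
  "face_integral F n g =
     (LINT y | lebesgue_on {x + t *\<^sub>R n |x t. x \<in> F \<and> 0 \<le> t \<and> t \<le> 1}.
        g (closest_point (affine hull F) y))"

definition ip :: "(real^'n) set \<Rightarrow> (real^'n \<Rightarrow> 'v::euclidean_space) \<Rightarrow> (real^'n \<Rightarrow> 'v) \<Rightarrow> real" where
  "ip D f g = (LINT x | lebesgue_on D. f x \<bullet> g x)"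

text \<open>The \<open>L\<^sup>2(\<Omega>)\<close> inner product of fields given element by element.\<close>

definition mesh_ip :: "(real^'n) set set \<Rightarrow> ((real^'n) set \<Rightarrow> real^'n \<Rightarrow> 'v::euclidean_space)
      \<Rightarrow> ((real^'n) set \<Rightarrow> real^'n \<Rightarrow> 'v) \<Rightarrow> real" where
  "mesh_ip Th f g = (\<Sum>T\<in>Th. ip T (f T) (g T))"

definition L2 :: "(real^'n) set \<Rightarrow> (real^'n \<Rightarrow> 'v::euclidean_space) set" where
  "L2 D = {f. f \<in> borel_measurable (lebesgue_on D) \<and> integrable (lebesgue_on D) (\<lambda>x. (norm (f x))\<^sup>2)}"


section \<open>Differential operators and \<open>H(div)\<close>\<close>

definition partial :: "'n \<Rightarrow> (real^'n \<Rightarrow> 'v::real_normed_vector) \<Rightarrow> real^'n \<Rightarrow> 'v" where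
  "partial j f x = frechet_derivative f (at x) (axis j 1)"

definition divg :: "(real^'n \<Rightarrow> real^'n) \<Rightarrow> real^'n \<Rightarrow> real" where
  "divg v x = (\<Sum>j\<in>UNIV. partial j v x $ j)"

definition row_div :: "(real^'n \<Rightarrow> real^'n^'n) \<Rightarrow> real^'n \<Rightarrow> real^'n" where
  "row_div \<tau> x = (\<chi> i. \<Sum>j\<in>UNIV. partial j \<tau> x $ i $ j)"

definition grad :: "(real^'n \<Rightarrow> real) \<Rightarrow> real^'n \<Rightarrow> real^'n" where
  "grad \<phi> x = (\<chi> j. partial j \<phi> x)"

text \<open>Infinitely differentiable functions: all iterated partial derivatives exist and are
  differentiable (hence continuous).\<close>

coinductive C_infinity :: "(real^'n \<Rightarrow> real) \<Rightarrow> bool" where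
  "\<lbrakk>\<forall>x. \<phi> differentiable (at x); \<forall>j. C_infinity (partial j \<phi>)\<rbrakk> \<Longrightarrow> C_infinity \<phi>"

definition test_functions :: "(real^'n) set \<Rightarrow> (real^'n \<Rightarrow> real) set" where
  "test_functions \<Omega> =
     {\<phi>. C_infinity \<phi> \<and> compact (closure {x. \<phi> x \<noteq> 0}) \<and> closure {x. \<phi> x \<noteq> 0} \<subseteq> \<Omega>}"

definition H_div :: "(real^'n) set \<Rightarrow> (real^'n \<Rightarrow> real^'n) set" where
  "H_div \<Omega> = {v \<in> L2 \<Omega>. \<exists>g\<in>L2 \<Omega>. \<forall>\<phi>\<in>test_functions \<Omega>. ip \<Omega> v (grad \<phi>) = - ip \<Omega> g \<phi>}"

text \<open>The function on \<open>\<Omega>\<close> represented by a field on the mesh.  For fields that vanish outside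
  their elements it equals \<open>v T\<close> in the interior of each \<open>T\<close>; the values on the mesh skeleton, a
  null set, are irrelevant.\<close>

definition glue :: "(real^'n) set set \<Rightarrow> ((real^'n) set \<Rightarrow> real^'n \<Rightarrow> 'v::comm_monoid_add)
      \<Rightarrow> real^'n \<Rightarrow> 'v" where
  "glue Th v x = (\<Sum>T\<in>Th. v T x)"


section \<open>Polynomial spaces\<close>

definition monomial :: "('n \<Rightarrow> nat) \<Rightarrow> real^'n \<Rightarrow> real" where
  "monomial \<alpha> x = (\<Prod>i\<in>UNIV. x $ i ^ \<alpha> i)"

text \<open>Polynomials on \<open>D\<close> with values in the subspace \<open>W\<close>, extended by zero.  The degree is an
  integer; for degree \<open>-1\<close> the index sets are empty and both spaces are \<open>{0}\<close>.\<close>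

definition P_space :: "int \<Rightarrow> (real^'n) set \<Rightarrow> 'v::real_vector set \<Rightarrow> (real^'n \<Rightarrow> 'v) set" where
  "P_space k D W = {p. \<exists>c. (\<forall>\<alpha>. c \<alpha> \<in> W) \<and>
     p = (\<lambda>x. if x \<in> D then \<Sum>\<alpha> | int (\<Sum>i\<in>UNIV. \<alpha> i) \<le> k. monomial \<alpha> x *\<^sub>R c \<alpha> else 0)}"

definition H_space :: "int \<Rightarrow> (real^'n) set \<Rightarrow> (real^'n \<Rightarrow> real) set" where
  "H_space k D = {p. \<exists>c.
     p = (\<lambda>x. if x \<in> D then \<Sum>\<alpha> | int (\<Sum>i\<in>UNIV. \<alpha> i) = k. monomial \<alpha> x *\<^sub>R c \<alpha> else 0)}"

definition V_loc :: "int \<Rightarrow> int \<Rightarrow> (real^'n) set \<Rightarrow> (real^'n \<Rightarrow> real^'n) set" where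
  "V_loc k l T = {\<lambda>x. p x + q x *\<^sub>R x | p q. p \<in> P_space k T UNIV \<and> q \<in> H_space l T}"

text \<open>Families indexed by \<open>I\<close>, zero off \<open>I\<close>.\<close>

definition family_space :: "'i set \<Rightarrow> ('i \<Rightarrow> ('a \<Rightarrow> 'v::zero) set) \<Rightarrow> ('i \<Rightarrow> 'a \<Rightarrow> 'v) set" where
  "family_space I S = {v. (\<forall>i\<in>I. v i \<in> S i) \<and> (\<forall>i. i \<notin> I \<longrightarrow> v i = (\<lambda>_. 0))}"

definition V_div0 :: "(real^'n) set \<Rightarrow> (real^'n) set set \<Rightarrow> ((real^'n) set \<Rightarrow> real^'n)
      \<Rightarrow> int \<Rightarrow> int \<Rightarrow> ((real^'n) set \<Rightarrow> real^'n \<Rightarrow> real^'n) set" where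
  "V_div0 \<Omega> Th nF k l = {v \<in> family_space Th (V_loc k l).
     glue Th v \<in> H_div \<Omega> \<and>
     (\<forall>F\<in>boundary_faces \<Omega> Th. \<forall>T\<in>Th. F facet_of T \<longrightarrow> (\<forall>x\<in>F. v T x \<bullet> nF F = 0))}"

text \<open>For piecewise polynomial fields in \<open>H(div)\<close> the distributional divergence is computed
  element by element.\<close>

definition ker_div :: "(real^'n) set set \<Rightarrow> ((real^'n) set \<Rightarrow> real^'n \<Rightarrow> real^'n) set" where
  "ker_div Th = {v. \<forall>T\<in>Th. \<forall>x\<in>interior T. divg (v T) x = 0}"

text \<open>Pressures, and facial multipliers.  The latter take values in the tangent space of the face
  itself, without choosing an orthonormal basis of it.\<close>

definition Q_space :: "(real^'n) set set \<Rightarrow> int \<Rightarrow> ((real^'n) set \<Rightarrow> real^'n \<Rightarrow> real) set" where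
  "Q_space Th l = {q \<in> family_space Th (\<lambda>T. P_space l T UNIV).
     (\<Sum>T\<in>Th. LINT x | lebesgue_on T. q T x) = 0}"

definition Lambda_space :: "(real^'n) set \<Rightarrow> (real^'n) set set \<Rightarrow> ((real^'n) set \<Rightarrow> real^'n)
      \<Rightarrow> int \<Rightarrow> ((real^'n) set \<Rightarrow> real^'n \<Rightarrow> real^'n) set" where
  "Lambda_space \<Omega> Th nF k =
     family_space (interior_faces \<Omega> Th) (\<lambda>F. P_space k F {w. w \<bullet> nF F = 0})"

definition traceless :: "(real^'n^'n) set" where
  "traceless = {A. trace A = 0}"

definition Sigma_disc ::
    "(real^'n) set set \<Rightarrow> int \<Rightarrow> ((real^'n) set \<Rightarrow> real^'n \<Rightarrow> real^'n^'n) set" where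
  "Sigma_disc Th k = family_space Th (\<lambda>T. P_space k T traceless)"

definition Sigma_tn :: "(real^'n) set \<Rightarrow> (real^'n) set set \<Rightarrow> ((real^'n) set \<Rightarrow> real^'n)
      \<Rightarrow> int \<Rightarrow> ((real^'n) set \<Rightarrow> real^'n \<Rightarrow> real^'n^'n) set" where
  "Sigma_tn \<Omega> Th nF k = {\<tau> \<in> Sigma_disc Th k.
     \<forall>F\<in>interior_faces \<Omega> Th. \<forall>x\<in>F.
       jump Th nF (\<lambda>T y. tangential (nF F) (\<tau> T y *v nF F)) F x = 0}"


section \<open>Weak operators\<close>

text \<open>The pairing \<open>(div\<^sub>w \<tau>, v)\<^sub>0\<^sub>,\<^sub>h\<close>.  The normal component of a field in \<open>H(div)\<close> is single
  valued on an interior face, so it may be evaluated from either side.\<close>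

definition div_w_pair :: "(real^'n) set \<Rightarrow> (real^'n) set set \<Rightarrow> ((real^'n) set \<Rightarrow> real^'n)
      \<Rightarrow> ((real^'n) set \<Rightarrow> real^'n \<Rightarrow> real^'n^'n) \<Rightarrow> ((real^'n) set \<Rightarrow> real^'n \<Rightarrow> real^'n) \<Rightarrow> real" where
  "div_w_pair \<Omega> Th nF \<tau> v =
     (\<Sum>T\<in>Th. ip T (row_div (\<tau> T)) (v T)) -
     (\<Sum>F\<in>interior_faces \<Omega> Th. face_integral F (nF F)
        (\<lambda>x. jump Th nF (\<lambda>T y. nF F \<bullet> (\<tau> T y *v nF F)) F x *
             (nF F \<bullet> v (plus_elem Th nF F) x)))"

definition dev_grad_w :: "(real^'n) set set \<Rightarrow> int
      \<Rightarrow> ((real^'n) set \<Rightarrow> real^'n \<Rightarrow> real^'n) \<Rightarrow> ((real^'n) set \<Rightarrow> real^'n \<Rightarrow> real^'n)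
      \<Rightarrow> (real^'n) set \<Rightarrow> real^'n \<Rightarrow> real^'n^'n" where
  "dev_grad_w Th k v \<mu> = (THE \<sigma>. \<sigma> \<in> Sigma_disc Th k \<and>
     (\<forall>T\<in>Th. \<forall>\<tau>\<in>P_space k T traceless.
        ip T (\<sigma> T) \<tau> = - ip T (v T) (row_div \<tau>)
          + (\<Sum>F | F facet_of T. face_integral F (outward_normal T F)
               (\<lambda>x. let n = outward_normal T F in
                  (n \<bullet> v T x) * (n \<bullet> (\<tau> x *v n))))
          + (\<Sum>F | F facet_of T. face_integral F (outward_normal T F)
               (\<lambda>x. let n = outward_normal T F in
                  \<mu> F x \<bullet> tangential n (\<tau> x *v n)))))"


section \<open>The mixed method\<close>

definition mixed_solution :: "(real^'n) set \<Rightarrow> (real^'n) set set \<Rightarrow> ((real^'n) set \<Rightarrow> real^'n)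
      \<Rightarrow> int \<Rightarrow> int \<Rightarrow> (real^'n \<Rightarrow> real^'n)
      \<Rightarrow> ((real^'n) set \<Rightarrow> real^'n \<Rightarrow> real^'n) \<Rightarrow> ((real^'n) set \<Rightarrow> real^'n \<Rightarrow> real^'n)
      \<Rightarrow> ((real^'n) set \<Rightarrow> real^'n \<Rightarrow> real) \<Rightarrow> bool" where
  "mixed_solution \<Omega> Th nF k l f u lam p \<longleftrightarrow>
     u \<in> V_div0 \<Omega> Th nF k l \<and> lam \<in> Lambda_space \<Omega> Th nF k \<and> p \<in> Q_space Th l \<and>
     (\<forall>v\<in>V_div0 \<Omega> Th nF k l. \<forall>\<mu>\<in>Lambda_space \<Omega> Th nF k.
        mesh_ip Th (dev_grad_w Th k u lam) (dev_grad_w Th k v \<mu>)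
          + mesh_ip Th (\<lambda>T. divg (v T)) p = mesh_ip Th (\<lambda>_. f) v) \<and>
     (\<forall>q\<in>Q_space Th l. mesh_ip Th (\<lambda>T. divg (u T)) q = 0)"

definition mesh_norm ::
    "(real^'n) set set \<Rightarrow> ((real^'n) set \<Rightarrow> real^'n \<Rightarrow> 'v::euclidean_space) \<Rightarrow> real" where
  "mesh_norm Th v = sqrt (mesh_ip Th v v)"

definition face_norm :: "(real^'n) set \<Rightarrow> (real^'n) set set \<Rightarrow> ((real^'n) set \<Rightarrow> real^'n)
      \<Rightarrow> ((real^'n) set \<Rightarrow> real^'n \<Rightarrow> real^'n) \<Rightarrow> real" where
  "face_norm \<Omega> Th nF \<mu> =
     sqrt (\<Sum>F\<in>interior_faces \<Omega> Th. face_integral F (nF F) (\<lambda>x. \<mu> F x \<bullet> \<mu> F x))"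

text \<open>Well-posedness in the sense of Hadamard on the given mesh: existence, uniqueness and, the
  problem being linear, boundedness of the map from data to solution.\<close>

definition well_posed :: "(real^'n) set \<Rightarrow> (real^'n) set set \<Rightarrow> ((real^'n) set \<Rightarrow> real^'n)
      \<Rightarrow> int \<Rightarrow> int \<Rightarrow> bool" where
  "well_posed \<Omega> Th nF k l \<longleftrightarrow>
     (\<forall>f\<in>L2 \<Omega>. \<exists>!(u, lam, p). mixed_solution \<Omega> Th nF k l f u lam p) \<and>
     (\<exists>C. \<forall>f\<in>L2 \<Omega>. \<forall>u lam p. mixed_solution \<Omega> Th nF k l f u lam p \<longrightarrow>
        mesh_norm Th (dev_grad_w Th k u lam) + mesh_norm Th u + face_norm \<Omega> Th nF lam
          + mesh_norm Th p \<le> C * sqrt (ip \<Omega> f f))"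

end

theory Submission
  imports Defs "HOL-Library.Function_Algebras"
begin

text \<open>All discrete spaces have finite dimension, so well-posedness of the mixed method amounts to
  uniqueness for \<open>f = 0\<close>.  There, testing with the solution itself gives \<open>dev grad\<^sub>w (u, \<lambda>) = 0\<close> and
  \<open>div u = 0\<close>, so that \<open>u\<close> is piecewise of degree \<open>k\<close>.  Testing \<open>dev grad\<^sub>w\<close> on one element with
  barycentric multiples of constant traceless matrices whose tangential-normal component vanishes on
  all facets but one shows first that \<open>grad u\<close> vanishes and then that \<open>\<lambda>\<close> is the tangential trace
  of \<open>u\<close> on every facet.  Hence \<open>u\<close> is constant on \<open>\<Omega>\<close> and vanishes at the boundary.  For the
  pressure, a radial bubble in the velocity space shows that \<open>p\<close> is constant on each element, and a
  velocity with unit flux through one face that the constants agree.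

  The stress formulation is the duality of \<open>div\<^sub>w\<close> and \<open>dev grad\<^sub>w\<close>: up to the jumps of the
  tangential-normal component paired with the multiplier, \<open>dev grad\<^sub>w\<close> is the negative adjoint of
  \<open>div\<^sub>w\<close>.  The divergence theorem on a simplex, in terms of \<open>face_integral\<close>, is proved by scaling the
  simplex; that \<open>H(div)\<close> forces continuity of normal components follows by testing with
  bump functions.\<close>

section \<open>Bilinear forms on finite-dimensional subspaces\<close>

text \<open>The method is treated as one symmetric indefinite form on the product of the three
  spaces: testing with \<open>(u, lam, - p)\<close> cancels the pressure, and the bound by the data
  comes from dual bases on the fixed mesh. Degrees dictate the kernel argument. After integration by
  parts the weak gradient tested with \<open>q M\<close>, \<open>M\<close> constant, is the integral
  of \<open>q (grad u : M)\<close> plus the tangential mismatch of multiplier and velocity against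
  \<open>q M n\<close> on the facets. The choice \<open>q = bl i (grad u : M)\<close> has degree at
  most \<open>k\<close> only if \<open>grad u\<close> has degree \<open>k - 1\<close>, which is why
  \<open>div u = 0\<close> must first remove the enriched part of \<open>u\<close>. The matrices
  come from edges: \<open>j - i\<close> is tangent to every facet except those opposite
  \<open>i\<close> and \<open>j\<close>, and in the product of \<open>bg j\<close> with this edge
  the contribution on the facet opposite \<open>j\<close> is purely normal. Each product has trace
  1, so a difference of two is traceless; orthogonality to all differences leaves multiples of the
  identity, which the trace excludes.\<close>

instantiation "fun" :: (type, real_vector) real_vector
begin
definition scaleR_fun :: "real \<Rightarrow> ('a \<Rightarrow> 'b) \<Rightarrow> 'a \<Rightarrow> 'b" where
  "scaleR_fun r f = (\<lambda>x. r *\<^sub>R f x)"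
instance
  by standard (auto simp: scaleR_fun_def scaleR_right_distrib scaleR_left_distrib fun_eq_iff)
end

lemma scaleR_fun_apply [simp]: "(r *\<^sub>R f) x = r *\<^sub>R f x"
  by (simp add: scaleR_fun_def)

lemma sum_fun_apply: "(\<Sum>i\<in>A. f i) x = (\<Sum>i\<in>A. f i x)"
  by (induction A rule: infinite_finite_induct) auto

text \<open>The ambient function spaces are infinite-dimensional, so finite dimension is expressed
  by a finite spanning set. Here \<open>S\<close> may be any set, which lets the property pass to
  arbitrary subsets and to sets of sums.\<close>

definition findim :: "'a::real_vector set \<Rightarrow> bool" where
  "findim S \<longleftrightarrow> (\<exists>B. finite B \<and> S \<subseteq> span B)"

lemma findim_subset: "findim T \<Longrightarrow> S \<subseteq> T \<Longrightarrow> findim S"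
  unfolding findim_def by blast

lemma findim_sum:
  assumes "findim S" "findim T"
  shows "findim {x + y |x y. x \<in> S \<and> y \<in> T}"
proof -
  obtain A B where "finite A" "S \<subseteq> span A" "finite B" "T \<subseteq> span B"
    using assms unfolding findim_def by blast
  then have "{x + y |x y. x \<in> S \<and> y \<in> T} \<subseteq> span (A \<union> B)"
    by (auto simp: span_Un)
  then show ?thesis
    unfolding findim_def using \<open>finite A\<close> \<open>finite B\<close> by blast
qed

lemma findim_linear_image:
  assumes "linear f" "findim S"
  shows "findim (f ` S)"
proof -
  obtain A where "finite A" "S \<subseteq> span A"
    using assms unfolding findim_def by blast
  then have "f ` S \<subseteq> span (f ` A)"
    using assms(1) by (auto simp: linear_span_image)
  then show ?thesis
    unfolding findim_def using \<open>finite A\<close> by blast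
qed

lemma findim_finite_sum:
  assumes "finite I" "\<And>i. i \<in> I \<Longrightarrow> findim (S i)"
  shows "findim {\<Sum>i\<in>I. x i |x. \<forall>i\<in>I. x i \<in> S i}"
proof -
  obtain B where B: "\<And>i. i \<in> I \<Longrightarrow> finite (B i) \<and> S i \<subseteq> span (B i)"
    using assms(2) unfolding findim_def by metis
  have "{\<Sum>i\<in>I. x i |x. \<forall>i\<in>I. x i \<in> S i} \<subseteq> span (\<Union>i\<in>I. B i)"
  proof clarify
    fix x assume x: "\<forall>i\<in>I. x i \<in> S i"
    show "(\<Sum>i\<in>I. x i) \<in> span (\<Union>i\<in>I. B i)"
    proof (rule span_sum)
      fix i assume i: "i \<in> I"
      then have "x i \<in> span (B i)" using x B by blast
      then show "x i \<in> span (\<Union>i\<in>I. B i)"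
        using i span_mono[of "B i" "\<Union>i\<in>I. B i"] by blast
    qed
  qed
  then show ?thesis
    unfolding findim_def using assms(1) B by (intro exI[of _ "\<Union>i\<in>I. B i"]) auto
qed

lemma findim_Times:
  assumes "findim S" "findim T"
  shows "findim (S \<times> T)"
proof -
  have "linear (\<lambda>x::'a. (x, 0::'b))" "linear (\<lambda>y::'b. (0::'a, y))"
    by (auto intro!: linearI)
  then have "findim {x + y |x y. x \<in> (\<lambda>x::'a. (x, 0::'b)) ` S \<and> y \<in> (\<lambda>y::'b. (0::'a, y)) ` T}"
    using assms by (intro findim_sum findim_linear_image)
  then show ?thesis
    by (rule findim_subset) force
qed

text \<open>Injectivity of \<open>x \<mapsto> B x \<cdot>\<close> on a basis gives as many independent vectors as the basis has,
  hence surjectivity by the exchange lemma.\<close>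

locale nondegenerate_form =
  fixes S :: "'a::real_vector set" and B :: "'a \<Rightarrow> 'a \<Rightarrow> real"
  assumes subspace: "subspace S" and findim: "findim S"
    and add_left: "\<And>x y z. x \<in> S \<Longrightarrow> y \<in> S \<Longrightarrow> z \<in> S \<Longrightarrow> B (x + y) z = B x z + B y z"
    and scale_left: "\<And>x z r. x \<in> S \<Longrightarrow> z \<in> S \<Longrightarrow> B (r *\<^sub>R x) z = r * B x z"
    and add_right: "\<And>x y z. x \<in> S \<Longrightarrow> y \<in> S \<Longrightarrow> z \<in> S \<Longrightarrow> B z (x + y) = B z x + B z y"
    and scale_right: "\<And>x z r. x \<in> S \<Longrightarrow> z \<in> S \<Longrightarrow> B z (r *\<^sub>R x) = r * B z x"
    and nondegenerate: "\<And>x. x \<in> S \<Longrightarrow> (\<And>y. y \<in> S \<Longrightarrow> B x y = 0) \<Longrightarrow> x = 0"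
begin

lemma zero_left: "z \<in> S \<Longrightarrow> B 0 z = 0"
  using scale_left[of z z 0] by simp

lemma diff_left: "x \<in> S \<Longrightarrow> y \<in> S \<Longrightarrow> z \<in> S \<Longrightarrow> B (x - y) z = B x z - B y z"
  using add_left[of x "(-1) *\<^sub>R y" z] scale_left[of y z "-1"]
  by (simp add: subspace_neg[OF subspace])

lemma sum_mem: "(\<And>i. i \<in> I \<Longrightarrow> x i \<in> S) \<Longrightarrow> (\<Sum>i\<in>I. c i *\<^sub>R x i) \<in> S"
  by (intro subspace_sum[OF subspace] subspace_scale[OF subspace])

lemma sum_left:
  assumes "finite I" "\<And>i. i \<in> I \<Longrightarrow> x i \<in> S" "z \<in> S"
  shows "B (\<Sum>i\<in>I. c i *\<^sub>R x i) z = (\<Sum>i\<in>I. c i * B (x i) z)"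
  using assms
proof (induction I rule: finite_induct)
  case empty
  then show ?case by (simp add: zero_left)
next
  case (insert i I)
  then show ?case
    by (simp add: add_left scale_left sum_mem subspace_scale[OF subspace])
qed

lemma sum_right:
  assumes "finite I" "\<And>i. i \<in> I \<Longrightarrow> x i \<in> S" "z \<in> S"
  shows "B z (\<Sum>i\<in>I. c i *\<^sub>R x i) = (\<Sum>i\<in>I. c i * B z (x i))"
  using assms
proof (induction I rule: finite_induct)
  case empty
  then show ?case using scale_right[of z z 0] by simp
next
  case (insert i I)
  then show ?case
    by (simp add: add_right scale_right sum_mem subspace_scale[OF subspace])
qed

lemma basis_exists:
  obtains b where "finite b" "independent b" "b \<subseteq> S" "S = span b"
proof -
  obtain A where A: "finite A" "S \<subseteq> span A"
    using findim unfolding findim_def by blast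
  obtain b where b: "b \<subseteq> S" "independent b" "S \<subseteq> span b"
    using maximal_independent_subset[of S] by blast
  have "finite b"
    using independent_span_bound[OF A(1) b(2)] A(2) b(1) by blast
  moreover have "S = span b"
    using b subspace by (simp add: span_minimal subset_antisym)
  ultimately show ?thesis
    using b that by blast
qed

text \<open>The vectors \<open>x i\<close> represent the coordinate functionals of \<open>b\<close>
  through \<open>B\<close>. With them the solution for data \<open>F\<close> is the explicit sum of
  \<open>F i *\<^sub>R x i\<close> over \<open>b\<close>, and both existence and the bound by the
  data are read off from it.\<close>

definition dual_bases :: "'a set \<Rightarrow> ('a \<Rightarrow> 'a) \<Rightarrow> bool" where
  "dual_bases b x \<longleftrightarrow> finite b \<and> b \<subseteq> S \<and> (\<forall>y\<in>S. \<exists>c. y = (\<Sum>i\<in>b. c i *\<^sub>R i)) \<and>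
    (\<forall>i\<in>b. x i \<in> S) \<and> (\<forall>i\<in>b. \<forall>j\<in>b. B (x i) j = (if i = j then 1 else 0))"

lemma dual_basesD:
  assumes "dual_bases b x"
  shows "finite b" "b \<subseteq> S" "y \<in> S \<Longrightarrow> \<exists>c. y = (\<Sum>i\<in>b. c i *\<^sub>R i)"
    "i \<in> b \<Longrightarrow> x i \<in> S" "i \<in> b \<Longrightarrow> j \<in> b \<Longrightarrow> B (x i) j = (if i = j then 1 else 0)"
  using assms unfolding dual_bases_def by blast+

lemma B_dual_sum:
  assumes "dual_bases b x" "j \<in> b"
  shows "B (\<Sum>i\<in>b. F i *\<^sub>R x i) j = F j"
proof -
  note b = dual_basesD[OF assms(1)]
  have "B (\<Sum>i\<in>b. F i *\<^sub>R x i) j = (\<Sum>i\<in>b. F i * B (x i) j)"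
    using b(1,2,4) assms(2) by (intro sum_left) auto
  also have "\<dots> = (\<Sum>i\<in>b. if i = j then F i else 0)"
    by (intro sum.cong) (auto simp: b(5) assms(2))
  finally show ?thesis using b(1) assms(2) by simp
qed

lemma dual_basis_exists:
  "\<exists>b x. dual_bases b x"
proof -
  obtain b where b: "finite b" "independent b" "b \<subseteq> S" "S = span b"
    by (rule basis_exists)
  have repr: "\<exists>c. y = (\<Sum>i\<in>b. c i *\<^sub>R i)" if "y \<in> S" for y
    using that b span_finite[OF b(1)] by auto
  \<comment> \<open>The functional \<open>B x\<close> is recorded by its values on \<open>b\<close>,
    as a vector of \<open>span b\<close> itself. A linear map of \<open>span b\<close> into itself
    can then be counted against \<open>b\<close> without a dual space.\<close>
  define T where "T x = (\<Sum>i\<in>b. B x i *\<^sub>R i)" for x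
  have T_sum: "T (\<Sum>j\<in>b. c j *\<^sub>R j) = (\<Sum>j\<in>b. c j *\<^sub>R T j)" for c
  proof -
    have "T (\<Sum>j\<in>b. c j *\<^sub>R j) = (\<Sum>i\<in>b. (\<Sum>j\<in>b. c j * B j i) *\<^sub>R i)"
      unfolding T_def using b by (intro sum.cong refl) (subst sum_left, auto)
    also have "\<dots> = (\<Sum>j\<in>b. c j *\<^sub>R T j)"
      unfolding T_def by (simp add: scaleR_sum_left scaleR_sum_right) (rule sum.swap)
    finally show ?thesis .
  qed
  have coeff: "c i = d i" if "(\<Sum>i\<in>b. c i *\<^sub>R i) = (\<Sum>i\<in>b. d i *\<^sub>R i)" "i \<in> b" for c d :: "'a \<Rightarrow> real" and i
  proof -
    have "(\<Sum>i\<in>b. (c i - d i) *\<^sub>R i) = 0"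
      using that(1) by (simp add: scaleR_left_diff_distrib sum_subtractf)
    then show ?thesis
      using independentD[OF b(2) b(1) subset_refl _ that(2), of "\<lambda>i. c i - d i"] by simp
  qed
  have T_inj0: "x = 0" if "x \<in> S" "T x = 0" for x
  proof (rule nondegenerate[OF that(1)])
    fix y assume "y \<in> S"
    then obtain c where c: "y = (\<Sum>i\<in>b. c i *\<^sub>R i)" using repr by blast
    have "B x i = 0" if i: "i \<in> b" for i
      using coeff[of "B x" "\<lambda>_. 0" i] \<open>T x = 0\<close> i by (simp add: T_def)
    then show "B x y = 0"
      unfolding c using b that(1) by (subst sum_right) auto
  qed
  have inj: "inj_on T b"
  proof (rule inj_onI)
    fix i j assume ij: "i \<in> b" "j \<in> b" "T i = T j"
    have eq: "B i m = B j m" if "m \<in> b" for m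
      using coeff[of "B i" "B j" m] ij(3) that by (simp add: T_def)
    have "B (i - j) m = 0" if m: "m \<in> b" for m
    proof -
      have "i \<in> S" "j \<in> S" "m \<in> S" using ij(1,2) m b(3) by blast+
      then show ?thesis using diff_left[of i j m] eq[OF m] by simp
    qed
    then have "T (i - j) = 0" by (simp add: T_def)
    moreover have "i - j \<in> S" using ij(1,2) b(3) by (meson subsetD subspace subspace_diff)
    ultimately show "i = j" using T_inj0[of "i - j"] by simp
  qed
  have ind: "independent (T ` b)"
  proof (rule independent_if_scalars_zero)
    show "finite (T ` b)" using b by simp
    fix f v assume f: "(\<Sum>v\<in>T ` b. f v *\<^sub>R v) = 0" and v: "v \<in> T ` b"
    then obtain j where j: "j \<in> b" "v = T j" by blast
    have "T (\<Sum>j\<in>b. f (T j) *\<^sub>R j) = 0"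
      using f unfolding T_sum by (simp only: sum.reindex[OF inj] o_def)
    then have "(\<Sum>j\<in>b. f (T j) *\<^sub>R j) = 0"
      by (rule T_inj0[rotated]) (use b(3) in \<open>auto intro: sum_mem\<close>)
    from independentD[OF b(2) b(1) subset_refl this j(1)] show "f v = 0"
      by (simp only: j(2))
  qed
  have "T ` b \<subseteq> span b"
    unfolding T_def by (intro image_subsetI span_sum span_scale span_base)
  then have Tb: "T ` b \<subseteq> span b" .
  have span: "b \<subseteq> span (T ` b)"
  proof
    fix i assume i: "i \<in> b"
    show "i \<in> span (T ` b)"
    proof (rule ccontr)
      \<comment> \<open>A basis vector outside the span of the images would give
        \<open>card b + 1\<close> independent vectors in \<open>span b\<close>.\<close>
      assume ni: "i \<notin> span (T ` b)"
      then have "independent (insert i (T ` b))" using ind by (simp add: independent_insertI)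
      moreover have "insert i (T ` b) \<subseteq> span b" using Tb i span_base by blast
      ultimately have "card (insert i (T ` b)) \<le> card b"
        using independent_span_bound[OF b(1)] by blast
      moreover have "i \<notin> T ` b" using ni span_base[of i "T ` b"] by metis
      ultimately show False using b(1) card_image[OF inj] by simp
    qed
  qed
  have "\<exists>x\<in>S. T x = i" if i: "i \<in> b" for i
  proof -
    have "i \<in> span (T ` b)" using span i by blast
    then obtain d where "i = (\<Sum>v\<in>T ` b. d v *\<^sub>R v)"
      using span_finite[of "T ` b"] b(1) by auto
    then have "i = T (\<Sum>j\<in>b. d (T j) *\<^sub>R j)"
      unfolding T_sum by (simp only: sum.reindex[OF inj] o_def)
    moreover have "(\<Sum>j\<in>b. d (T j) *\<^sub>R j) \<in> S"
      by (rule sum_mem) (use b(3) in blast)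
    ultimately show ?thesis by metis
  qed
  then obtain x where x: "\<And>i. i \<in> b \<Longrightarrow> x i \<in> S \<and> T (x i) = i" by metis
  have dual: "B (x i) j = (if i = j then 1 else 0)" if "i \<in> b" "j \<in> b" for i j
  proof -
    have "(\<Sum>m\<in>b. B (x i) m *\<^sub>R m) = i" using x[OF that(1)] by (simp add: T_def)
    also have "i = (\<Sum>m\<in>b. (if i = m then 1 else 0) *\<^sub>R m)"
      using that b(1) by (simp add: if_distrib[of "\<lambda>r. r *\<^sub>R _"] cong: if_cong)
    finally show ?thesis by (rule coeff[OF _ that(2)])
  qed
  show ?thesis
    unfolding dual_bases_def
    using b(1,3) by (intro exI[of _ b] exI[of _ x] conjI ballI repr) (simp_all add: x dual)
qed

theorem solution_exists:
  assumes "\<And>x y. x \<in> S \<Longrightarrow> y \<in> S \<Longrightarrow> F (x + y) = F x + F y"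
    and "\<And>x r. x \<in> S \<Longrightarrow> F (r *\<^sub>R x) = r * F x"
  shows "\<exists>!x. x \<in> S \<and> (\<forall>y\<in>S. B x y = F y)"
proof -
  obtain b x where bx: "dual_bases b x"
    using dual_basis_exists by (elim exE)
  note b = dual_basesD(1-3)[OF bx] and x = dual_basesD(4-5)[OF bx]
  have F_sum: "F (\<Sum>i\<in>b. c i *\<^sub>R i) = (\<Sum>i\<in>b. c i * F i)" for c
  proof -
    have "J \<subseteq> b \<Longrightarrow> F (\<Sum>i\<in>J. c i *\<^sub>R i) = (\<Sum>i\<in>J. c i * F i)" if "finite J" for J
      using that
    proof (induction J rule: finite_induct)
      case empty
      show ?case using assms(2)[of 0 0] subspace_0[OF subspace] by simp
    next
      case (insert i J)
      then show ?case
        using b(2) assms by (simp add: subset_iff sum_mem subspace_scale[OF subspace])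
    qed
    then show ?thesis using b(1) by blast
  qed
  define z where "z = (\<Sum>i\<in>b. F i *\<^sub>R x i)"
  have z: "z \<in> S" unfolding z_def using x(1) by (intro sum_mem) auto
  have "B z y = F y" if y: "y \<in> S" for y
  proof -
    obtain c where c: "y = (\<Sum>i\<in>b. c i *\<^sub>R i)" using b(3)[OF y] by blast
    have "B z j = F j" if "j \<in> b" for j
      unfolding z_def using B_dual_sum[OF bx that] .
    then show ?thesis
      unfolding c F_sum using b(1,2) z by (subst sum_right) auto
  qed
  moreover have "w = w'" if ww: "w \<in> S" "w' \<in> S" "\<forall>y\<in>S. B w y = F y" "\<forall>y\<in>S. B w' y = F y" for w w'
  proof -
    have "w - w' = 0"
    proof (rule nondegenerate)
      show "w - w' \<in> S" using ww subspace_diff[OF subspace] by blast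
      show "B (w - w') y = 0" if y: "y \<in> S" for y
        using diff_left[of w w' y] ww y by simp
    qed
    then show ?thesis by simp
  qed
  ultimately show ?thesis using z by blast
qed

text \<open>A solution equals the sum of \<open>F i *\<^sub>R x i\<close>, so \<open>q w\<close> is
  a quadratic expression in the finitely many numbers \<open>F i\<close>, each at most
  \<open>G * \<bar>N i\<bar>\<close> in absolute value. The constant is therefore the same for all
  data. The function \<open>s\<close> supplies the coefficients that make \<open>q\<close>
  quadratic.\<close>

lemma solution_bound:
  assumes q: "\<And>(I :: 'a set) c x. finite I \<Longrightarrow> (\<And>i. i \<in> I \<Longrightarrow> x i \<in> S) \<Longrightarrow>
      q (\<Sum>i\<in>I. c i *\<^sub>R x i) = (\<Sum>i\<in>I. \<Sum>j\<in>I. c i * c j * s (x i) (x j))"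
  obtains C where "\<And>F G w. w \<in> S \<Longrightarrow> (\<And>y. y \<in> S \<Longrightarrow> B w y = F y) \<Longrightarrow> 0 \<le> G \<Longrightarrow>
      (\<And>y. y \<in> S \<Longrightarrow> \<bar>F y\<bar> \<le> G * N y) \<Longrightarrow> q w \<le> C * G\<^sup>2" "0 \<le> C"
proof -
  obtain b x where bx: "dual_bases b x"
    using dual_basis_exists by (elim exE)
  note b = dual_basesD(1-3)[OF bx] and x = dual_basesD(4-5)[OF bx]
  define C where "C = (\<Sum>i\<in>b. \<Sum>j\<in>b. \<bar>N i\<bar> * \<bar>N j\<bar> * \<bar>s (x i) (x j)\<bar>)"
  show ?thesis
  proof (rule that[of C])
    fix F G w assume w: "w \<in> S" and F: "\<And>y. y \<in> S \<Longrightarrow> B w y = F y" and G: "0 \<le> G"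
      and FG: "\<And>y. y \<in> S \<Longrightarrow> \<bar>F y\<bar> \<le> G * N y"
    define z where "z = (\<Sum>i\<in>b. F i *\<^sub>R x i)"
    have z: "z \<in> S" unfolding z_def using x(1) by (intro sum_mem) auto
    have wz: "w - z = 0"
    proof (rule nondegenerate)
      show wz: "w - z \<in> S" using w z subspace_diff[OF subspace] by blast
      fix y assume y: "y \<in> S"
      obtain c where c: "y = (\<Sum>i\<in>b. c i *\<^sub>R i)" using b(3)[OF y] by blast
      have zj: "B z j = F j" if "j \<in> b" for j
        unfolding z_def using B_dual_sum[OF bx that] .
      have "B (w - z) j = 0" if "j \<in> b" for j
        using diff_left[of w z j] w z zj[OF that] F[of j] that b(2) by auto
      then show "B (w - z) y = 0"
        unfolding c using b(1,2) wz by (subst sum_right) auto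
    qed
    have "q w = (\<Sum>i\<in>b. \<Sum>j\<in>b. F i * F j * s (x i) (x j))"
      unfolding eq_iff_diff_eq_0[THEN iffD2, OF wz] z_def by (rule q) (use b(1) x(1) in auto)
    also have "\<dots> \<le> (\<Sum>i\<in>b. \<Sum>j\<in>b. G\<^sup>2 * (\<bar>N i\<bar> * \<bar>N j\<bar> * \<bar>s (x i) (x j)\<bar>))"
    proof (intro sum_mono)
      fix i j assume ij: "i \<in> b" "j \<in> b"
      have *: "\<bar>F i\<bar> \<le> G * \<bar>N i\<bar>" if "i \<in> b" for i
      proof -
        have "G * N i \<le> G * \<bar>N i\<bar>" using G by (intro mult_left_mono) auto
        then show ?thesis using FG[of i] that b(2) by auto
      qed
      have "F i * F j * s (x i) (x j) \<le> \<bar>F i\<bar> * \<bar>F j\<bar> * \<bar>s (x i) (x j)\<bar>"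
        by (metis abs_ge_self abs_mult)
      also have "\<dots> \<le> (G * \<bar>N i\<bar>) * (G * \<bar>N j\<bar>) * \<bar>s (x i) (x j)\<bar>"
        using * ij G by (intro mult_right_mono mult_mono) auto
      finally show "F i * F j * s (x i) (x j) \<le> G\<^sup>2 * (\<bar>N i\<bar> * \<bar>N j\<bar> * \<bar>s (x i) (x j)\<bar>)"
        by (simp add: power2_eq_square ac_simps)
    qed
    also have "\<dots> = C * G\<^sup>2"
      by (simp add: C_def sum_distrib_left mult.commute)
    finally show "q w \<le> C * G\<^sup>2" .
  next
    show "0 \<le> C" unfolding C_def by (intro sum_nonneg) auto
  qed
qed

end

section \<open>Polynomials\<close>

definition multi_deg :: "('n::finite \<Rightarrow> nat) \<Rightarrow> nat" where
  "multi_deg \<alpha> = (\<Sum>i\<in>UNIV. \<alpha> i)"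

lemma finite_multi_deg_le: "finite {\<alpha>::'n::finite \<Rightarrow> nat. multi_deg \<alpha> \<le> m}"
proof -
  have "finite (PiE (UNIV::'n set) (\<lambda>_. {..m}))"
    by (intro finite_PiE) auto
  moreover have "{\<alpha>::'n \<Rightarrow> nat. multi_deg \<alpha> \<le> m} \<subseteq> PiE (UNIV::'n set) (\<lambda>_. {..m})"
  proof
    fix \<alpha> :: "'n \<Rightarrow> nat" assume "\<alpha> \<in> {\<alpha>. multi_deg \<alpha> \<le> m}"
    moreover have "\<alpha> i \<le> multi_deg \<alpha>" for i unfolding multi_deg_def by (rule member_le_sum) auto
    ultimately show "\<alpha> \<in> PiE (UNIV::'n set) (\<lambda>_. {..m})" using order_trans by (fastforce simp: PiE_def)
  qed
  ultimately show ?thesis by (rule rev_finite_subset)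
qed

lemma finite_multi_deg_int_le: "finite {\<alpha>::'n::finite \<Rightarrow> nat. int (multi_deg \<alpha>) \<le> k}"
  by (rule finite_subset[OF _ finite_multi_deg_le[of "nat k"]]) auto

lemma finite_multi_deg_int_eq: "finite {\<alpha>::'n::finite \<Rightarrow> nat. int (multi_deg \<alpha>) = k}"
  by (rule finite_subset[OF _ finite_multi_deg_le[of "nat k"]]) auto

lemma monomial_mult: "monomial \<alpha> x * monomial \<beta> x = monomial (\<lambda>i. \<alpha> i + \<beta> i) x"
  by (simp add: monomial_def power_add prod.distrib)

lemma multi_deg_add: "multi_deg (\<lambda>i. \<alpha> i + \<beta> i) = multi_deg \<alpha> + multi_deg \<beta>"
  by (simp add: multi_deg_def sum.distrib)

lemma sum_scaleR_delta:
  fixes w :: "'v::real_vector"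
  shows "finite A \<Longrightarrow> a \<in> A \<Longrightarrow> (\<Sum>b\<in>A. f b *\<^sub>R (if b = a then w else 0)) = f a *\<^sub>R w"
  by (subst sum.remove[of A a]) (auto intro!: sum.neutral)

text \<open>Polynomials on the whole space, as opposed to \<open>P_space\<close>, whose members are
  cut off outside an element and need not be differentiable on its boundary. Writing the space as a
  span of monomials gives an induction principle.\<close>

definition Pol :: "int \<Rightarrow> 'v::real_vector set \<Rightarrow> (real^'n \<Rightarrow> 'v) set" where
  "Pol k W = span {\<lambda>x. monomial \<alpha> x *\<^sub>R w |\<alpha> w. int (multi_deg \<alpha>) \<le> k \<and> w \<in> W}"

definition Hom :: "int \<Rightarrow> (real^'n \<Rightarrow> real) set" where
  "Hom k = span {\<lambda>x. monomial \<alpha> x |\<alpha>. int (multi_deg \<alpha>) = k}"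

definition trunc :: "'a set \<Rightarrow> ('a \<Rightarrow> 'v::zero) \<Rightarrow> 'a \<Rightarrow> 'v" where
  "trunc D p x = (if x \<in> D then p x else 0)"

lemma trunc_in [simp]: "x \<in> D \<Longrightarrow> trunc D p x = p x"
  and trunc_notin [simp]: "x \<notin> D \<Longrightarrow> trunc D p x = 0"
  by (auto simp: trunc_def)

lemma Pol_coeffs:
  assumes "subspace W"
  shows "Pol k W = {p. \<exists>c. (\<forall>\<alpha>. c \<alpha> \<in> W) \<and>
    p = (\<lambda>x::real^'n. \<Sum>\<alpha> | int (multi_deg \<alpha>) \<le> k. monomial \<alpha> x *\<^sub>R c \<alpha>)}" (is "_ = ?R")
proof (rule antisym)
  show "?R \<subseteq> Pol k W"
  proof clarify
    fix c :: "('n \<Rightarrow> nat) \<Rightarrow> 'a" assume c: "\<forall>\<alpha>. c \<alpha> \<in> W"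
    have "(\<Sum>\<alpha> | int (multi_deg \<alpha>) \<le> k. (\<lambda>x::real^'n. monomial \<alpha> x *\<^sub>R c \<alpha>)) \<in> Pol k W"
      unfolding Pol_def using c by (intro span_sum span_base) auto
    also have "(\<Sum>\<alpha> | int (multi_deg \<alpha>) \<le> k. (\<lambda>x::real^'n. monomial \<alpha> x *\<^sub>R c \<alpha>)) =
      (\<lambda>x::real^'n. \<Sum>\<alpha> | int (multi_deg \<alpha>) \<le> k. monomial \<alpha> x *\<^sub>R c \<alpha>)"
      by (simp add: fun_eq_iff sum_fun_apply)
    finally show "(\<lambda>x::real^'n. \<Sum>\<alpha> | int (multi_deg \<alpha>) \<le> k. monomial \<alpha> x *\<^sub>R c \<alpha>) \<in> Pol k W" .
  qed
  have "subspace ?R"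
    unfolding subspace_def
  proof (intro conjI allI ballI)
    show "0 \<in> ?R"
      using assms by (auto intro!: exI[of _ "\<lambda>_. 0"] simp: subspace_0 fun_eq_iff)
    fix p q assume "p \<in> ?R" "q \<in> ?R"
    then obtain c d where c: "\<forall>\<alpha>. c \<alpha> \<in> W" "p = (\<lambda>x::real^'n. \<Sum>\<alpha> | int (multi_deg \<alpha>) \<le> k. monomial \<alpha> x *\<^sub>R c \<alpha>)"
      and d: "\<forall>\<alpha>. d \<alpha> \<in> W" "q = (\<lambda>x::real^'n. \<Sum>\<alpha> | int (multi_deg \<alpha>) \<le> k. monomial \<alpha> x *\<^sub>R d \<alpha>)"
      by blast
    show "p + q \<in> ?R"
      using c d assms by (auto intro!: exI[of _ "\<lambda>\<alpha>. c \<alpha> + d \<alpha>"] simp: subspace_add fun_eq_iff sum.distrib scaleR_right_distrib)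
  next
    fix r p assume "p \<in> ?R"
    then obtain c where c: "\<forall>\<alpha>. c \<alpha> \<in> W" "p = (\<lambda>x::real^'n. \<Sum>\<alpha> | int (multi_deg \<alpha>) \<le> k. monomial \<alpha> x *\<^sub>R c \<alpha>)"
      by blast
    show "r *\<^sub>R p \<in> ?R"
      using c assms by (auto intro!: exI[of _ "\<lambda>\<alpha>. r *\<^sub>R c \<alpha>"] simp: subspace_scale fun_eq_iff scaleR_sum_right mult.commute)
  qed
  moreover have "{\<lambda>x. monomial \<alpha> x *\<^sub>R w |\<alpha> w. int (multi_deg \<alpha>) \<le> k \<and> w \<in> W} \<subseteq> ?R"
  proof clarify
    fix \<alpha> :: "'n \<Rightarrow> nat" and w assume \<alpha>: "int (multi_deg \<alpha>) \<le> k" "w \<in> W"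
    show "\<exists>c. (\<forall>\<alpha>. c \<alpha> \<in> W) \<and>
        (\<lambda>x::real^'n. monomial \<alpha> x *\<^sub>R w) = (\<lambda>x. \<Sum>\<alpha> | int (multi_deg \<alpha>) \<le> k. monomial \<alpha> x *\<^sub>R c \<alpha>)"
      using \<alpha> assms finite_multi_deg_int_le[of k]
      by (intro exI[of _ "\<lambda>\<beta>. if \<beta> = \<alpha> then w else 0"]) (simp add: subspace_0, intro ext, subst sum_scaleR_delta, auto)
  qed
  ultimately show "Pol k W \<subseteq> ?R"
    unfolding Pol_def by (intro span_minimal)
qed

lemma Hom_coeffs:
  "Hom k = {p. \<exists>c. p = (\<lambda>x::real^'n. \<Sum>\<alpha> | int (multi_deg \<alpha>) = k. monomial \<alpha> x *\<^sub>R c \<alpha>)}" (is "_ = ?R")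
proof (rule antisym)
  show "?R \<subseteq> Hom k"
  proof clarify
    fix c :: "('n \<Rightarrow> nat) \<Rightarrow> real"
    have "(\<Sum>\<alpha> | int (multi_deg \<alpha>) = k. c \<alpha> *\<^sub>R (\<lambda>x::real^'n. monomial \<alpha> x)) \<in> Hom k"
      unfolding Hom_def by (intro span_sum span_scale span_base) auto
    also have "(\<Sum>\<alpha> | int (multi_deg \<alpha>) = k. c \<alpha> *\<^sub>R (\<lambda>x::real^'n. monomial \<alpha> x)) =
      (\<lambda>x::real^'n. \<Sum>\<alpha> | int (multi_deg \<alpha>) = k. monomial \<alpha> x *\<^sub>R c \<alpha>)"
      by (simp add: fun_eq_iff sum_fun_apply mult.commute)
    finally show "(\<lambda>x::real^'n. \<Sum>\<alpha> | int (multi_deg \<alpha>) = k. monomial \<alpha> x *\<^sub>R c \<alpha>) \<in> Hom k" .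
  qed
  have "subspace ?R"
    unfolding subspace_def
  proof (intro conjI allI ballI)
    show "0 \<in> ?R"
      by (auto intro!: exI[of _ "\<lambda>_. 0"] simp: fun_eq_iff)
    fix p q assume "p \<in> ?R" "q \<in> ?R"
    then obtain c d where "p = (\<lambda>x::real^'n. \<Sum>\<alpha> | int (multi_deg \<alpha>) = k. monomial \<alpha> x *\<^sub>R c \<alpha>)"
      "q = (\<lambda>x::real^'n. \<Sum>\<alpha> | int (multi_deg \<alpha>) = k. monomial \<alpha> x *\<^sub>R d \<alpha>)"
      by blast
    then show "p + q \<in> ?R"
      by (auto intro!: exI[of _ "\<lambda>\<alpha>. c \<alpha> + d \<alpha>"] simp: fun_eq_iff sum.distrib distrib_left)
  next
    fix r p assume "p \<in> ?R"
    then obtain c where "p = (\<lambda>x::real^'n. \<Sum>\<alpha> | int (multi_deg \<alpha>) = k. monomial \<alpha> x *\<^sub>R c \<alpha>)"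
      by blast
    then show "r *\<^sub>R p \<in> ?R"
      by (auto intro!: exI[of _ "\<lambda>\<alpha>. r *\<^sub>R c \<alpha>"] simp: fun_eq_iff sum_distrib_left ac_simps)
  qed
  moreover have "{\<lambda>x. monomial \<alpha> x |\<alpha>. int (multi_deg \<alpha>) = k} \<subseteq> ?R"
  proof clarify
    fix \<alpha> :: "'n \<Rightarrow> nat" assume \<alpha>: "k = int (multi_deg \<alpha>)"
    show "\<exists>c. (\<lambda>x::real^'n. monomial \<alpha> x) = (\<lambda>x. \<Sum>\<beta> | int (multi_deg \<beta>) = int (multi_deg \<alpha>). monomial \<beta> x *\<^sub>R c \<beta>)"
      using \<alpha> finite_multi_deg_int_eq[of k]
      by (intro exI[of _ "\<lambda>\<beta>. if \<beta> = \<alpha> then 1 else 0"] ext)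
        (subst sum_scaleR_delta, auto)
  qed
  ultimately show "Hom k \<subseteq> ?R"
    unfolding Hom_def by (intro span_minimal) auto
qed

text \<open>Together with \<open>linear_trunc\<close> this makes the polynomial spaces on an element
  linear images of \<open>Pol\<close>, which is how subspace and dimension facts are
  transferred.\<close>

lemma P_space_eq:
  assumes "subspace W"
  shows "P_space k D W = trunc D ` Pol k W"
proof (intro set_eqI iffI)
  fix p assume "p \<in> P_space k D W"
  then obtain c where c: "\<forall>\<alpha>. c \<alpha> \<in> W"
    "p = (\<lambda>x. if x \<in> D then \<Sum>\<alpha> | int (\<Sum>i\<in>UNIV. \<alpha> i) \<le> k. monomial \<alpha> x *\<^sub>R c \<alpha> else 0)"
    unfolding P_space_def mem_Collect_eq by (elim exE conjE)
  have "p = trunc D (\<lambda>x. \<Sum>\<alpha> | int (multi_deg \<alpha>) \<le> k. monomial \<alpha> x *\<^sub>R c \<alpha>)"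
    unfolding c(2) trunc_def[abs_def] multi_deg_def ..
  then show "p \<in> trunc D ` Pol k W"
    unfolding Pol_coeffs[OF assms] using c(1) by blast
next
  fix p assume "p \<in> trunc D ` Pol k W"
  then obtain c where c: "\<forall>\<alpha>. c \<alpha> \<in> W" "p = trunc D (\<lambda>x. \<Sum>\<alpha> | int (multi_deg \<alpha>) \<le> k. monomial \<alpha> x *\<^sub>R c \<alpha>)"
    unfolding Pol_coeffs[OF assms] by blast
  show "p \<in> P_space k D W"
    unfolding P_space_def c(2) trunc_def[abs_def] multi_deg_def mem_Collect_eq using c(1) by (intro exI conjI) (auto intro: refl)
qed

lemma H_space_eq: "H_space k D = trunc D ` Hom k"
proof (intro set_eqI iffI)
  fix p assume "p \<in> H_space k D"
  then obtain c where c: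
    "p = (\<lambda>x. if x \<in> D then \<Sum>\<alpha> | int (\<Sum>i\<in>UNIV. \<alpha> i) = k. monomial \<alpha> x *\<^sub>R c \<alpha> else 0)"
    unfolding H_space_def mem_Collect_eq by (elim exE conjE)
  have "p = trunc D (\<lambda>x. \<Sum>\<alpha> | int (multi_deg \<alpha>) = k. monomial \<alpha> x *\<^sub>R c \<alpha>)"
    unfolding c trunc_def[abs_def] multi_deg_def ..
  then show "p \<in> trunc D ` Hom k"
    unfolding Hom_coeffs by blast
next
  fix p assume "p \<in> trunc D ` Hom k"
  then obtain c where c: "p = trunc D (\<lambda>x. \<Sum>\<alpha> | int (multi_deg \<alpha>) = k. monomial \<alpha> x *\<^sub>R c \<alpha>)"
    unfolding Hom_coeffs by blast
  show "p \<in> H_space k D"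
    unfolding H_space_def c trunc_def[abs_def] multi_deg_def mem_Collect_eq by (intro exI) (rule refl)
qed

lemma subspace_Pol: "subspace (Pol k W)"
  and subspace_Hom: "subspace (Hom k)"
  by (simp_all add: Pol_def Hom_def)

lemma Pol_0: "(\<lambda>x. 0) \<in> Pol k W"
  using subspace_0[OF subspace_Pol] by (simp add: zero_fun_def)

lemma Pol_add: "p \<in> Pol k W \<Longrightarrow> q \<in> Pol k W \<Longrightarrow> (\<lambda>x. p x + q x) \<in> Pol k W"
  using subspace_add[OF subspace_Pol] by (fastforce simp: plus_fun_def)

lemma Pol_scale: "p \<in> Pol k W \<Longrightarrow> (\<lambda>x. r *\<^sub>R p x) \<in> Pol k W"
  using subspace_scale[OF subspace_Pol] by (fastforce simp: scaleR_fun_def)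

lemma Pol_diff: "p \<in> Pol k W \<Longrightarrow> q \<in> Pol k W \<Longrightarrow> (\<lambda>x. p x - q x) \<in> Pol k W"
  using Pol_add[OF _ Pol_scale[of q k W "-1"]] by simp

lemma Pol_sum: "(\<And>i. i \<in> I \<Longrightarrow> p i \<in> Pol k W) \<Longrightarrow> (\<lambda>x. \<Sum>i\<in>I. p i x) \<in> Pol k W"
  by (induction I rule: infinite_finite_induct) (auto simp: Pol_0 intro!: Pol_add)

lemma Pol_mono: "j \<le> k \<Longrightarrow> V \<subseteq> W \<Longrightarrow> Pol j V \<subseteq> Pol k W"
  unfolding Pol_def by (rule span_mono) fastforce

text \<open>Membership is kept in the induction hypotheses, so that the sum and scaling cases can
  use analytic facts about the summands, such as differentiability.\<close>

lemma Pol_induct [consumes 1, case_names zero add scale monom]: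
  assumes "p \<in> Pol k W"
    and "P (\<lambda>x. 0)"
    and "\<And>p q. p \<in> Pol k W \<Longrightarrow> q \<in> Pol k W \<Longrightarrow> P p \<Longrightarrow> P q \<Longrightarrow> P (\<lambda>x. p x + q x)"
    and "\<And>p r. p \<in> Pol k W \<Longrightarrow> P p \<Longrightarrow> P (\<lambda>x. r *\<^sub>R p x)"
    and "\<And>\<alpha> w. int (multi_deg \<alpha>) \<le> k \<Longrightarrow> w \<in> W \<Longrightarrow> P (\<lambda>x. monomial \<alpha> x *\<^sub>R w)"
  shows "P p"
proof -
  let ?G = "{\<lambda>x. monomial \<alpha> x *\<^sub>R w |\<alpha> w. int (multi_deg \<alpha>) \<le> k \<and> w \<in> W}"
  have "p \<in> span ?G" using assms(1) by (simp add: Pol_def)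
  then have "p \<in> Pol k W \<and> P p"
  proof (induction rule: span_induct_alt)
    case base
    show ?case using assms(2) Pol_0 by (simp add: zero_fun_def)
  next
    case (step c x y)
    then obtain \<alpha> w where x: "x = (\<lambda>x. monomial \<alpha> x *\<^sub>R w)" "int (multi_deg \<alpha>) \<le> k" "w \<in> W" by blast
    have xP: "x \<in> Pol k W" unfolding Pol_def using step by (intro span_base)
    have "P (\<lambda>t. c *\<^sub>R x t)" using assms(4)[OF xP] assms(5) x by blast
    then have "P (\<lambda>t. c *\<^sub>R x t + y t)"
      using step assms(3)[OF Pol_scale[OF xP]] by blast
    moreover have "(\<lambda>t. c *\<^sub>R x t + y t) \<in> Pol k W"
      using step xP by (intro Pol_add Pol_scale) auto
    ultimately show ?case by (simp add: plus_fun_def scaleR_fun_def)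
  qed
  then show ?thesis by simp
qed

lemma Pol_monomial: "int (multi_deg \<alpha>) \<le> k \<Longrightarrow> w \<in> W \<Longrightarrow> (\<lambda>x. monomial \<alpha> x *\<^sub>R w) \<in> Pol k W"
  unfolding Pol_def by (rule span_base) auto

lemma Pol_const: "0 \<le> k \<Longrightarrow> w \<in> W \<Longrightarrow> (\<lambda>x. w) \<in> Pol k W"
  using Pol_monomial[of "\<lambda>_. 0" k w W] by (simp add: multi_deg_def monomial_def)

lemma Pol_neg_degree: "k < 0 \<Longrightarrow> p \<in> Pol k W \<Longrightarrow> p = (\<lambda>x. 0)"
  by (simp add: Pol_def zero_fun_def)

lemma Pol_component: "1 \<le> k \<Longrightarrow> (\<lambda>x::real^'n. x $ i) \<in> Pol k UNIV"
proof -
  assume k: "1 \<le> k"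
  have "monomial (\<lambda>j. if j = i then 1 else 0) x = x $ i" for x :: "real^'n"
  proof -
    have "monomial (\<lambda>j. if j = i then 1 else 0) x = (\<Prod>j\<in>UNIV. if j = i then x $ j else 1)"
      unfolding monomial_def by (intro prod.cong) auto
    then show ?thesis by simp
  qed
  moreover have "int (multi_deg (\<lambda>j. if j = i then 1 else 0)) \<le> k"
    using k by (simp add: multi_deg_def)
  ultimately show ?thesis
    using Pol_monomial[of "\<lambda>j. if j = i then 1 else 0" k "1::real" UNIV] by simp
qed

lemma Pol_linear_image:
  assumes "linear f" "\<And>w. w \<in> V \<Longrightarrow> f w \<in> W" "p \<in> Pol k V"
  shows "(\<lambda>x. f (p x)) \<in> Pol k W"
  using assms(3)
proof (induction rule: Pol_induct)
  case (monom \<alpha> w)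
  then show ?case
    using assms by (simp add: linear_cmul Pol_monomial)
qed (use assms(1) in \<open>auto simp: linear_0 linear_add linear_cmul Pol_0 intro: Pol_add Pol_scale\<close>)

lemma Pol_mult:
  assumes "q \<in> Pol j UNIV" "p \<in> Pol k W" "subspace W"
  shows "(\<lambda>x. q x *\<^sub>R p x) \<in> Pol (j + k) W"
  using assms(1)
proof (induction rule: Pol_induct)
  case zero
  then show ?case by (simp add: Pol_0)
next
  case (add p q)
  then show ?case by (simp add: scaleR_left_distrib Pol_add)
next
  case (scale p r)
  then show ?case using Pol_scale[of _ _ _ r] by fastforce
next
  case (monom \<alpha> a)
  show ?case
    using assms(2)
  proof (induction rule: Pol_induct)
    case (monom \<beta> w)
    have "(\<lambda>x. monomial (\<lambda>i. \<alpha> i + \<beta> i) x *\<^sub>R (a *\<^sub>R w)) \<in> Pol (j + k) W"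
      using \<open>int (multi_deg \<alpha>) \<le> j\<close> monom assms(3)
      by (intro Pol_monomial) (auto simp: multi_deg_add subspace_scale)
    then show ?case by (simp add: monomial_mult[symmetric] mult_ac)
  next
    case (scale p r)
    then show ?case using Pol_scale[of _ _ _ r] by (fastforce simp: mult_ac)
  qed (auto simp: Pol_0 scaleR_right_distrib intro!: Pol_add)
qed

lemma Pol_times: "q \<in> Pol j UNIV \<Longrightarrow> p \<in> Pol k UNIV \<Longrightarrow> (\<lambda>x. q x * p x :: real) \<in> Pol (j + k) UNIV"
  using Pol_mult[of q j p k UNIV] by simp

lemma Pol_affine: "1 \<le> k \<Longrightarrow> (\<lambda>x::real^'n. g \<bullet> x + b) \<in> Pol k UNIV"
proof -
  assume k: "1 \<le> k"
  have "(\<lambda>x::real^'n. (\<Sum>i\<in>UNIV. g $ i *\<^sub>R (x $ i)) + b) \<in> Pol k UNIV"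
    using k by (intro Pol_add Pol_sum Pol_scale Pol_component Pol_const) auto
  then show ?thesis by (simp add: inner_vec_def)
qed

lemma Pol_id: "1 \<le> k \<Longrightarrow> (\<lambda>x::real^'n. x) \<in> Pol k UNIV"
proof -
  assume k: "1 \<le> k"
  have "(\<lambda>x::real^'n. \<Sum>i\<in>UNIV. (x $ i) *\<^sub>R axis i 1) \<in> Pol (1 + 0) UNIV"
    by (intro Pol_sum Pol_mult Pol_component Pol_const) auto
  also have "(\<lambda>x::real^'n. \<Sum>i\<in>UNIV. (x $ i) *\<^sub>R axis i 1) = (\<lambda>x. x)"
    by (simp add: fun_eq_iff basis_expansion flip: scalar_mult_eq_scaleR)
  finally show ?thesis using Pol_mono[of 1 k UNIV UNIV] k by auto
qed

section \<open>Derivatives of polynomials\<close>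

lemma monomial_has_derivative:
  "((monomial \<alpha> :: real^'n \<Rightarrow> real) has_derivative
     (\<lambda>h. \<Sum>i\<in>UNIV. h $ i * (real (\<alpha> i) * monomial (\<alpha>(i := \<alpha> i - 1)) x))) (at x)"
proof -
  have "((\<lambda>x::real^'n. \<Prod>i\<in>UNIV. x $ i ^ \<alpha> i) has_derivative
     (\<lambda>h. \<Sum>i\<in>UNIV. (of_nat (\<alpha> i) * h $ i * (x $ i) ^ (\<alpha> i - 1)) * (\<Prod>j\<in>UNIV - {i}. x $ j ^ \<alpha> j))) (at x)"
    by (rule has_derivative_prod) (auto intro!: derivative_eq_intros bounded_linear.has_derivative[OF bounded_linear_vec_nth] simp: fun_eq_iff)
  \<comment> \<open>For \<open>\<alpha> i = 0\<close> the truncated exponent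
    \<open>\<alpha> i - 1\<close> is again 0 and the factor \<open>real (\<alpha> i)\<close> removes
    the term, so no case distinction arises.\<close>
  moreover have "(of_nat (\<alpha> i) * h $ i * (x $ i) ^ (\<alpha> i - 1)) * (\<Prod>j\<in>UNIV - {i}. x $ j ^ \<alpha> j) =
      h $ i * (real (\<alpha> i) * monomial (\<alpha>(i := \<alpha> i - 1)) x)" for i and h :: "real^'n"
  proof -
    have "monomial (\<alpha>(i := \<alpha> i - 1)) x = x $ i ^ (\<alpha> i - 1) * (\<Prod>j\<in>UNIV - {i}. x $ j ^ (\<alpha>(i := \<alpha> i - 1)) j)"
      unfolding monomial_def by (subst prod.remove[of UNIV i]) auto
    also have "(\<Prod>j\<in>UNIV - {i}. x $ j ^ (\<alpha>(i := \<alpha> i - 1)) j) = (\<Prod>j\<in>UNIV - {i}. x $ j ^ \<alpha> j)"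
      by (intro prod.cong) auto
    finally show ?thesis by (simp del: fun_upd_apply)
  qed
  moreover have "(monomial \<alpha> :: real^'n \<Rightarrow> real) = (\<lambda>x. \<Prod>i\<in>UNIV. x $ i ^ \<alpha> i)"
    by (rule ext) (rule monomial_def)
  ultimately show ?thesis by (simp only:)
qed

lemma Pol_differentiable:
  fixes p :: "real^'n \<Rightarrow> 'v::real_normed_vector"
  shows "p \<in> Pol k W \<Longrightarrow> p differentiable (at x)"
proof (induction rule: Pol_induct)
  case (monom \<alpha> w)
  show ?case
    using monomial_has_derivative[of \<alpha> x] by (auto simp: differentiable_def intro!: exI has_derivative_scaleR_left)
qed (auto intro: derivative_intros)

lemma Pol_continuous: 
  fixes p :: "real^'n \<Rightarrow> 'v::real_normed_vector"
  shows "p \<in> Pol k W \<Longrightarrow> continuous_on S p"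
  by (meson Pol_differentiable continuous_at_imp_continuous_on differentiable_imp_continuous_within)

lemma partial_eq: "(f has_derivative f') (at x) \<Longrightarrow> partial j f x = f' (axis j 1)"
  unfolding partial_def by (simp add: frechet_derivative_at[symmetric])

lemma partial_has_derivative:
  fixes f :: "real^'n \<Rightarrow> 'v::real_normed_vector"
  assumes "f differentiable (at x)"
  shows "(f has_derivative (\<lambda>h. \<Sum>j\<in>UNIV. h $ j *\<^sub>R partial j f x)) (at x)"
proof -
  obtain f' where f': "(f has_derivative f') (at x)"
    using assms unfolding differentiable_def by blast
  have "f' h = (\<Sum>j\<in>UNIV. h $ j *\<^sub>R partial j f x)" for h
  proof -
    have "f' h = f' (\<Sum>j\<in>UNIV. h $ j *\<^sub>R axis j 1)"
      by (simp add: basis_expansion flip: scalar_mult_eq_scaleR)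
    also have "\<dots> = (\<Sum>j\<in>UNIV. h $ j *\<^sub>R f' (axis j 1))"
      using has_derivative_linear[OF f'] by (simp add: linear_sum linear_cmul)
    finally show ?thesis by (simp add: partial_eq[OF f'])
  qed
  then show ?thesis using f' by (metis (no_types, lifting) ext)
qed

lemma partial_add: "f differentiable (at x) \<Longrightarrow> g differentiable (at x) \<Longrightarrow>
    partial j (\<lambda>x. f x + g x) x = partial j f x + partial j g x"
  by (subst partial_eq[OF has_derivative_add[OF partial_has_derivative partial_has_derivative]])
     (auto simp: partial_eq[OF partial_has_derivative])

lemma partial_scaleR: "f differentiable (at x) \<Longrightarrow> partial j (\<lambda>x. r *\<^sub>R f x) x = r *\<^sub>R partial j f x"
  by (subst partial_eq[OF has_derivative_scaleR_right[OF partial_has_derivative]])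
     (auto simp: partial_eq[OF partial_has_derivative])

lemma partial_linear:
  assumes "f differentiable (at x)" "bounded_linear L"
  shows "partial j (\<lambda>x. L (f x)) x = L (partial j f x)"
proof -
  obtain f' where f': "(f has_derivative f') (at x)"
    using assms unfolding differentiable_def by blast
  show ?thesis
    using partial_eq[OF f'] partial_eq[OF bounded_linear.has_derivative[OF assms(2) f']] by simp
qed

lemma partial_cong_open:
  assumes "open S" "x \<in> S" "\<And>y. y \<in> S \<Longrightarrow> f y = g y" "g differentiable (at x)"
  shows "partial j f x = partial j g x"
proof -
  obtain g' where g': "(g has_derivative g') (at x)"
    using assms unfolding differentiable_def by blast
  then have "(f has_derivative g') (at x)"
    by (rule has_derivative_transform_within_open[OF _ assms(1,2)]) (simp add: assms(3))
  then show ?thesis using g' by (simp add: partial_eq)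
qed

lemma partial_monomial:
  "partial j (\<lambda>x::real^'n. monomial \<alpha> x *\<^sub>R w) = (\<lambda>x. monomial (\<alpha>(j := \<alpha> j - 1)) x *\<^sub>R (real (\<alpha> j) *\<^sub>R w))"
proof
  fix x :: "real^'n"
  have "((\<lambda>x. monomial \<alpha> x *\<^sub>R w) has_derivative
     (\<lambda>h. (\<Sum>i\<in>UNIV. h $ i * (real (\<alpha> i) * monomial (\<alpha>(i := \<alpha> i - 1)) x)) *\<^sub>R w)) (at x)"
    by (intro has_derivative_scaleR_left monomial_has_derivative)
  note partial_eq[OF this, of j]
  moreover have "(\<Sum>i\<in>UNIV. axis j 1 $ i * (real (\<alpha> i) * monomial (\<alpha>(i := \<alpha> i - 1)) x)) =
    (\<Sum>i\<in>UNIV. if i = j then real (\<alpha> i) * monomial (\<alpha>(i := \<alpha> i - 1)) x else 0)"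
    by (intro sum.cong) (auto simp: axis_def)
  ultimately show "partial j (\<lambda>x::real^'n. monomial \<alpha> x *\<^sub>R w) x = monomial (\<alpha>(j := \<alpha> j - 1)) x *\<^sub>R (real (\<alpha> j) *\<^sub>R w)"
    by (simp add: mult.commute)
qed

text \<open>Degrees are integers, so the derivative of a constant may be assigned degree -1, where
  the space is zero.\<close>

lemma Pol_partial:
  fixes p :: "real^'n \<Rightarrow> 'v::real_normed_vector"
  assumes "p \<in> Pol k W" "subspace W"
  shows "partial j p \<in> Pol (k - 1) W"
  using assms(1)
proof (induction rule: Pol_induct)
  case zero
  have "partial j (\<lambda>x::real^'n. 0::'v) = (\<lambda>x. 0)"
    by (intro ext partial_eq[THEN trans]) auto
  then show ?case by (simp add: Pol_0)
next
  case (add p q)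
  then have "partial j (\<lambda>x. p x + q x) = (\<lambda>x. partial j p x + partial j q x)"
    by (intro ext partial_add) (auto intro: Pol_differentiable)
  then show ?case using add by (simp add: Pol_add)
next
  case (scale p r)
  then have "partial j (\<lambda>x. r *\<^sub>R p x) = (\<lambda>x. r *\<^sub>R partial j p x)"
    by (intro ext partial_scaleR) (auto intro: Pol_differentiable)
  then show ?case using scale by (simp add: Pol_scale)
next
  case (monom \<alpha> w)
  show ?case
  proof (cases "\<alpha> j = 0")
    case True
    then show ?thesis by (simp add: partial_monomial Pol_0)
  next
    case False
    have "multi_deg \<alpha> = \<alpha> j + (\<Sum>i\<in>UNIV - {j}. \<alpha> i)"
      unfolding multi_deg_def by (subst sum.remove[of UNIV j]) auto
    moreover have "multi_deg (\<alpha>(j := \<alpha> j - 1)) = (\<alpha> j - 1) + (\<Sum>i\<in>UNIV - {j}. (\<alpha>(j := \<alpha> j - 1)) i)"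
      unfolding multi_deg_def by (subst sum.remove[of UNIV j]) auto
    moreover have "(\<Sum>i\<in>UNIV - {j}. (\<alpha>(j := \<alpha> j - 1)) i) = (\<Sum>i\<in>UNIV - {j}. \<alpha> i)"
      by (intro sum.cong) auto
    ultimately have "int (multi_deg (\<alpha>(j := \<alpha> j - 1))) \<le> k - 1"
      using monom False by linarith
    then show ?thesis
      unfolding partial_monomial using monom assms(2) by (intro Pol_monomial) (auto simp: subspace_scale)
  qed
qed

section \<open>Homogeneous parts and the identity principle\<close>

lemma Pol_split:
  assumes "p \<in> Pol k (UNIV :: real set)"
  obtains q h where "q \<in> Pol (k - 1) UNIV" "h \<in> Hom k" "p = (\<lambda>x. q x + h x)"
proof -
  have "\<exists>q h. q \<in> Pol (k - 1) UNIV \<and> h \<in> Hom k \<and> p = (\<lambda>x. q x + h x)"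
    using assms
  proof (induction rule: Pol_induct)
    case zero
    show ?case using Pol_0 subspace_0[OF subspace_Hom] by (intro exI[of _ "\<lambda>x. 0"]) (auto simp: zero_fun_def)
  next
    case (add p p')
    then obtain q h q' h' where "q \<in> Pol (k - 1) UNIV" "h \<in> Hom k" "p = (\<lambda>x. q x + h x)"
      "q' \<in> Pol (k - 1) UNIV" "h' \<in> Hom k" "p' = (\<lambda>x. q' x + h' x)" by blast
    then show ?case
      using subspace_add[OF subspace_Hom, of h k h']
      by - (rule exI[of _ "\<lambda>x. q x + q' x"], rule exI[of _ "h + h'"], simp add: Pol_add fun_eq_iff, simp add: plus_fun_def)
  next
    case (scale p r)
    then obtain q h where "q \<in> Pol (k - 1) UNIV" "h \<in> Hom k" "p = (\<lambda>x. q x + h x)" by blast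
    then show ?case
      using subspace_scale[OF subspace_Hom, of h k r] Pol_scale[of q "k - 1" UNIV r]
      by - (rule exI[of _ "\<lambda>x. r * q x"], rule exI[of _ "r *\<^sub>R h"], auto simp: distrib_left, simp add: scaleR_fun_def)
  next
    case (monom \<alpha> w)
    show ?case
    proof (cases "int (multi_deg \<alpha>) = k")
      case True
      then have "monomial \<alpha> \<in> Hom k" unfolding Hom_def by (intro span_base) auto
      then have "w *\<^sub>R monomial \<alpha> \<in> Hom k" by (rule subspace_scale[OF subspace_Hom])
      then show ?thesis
        using Pol_0 by - (rule exI[of _ "\<lambda>x. 0"], rule exI[of _ "w *\<^sub>R monomial \<alpha>"], auto simp: mult.commute, simp add: scaleR_fun_def)
    next
      case False
      then show ?thesis
        using monom subspace_0[OF subspace_Hom] Pol_monomial[of \<alpha> "k - 1" w UNIV]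
        by - (rule exI[of _ "\<lambda>x. monomial \<alpha> x *\<^sub>R w"], rule exI[of _ "\<lambda>x. 0"], auto simp: zero_fun_def)
    qed
  qed
  then show ?thesis using that by blast
qed

lemma Hom_induct [consumes 1, case_names zero step]:
  assumes "h \<in> Hom k"
    and "P (\<lambda>x. 0)"
    and "\<And>\<alpha> c h. int (multi_deg \<alpha>) = k \<Longrightarrow> h \<in> Hom k \<Longrightarrow> P h \<Longrightarrow> P (\<lambda>x. c * monomial \<alpha> x + h x)"
  shows "P h"
proof -
  have "h \<in> span {\<lambda>x. monomial \<alpha> x |\<alpha>. int (multi_deg \<alpha>) = k}" using assms(1) by (simp add: Hom_def)
  then have "h \<in> Hom k \<and> P h"
  proof (induction rule: span_induct_alt)
    case base
    show ?case using assms(2) subspace_0[OF subspace_Hom] by (simp add: zero_fun_def)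
  next
    case (step c x y)
    then obtain \<alpha> where \<alpha>: "x = monomial \<alpha>" "int (multi_deg \<alpha>) = k" by auto
    have "c *\<^sub>R x + y \<in> Hom k"
      using step unfolding Hom_def by (intro span_add span_scale) (auto intro: span_base)
    then show ?case using assms(3)[OF \<alpha>(2), of y c] step \<alpha> by (simp add: plus_fun_def scaleR_fun_def)
  qed
  then show ?thesis by simp
qed

lemma Hom_subset_Pol: "h \<in> Hom k \<Longrightarrow> h \<in> Pol k UNIV"
proof (induction rule: Hom_induct)
  case (step \<alpha> c h)
  then show ?case using Pol_monomial[of \<alpha> k c UNIV] by (auto simp: mult.commute intro!: Pol_add)
qed (simp add: Pol_0)

lemma monomial_scaleR: "monomial \<alpha> (t *\<^sub>R x) = t ^ multi_deg \<alpha> * monomial \<alpha> x"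
  by (simp add: monomial_def multi_deg_def power_mult_distrib prod.distrib power_sum)

lemma Hom_scaleR: "h \<in> Hom (int k) \<Longrightarrow> h (t *\<^sub>R x) = t ^ k * h x"
  by (induction rule: Hom_induct) (auto simp: monomial_scaleR algebra_simps)

text \<open>Euler's identity. It is checked on monomials, where the factor \<open>x $ j\<close>
  restores the exponent lost by differentiation, and it produces the factor in the divergence of
  \<open>h x *\<^sub>R x\<close>.\<close>

lemma Hom_euler: "h \<in> Hom (int k) \<Longrightarrow> (\<Sum>j\<in>UNIV. x $ j * partial j h x) = real k * h x"
proof (induction rule: Hom_induct)
  case zero
  have "partial j (\<lambda>x::real^'a. 0::real) = (\<lambda>x. 0)" for j
    by (intro ext partial_eq[THEN trans]) auto
  then show ?case by simp
next
  case (step \<alpha> c h)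
  have d: "h differentiable (at x)" "(\<lambda>x. monomial \<alpha> x *\<^sub>R c) differentiable (at x)"
    by (rule Pol_differentiable[OF Hom_subset_Pol[OF step(2)]],
        rule Pol_differentiable[OF Pol_monomial[of \<alpha> "int (multi_deg \<alpha>)" c UNIV]]) auto
  have "partial j (\<lambda>x. c * monomial \<alpha> x + h x) x = monomial (\<alpha>(j := \<alpha> j - 1)) x * (real (\<alpha> j) * c) + partial j h x" for j
  proof -
    have "partial j (\<lambda>x. c * monomial \<alpha> x + h x) x = partial j (\<lambda>x. monomial \<alpha> x *\<^sub>R c + h x) x"
      by (simp add: mult.commute)
    also have "\<dots> = partial j (\<lambda>x. monomial \<alpha> x *\<^sub>R c) x + partial j h x" by (rule partial_add[OF d(2) d(1)])
    finally show ?thesis by (simp only: partial_monomial) (simp only: real_scaleR_def)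
  qed
  moreover have eul: "x $ j * (monomial (\<alpha>(j := \<alpha> j - 1)) x * (real (\<alpha> j) * c)) = real (\<alpha> j) * (c * monomial \<alpha> x)" for j
  proof (cases "\<alpha> j = 0")
    case False
    have "monomial (\<alpha>(j := \<alpha> j - 1)) x = x $ j ^ (\<alpha> j - 1) * (\<Prod>i\<in>UNIV - {j}. x $ i ^ (\<alpha>(j := \<alpha> j - 1)) i)"
      unfolding monomial_def by (subst prod.remove[of UNIV j]) auto
    also have "(\<Prod>i\<in>UNIV - {j}. x $ i ^ (\<alpha>(j := \<alpha> j - 1)) i) = (\<Prod>i\<in>UNIV - {j}. x $ i ^ \<alpha> i)"
      by (intro prod.cong) auto
    finally have "x $ j * monomial (\<alpha>(j := \<alpha> j - 1)) x = x $ j ^ \<alpha> j * (\<Prod>i\<in>UNIV - {j}. x $ i ^ \<alpha> i)"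
      using False by (simp del: fun_upd_apply flip: power_Suc mult.assoc)
    also have "\<dots> = monomial \<alpha> x"
      unfolding monomial_def by (simp add: prod.remove[of UNIV j])
    finally show ?thesis by (simp add: mult_ac)
  qed simp
  ultimately have "(\<Sum>j\<in>UNIV. x $ j * partial j (\<lambda>x. c * monomial \<alpha> x + h x) x) =
      (\<Sum>j\<in>UNIV. real (\<alpha> j) * (c * monomial \<alpha> x)) + real k * h x"
    using step(3) by (simp only: distrib_left sum.distrib eul)
  also have "(\<Sum>j\<in>UNIV. real (\<alpha> j) * (c * monomial \<alpha> x)) = real k * (c * monomial \<alpha> x)"
    using step(1) by (simp add: multi_deg_def flip: sum_distrib_right of_nat_sum)
  finally show ?case by (simp add: distrib_left)
qed

lemma Pol_real_polynomial:
  assumes "p \<in> Pol k (UNIV :: real set)"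
  shows "real_polynomial_function (\<lambda>t. p (x0 + t *\<^sub>R y))"
  using assms
proof (induction rule: Pol_induct)
  case (monom \<alpha> w)
  have "real_polynomial_function (\<lambda>t::real. x0 $ i + t * y $ i)" for i
    by (intro real_polynomial_function.intros bounded_linear_mult_left)
  then show ?case
    by (auto simp: monomial_def intro!: real_polynomial_function.intros(4) real_polynomial_function.intros(2)
        real_polynomial_function_prod real_polynomial_function_power)
qed (auto intro: real_polynomial_function.intros)

lemma real_polynomial_function_eq_0:
  assumes "real_polynomial_function p" "infinite {t::real. p t = 0}"
  shows "p t = 0"
proof -
  obtain a n where p: "p = (\<lambda>x. \<Sum>i\<le>n. a i * x ^ i)"
    using real_polynomial_function_imp_sum[OF assms(1)] by blast
  have "a i = 0" if "i \<le> n" for i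
    using Transcendental.polyfun_rootbound[of a i n] assms(2) that unfolding p by auto
  then show ?thesis by (simp add: p)
qed

text \<open>On the line from a point of \<open>U\<close> to \<open>x\<close> each component is a
  univariate polynomial that vanishes on an interval, hence everywhere, in particular at parameter
  1.\<close>

lemma Pol_identity:
  fixes p :: "real^'n \<Rightarrow> 'v::euclidean_space"
  assumes "p \<in> Pol k W" "open U" "U \<noteq> {}" "\<And>x. x \<in> U \<Longrightarrow> p x = 0"
  shows "p x = 0"
proof (rule euclidean_eqI)
  fix b :: 'v assume "b \<in> Basis"
  obtain x0 where x0: "x0 \<in> U" using assms by blast
  obtain e where e: "e > 0" "ball x0 e \<subseteq> U"
    using assms(2) x0 open_contains_ball by blast
  let ?y = "x - x0"
  have lin: "linear (\<lambda>v. v \<bullet> b)" by (intro linearI) (auto simp: inner_left_distrib)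
  have rp: "real_polynomial_function (\<lambda>t. p (x0 + t *\<^sub>R ?y) \<bullet> b)"
    using Pol_real_polynomial[OF Pol_linear_image[OF lin _ assms(1), of UNIV]] by blast
  \<comment> \<open>The summand 1 in the denominator keeps the bound meaningful when
    \<open>x = x0\<close>.\<close>
  have "{0<..<e / (norm ?y + 1)} \<subseteq> {t. p (x0 + t *\<^sub>R ?y) \<bullet> b = 0}"
  proof clarsimp
    fix t assume t: "0 < t" "t < e / (norm ?y + 1)"
    have "t * (norm ?y + 1) < e" using t by (simp add: pos_less_divide_eq add_nonneg_pos)
    moreover have "t * norm ?y \<le> t * (norm ?y + 1)" using t by (intro mult_left_mono) auto
    ultimately have "t * norm ?y < e" by linarith
    then have "x0 + t *\<^sub>R ?y \<in> ball x0 e"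
      using t by (simp add: dist_norm)
    then show "p (x0 + t *\<^sub>R (x - x0)) \<bullet> b = 0" using e assms(4) by auto
  qed
  moreover have "infinite {0<..<e / (norm ?y + 1)}"
    using e by (simp add: infinite_Ioo add_nonneg_pos)
  ultimately have "infinite {t. p (x0 + t *\<^sub>R ?y) \<bullet> b = 0}"
    using infinite_super by blast
  from real_polynomial_function_eq_0[OF rp this, of 1] show "p x \<bullet> b = 0 \<bullet> b" by simp
qed

text \<open>Along a ray a monomial of degree \<open>m < k\<close> grows like the \<open>m\<close>-th
  power of the parameter; this separates it from a homogeneous part of degree
  \<open>k\<close>.\<close>

lemma Pol_scale_growth:
  assumes "p \<in> Pol (int k - 1) (UNIV :: real set)"
  shows "((\<lambda>t. p (t *\<^sub>R x) / t ^ k) \<longlongrightarrow> 0) at_top"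
  using assms
proof (induction rule: Pol_induct)
  case (add p q)
  then show ?case using tendsto_add[OF add(3,4)] by (simp add: add_divide_distrib)
next
  case (scale p r)
  then show ?case using tendsto_mult_left[of _ 0, of "\<lambda>t. p (t *\<^sub>R x) / t ^ k" at_top r] by simp
next
  case (monom \<alpha> w)
  define m where "m = multi_deg \<alpha>"
  have m: "m < k" using monom by (simp add: m_def)
  have "((\<lambda>t::real. (monomial \<alpha> x * w) * (1 / t ^ (k - m))) \<longlongrightarrow> (monomial \<alpha> x * w) * 0) at_top"
    using m by (intro tendsto_intros tendsto_divide_0[OF tendsto_const] filterlim_at_top_imp_at_infinity
        filterlim_pow_at_top filterlim_ident) auto
  moreover have "\<forall>\<^sub>F t::real in at_top. (monomial \<alpha> x * w) * (1 / t ^ (k - m)) = monomial \<alpha> (t *\<^sub>R x) *\<^sub>R w / t ^ k"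
    using eventually_gt_at_top[of 0]
  proof eventually_elim
    case (elim t)
    have "t ^ k = t ^ m * t ^ (k - m)" using m by (simp flip: power_add)
    then show ?case using elim by (simp add: monomial_scaleR m_def)
  qed
  ultimately show ?case by (simp add: tendsto_cong)
qed simp

text \<open>The parts of different degree separate along rays.\<close>

lemma Hom_Pol_independent:
  assumes "p \<in> Pol (int k - 1) UNIV" "h \<in> Hom (int k)" "\<And>x. p x + h x = 0"
  shows "h x = 0"
proof -
  have "\<forall>\<^sub>F t in at_top. p (t *\<^sub>R x) / t ^ k = - h x"
    using eventually_gt_at_top[of 0]
  proof eventually_elim
    case (elim t)
    then show ?case using assms(3)[of "t *\<^sub>R x"] by (simp add: Hom_scaleR[OF assms(2)] divide_simps) (simp add: algebra_simps)
  qed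
  then have "((\<lambda>t. p (t *\<^sub>R x) / t ^ k) \<longlongrightarrow> - h x) at_top"
    by (rule tendsto_eventually)
  with Pol_scale_growth[OF assms(1), of x] show ?thesis
    using tendsto_unique[OF trivial_limit_at_top_linorder] by fastforce
qed

lemma findim_Pol: "findim (Pol k (UNIV :: 'v::euclidean_space set) :: (real^'n \<Rightarrow> 'v) set)"
proof -
  let ?B = "(\<lambda>(\<alpha>, b) (x::real^'n). monomial \<alpha> x *\<^sub>R b) ` ({\<alpha>::'n \<Rightarrow> nat. int (multi_deg \<alpha>) \<le> k} \<times> (Basis :: 'v set))"
  have fin: "finite ?B" by (intro finite_imageI finite_cartesian_product finite_multi_deg_int_le finite_Basis)
  have "p \<in> span ?B" if "p \<in> Pol k UNIV" for p :: "real^'n \<Rightarrow> 'v"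
    using that
  proof (induction rule: Pol_induct)
    case zero
    show ?case using span_zero[of ?B] by (simp add: zero_fun_def)
  next
    case (add p q)
    then show ?case using span_add[of p ?B q] by (simp add: plus_fun_def)
  next
    case (scale p r)
    then show ?case using span_scale[of p ?B r] by (simp add: scaleR_fun_def)
  next
    case (monom \<alpha> w)
    have "(\<lambda>x::real^'n. monomial \<alpha> x *\<^sub>R w) = (\<Sum>b\<in>Basis. (w \<bullet> b) *\<^sub>R (\<lambda>x::real^'n. monomial \<alpha> x *\<^sub>R b))"
    proof
      fix x :: "real^'n"
      have "monomial \<alpha> x *\<^sub>R w = monomial \<alpha> x *\<^sub>R (\<Sum>b\<in>Basis. (w \<bullet> b) *\<^sub>R b)" by (simp add: euclidean_representation)
      also have "\<dots> = (\<Sum>b\<in>Basis. (w \<bullet> b) *\<^sub>R (monomial \<alpha> x *\<^sub>R b))"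
        by (simp add: scaleR_sum_right mult.commute)
      finally show "monomial \<alpha> x *\<^sub>R w = (\<Sum>b\<in>Basis. (w \<bullet> b) *\<^sub>R (\<lambda>x::real^'n. monomial \<alpha> x *\<^sub>R b)) x"
        by (simp add: sum_fun_apply)
    qed
    also have "\<dots> \<in> span ?B"
    proof (intro span_sum span_scale span_base)
      fix b :: 'v assume "b \<in> Basis"
      then show "(\<lambda>x. monomial \<alpha> x *\<^sub>R b) \<in> ?B" using monom by (intro image_eqI[of _ _ "(\<alpha>, b)"]) auto
    qed
    finally show ?case .
  qed
  then show ?thesis unfolding findim_def using fin by blast
qed

lemma linear_trunc: "linear (trunc D :: ('a \<Rightarrow> 'v::real_vector) \<Rightarrow> _)"
  by (intro linearI) (auto simp: trunc_def fun_eq_iff)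

section \<open>Barycentric coordinates\<close>

text \<open>A full-dimensional simplex is given by its vertex set. Facets are indexed by the
  opposite vertex, so that a facet is the zero set of one barycentric coordinate in the simplex and
  sums over facets are sums over \<open>C\<close>.\<close>

locale vertices =
  fixes C :: "(real^'n) set"
  assumes finite_C: "finite C" and independent_C: "\<not> affine_dependent C"
    and card_C: "card C = CARD('n) + 1"
begin

abbreviation "T \<equiv> convex hull C"
abbreviation "facet a \<equiv> convex hull (C - {a})"

definition "bary_pair a = (SOME p. \<forall>b\<in>C. fst p \<bullet> b + snd p = (if b = a then 1 else (0::real)))"

text \<open>The barycentric coordinate \<open>bl a\<close> belonging to the vertex \<open>a\<close> and its gradient \<open>bg a\<close>.\<close>

definition bg :: "real^'n \<Rightarrow> real^'n" where "bg a = fst (bary_pair a)"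
definition bl :: "real^'n \<Rightarrow> real^'n \<Rightarrow> real" where "bl a x = bg a \<bullet> x + snd (bary_pair a)"

lemma other_vertex: obtains b where "b \<in> C" "b \<noteq> a"
proof -
  have "0 < CARD('n)" by simp
  then have "\<not> C \<subseteq> {a}"
    using card_C card_mono[of "{a}" C] by auto
  then show ?thesis using that by blast
qed

text \<open>Existence of the affine function behind the choice in \<open>bary_pair\<close>: the
  edges from another vertex \<open>c\<close> are independent, so a linear functional can be
  prescribed on them, and the constant term makes the function vanish at \<open>c\<close>.\<close>

lemma bl_vertex:
  assumes "a \<in> C" "b \<in> C"
  shows "bl a b = (if b = a then 1 else 0)"
proof -
  obtain c where c: "c \<in> C" "c \<noteq> a" by (rule other_vertex)
  let ?B = "(\<lambda>x. - c + x) ` (C - {c})"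
  have "independent ?B"
    using independent_C affine_dependent_iff_dependent2[OF c(1)] by blast
  then obtain g :: "real^'n \<Rightarrow> real" where g: "linear g" "\<And>v. v \<in> ?B \<Longrightarrow> g v = (if v = - c + a then 1 else 0)"
    using linear_independent_extend[of ?B "\<lambda>v. if v = - c + a then 1 else 0"] by blast
  define w where "w = adjoint g 1"
  have ga: "g x = w \<bullet> x" for x
    using adjoint_works[OF g(1), of x 1] by (simp add: inner_commute w_def)
  have "w \<bullet> b + (- (w \<bullet> c)) = (if b = a then 1 else 0)" if "b \<in> C" for b
  proof (cases "b = c")
    case True
    then show ?thesis using c by auto
  next
    case False
    have "w \<bullet> b + (- (w \<bullet> c)) = g (- c + b)"
      by (simp add: ga inner_diff_right)
    also have "\<dots> = (if b = a then 1 else 0)"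
      using False that by (subst g(2)) auto
    finally show ?thesis .
  qed
  then have "\<exists>p. \<forall>b\<in>C. fst p \<bullet> b + snd p = (if b = a then 1 else (0::real))"
    by (intro exI[of _ "(w, - (w \<bullet> c))"]) auto
  from someI_ex[OF this] show ?thesis
    using assms(2) unfolding bl_def bg_def bary_pair_def by blast
qed

lemma bl_affine: "sum u S = 1 \<Longrightarrow> bl a (\<Sum>v\<in>S. u v *\<^sub>R v) = (\<Sum>v\<in>S. u v * bl a v)"
  by (simp add: bl_def inner_sum_right distrib_left sum.distrib flip: sum_distrib_right)

lemma bl_diff: "bl a y - bl a x = bg a \<bullet> (y - x)"
  by (simp add: bl_def inner_diff_right)

lemma bl_add: "bl a (x + v) = bl a x + bg a \<bullet> v"
  by (simp add: bl_def inner_add_right)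

lemma affine_hull_C: "affine hull C = UNIV"
proof -
  have "aff_dim C = DIM(real^'n)"
    using aff_dim_affine_independent[OF independent_C] card_C by simp
  then show ?thesis using aff_dim_eq_full by blast
qed

lemma affine_comb:
  obtains u where "sum u C = 1" "x = (\<Sum>v\<in>C. u v *\<^sub>R v)" "\<And>a. a \<in> C \<Longrightarrow> bl a x = u a"
proof -
  obtain u where u: "sum u C = 1" "x = (\<Sum>v\<in>C. u v *\<^sub>R v)"
  proof -
    assume that: "\<And>u. sum u C = 1 \<Longrightarrow> x = (\<Sum>v\<in>C. u v *\<^sub>R v) \<Longrightarrow> thesis"
    have "x \<in> affine hull C" using affine_hull_C by simp
    then show thesis
      unfolding affine_hull_finite[OF finite_C] mem_Collect_eq using that by blast
  qed
  have "bl a x = u a" if "a \<in> C" for a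
  proof -
    have "bl a x = (\<Sum>v\<in>C. u v * bl a v)" using bl_affine[OF u(1)] u(2) by simp
    also have "\<dots> = (\<Sum>v\<in>C. if v = a then u v else 0)"
      using that by (intro sum.cong) (auto simp: bl_vertex)
    finally show ?thesis using finite_C that by simp
  qed
  then show ?thesis using that u by blast
qed

lemma bl_sum: "(\<Sum>a\<in>C. bl a x) = 1"
  by (rule affine_comb[of x]) (metis (no_types, lifting) sum.cong)

lemma bl_repr: "(\<Sum>a\<in>C. bl a x *\<^sub>R a) = x"
  by (rule affine_comb[of x]) (metis (no_types, lifting) sum.cong)

lemma T_eq: "T = {x. \<forall>a\<in>C. 0 \<le> bl a x}"
proof (rule set_eqI)
  fix x
  obtain u where u: "sum u C = 1" "x = (\<Sum>v\<in>C. u v *\<^sub>R v)" "\<And>a. a \<in> C \<Longrightarrow> bl a x = u a"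
    by (rule affine_comb[of x]) blast
  have coeff: "bl a x = w a" if "\<forall>v\<in>C. 0 \<le> w v" "sum w C = 1" "(\<Sum>v\<in>C. w v *\<^sub>R v) = x" "a \<in> C" for a w
  proof -
    have "bl a x = (\<Sum>v\<in>C. w v * bl a v)" using bl_affine[OF that(2)] that(3) by simp
    also have "\<dots> = (\<Sum>v\<in>C. if v = a then w v else 0)"
      using that by (intro sum.cong) (auto simp: bl_vertex)
    finally show ?thesis using finite_C that by simp
  qed
  show "x \<in> T \<longleftrightarrow> x \<in> {x. \<forall>a\<in>C. 0 \<le> bl a x}"
  proof
    assume "x \<in> T"
    then obtain w where w: "\<forall>v\<in>C. 0 \<le> w v" "sum w C = 1" "(\<Sum>v\<in>C. w v *\<^sub>R v) = x"
      unfolding convex_hull_finite[OF finite_C] by blast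
    then show "x \<in> {x. \<forall>a\<in>C. 0 \<le> bl a x}" using coeff[OF w] by simp
  next
    assume "x \<in> {x. \<forall>a\<in>C. 0 \<le> bl a x}"
    then have "\<forall>a\<in>C. 0 \<le> u a" using u(3) by simp
    then show "x \<in> T"
      unfolding convex_hull_finite[OF finite_C] mem_Collect_eq using u(1) u(2)[symmetric] by blast
  qed
qed

lemma in_T: "x \<in> T \<longleftrightarrow> (\<forall>a\<in>C. 0 \<le> bl a x)"
  by (simp add: T_eq)

lemma bl_facet_convex:
  assumes "a \<in> C"
  shows "x \<in> facet a \<longleftrightarrow> x \<in> T \<and> bl a x = 0"
proof
  assume x: "x \<in> facet a"
  then have "x \<in> T" using hull_mono[of "C - {a}" C convex] by blast
  obtain u where u: "\<forall>v\<in>C - {a}. 0 \<le> u v" "sum u (C - {a}) = 1" "(\<Sum>v\<in>C - {a}. u v *\<^sub>R v) = x"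
    using x unfolding convex_hull_finite[OF finite_Diff[OF finite_C]] by blast
  have "bl a x = (\<Sum>v\<in>C - {a}. u v * bl a v)" using bl_affine[OF u(2)] u(3) by simp
  also have "\<dots> = 0" using assms by (intro sum.neutral) (auto simp: bl_vertex)
  finally show "x \<in> T \<and> bl a x = 0" using \<open>x \<in> T\<close> by blast
next
  assume x: "x \<in> T \<and> bl a x = 0"
  have "(\<Sum>v\<in>C - {a}. bl v x) = 1"
    using bl_sum[of x] x by (simp add: sum.remove[OF finite_C assms])
  moreover have "(\<Sum>v\<in>C - {a}. bl v x *\<^sub>R v) = x"
    using bl_repr[of x] x by (simp add: sum.remove[OF finite_C assms])
  ultimately show "x \<in> facet a"
    unfolding convex_hull_finite[OF finite_Diff[OF finite_C]] using x by (auto simp: in_T intro!: exI[of _ "\<lambda>v. bl v x"])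
qed

lemma affine_hull_facet:
  assumes "a \<in> C"
  shows "affine hull facet a = {x. bl a x = 0}"
proof (rule set_eqI)
  fix x
  have hull: "affine hull facet a = affine hull (C - {a})" by simp
  show "x \<in> affine hull facet a \<longleftrightarrow> x \<in> {x. bl a x = 0}"
  proof
    assume "x \<in> affine hull facet a"
    then obtain u where u: "sum u (C - {a}) = 1" "(\<Sum>v\<in>C - {a}. u v *\<^sub>R v) = x"
      unfolding hull affine_hull_finite[OF finite_Diff[OF finite_C]] by blast
    have "bl a x = (\<Sum>v\<in>C - {a}. u v * bl a v)" using bl_affine[OF u(1)] u(2) by simp
    also have "\<dots> = 0" using assms by (intro sum.neutral) (auto simp: bl_vertex)
    finally show "x \<in> {x. bl a x = 0}" by simp
  next
    assume x: "x \<in> {x. bl a x = 0}"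
    have "(\<Sum>v\<in>C - {a}. bl v x) = 1"
      using bl_sum[of x] x by (simp add: sum.remove[OF finite_C assms])
    moreover have "(\<Sum>v\<in>C - {a}. bl v x *\<^sub>R v) = x"
      using bl_repr[of x] x by (simp add: sum.remove[OF finite_C assms])
    ultimately show "x \<in> affine hull facet a"
      unfolding hull affine_hull_finite[OF finite_Diff[OF finite_C]] by (auto intro!: exI[of _ "\<lambda>v. bl v x"])
  qed
qed

lemma in_rel_interior_facet:
  assumes "a \<in> C"
  shows "x \<in> rel_interior (facet a) \<longleftrightarrow> bl a x = 0 \<and> (\<forall>b\<in>C - {a}. 0 < bl b x)"
proof -
  have ind: "\<not> affine_dependent (C - {a})"
    using independent_C affine_independent_Diff by blast
  note expl = rel_interior_convex_hull_explicit[OF ind]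
  show ?thesis
  proof
    assume x: "x \<in> rel_interior (facet a)"
    then obtain u where u: "\<forall>v\<in>C - {a}. 0 < u v" "sum u (C - {a}) = 1" "(\<Sum>v\<in>C - {a}. u v *\<^sub>R v) = x"
      unfolding expl by blast
    have "bl a x = 0"
      using x rel_interior_subset bl_facet_convex[OF assms] by blast
    moreover have "bl b x = u b" if "b \<in> C - {a}" for b
    proof -
      have "bl b x = (\<Sum>v\<in>C - {a}. u v * bl b v)" using bl_affine[OF u(2)] u(3) by simp
      also have "\<dots> = (\<Sum>v\<in>C - {a}. if v = b then u v else 0)"
        using that by (intro sum.cong) (auto simp: bl_vertex)
      finally show ?thesis using finite_C that by simp
    qed
    ultimately show "bl a x = 0 \<and> (\<forall>b\<in>C - {a}. 0 < bl b x)" using u(1) by simp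
  next
    assume x: "bl a x = 0 \<and> (\<forall>b\<in>C - {a}. 0 < bl b x)"
    have "(\<Sum>v\<in>C - {a}. bl v x) = 1"
      using bl_sum[of x] x by (simp add: sum.remove[OF finite_C assms])
    moreover have "(\<Sum>v\<in>C - {a}. bl v x *\<^sub>R v) = x"
      using bl_repr[of x] x by (simp add: sum.remove[OF finite_C assms])
    ultimately show "x \<in> rel_interior (facet a)"
      unfolding expl using x by (auto intro!: exI[of _ "\<lambda>v. bl v x"])
  qed
qed

lemma facet_nonempty: "facet a \<noteq> {}"
  using other_vertex[of a] hull_inc[of _ "C - {a}"] by blast

lemma facet_of_T: "F facet_of T \<longleftrightarrow> (\<exists>a\<in>C. F = facet a)"
  using facet_of_convex_hull_affine_independent[OF independent_C, of F] facet_nonempty by blast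

lemma vertex_in_facet: "a \<in> C \<Longrightarrow> b \<in> C \<Longrightarrow> b \<in> facet a \<longleftrightarrow> b \<noteq> a"
  by (metis bl_facet_convex bl_vertex hull_inc zero_neq_one)

lemma facet_inj: "inj_on (\<lambda>a. facet a) C"
  by (rule inj_onI) (metis vertex_in_facet)

lemma facets_eq: "{F. F facet_of T} = (\<lambda>a. facet a) ` C"
  by (auto simp: facet_of_T)

lemma finite_facets: "finite {F. F facet_of T}"
  by (simp add: facets_eq finite_C)

lemma sum_facets: "(\<Sum>F | F facet_of T. f F) = (\<Sum>a\<in>C. f (facet a))"
  unfolding facets_eq by (simp add: sum.reindex[OF facet_inj])

lemma compact_T: "compact T" and compact_facet: "compact (facet a)"
  using finite_C by (auto intro: finite_imp_compact_convex_hull)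

lemma bg_nonzero: "a \<in> C \<Longrightarrow> bg a \<noteq> 0"
proof
  assume a: "a \<in> C" "bg a = 0"
  obtain b where "b \<in> C" "b \<noteq> a" by (rule other_vertex)
  then show False using bl_vertex[of a b] bl_vertex[of a a] a bl_diff[of a a b] by simp
qed

lemma bg_sum: "(\<Sum>a\<in>C. bg a) = 0"
proof -
  have "(\<Sum>a\<in>C. bg a) \<bullet> v = 0" for v
  proof -
    have "(\<Sum>a\<in>C. bl a v - bl a 0) = 0" by (simp add: sum_subtractf bl_sum)
    then show ?thesis by (simp add: bl_diff inner_sum_left)
  qed
  then show ?thesis by (metis inner_eq_zero_iff)
qed

text \<open>The linear part of \<open>bl_repr\<close>. As the coefficients sum to 0 by
  \<open>bg_sum\<close>, the vertices may be replaced by their differences from any fixed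
  point.\<close>

lemma bg_repr: "(\<Sum>a\<in>C. (bg a \<bullet> v) *\<^sub>R a) = v"
proof -
  have "(\<Sum>a\<in>C. (bl a v - bl a 0) *\<^sub>R a) = v"
    by (simp add: scaleR_left_diff_distrib sum_subtractf bl_repr)
  then show ?thesis by (simp add: bl_diff)
qed

lemma bg_edge: "a \<in> C \<Longrightarrow> b \<in> C \<Longrightarrow> c \<in> C \<Longrightarrow>
    bg a \<bullet> (b - c) = (if b = a then 1 else 0) - (if c = a then 1 else 0)"
  by (simp add: bl_vertex flip: bl_diff)

section \<open>Facet normals and heights\<close>

definition nrm :: "real^'n \<Rightarrow> real^'n" where
  "nrm a = - (1 / norm (bg a)) *\<^sub>R bg a"

text \<open>The distance from the vertex \<open>a\<close> to the plane of the opposite facet: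
  \<open>bl a\<close> rises from 0 to 1 over it, at the rate \<open>norm (bg a)\<close>.\<close>

definition height :: "real^'n \<Rightarrow> real" where
  "height a = 1 / norm (bg a)"

lemma norm_nrm: "a \<in> C \<Longrightarrow> norm (nrm a) = 1"
  using bg_nonzero by (simp add: nrm_def)

lemma height_pos: "a \<in> C \<Longrightarrow> 0 < height a"
  using bg_nonzero by (simp add: height_def)

lemma bg_nrm: "a \<in> C \<Longrightarrow> bg a = - (1 / height a) *\<^sub>R nrm a"
  using bg_nonzero by (simp add: height_def nrm_def)

text \<open>Every vector is a combination of the edges from a vertex \<open>b\<close> of the facet,
  and \<open>n\<close> annihilates all of them but the edge to \<open>a\<close>. Hence
  \<open>n\<close> acts like a multiple of \<open>bg a\<close>, with the factor given by any edge
  ending at \<open>a\<close>.\<close>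

lemma normal_parallel:
  assumes "a \<in> C" "\<And>x y. x \<in> facet a \<Longrightarrow> y \<in> facet a \<Longrightarrow> n \<bullet> (y - x) = 0"
  obtains \<kappa> where "n = \<kappa> *\<^sub>R bg a" "\<And>b. b \<in> C \<Longrightarrow> b \<noteq> a \<Longrightarrow> \<kappa> = n \<bullet> (a - b)"
proof -
  obtain b where b: "b \<in> C" "b \<noteq> a" by (rule other_vertex)
  have perp: "n \<bullet> (c - b) = 0" if "c \<in> C" "c \<noteq> a" for c
    using assms(1) b that by (intro assms(2)) (auto simp: vertex_in_facet)
  have *: "n \<bullet> v = (n \<bullet> (a - b)) * (bg a \<bullet> v)" for v
  proof -
    have "v = (\<Sum>c\<in>C. (bg c \<bullet> v) *\<^sub>R (c - b))"
      using bg_repr[of v] bg_sum by (simp add: scaleR_right_diff_distrib sum_subtractf flip: scaleR_sum_left inner_sum_left)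
    then have "n \<bullet> v = (\<Sum>c\<in>C. (bg c \<bullet> v) * (n \<bullet> (c - b)))"
      by (metis (no_types, lifting) inner_scaleR_right inner_sum_right sum.cong)
    also have "\<dots> = (\<Sum>c\<in>C. if c = a then (bg c \<bullet> v) * (n \<bullet> (c - b)) else 0)"
      using perp by (intro sum.cong) auto
    finally show ?thesis using finite_C assms(1) by simp
  qed
  have "n = (n \<bullet> (a - b)) *\<^sub>R bg a"
  proof (rule vector_eq_ldot[THEN iffD1], rule allI)
    show "x \<bullet> n = x \<bullet> ((n \<bullet> (a - b)) *\<^sub>R bg a)" for x
      using *[of x] by (simp add: inner_commute)
  qed
  moreover have "n \<bullet> (a - b) = n \<bullet> (a - c)" if "c \<in> C" "c \<noteq> a" for c
    using perp[OF that] by (simp add: inner_diff_right)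
  ultimately show ?thesis using that by blast
qed

lemma normal_cases:
  assumes "a \<in> C" "norm n = 1" "\<And>x y. x \<in> facet a \<Longrightarrow> y \<in> facet a \<Longrightarrow> n \<bullet> (y - x) = 0"
  shows "n = nrm a \<or> n = - nrm a"
proof -
  obtain \<kappa> where k: "n = \<kappa> *\<^sub>R bg a" by (rule normal_parallel[OF assms(1,3)]) blast
  then have "\<bar>\<kappa>\<bar> * norm (bg a) = 1" using assms(2) by simp
  then have "\<bar>\<kappa>\<bar> = 1 / norm (bg a)" using bg_nonzero[OF assms(1)] by (simp add: field_simps)
  then have "\<kappa> = 1 / norm (bg a) \<or> \<kappa> = - (1 / norm (bg a))" by linarith
  then show ?thesis using k by (auto simp: nrm_def)
qed

lemma nrm_perp: "a \<in> C \<Longrightarrow> x \<in> facet a \<Longrightarrow> y \<in> facet a \<Longrightarrow> nrm a \<bullet> (y - x) = 0"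
  using bl_diff[of a y x] by (simp add: nrm_def bl_facet_convex)

lemma nrm_outward: "a \<in> C \<Longrightarrow> x \<in> facet a \<Longrightarrow> y \<in> T \<Longrightarrow> nrm a \<bullet> (y - x) \<le> 0"
  using bl_diff[of a y x] by (auto simp: nrm_def bl_facet_convex in_T)

lemma outward_normal_eq:
  assumes a: "a \<in> C"
  shows "outward_normal T (facet a) = nrm a"
  unfolding outward_normal_def
proof (rule the_equality)
  show "norm (nrm a) = 1 \<and> (\<forall>x\<in>facet a. \<forall>y\<in>T. nrm a \<bullet> (y - x) \<le> 0)"
    using a norm_nrm nrm_outward by blast
next
  fix n assume n: "norm n = 1 \<and> (\<forall>x\<in>facet a. \<forall>y\<in>T. n \<bullet> (y - x) \<le> 0)"
  have sub: "facet a \<subseteq> T" using bl_facet_convex[OF a] by blast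
  have "n \<bullet> (y - x) = 0" if "x \<in> facet a" "y \<in> facet a" for x y
  proof -
    have "n \<bullet> (y - x) \<le> 0" "n \<bullet> (x - y) \<le> 0" using n that sub by blast+
    then show ?thesis by (simp add: inner_diff_right)
  qed
  then have "n = nrm a \<or> n = - nrm a" using normal_cases[OF a] n by blast
  \<comment> \<open>The coordinate \<open>bl a\<close> grows towards the opposite vertex, so an edge
    from the facet to \<open>a\<close> has positive product with \<open>- nrm a\<close>; this fixes
    the sign.\<close>
  moreover have False if "n = - nrm a"
  proof -
    obtain b where b: "b \<in> C" "b \<noteq> a" by (rule other_vertex)
    then have "n \<bullet> (a - b) \<le> 0" using n vertex_in_facet[OF a b(1)] hull_inc[OF a] by blast
    moreover have "n \<bullet> (a - b) = 1 / norm (bg a)"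
      using that bg_edge[OF a a b(1)] b by (simp add: nrm_def)
    ultimately show False using bg_nonzero[OF a] by (simp add: divide_le_0_iff)
  qed
  ultimately show "n = nrm a" by blast
qed

lemma closest_point_facet:
  assumes a: "a \<in> C"
  shows "closest_point (affine hull facet a) y = y - (bl a y / (norm (bg a))\<^sup>2) *\<^sub>R bg a"
proof (rule closest_point_unique[symmetric])
  have g: "bg a \<noteq> 0" using bg_nonzero[OF a] .
  let ?p = "y - (bl a y / (norm (bg a))\<^sup>2) *\<^sub>R bg a"
  show "convex (affine hull facet a)" "closed (affine hull facet a)"
    by (auto simp: affine_imp_convex affine_affine_hull closed_affine_hull)
  have "bl a ?p = 0"
    using bl_diff[of a ?p y] g by (simp add: inner_diff_right power2_norm_eq_inner)
  then show "?p \<in> affine hull facet a" unfolding affine_hull_facet[OF a] by simp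
  show "\<forall>z\<in>affine hull facet a. dist y ?p \<le> dist y z"
  proof
    fix z assume "z \<in> affine hull facet a"
    then have "bl a z = 0" unfolding affine_hull_facet[OF a] by simp
    then have "\<bar>bl a y\<bar> \<le> norm (bg a) * norm (y - z)"
      using bl_diff[of a y z] Cauchy_Schwarz_ineq2[of "bg a" "y - z"] by simp
    then have "\<bar>bl a y\<bar> / norm (bg a) \<le> norm (y - z)" using g by (simp add: field_simps)
    moreover have "dist y ?p = \<bar>bl a y\<bar> / norm (bg a)"
      using g by (simp add: dist_norm power2_eq_square)
    ultimately show "dist y ?p \<le> dist y z" by (simp add: dist_norm)
  qed
qed

lemma continuous_bl: "continuous_on S (bl a)"
  unfolding bl_def[abs_def] by (intro continuous_intros)

lemma Pol_bl: "bl a \<in> Pol 1 UNIV"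
  unfolding bl_def[abs_def] by (rule Pol_affine) simp

lemma interior_T: "interior T = {x. \<forall>a\<in>C. 0 < bl a x}"
proof
  have "{x. \<forall>a\<in>C. 0 < bl a x} = (\<Inter>a\<in>C. {x. 0 < bl a x})" by auto
  moreover have "open (\<Inter>a\<in>C. {x. 0 < bl a x})"
    using finite_C by (intro open_INT ballI open_Collect_less continuous_bl continuous_intros) auto
  ultimately show "{x. \<forall>a\<in>C. 0 < bl a x} \<subseteq> interior T"
    by (intro interior_maximal) (auto simp: in_T less_imp_le)
  show "interior T \<subseteq> {x. \<forall>a\<in>C. 0 < bl a x}"
  proof clarify
    fix x a assume x: "x \<in> interior T" and a: "a \<in> C"
    obtain e where e: "e > 0" "ball x e \<subseteq> T" using x mem_interior by blast
    \<comment> \<open>A step along the outward normal of the facet opposite \<open>a\<close> stays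
      in the ball and lowers \<open>bl a\<close> by \<open>(e / 2) * norm (bg a)\<close>. Since the
      result is still nonnegative, the value at \<open>x\<close> was positive.\<close>
    define y where "y = x + (e / 2) *\<^sub>R nrm a"
    have "y \<in> T" using e norm_nrm[OF a] by (intro subsetD[OF e(2)]) (simp add: y_def dist_norm)
    then have "0 \<le> bl a y" using a by (simp add: in_T)
    moreover have "bl a y = bl a x - (e / 2) * norm (bg a)"
      unfolding y_def bl_add using bg_nonzero[OF a] by (simp add: nrm_def power2_norm_eq_inner[symmetric] power2_eq_square)
    ultimately show "0 < bl a x"
      using e(1) bg_nonzero[OF a] by (smt (verit) half_gt_zero mult_pos_pos zero_less_norm_iff)
  qed
qed

lemma interior_T_nonempty: "interior T \<noteq> {}"
proof -
  have C0: "real (card C) > 0" using card_C by simp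
  define x where "x = (\<Sum>v\<in>C. (1 / real (card C)) *\<^sub>R v)"
  have "bl a x > 0" if "a \<in> C" for a
  proof -
    have "bl a x = (\<Sum>v\<in>C. (1 / real (card C)) * bl a v)"
      unfolding x_def using C0 by (intro bl_affine) simp
    also have "\<dots> = (\<Sum>v\<in>C. if v = a then 1 / real (card C) else 0)"
      using that by (intro sum.cong) (auto simp: bl_vertex)
    finally show ?thesis using C0 that finite_C by simp
  qed
  then show ?thesis unfolding interior_T by blast
qed

text \<open>Close to a relative interior point of a facet all other barycentric coordinates stay
  positive, so the simplex is locally a half space.\<close>

lemma half_ball:
  assumes "a \<in> C" "x \<in> rel_interior (facet a)"
  obtains e where "0 < e" "\<And>y. y \<in> ball x e \<Longrightarrow> 0 \<le> bl a y \<Longrightarrow> y \<in> T"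
proof -
  have "open (\<Inter>b\<in>C - {a}. {x. 0 < bl b x})"
    using finite_C by (intro open_INT ballI open_Collect_less continuous_bl continuous_intros) auto
  moreover have "x \<in> (\<Inter>b\<in>C - {a}. {x. 0 < bl b x})"
    using assms by (simp add: in_rel_interior_facet)
  ultimately obtain e where e: "0 < e" "ball x e \<subseteq> (\<Inter>b\<in>C - {a}. {x. 0 < bl b x})"
    using open_contains_ball by blast
  show ?thesis
  proof (rule that[OF e(1)])
    fix y assume y: "y \<in> ball x e" "0 \<le> bl a y"
    have "0 \<le> bl b y" if "b \<in> C" for b
      using y e(2) that by (cases "b = a") (auto simp: less_imp_le)
    then show "y \<in> T" by (simp add: in_T)
  qed
qed

lemma edges_span:
  assumes "a \<in> C" "\<And>b. b \<in> C \<Longrightarrow> v \<bullet> (a - b) = 0"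
  shows "v = 0"
proof -
  have "v \<bullet> w = 0" for w
  proof -
    have "w = (\<Sum>b\<in>C. (bg b \<bullet> w) *\<^sub>R (b - a))"
      using bg_repr[of w] bg_sum by (simp add: scaleR_right_diff_distrib sum_subtractf flip: scaleR_sum_left inner_sum_left)
    then have "v \<bullet> w = (\<Sum>b\<in>C. (bg b \<bullet> w) * (v \<bullet> (b - a)))"
      by (metis (no_types, lifting) inner_scaleR_right inner_sum_right sum.cong)
    also have "\<dots> = 0"
      using assms(2) by (intro sum.neutral) (auto simp: inner_diff_right)
    finally show ?thesis .
  qed
  then show ?thesis by (metis inner_eq_zero_iff)
qed

end

lemma vertices_exist:
  assumes "int CARD('n) simplex (T :: (real^'n) set)"
  obtains C where "vertices C" "T = convex hull C"
proof -
  obtain C where C: "finite C" "\<not> affine_dependent C" "int (card C) = int CARD('n) + 1" "T = convex hull C"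
    using assms unfolding simplex by blast
  then have "vertices C" by unfold_locales auto
  then show ?thesis using that C(4) by blast
qed

section \<open>The divergence theorem on a simplex\<close>

lemma LINT_lebesgue_on_borel:
  fixes f :: "'a::euclidean_space \<Rightarrow> 'b::euclidean_space"
  assumes "D \<in> sets borel" "(\<lambda>x. indicator D x *\<^sub>R f x) \<in> borel_measurable borel"
  shows "(LINT x|lebesgue_on D. f x) = (LINT x|lborel. indicator D x *\<^sub>R f x)"
proof -
  have "(LINT x|lebesgue_on D. f x) = (LINT x|lebesgue. indicator D x *\<^sub>R f x)"
    using assms(1) by (intro integral_restrict_space) auto
  also have "\<dots> = (LINT x|lborel. indicator D x *\<^sub>R f x)"
    using assms(2) by (intro integral_completion) auto
  finally show ?thesis .
qed

text \<open>Moves integrals to \<open>lborel\<close>, where translation and scaling are available.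
  Continuity is asked on \<open>D\<close> alone because discrete fields jump to zero outside their
  elements.\<close>

lemma LINT_compact:
  fixes f :: "'a::euclidean_space \<Rightarrow> 'b::euclidean_space"
  assumes "compact D" "continuous_on D f"
  shows "(LINT x|lebesgue_on D. f x) = (LINT x|lborel. indicator D x *\<^sub>R f x)"
    and "integrable lborel (\<lambda>x. indicator D x *\<^sub>R f x)"
    and "integrable (lebesgue_on D) f"
proof -
  show int: "integrable lborel (\<lambda>x. indicator D x *\<^sub>R f x)"
    using borel_integrable_compact[OF assms] by (simp add: indicator_scaleR_eq_if)
  have D: "D \<in> sets borel" using assms(1) by (simp add: borel_compact)
  show "(LINT x|lebesgue_on D. f x) = (LINT x|lborel. indicator D x *\<^sub>R f x)"
    using int D by (intro LINT_lebesgue_on_borel) auto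
  have "integrable lebesgue (\<lambda>x. indicator D x *\<^sub>R f x)"
    using int by (simp add: integrable_completion borel_measurable_integrable)
  then show "integrable (lebesgue_on D) f"
    using D by (subst integrable_restrict_space) auto
qed

lemma LINT_translation:
  fixes f :: "'a::euclidean_space \<Rightarrow> 'b::{banach, second_countable_topology}"
  assumes "f \<in> borel_measurable borel"
  shows "(LINT x|lborel. f (x + c)) = (LINT x|lborel. f x)"
proof -
  have "(LINT x|lborel. f x) = (LINT x|distr lborel borel ((+) c). f x)"
    by (simp add: lborel_distr_plus)
  also have "\<dots> = (LINT x|lborel. f (c + x))"
    using assms by (intro integral_distr) auto
  finally show ?thesis by (simp add: add.commute)
qed

lemma LINT_scaling:
  fixes f :: "'a::euclidean_space \<Rightarrow> real"
  assumes "f \<in> borel_measurable borel" "c > 0"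
  shows "(LINT x|lborel. f x) = c ^ DIM('a) * (LINT x|lborel. f (t + c *\<^sub>R x))"
proof -
  have "(LINT x|lborel. f x) = (LINT x|density (distr lborel borel (\<lambda>x. t + c *\<^sub>R x)) (\<lambda>_. \<bar>c\<bar> ^ DIM('a)). f x)"
    using assms(2) lborel_affine[of c t] by simp
  also have "\<dots> = (LINT x|distr lborel borel (\<lambda>x. t + c *\<^sub>R x). \<bar>c\<bar> ^ DIM('a) *\<^sub>R f x)"
    using assms by (subst integral_density) auto
  also have "\<dots> = (LINT x|lborel. \<bar>c\<bar> ^ DIM('a) *\<^sub>R f (t + c *\<^sub>R x))"
    using assms by (subst integral_distr) auto
  finally show ?thesis using assms(2) by simp
qed

text \<open>For \<open>g = 0\<close> the level set is empty when \<open>c\<close> is not 0; the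
  hypothesis excludes just the case in which it is the whole space.\<close>

lemma AE_hyperplane:
  fixes g :: "'a::euclidean_space"
  assumes "g \<noteq> 0 \<or> c \<noteq> 0"
  shows "AE y in lborel. g \<bullet> y \<noteq> c"
proof -
  have "negligible {y. g \<bullet> y = c}" using assms by (rule negligible_hyperplane)
  then have "{y. g \<bullet> y = c} \<in> null_sets lebesgue" by (simp add: negligible_iff_null_sets)
  moreover have "{y. g \<bullet> y = c} \<in> sets lborel" by simp
  ultimately have "{y. g \<bullet> y = c} \<in> null_sets lborel"
    by (auto simp: null_sets_def)
  then show ?thesis by (rule AE_I') auto
qed

definition C1 :: "(real^'n \<Rightarrow> real) \<Rightarrow> bool" where
  "C1 \<psi> \<longleftrightarrow> (\<forall>x. \<psi> differentiable (at x)) \<and> continuous_on UNIV (grad \<psi>)"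

lemma grad_has_derivative:
  assumes "\<psi> differentiable (at x)"
  shows "(\<psi> has_derivative (\<lambda>v. grad \<psi> x \<bullet> v)) (at x)"
  using partial_has_derivative[OF assms] by (simp add: grad_def inner_vec_def mult.commute)

lemma C1_derivative: "C1 \<psi> \<Longrightarrow> (\<psi> has_derivative (\<lambda>v. grad \<psi> x \<bullet> v)) (at x)"
  by (simp add: C1_def grad_has_derivative)

lemma C1_continuous: "C1 \<psi> \<Longrightarrow> continuous_on S \<psi>"
  by (meson C1_derivative continuous_at_imp_continuous_on has_derivative_continuous)

lemma C1_grad_continuous: "C1 \<psi> \<Longrightarrow> continuous_on S (grad \<psi>)"
  unfolding C1_def using continuous_on_subset by blast

lemma C1_partial_continuous: "C1 \<psi> \<Longrightarrow> continuous_on S (partial j \<psi>)"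
  using continuous_on_component[OF C1_grad_continuous, of \<psi> S j] by (simp add: grad_def)

lemma C1_Pol: "p \<in> Pol k UNIV \<Longrightarrow> C1 p"
  unfolding C1_def
proof (intro conjI allI)
  assume p: "p \<in> Pol k UNIV"
  show "p differentiable (at x)" for x using p by (rule Pol_differentiable)
  show "continuous_on UNIV (grad p)"
    unfolding grad_def[abs_def] using Pol_continuous[OF Pol_partial[OF p]] by (intro continuous_on_vec_lambda) auto
qed

lemma partial_mult:
  assumes "f differentiable (at x)" "g differentiable (at x)"
  shows "partial j (\<lambda>x. f x * g x) x = f x * partial j g x + partial j f x * (g x :: real)"
proof -
  have "((\<lambda>x. f x * g x) has_derivative
     (\<lambda>h. f x * (\<Sum>j\<in>UNIV. h $ j *\<^sub>R partial j g x) + (\<Sum>j\<in>UNIV. h $ j *\<^sub>R partial j f x) * g x)) (at x)"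
    by (intro has_derivative_mult partial_has_derivative assms)
  from partial_eq[OF this, of j] partial_eq[OF partial_has_derivative[OF assms(1)], of j]
    partial_eq[OF partial_has_derivative[OF assms(2)], of j]
  show ?thesis by simp
qed

lemma C1_mult:
  assumes "C1 f" "C1 g"
  shows "C1 (\<lambda>x. f x * g x)"
  unfolding C1_def
proof (intro conjI allI)
  have d: "f differentiable (at x)" "g differentiable (at x)" for x
    using assms by (auto simp: C1_def)
  show "(\<lambda>x. f x * g x) differentiable (at x)" for x by (intro differentiable_mult d)
  have "grad (\<lambda>x. f x * g x) = (\<lambda>x. \<chi> j. f x * partial j g x + partial j f x * g x)"
    by (simp add: grad_def[abs_def] partial_mult[OF d])
  then show "continuous_on UNIV (grad (\<lambda>x. f x * g x))"
    by (simp only:) (intro continuous_on_vec_lambda continuous_intros C1_continuous C1_partial_continuous assms)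
qed

lemma C1_lipschitz:
  assumes "C1 \<psi>" "compact S" "convex S"
  obtains L where "0 \<le> L" "\<And>x y. x \<in> S \<Longrightarrow> y \<in> S \<Longrightarrow> \<bar>\<psi> y - \<psi> x\<bar> \<le> L * norm (y - x)"
proof -
  have "compact (grad \<psi> ` S)"
    using C1_grad_continuous[OF assms(1)] assms(2) compact_continuous_image by blast
  then obtain L where L: "L > 0" "\<And>x. x \<in> S \<Longrightarrow> norm (grad \<psi> x) \<le> L"
    using compact_imp_bounded bounded_pos by (metis imageI)
  have "\<bar>\<psi> y - \<psi> x\<bar> \<le> L * norm (y - x)" if "x \<in> S" "y \<in> S" for x y
  proof -
    have "norm (\<psi> y - \<psi> x) \<le> L * norm (y - x)"
    proof (rule differentiable_bound[OF assms(3)])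
      fix z assume z: "z \<in> S"
      show "(\<psi> has_derivative (\<lambda>v. grad \<psi> z \<bullet> v)) (at z within S)"
        using C1_derivative[OF assms(1)] has_derivative_at_withinI by blast
      show "onorm (\<lambda>v. grad \<psi> z \<bullet> v) \<le> L"
      proof (rule onorm_le)
        fix v
        show "norm (grad \<psi> z \<bullet> v) \<le> L * norm v"
          using Cauchy_Schwarz_ineq2[of "grad \<psi> z" v] L(2)[OF z] mult_right_mono[of "norm (grad \<psi> z)" L "norm v"] by simp
      qed
    qed (use that in auto)
    then show ?thesis by simp
  qed
  then show ?thesis using that L(1) less_imp_le by blast
qed

section \<open>Integrals over a facet as integrals over prisms\<close>

locale vertex_in = vertices C for C :: "(real^'n) set" +
  fixes a :: "real^'n"
  assumes a: "a \<in> C"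
begin

text \<open>\<open>depth\<close> is the signed distance from the plane of the facet, positive on the
  side of \<open>a\<close>; \<open>foot\<close> is the orthogonal projection to that plane. A
  translation along the normal shifts the first by a constant and leaves the second alone, which
  replaces Fubini's theorem in \<open>slab_scaling\<close>.\<close>

definition depth :: "real^'n \<Rightarrow> real" where "depth y = height a * bl a y"
definition foot :: "real^'n \<Rightarrow> real^'n" where "foot y = y + depth y *\<^sub>R nrm a"

lemma bg_dot_nrm: "bg a \<bullet> nrm a = - norm (bg a)"
  using bg_nonzero[OF a] by (simp add: nrm_def power2_norm_eq_inner[symmetric] power2_eq_square)

lemma height_mult: "height a * norm (bg a) = 1"
  using bg_nonzero[OF a] by (simp add: height_def)

lemma depth_translate: "depth (y + s *\<^sub>R nrm a) = depth y - s"
proof -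
  have "depth (y + s *\<^sub>R nrm a) = depth y - s * (height a * norm (bg a))"
    by (simp add: depth_def bl_add bg_dot_nrm algebra_simps)
  then show ?thesis by (simp add: height_mult)
qed

lemma foot_translate: "foot (y + s *\<^sub>R nrm a) = foot y"
  by (simp add: foot_def depth_translate algebra_simps)

lemma depth_foot: "depth (foot y) = 0"
  by (simp add: foot_def depth_translate)

lemma bl_foot: "bl a (foot y) = 0"
  using depth_foot[of y] height_pos[OF a] by (simp add: depth_def)

lemma closest_point_foot: "closest_point (affine hull facet a) y = foot y"
  using bg_nonzero[OF a]
  by (simp only: closest_point_facet[OF a]) (simp add: foot_def depth_def nrm_def height_def power2_eq_square)

lemma foot_facet: "x \<in> facet a \<Longrightarrow> foot x = x"
  by (simp add: foot_def depth_def bl_facet_convex[OF a])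

lemma foot_in_facet: "foot y \<in> facet a \<longleftrightarrow> (\<forall>b\<in>C - {a}. 0 \<le> bl b (foot y))"
  using bl_foot[of y] a by (auto simp: bl_facet_convex in_T)

lemma foot_decomp: "y = foot y + (- depth y) *\<^sub>R nrm a"
  by (simp add: foot_def)

lemma bl_foot_diff: "bl b (foot y) - bl b y = depth y * (bg b \<bullet> nrm a)"
  by (simp add: foot_def bl_add)

lemma continuous_depth: "continuous_on S depth"
  unfolding depth_def[abs_def] by (intro continuous_intros continuous_bl)

lemma continuous_foot: "continuous_on S foot"
  unfolding foot_def[abs_def] by (intro continuous_intros continuous_depth)

lemma measurable_depth [measurable]: "depth \<in> borel_measurable borel"
  by (intro borel_measurable_continuous_onI continuous_depth)

lemma measurable_foot [measurable]: "foot \<in> borel_measurable borel"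
  by (intro borel_measurable_continuous_onI continuous_foot)

lemma measurable_bl [measurable]: "bl b \<in> borel_measurable borel"
  by (intro borel_measurable_continuous_onI continuous_bl)

lemma AE_depth: "AE y in lborel. depth y \<noteq> c"
proof -
  have "AE y in lborel. (height a *\<^sub>R bg a) \<bullet> y \<noteq> c - depth 0"
    using bg_nonzero[OF a] height_pos[OF a] by (intro AE_hyperplane) auto
  then show ?thesis
    by (rule AE_mp) (auto simp: depth_def bl_def algebra_simps)
qed

text \<open>The composition is affine, and it is not identically zero because it takes the value 1
  at the vertex \<open>b\<close>, which lies in the facet and is its own foot.\<close>

lemma AE_bl_foot:
  assumes "b \<in> C" "b \<noteq> a"
  shows "AE y in lborel. bl b (foot y) \<noteq> 0"
proof -
  let ?g = "bg b + (height a * (bg b \<bullet> nrm a)) *\<^sub>R bg a"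
  have eq: "bl b (foot y) = ?g \<bullet> y + bl b (foot 0)" for y
    by (simp add: foot_def bl_add depth_def) (simp add: bl_def algebra_simps)
  have "?g \<noteq> 0 \<or> - bl b (foot 0) \<noteq> 0"
  proof (rule ccontr)
    assume "\<not> ?thesis"
    then have "bl b (foot b) = 0" using eq[of b] by auto
    moreover have "foot b = b" using assms a by (intro foot_facet) (simp add: vertex_in_facet)
    ultimately show False using bl_vertex[OF assms(1) assms(1)] by simp
  qed
  then have "AE y in lborel. ?g \<bullet> y \<noteq> - bl b (foot 0)" by (rule AE_hyperplane)
  moreover have "?g \<bullet> y \<noteq> - bl b (foot 0) \<Longrightarrow> bl b (foot y) \<noteq> 0" for y
    using eq[of y] by linarith
  ultimately show ?thesis by (rule eventually_mono)
qed

text \<open>Half open, so that the unit slab is the disjoint union of \<open>N\<close> translates of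
  the slab of thickness \<open>1 / N\<close>.\<close>

abbreviation "slab r \<equiv> indicator {y. 0 \<le> depth y \<and> depth y < r} :: real^'n \<Rightarrow> real"

text \<open>The integrand is constant along the normal, so the \<open>N\<close> thin slabs that tile
  the unit slab are translates of each other with equal integrals.\<close>

lemma slab_scaling:
  assumes K [measurable]: "K \<in> borel_measurable borel" and inv: "\<And>y s. K (y + s *\<^sub>R nrm a) = K y"
    and int: "integrable lborel (\<lambda>y. slab 1 y * K y)" and N: "0 < N"
  shows "(LINT y|lborel. slab (1 / real N) y * K y) = (1 / real N) * (LINT y|lborel. slab 1 y * K y)"
    and "integrable lborel (\<lambda>y. slab (1 / real N) y * K y)"
proof -
  define F where "F j y = indicator {y. real j / real N \<le> depth y \<and> depth y < (real j + 1) / real N} y * K y"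
    for j :: nat and y
  have [measurable]: "F j \<in> borel_measurable borel" for j
    unfolding F_def[abs_def] by measurable
  have N': "real N > 0" using N by simp
  have Feq: "F j y = indicator {y. real j / real N \<le> depth y \<and> depth y < (real j + 1) / real N} y * (slab 1 y * K y)"
    if "j < N" for j y
  proof -
    have "0 \<le> real j / real N" "(real j + 1) / real N \<le> 1" using N' that by (auto simp: divide_simps)
    moreover have "0 \<le> depth y" if "real j / real N \<le> depth y"
      using that N' by (meson divide_nonneg_pos of_nat_0_le_iff order_trans)
    ultimately show ?thesis unfolding F_def by (auto simp: indicator_def)
  qed
  have Fint: "integrable lborel (F j)" if "j < N" for j
  proof -
    have "integrable lborel (\<lambda>y. indicator {y. real j / real N \<le> depth y \<and> depth y < (real j + 1) / real N} y *\<^sub>R (slab 1 y * K y))"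
      by (rule integrable_mult_indicator[OF _ int]) simp
    moreover have "F j = (\<lambda>y. indicator {y. real j / real N \<le> depth y \<and> depth y < (real j + 1) / real N} y *\<^sub>R (slab 1 y * K y))"
      by (rule ext) (simp add: Feq[OF that])
    ultimately show ?thesis by simp
  qed
  have trans: "(LINT y|lborel. F j y) = (LINT y|lborel. F 0 y)" for j
  proof -
    have "F j y = F 0 (y + (real j / real N) *\<^sub>R nrm a)" for y
      unfolding F_def by (simp add: depth_translate inv indicator_def add_divide_distrib)
        (simp add: algebra_simps)
    then show ?thesis by (simp add: LINT_translation)
  qed
  have sum: "slab 1 y * K y = (\<Sum>j<N. F j y)" for y
  proof (cases "0 \<le> depth y \<and> depth y < 1")
    case True
    \<comment> \<open>The index of the one thin slab that contains \<open>y\<close>.\<close>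
    define m where "m = nat \<lfloor>depth y * real N\<rfloor>"
    have m: "real m \<le> depth y * real N" "depth y * real N < real m + 1"
      using True N' by (auto simp: m_def)
    have "depth y * real N < 1 * real N" using True N' by (intro mult_strict_right_mono) auto
    then have mN: "m < N" using m(1) by (metis le_less_trans mult_1 of_nat_less_iff)
    have iff: "real j / real N \<le> depth y \<and> depth y < (real j + 1) / real N \<longleftrightarrow> j = m" for j :: nat
    proof -
      have "real j / real N \<le> depth y \<longleftrightarrow> real j \<le> depth y * real N"
        using N' by (simp add: divide_le_eq)
      moreover have "depth y < (real j + 1) / real N \<longleftrightarrow> depth y * real N < real j + 1"
        using N' by (simp add: less_divide_eq)
      moreover have "real j \<le> depth y * real N \<and> depth y * real N < real j + 1 \<longleftrightarrow> j = m"
        using m by auto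
      ultimately show ?thesis by blast
    qed
    have "(\<Sum>j<N. F j y) = (\<Sum>j<N. if j = m then K y else 0)"
      unfolding F_def by (intro sum.cong) (simp_all add: indicator_def iff)
    then show ?thesis using True mN by (simp add: indicator_def)
  next
    case False
    have "F j y = 0" if "j < N" for j
      using Feq[OF that, of y] False by (auto simp: indicator_def)
    then show ?thesis using False by (simp add: indicator_def)
  qed
  have "(LINT y|lborel. slab 1 y * K y) = (\<Sum>j<N. LINT y|lborel. F j y)"
    unfolding sum by (intro Bochner_Integration.integral_sum Fint) auto
  also have "\<dots> = (\<Sum>j<N. LINT y|lborel. F 0 y)"
    by (intro sum.cong refl trans)
  also have "\<dots> = real N * (LINT y|lborel. F 0 y)" by simp
  finally have eq: "(LINT y|lborel. slab 1 y * K y) = real N * (LINT y|lborel. F 0 y)" .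
  have F0: "F 0 = (\<lambda>y. slab (1 / real N) y * K y)"
    by (simp add: F_def fun_eq_iff)
  show "(LINT y|lborel. slab (1 / real N) y * K y) = (1 / real N) * (LINT y|lborel. slab 1 y * K y)"
    using eq N' by (simp add: F0)
  show "integrable lborel (\<lambda>y. slab (1 / real N) y * K y)"
    using Fint[OF N] by (simp add: F0)
qed

text \<open>The coordinates of the foot sum to 1, so lower bounds for all of them imply upper
  bounds. The margin \<open>r\<close> admits prisms over slightly enlarged facets, which occur in
  the estimates near the relative boundary.\<close>

lemma bounded_prism: "bounded {y. (\<forall>b\<in>C - {a}. - r \<le> bl b (foot y)) \<and> \<bar>depth y\<bar> \<le> s}"
proof -
  have "norm y \<le> (\<Sum>b\<in>C. (\<bar>r\<bar> + 1 + \<bar>r\<bar> * real (card C)) * norm b) + \<bar>s\<bar>"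
    if y: "\<forall>b\<in>C - {a}. - r \<le> bl b (foot y)" "\<bar>depth y\<bar> \<le> s" for y
  proof -
    have low: "- \<bar>r\<bar> \<le> bl b (foot y)" if "b \<in> C" for b
      using y(1) that bl_foot[of y] by (cases "b = a") (auto, smt (verit) DiffI singletonD)
    have abs: "\<bar>bl b (foot y)\<bar> \<le> \<bar>r\<bar> + 1 + \<bar>r\<bar> * real (card C)" if b: "b \<in> C" for b
    proof -
      have "bl b (foot y) = 1 - (\<Sum>c\<in>C - {b}. bl c (foot y))"
        using bl_sum[of "foot y"] by (simp add: sum.remove[OF finite_C b])
      moreover have "(\<Sum>c\<in>C - {b}. - \<bar>r\<bar>) \<le> (\<Sum>c\<in>C - {b}. bl c (foot y))"
        using low by (intro sum_mono) auto
      ultimately have "bl b (foot y) \<le> 1 + \<bar>r\<bar> * real (card (C - {b}))" by (simp add: mult.commute)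
      also have "\<dots> \<le> 1 + \<bar>r\<bar> * real (card C)"
        using finite_C by (intro add_left_mono mult_left_mono) (auto intro: card_mono)
      finally show ?thesis using low[OF b] by (smt (verit) mult_nonneg_nonneg of_nat_0_le_iff)
    qed
    have "norm (foot y) = norm (\<Sum>b\<in>C. bl b (foot y) *\<^sub>R b)" by (simp add: bl_repr)
    also have "\<dots> \<le> (\<Sum>b\<in>C. norm (bl b (foot y) *\<^sub>R b))" by (rule norm_sum)
    also have "\<dots> \<le> (\<Sum>b\<in>C. (\<bar>r\<bar> + 1 + \<bar>r\<bar> * real (card C)) * norm b)"
      using abs by (intro sum_mono) (auto intro: mult_right_mono)
    finally have "norm (foot y) \<le> (\<Sum>b\<in>C. (\<bar>r\<bar> + 1 + \<bar>r\<bar> * real (card C)) * norm b)" .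
    moreover have "norm y \<le> norm (foot y) + norm ((- depth y) *\<^sub>R nrm a)"
      using norm_triangle_ineq[of "foot y" "(- depth y) *\<^sub>R nrm a"] foot_decomp[of y] by metis
    ultimately show ?thesis using y(2) norm_nrm[OF a] by auto
  qed
  then show ?thesis unfolding bounded_iff by blast
qed

text \<open>\<open>face_integral\<close> extrudes the facet along the given normal: for the outward
  normal the prism lies on the far side of the facet plane, for its negative on the side of the
  simplex.\<close>

lemma prism_eq:
  "{x + t *\<^sub>R nrm a |x t. x \<in> facet a \<and> 0 \<le> t \<and> t \<le> 1} = {y. foot y \<in> facet a \<and> - 1 \<le> depth y \<and> depth y \<le> 0}"
  "{x + t *\<^sub>R (- nrm a) |x t. x \<in> facet a \<and> 0 \<le> t \<and> t \<le> 1} = {y. foot y \<in> facet a \<and> 0 \<le> depth y \<and> depth y \<le> 1}"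
proof -
  have d0: "depth x = 0" if "x \<in> facet a" for x using that by (simp add: depth_def bl_facet_convex[OF a])
  show "{x + t *\<^sub>R nrm a |x t. x \<in> facet a \<and> 0 \<le> t \<and> t \<le> 1} = {y. foot y \<in> facet a \<and> - 1 \<le> depth y \<and> depth y \<le> 0}"
  proof (intro set_eqI iffI)
    fix y assume "y \<in> {x + t *\<^sub>R nrm a |x t. x \<in> facet a \<and> 0 \<le> t \<and> t \<le> 1}"
    then show "y \<in> {y. foot y \<in> facet a \<and> - 1 \<le> depth y \<and> depth y \<le> 0}"
      by (auto simp: foot_translate depth_translate foot_facet d0)
  next
    fix y assume "y \<in> {y. foot y \<in> facet a \<and> - 1 \<le> depth y \<and> depth y \<le> 0}"
    then show "y \<in> {x + t *\<^sub>R nrm a |x t. x \<in> facet a \<and> 0 \<le> t \<and> t \<le> 1}"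
      using foot_decomp[of y] by (intro CollectI exI[of _ "foot y"] exI[of _ "- depth y"]) auto
  qed
  show "{x + t *\<^sub>R (- nrm a) |x t. x \<in> facet a \<and> 0 \<le> t \<and> t \<le> 1} = {y. foot y \<in> facet a \<and> 0 \<le> depth y \<and> depth y \<le> 1}"
  proof (intro set_eqI iffI)
    fix y assume "y \<in> {x + t *\<^sub>R (- nrm a) |x t. x \<in> facet a \<and> 0 \<le> t \<and> t \<le> 1}"
    then obtain x t where x: "y = x + t *\<^sub>R (- nrm a)" "x \<in> facet a" "0 \<le> t" "t \<le> 1" by blast
    then show "y \<in> {y. foot y \<in> facet a \<and> 0 \<le> depth y \<and> depth y \<le> 1}"
      using foot_translate[of x "- t"] depth_translate[of x "- t"] by (simp add: foot_facet d0)
  next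
    fix y assume "y \<in> {y. foot y \<in> facet a \<and> 0 \<le> depth y \<and> depth y \<le> 1}"
    then show "y \<in> {x + t *\<^sub>R (- nrm a) |x t. x \<in> facet a \<and> 0 \<le> t \<and> t \<le> 1}"
      using foot_decomp[of y] by (intro CollectI exI[of _ "foot y"] exI[of _ "depth y"]) auto
  qed
qed

lemma compact_prism: "compact {y. foot y \<in> facet a \<and> r \<le> depth y \<and> depth y \<le> s}"
proof -
  have "closed (foot -` facet a)"
    using continuous_foot[of UNIV] compact_facet[of a] by (simp add: compact_imp_closed continuous_closed_vimage continuous_on_eq_continuous_at)
  moreover have "closed {y. r \<le> depth y}" "closed {y. depth y \<le> s}"
    by (intro closed_Collect_le continuous_intros continuous_depth)+
  ultimately have "closed (foot -` facet a \<inter> {y. r \<le> depth y} \<inter> {y. depth y \<le> s})"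
    by (intro closed_Int)
  moreover have "bounded (foot -` facet a \<inter> {y. r \<le> depth y} \<inter> {y. depth y \<le> s})"
    by (rule bounded_subset[OF bounded_prism[of 0 "\<bar>r\<bar> + \<bar>s\<bar>"]]) (auto simp: foot_in_facet)
  moreover have "foot -` facet a \<inter> {y. r \<le> depth y} \<inter> {y. depth y \<le> s} = {y. foot y \<in> facet a \<and> r \<le> depth y \<and> depth y \<le> s}"
    by auto
  ultimately show ?thesis by (simp add: compact_eq_bounded_closed)
qed

text \<open>The value of \<open>face_integral\<close> on a facet for either sign of the normal.\<close>

definition fint :: "(real^'n \<Rightarrow> real) \<Rightarrow> real" where
  "fint \<psi> = (LINT y|lborel. slab 1 y * (indicator (facet a) (foot y) * \<psi> (foot y)))"

lemma fint_measurable: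
  fixes \<psi> :: "real^'n \<Rightarrow> real"
  assumes "continuous_on (facet a) \<psi>"
  shows "(\<lambda>y. indicator (facet a) (foot y) * \<psi> (foot y)) \<in> borel_measurable borel"
proof -
  have "(\<lambda>x. indicator (facet a) x *\<^sub>R \<psi> x) \<in> borel_measurable borel"
    using assms compact_facet[of a] by (intro borel_measurable_continuous_on_indicator) (auto simp: borel_compact)
  from measurable_compose[OF measurable_foot this] show ?thesis by simp
qed

lemma prism_integral:
  assumes "continuous_on (facet a) \<psi>"
  shows "(LINT y|lebesgue_on {y. foot y \<in> facet a \<and> 0 \<le> depth y \<and> depth y \<le> 1}. \<psi> (foot y)) = fint \<psi>"
    and "integrable lborel (\<lambda>y. slab 1 y * (indicator (facet a) (foot y) * \<psi> (foot y)))"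
proof -
  let ?P = "{y. foot y \<in> facet a \<and> 0 \<le> depth y \<and> depth y \<le> 1}"
  have cont: "continuous_on ?P (\<lambda>y. \<psi> (foot y))"
    by (rule continuous_on_compose2[OF assms continuous_foot]) auto
  note c = LINT_compact[OF compact_prism cont]
  have [measurable]: "(\<lambda>y. indicator (facet a) (foot y) * \<psi> (foot y)) \<in> borel_measurable borel"
    by (rule fint_measurable[OF assms])
  \<comment> \<open>The closed prism and the half-open slab differ only in the plane
    \<open>depth y = 1\<close>, a null set.\<close>
  have ae: "AE y in lborel. indicator ?P y *\<^sub>R \<psi> (foot y) = slab 1 y * (indicator (facet a) (foot y) * \<psi> (foot y))"
    using AE_depth[of 1] by (rule AE_mp) (auto simp: indicator_def)
  have m: "(\<lambda>y. slab 1 y * (indicator (facet a) (foot y) * \<psi> (foot y))) \<in> borel_measurable lborel"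
    by measurable
  show "(LINT y|lebesgue_on ?P. \<psi> (foot y)) = fint \<psi>"
    unfolding c(1) fint_def using c(2) m ae by (intro integral_cong_AE) auto
  show "integrable lborel (\<lambda>y. slab 1 y * (indicator (facet a) (foot y) * \<psi> (foot y)))"
    using c(2) by (rule integrable_cong_AE_imp[OF _ m]) (use ae in auto)
qed

lemma face_integral_eq:
  assumes "continuous_on (facet a) \<psi>" "n = nrm a \<or> n = - nrm a"
  shows "face_integral (facet a) n \<psi> = fint \<psi>"
proof -
  have eq: "face_integral (facet a) (- nrm a) \<psi> = fint \<psi>"
    unfolding face_integral_def prism_eq closest_point_foot by (rule prism_integral[OF assms(1)])
  have "face_integral (facet a) (nrm a) \<psi> = fint \<psi>"
  proof -
    let ?P = "{y. foot y \<in> facet a \<and> 0 \<le> depth y \<and> depth y \<le> 1}"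
    let ?P' = "{y. foot y \<in> facet a \<and> - 1 \<le> depth y \<and> depth y \<le> 0}"
    have cont: "continuous_on S (\<lambda>y. \<psi> (foot y))" if "S \<subseteq> foot -` facet a" for S
      by (rule continuous_on_compose2[OF assms(1) continuous_foot]) (use that in auto)
    have "face_integral (facet a) (nrm a) \<psi> = (LINT y|lebesgue_on ?P'. \<psi> (foot y))"
      unfolding face_integral_def prism_eq closest_point_foot ..
    also have "\<dots> = (LINT y|lborel. indicator ?P' y *\<^sub>R \<psi> (foot y))"
      by (rule LINT_compact[OF compact_prism cont]) auto
    \<comment> \<open>Translation by the unit normal carries one prism onto the other and does not
      change the foot.\<close>
    also have "\<dots> = (LINT y|lborel. indicator ?P' (y + 1 *\<^sub>R nrm a) *\<^sub>R \<psi> (foot (y + 1 *\<^sub>R nrm a)))"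
    proof (rule LINT_translation[symmetric])
      have "integrable lborel (\<lambda>y. indicator ?P' y *\<^sub>R \<psi> (foot y))"
        by (rule LINT_compact(2)[OF compact_prism cont]) auto
      from borel_measurable_integrable[OF this]
      show "(\<lambda>y. indicator ?P' y *\<^sub>R \<psi> (foot y)) \<in> borel_measurable borel" by simp
    qed
    also have "\<dots> = (LINT y|lborel. indicator ?P y *\<^sub>R \<psi> (foot y))"
      by (intro Bochner_Integration.integral_cong refl)
        (simp only: foot_translate depth_translate indicator_def mem_Collect_eq, auto)
    also have "\<dots> = (LINT y|lebesgue_on ?P. \<psi> (foot y))"
      by (rule LINT_compact(1)[OF compact_prism cont, symmetric]) auto
    also have "\<dots> = fint \<psi>" by (rule prism_integral[OF assms(1)])
    finally show ?thesis .
  qed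
  then show ?thesis using eq assms(2) by blast
qed

text \<open>The sets collect the points whose foot is close to the relative boundary of the facet. A
  point that lies in infinitely many of them has a foot with a vanishing coordinate, which excludes
  almost all points by \<open>AE_bl_foot\<close>; within the slab all of them stay in one bounded
  prism, so dominated convergence applies.\<close>

lemma near_boundary_limit:
  "(\<lambda>N. LINT y|lborel. slab 1 y * indicator {y. (\<forall>b\<in>C - {a}. - (G / real N) \<le> bl b (foot y)) \<and>
      (\<exists>b\<in>C - {a}. \<bar>bl b (foot y)\<bar> \<le> G / real N)} y) \<longlonglongrightarrow> 0"
    (is "(\<lambda>N. LINT y|lborel. slab 1 y * indicator (?E N) y) \<longlonglongrightarrow> 0")
  if G: "0 \<le> G"
proof -
  let ?B = "{y. (\<forall>b\<in>C - {a}. - G \<le> bl b (foot y)) \<and> \<bar>depth y\<bar> \<le> 1}"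
  have finC: "finite (C - {a})" using finite_C by simp
  have Em [measurable]: "?E N \<in> sets borel" for N
  proof -
    have "?E N = (\<Inter>b\<in>C - {a}. {y. - (G / real N) \<le> bl b (foot y)}) \<inter> (\<Union>b\<in>C - {a}. {y. \<bar>bl b (foot y)\<bar> \<le> G / real N})"
      by auto
    moreover have "{y. - (G / real N) \<le> bl b (foot y)} \<in> sets borel" "{y. \<bar>bl b (foot y)\<bar> \<le> G / real N} \<in> sets borel" for b
      by measurable
    moreover obtain b where "b \<in> C - {a}" using other_vertex[of a] by blast
    ultimately show ?thesis using finC by (auto intro!: sets.Int sets.finite_INT sets.finite_UN)
  qed
  have Bm: "?B \<in> sets borel"
  proof -
    have "?B = (\<Inter>b\<in>C - {a}. {y. - G \<le> bl b (foot y)}) \<inter> {y. \<bar>depth y\<bar> \<le> 1}" by auto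
    moreover have "{y. - G \<le> bl b (foot y)} \<in> sets borel" for b by measurable
    moreover have "{y. \<bar>depth y\<bar> \<le> 1} \<in> sets borel" by measurable
    moreover obtain b where "b \<in> C - {a}" using other_vertex[of a] by blast
    ultimately show ?thesis using finC by (auto intro!: sets.Int sets.finite_INT)
  qed
  have "(\<lambda>N. LINT y|lborel. slab 1 y * indicator (?E N) y) \<longlonglongrightarrow> (LINT y|(lborel :: (real^'n) measure). (0::real))"
  proof -
    have 2: "(\<lambda>y. slab 1 y * indicator (?E N) y) \<in> borel_measurable lborel" for N by measurable
    have 3: "integrable lborel (indicator ?B :: real^'n \<Rightarrow> real)"
      using Bm emeasure_bounded_finite[OF bounded_prism[of G 1]] by (simp add: integrable_indicator_iff)
    have 5: "AE y in lborel. norm (slab 1 y * indicator (?E N) y) \<le> indicator ?B y" for N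
    proof (rule AE_I2)
      fix y
      \<comment> \<open>For \<open>N = 0\<close> the quotient is 0 by the convention for division,
        so the prism with margin \<open>G\<close> dominates for every \<open>N\<close>.\<close>
      have "G / real N \<le> G"
        using G by (cases "N = 0") (auto simp: divide_le_eq mult_le_cancel_left1)
      then have "y \<in> ?B" if "y \<in> ?E N" "0 \<le> depth y" "depth y < 1"
        using that by (auto intro: order_trans[rotated])
      then show "norm (slab 1 y * indicator (?E N) y) \<le> indicator ?B y"
        by (auto simp: indicator_def)
    qed
    have "AE y in lborel. \<forall>b\<in>C - {a}. bl b (foot y) \<noteq> 0"
      by (intro AE_finite_allI finC AE_bl_foot) auto
    then have 4: "AE y in lborel. (\<lambda>N. slab 1 y * indicator (?E N) y) \<longlonglongrightarrow> 0"
    proof (rule eventually_mono)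
      fix y assume y: "\<forall>b\<in>C - {a}. bl b (foot y) \<noteq> 0"
      have "\<forall>\<^sub>F N in sequentially. G / real N < \<bar>bl b (foot y)\<bar>" if "b \<in> C - {a}" for b
      proof -
        have "(\<lambda>N. G / real N) \<longlonglongrightarrow> 0" by (rule lim_const_over_n)
        then show ?thesis using y that by (intro order_tendstoD) auto
      qed
      then have "\<forall>\<^sub>F N in sequentially. \<forall>b\<in>C - {a}. G / real N < \<bar>bl b (foot y)\<bar>"
        by (intro eventually_ball_finite finC) auto
      then have "\<forall>\<^sub>F N in sequentially. slab 1 y * indicator (?E N) y = 0"
        by eventually_elim (force simp: indicator_def)
      then show "(\<lambda>N. slab 1 y * indicator (?E N) y) \<longlonglongrightarrow> 0" by (rule tendsto_eventually)
    qed
    show ?thesis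
      by (rule integral_dominated_convergence[OF _ 2 3 4 5]) simp
  qed
  then show ?thesis by simp
qed

text \<open>Below the facet the layer of thickness \<open>1 / N\<close> of the simplex differs from the prism of the
  same thickness only near the relative boundary of the facet, which contributes \<open>o(1 / N)\<close>.\<close>

lemma layer_limit:
  assumes "C1 \<psi>"
  shows "(\<lambda>N. real N * (LINT y|lborel. indicator {y \<in> T. depth y < 1 / real N} y * \<psi> y)) \<longlonglongrightarrow> fint \<psi>"
proof -
  obtain L where L: "0 \<le> L" "\<And>x y. x \<in> T \<Longrightarrow> y \<in> T \<Longrightarrow> \<bar>\<psi> y - \<psi> x\<bar> \<le> L * norm (y - x)"
    using C1_lipschitz[OF assms compact_T convex_convex_hull] by metis
  have "compact (\<psi> ` T)"
    using C1_continuous[OF assms] compact_T compact_continuous_image by blast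
  then obtain M where M: "M > 0" "\<And>x. x \<in> T \<Longrightarrow> \<bar>\<psi> x\<bar> \<le> M"
    using compact_imp_bounded bounded_pos by (metis imageI real_norm_def)
  \<comment> \<open>\<open>G\<close> bounds the change of every barycentric coordinate per unit
    length along the normal. In a layer of thickness \<open>1 / N\<close> the coordinates of a point
    and of its foot therefore differ by at most \<open>G / N\<close>.\<close>
  define G where "G = (\<Sum>b\<in>C. \<bar>bg b \<bullet> nrm a\<bar>)"
  have G: "0 \<le> G" "\<And>b. b \<in> C \<Longrightarrow> \<bar>bg b \<bullet> nrm a\<bar> \<le> G"
    unfolding G_def using finite_C by (auto intro: sum_nonneg member_le_sum)
  define E where "E N = {y. (\<forall>b\<in>C - {a}. - (G / real N) \<le> bl b (foot y)) \<and>
      (\<exists>b\<in>C - {a}. \<bar>bl b (foot y)\<bar> \<le> G / real N)}" for N :: nat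
  have Em [measurable]: "E N \<in> sets borel" for N
  proof -
    have "E N = (\<Inter>b\<in>C - {a}. {y. - (G / real N) \<le> bl b (foot y)}) \<inter> (\<Union>b\<in>C - {a}. {y. \<bar>bl b (foot y)\<bar> \<le> G / real N})"
      unfolding E_def by auto
    moreover have "{y. - (G / real N) \<le> bl b (foot y)} \<in> sets borel" "{y. \<bar>bl b (foot y)\<bar> \<le> G / real N} \<in> sets borel" for b
      by measurable
    moreover obtain b where "b \<in> C - {a}" using other_vertex[of a] by blast
    ultimately show ?thesis using finite_C by (auto intro!: sets.Int sets.finite_INT sets.finite_UN)
  qed
  have cont: "continuous_on S \<psi>" for S using C1_continuous[OF assms] .
  have [measurable]: "\<psi> \<in> borel_measurable borel" using cont by (rule borel_measurable_continuous_onI)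
  have [measurable]: "T \<in> sets borel" using compact_T by (rule borel_compact)
  define f where "f N y = indicator {y \<in> T. depth y < 1 / real N} y * \<psi> y" for N :: nat and y
  define k where "k y = indicator (facet a) (foot y) * \<psi> (foot y)" for y
  define i1 where "i1 y = (indicator (facet a) (foot y) * 1 :: real)" for y
  \<comment> \<open>Pointwise majorant of the error: a Lipschitz term where the point lies in the
    simplex and its foot in the facet, and the bound \<open>M\<close> where exactly one of the two
    holds, which happens only in \<open>E N\<close>. It is constant along the normal, so
    \<open>slab_scaling\<close> applies to it.\<close>
  define K where "K N y = L / real N * i1 y + M * indicator (E N) y" for N :: nat and y
  have km: "k \<in> borel_measurable borel" unfolding k_def by (rule fint_measurable[OF cont])
  have im: "i1 \<in> borel_measurable borel" unfolding i1_def by (rule fint_measurable) simp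
  have ki: "integrable lborel (\<lambda>y. slab 1 y * k y)" unfolding k_def by (rule prism_integral[OF cont])
  have ii: "integrable lborel (\<lambda>y. slab 1 y * i1 y)" unfolding i1_def by (rule prism_integral) simp
  have Km: "K N \<in> borel_measurable borel" for N unfolding K_def using im by measurable
  have inv: "k (y + s *\<^sub>R nrm a) = k y" "K N (y + s *\<^sub>R nrm a) = K N y" for y s N
    unfolding k_def K_def i1_def E_def by (simp_all add: foot_translate indicator_def)
  have Ei: "integrable lborel (\<lambda>y. slab 1 y * indicator (E N) y :: real)" for N
  proof -
    let ?B = "{y. (\<forall>b\<in>C - {a}. - (G / real N) \<le> bl b (foot y)) \<and> \<bar>depth y\<bar> \<le> 1}"
    have "{y. 0 \<le> depth y \<and> depth y < 1} \<inter> E N \<subseteq> ?B" unfolding E_def by auto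
    then have "bounded ({y. 0 \<le> depth y \<and> depth y < 1} \<inter> E N)"
      using bounded_prism bounded_subset by blast
    moreover have "{y. 0 \<le> depth y \<and> depth y < 1} \<inter> E N \<in> sets borel" by measurable
    ultimately have "integrable lborel (indicator ({y. 0 \<le> depth y \<and> depth y < 1} \<inter> E N) :: real^'n \<Rightarrow> real)"
      using emeasure_bounded_finite by (simp add: integrable_indicator_iff)
    moreover have "(indicator ({y. 0 \<le> depth y \<and> depth y < 1} \<inter> E N) :: real^'n \<Rightarrow> real) = (\<lambda>y. slab 1 y * indicator (E N) y)"
      by (rule ext) (simp add: indicator_inter_arith)
    ultimately show ?thesis by simp
  qed
  have slabK: "slab 1 y * K N y = L / real N * (slab 1 y * i1 y) + M * (slab 1 y * indicator (E N) y)" for N y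
    by (simp add: K_def algebra_simps)
  have Ki: "integrable lborel (\<lambda>y. slab 1 y * K N y)" for N
    unfolding slabK using ii Ei by (intro Bochner_Integration.integrable_add integrable_mult_right) auto
  have Kint: "(LINT y|lborel. slab 1 y * K N y) = L / real N * (LINT y|lborel. slab 1 y * i1 y) + M * (LINT y|lborel. slab 1 y * indicator (E N) y)" for N
    unfolding slabK using ii Ei by simp
  have "(\<lambda>N. L / real N * (LINT y|lborel. slab 1 y * i1 y) + M * (LINT y|lborel. slab 1 y * indicator (E N) y))
      \<longlonglongrightarrow> 0 * (LINT y|lborel. slab 1 y * i1 y) + M * 0"
    unfolding E_def by (intro tendsto_intros lim_const_over_n near_boundary_limit G)
  then have Klim: "(\<lambda>N. LINT y|lborel. slab 1 y * K N y) \<longlonglongrightarrow> 0"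
    unfolding Kint by simp
  have point: "\<bar>f N y - slab (1 / real N) y * k y\<bar> \<le> slab (1 / real N) y * K N y" if N: "0 < N" for N y
  proof (cases "0 \<le> depth y \<and> depth y < 1 / real N")
    case False
    have "0 \<le> depth y" if "y \<in> T"
      using that a height_pos[OF a] by (simp add: depth_def in_T)
    then show ?thesis using False by (auto simp: f_def indicator_def)
  next
    case True
    have close: "\<bar>bl b (foot y) - bl b y\<bar> \<le> G / real N" if "b \<in> C" for b
    proof -
      have "\<bar>bl b (foot y) - bl b y\<bar> = depth y * \<bar>bg b \<bullet> nrm a\<bar>"
        using True by (simp add: bl_foot_diff abs_mult)
      also have "\<dots> \<le> (1 / real N) * G" using True G(2)[OF that] by (intro mult_mono) auto
      finally show ?thesis by simp
    qed
    have "\<bar>indicator T y * \<psi> y - k y\<bar> \<le> K N y"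
    proof (cases "y \<in> T \<longleftrightarrow> foot y \<in> facet a")
      case same: True
      show ?thesis
      proof (cases "y \<in> T")
        case True
        then have fy: "foot y \<in> facet a" "foot y \<in> T" using same bl_facet_convex[OF a] by auto
        have "\<bar>\<psi> y - \<psi> (foot y)\<bar> \<le> L * norm (y - foot y)" using L(2) fy True by blast
        also have "norm (y - foot y) = depth y"
          using \<open>0 \<le> depth y \<and> depth y < 1 / real N\<close> norm_nrm[OF a] by (simp add: foot_def)
        also have "L * depth y \<le> L * (1 / real N)"
          using L(1) \<open>0 \<le> depth y \<and> depth y < 1 / real N\<close> by (intro mult_left_mono) auto
        finally show ?thesis using True fy M(1) by (simp add: k_def K_def i1_def indicator_def)
      next
        case False
        then show ?thesis using same L M by (simp add: k_def K_def i1_def)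
      qed
    next
      \<comment> \<open>If exactly one of the two memberships holds, some coordinate changes sign
        between the point and its foot, or vanishes at one of them, so at the foot it is at most
        \<open>G / N\<close> in size.\<close>
      case differ: False
      have pos: "0 \<le> bl a y" using True height_pos[OF a] by (simp add: depth_def zero_le_mult_iff)
      have "y \<in> E N"
      proof (cases "y \<in> T")
        case True
        then obtain b where b: "b \<in> C - {a}" "bl b (foot y) < 0"
          using differ foot_in_facet by (meson not_le)
        have "- (G / real N) \<le> bl c (foot y)" if "c \<in> C - {a}" for c
          using close[of c] True that unfolding in_T by force
        moreover have "\<bar>bl b (foot y)\<bar> \<le> G / real N"
          using close[of b] True b unfolding in_T by force
        ultimately show ?thesis using b unfolding E_def by blast
      next
        case False
        then have fF: "\<forall>b\<in>C - {a}. 0 \<le> bl b (foot y)" using differ foot_in_facet by blast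
        obtain b where b: "b \<in> C" "bl b y < 0" using False unfolding in_T by (meson not_le)
        then have "b \<in> C - {a}" using pos by auto
        moreover have "\<bar>bl b (foot y)\<bar> \<le> G / real N"
          using close[OF b(1)] b fF calculation by force
        moreover have "- (G / real N) \<le> bl c (foot y)" if "c \<in> C - {a}" for c
        proof -
          have "0 \<le> G / real N" using G by simp
          then show ?thesis using fF that by force
        qed
        ultimately show ?thesis unfolding E_def by blast
      qed
      moreover have "\<bar>indicator T y * \<psi> y - k y\<bar> \<le> M"
      proof (cases "y \<in> T")
        case True
        then show ?thesis using differ M by (simp add: k_def)
      next
        case False
        then have "foot y \<in> T" using differ bl_facet_convex[OF a] by blast
        then show ?thesis using False differ M by (simp add: k_def)
      qed
      moreover have "0 \<le> L / real N * i1 y" using L by (simp add: i1_def)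
      ultimately show ?thesis by (simp add: K_def)
    qed
    then show ?thesis using True by (simp add: f_def indicator_def)
  qed
  have fi: "integrable lborel (f N)" for N
  proof -
    have "integrable lborel (\<lambda>y. indicator T y *\<^sub>R \<psi> y)" by (rule LINT_compact[OF compact_T cont])
    from integrable_mult_indicator[OF _ this, of "{y. depth y < 1 / real N}"]
    have "integrable lborel (\<lambda>y. indicator {y. depth y < 1 / real N} y *\<^sub>R (indicator T y *\<^sub>R \<psi> y))" by simp
    moreover have "f N = (\<lambda>y. indicator {y. depth y < 1 / real N} y *\<^sub>R (indicator T y *\<^sub>R \<psi> y))"
      by (auto simp: f_def fun_eq_iff indicator_def)
    ultimately show ?thesis by simp
  qed
  have est: "\<bar>real N * (LINT y|lborel. f N y) - fint \<psi>\<bar> \<le> (LINT y|lborel. slab 1 y * K N y)" if N: "0 < N" for N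
  proof -
    note ks = slab_scaling[OF km inv(1) ki N] and Ks = slab_scaling[OF Km inv(2) Ki N]
    have "fint \<psi> = real N * (LINT y|lborel. slab (1 / real N) y * k y)"
      using ks(1) N by (simp add: fint_def k_def)
    then have "\<bar>real N * (LINT y|lborel. f N y) - fint \<psi>\<bar> = real N * \<bar>LINT y|lborel. f N y - slab (1 / real N) y * k y\<bar>"
      using ks(2) fi[of N] by (simp add: abs_mult flip: right_diff_distrib)
    also have "\<dots> \<le> real N * (LINT y|lborel. \<bar>f N y - slab (1 / real N) y * k y\<bar>)"
      by (intro mult_left_mono integral_abs_bound) auto
    also have "\<dots> \<le> real N * (LINT y|lborel. slab (1 / real N) y * K N y)"
      using point[OF N] fi[of N] ks(2) Ks(2) by (intro mult_left_mono integral_mono) auto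
    \<comment> \<open>The factor \<open>N\<close> cancels against the thickness of the layer; what
      remains is an integral over the unit slab, which tends to 0 by \<open>Klim\<close>.\<close>
    also have "\<dots> = (LINT y|lborel. slab 1 y * K N y)" using Ks(1) N by simp
    finally show ?thesis .
  qed
  have "(\<lambda>N. real N * (LINT y|lborel. f N y) - fint \<psi>) \<longlonglongrightarrow> 0"
    by (rule Lim_null_comparison[OF _ Klim]) (use est in \<open>auto intro!: eventually_sequentiallyI[of 1]\<close>)
  then show ?thesis unfolding f_def by (simp add: LIM_zero_iff)
qed


text \<open>Shrinking towards \<open>a\<close> multiplies the coordinates of the other vertices by
  \<open>s\<close> and turns that of \<open>a\<close> into \<open>1 - s\<close> plus
  \<open>s\<close> times its old value. The image of the simplex is thus its part where
  \<open>bl a\<close> is at least \<open>1 - s\<close>.\<close>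

lemma scaled_in_T:
  assumes "0 < s" "s < 1"
  shows "a + s *\<^sub>R (w - a) \<in> T \<and> 1 - s \<le> bl a (a + s *\<^sub>R (w - a)) \<longleftrightarrow> w \<in> T"
proof -
  have bl: "bl b (a + s *\<^sub>R (w - a)) = (1 - s) * (if b = a then 1 else 0) + s * bl b w" if "b \<in> C" for b
  proof -
    have "bl b (a + s *\<^sub>R (w - a)) = bl b a + s * (bl b w - bl b a)"
      by (simp add: bl_add bl_diff)
    also have "bl b a = (if b = a then 1 else 0)" using bl_vertex[OF that a] by auto
    finally show ?thesis by (simp add: algebra_simps)
  qed
  have "0 \<le> bl b (a + s *\<^sub>R (w - a)) \<longleftrightarrow> 0 \<le> bl b w" if "b \<in> C" "b \<noteq> a" for b
    using bl[OF that(1)] that(2) assms by (simp add: zero_le_mult_iff)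
  moreover have "1 - s \<le> bl a (a + s *\<^sub>R (w - a)) \<longleftrightarrow> 0 \<le> bl a w"
    using bl[OF a] assms by (simp add: zero_le_mult_iff)
  moreover have "0 \<le> bl a (a + s *\<^sub>R (w - a))" if "0 \<le> bl a w"
    using bl[OF a] assms that by simp
  ultimately show ?thesis unfolding in_T by (metis a)
qed

text \<open>Both sides are the derivative at \<open>s = 1\<close> of the integral over the copy of the simplex that is
  shrunk towards \<open>a\<close> by the factor \<open>s\<close>.\<close>

lemma cone_formula:
  assumes "C1 \<psi>"
  shows "(LINT x|lebesgue_on T. real CARD('n) * \<psi> x + grad \<psi> x \<bullet> (x - a)) = height a * fint \<psi>"
proof -
  let ?d = "CARD('n)"
  let ?h = "height a"
  define X where "X x = real ?d * \<psi> x + grad \<psi> x \<bullet> (x - a)" for x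
  have h: "?h > 0" by (rule height_pos[OF a])
  have cont: "continuous_on S \<psi>" for S using C1_continuous[OF assms] .
  have contX: "continuous_on S X" for S
    unfolding X_def by (intro continuous_intros cont C1_grad_continuous[OF assms])
  have [measurable]: "\<psi> \<in> borel_measurable borel" using cont by (rule borel_measurable_continuous_onI)
  have [measurable]: "X \<in> borel_measurable borel" using contX by (rule borel_measurable_continuous_onI)
  have [measurable]: "T \<in> sets borel" using compact_T by (rule borel_compact)
  obtain L where L: "0 \<le> L" "\<And>x y. x \<in> T \<Longrightarrow> y \<in> T \<Longrightarrow> \<bar>\<psi> y - \<psi> x\<bar> \<le> L * norm (y - x)"
    using C1_lipschitz[OF assms compact_T convex_convex_hull] by metis
  have "compact (\<psi> ` T)" "compact ((\<lambda>x. x - a) ` T)"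
    using cont compact_T by (auto intro!: compact_continuous_image continuous_intros)
  then obtain M D where M: "M > 0" "\<And>x. x \<in> T \<Longrightarrow> \<bar>\<psi> x\<bar> \<le> M"
    and D: "D > 0" "\<And>x. x \<in> T \<Longrightarrow> norm (x - a) \<le> D"
    using compact_imp_bounded bounded_pos by (metis imageI real_norm_def)
  \<comment> \<open>The bound makes every factor \<open>s i\<close> exceed 1/2, in particular
    positive, as the change of variables requires.\<close>
  obtain N0 :: nat where N0: "2 / ?h < real N0" using reals_Archimedean2 by blast
  define n where "n i = i + N0" for i :: nat
  \<comment> \<open>Chosen so that the part of the simplex lost by shrinking is exactly the layer
    \<open>depth y < 1 / real (n i)\<close>.\<close>
  define s where "s i = 1 - 1 / (real (n i) * ?h)" for i
  have nh: "real (n i) * ?h > 2" for i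
  proof -
    have "2 / ?h < real (n i)" using N0 by (simp add: n_def)
    then show ?thesis using h by (simp add: divide_less_eq)
  qed
  have npos: "real (n i) > 0" for i
  proof -
    have "n i \<noteq> 0"
    proof
      assume "n i = 0"
      with nh[of i] show False by simp
    qed
    then show ?thesis by simp
  qed
  have s: "0 < s i" "s i < 1" for i
    using nh[of i] npos[of i] h by (auto simp: s_def divide_simps)
  define sc where "sc i w = a + s i *\<^sub>R (w - a)" for i w
  \<comment> \<open>The layer integral pulled back to the fixed simplex: \<open>\<psi>\<close> on
    the whole simplex minus its scaled copy, times \<open>n i\<close>. Up to the factor
    \<open>1 / height a\<close> this is a difference quotient at \<open>s = 1\<close>.\<close>
  define q where "q i w = real (n i) * (indicator T w * (\<psi> w - s i ^ ?d * \<psi> (sc i w)))" for i w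
  have sc_cont: "continuous_on S (sc i)" for S i unfolding sc_def by (intro continuous_intros)
  have [measurable]: "sc i \<in> borel_measurable borel" for i
    using sc_cont by (rule borel_measurable_continuous_onI)
  have int1: "integrable lborel (\<lambda>w. indicator T w * \<psi> w)"
    using LINT_compact(2)[OF compact_T cont] by simp
  have int2: "integrable lborel (\<lambda>w. indicator T w * \<psi> (sc i w))" for i
    using LINT_compact(2)[OF compact_T, of "\<lambda>w. \<psi> (sc i w)"] continuous_on_compose2[OF cont[of UNIV] sc_cont[of T i]] by simp
  have layer: "(LINT w|lborel. q i w) = real (n i) * (LINT y|lborel. indicator {y \<in> T. depth y < 1 / real (n i)} y * \<psi> y)" for i
  proof -
    let ?Ts = "{y \<in> T. \<not> depth y < 1 / real (n i)}"
    have "?Ts = T \<inter> {y. \<not> depth y < 1 / real (n i)}" by auto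
    then have Ts [measurable]: "?Ts \<in> sets borel" by (simp add: measurable_depth) measurable
    have dep: "\<not> depth y < 1 / real (n i) \<longleftrightarrow> 1 - s i \<le> bl a y" for y
      using h npos[of i] by (simp add: depth_def s_def not_less divide_le_eq le_divide_eq mult_ac)
    have "(LINT y|lborel. indicator ?Ts y * \<psi> y) = s i ^ DIM(real^'n) * (LINT w|lborel. indicator ?Ts (a - s i *\<^sub>R a + s i *\<^sub>R w) * \<psi> (a - s i *\<^sub>R a + s i *\<^sub>R w))"
      by (rule LINT_scaling) (use s in measurable)
    also have "(\<lambda>w. indicator ?Ts (a - s i *\<^sub>R a + s i *\<^sub>R w) * \<psi> (a - s i *\<^sub>R a + s i *\<^sub>R w)) = (\<lambda>w. indicator T w * \<psi> (sc i w))"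
    proof
      fix w
      have eq: "a - s i *\<^sub>R a + s i *\<^sub>R w = sc i w" by (simp add: sc_def algebra_simps)
      have "sc i w \<in> ?Ts \<longleftrightarrow> w \<in> T"
        using scaled_in_T[OF s, of i w] by (simp add: dep sc_def)
      then show "indicator ?Ts (a - s i *\<^sub>R a + s i *\<^sub>R w) * \<psi> (a - s i *\<^sub>R a + s i *\<^sub>R w) = indicator T w * \<psi> (sc i w)"
        unfolding eq by (simp add: indicator_def)
    qed
    finally have Ts_int: "(LINT y|lborel. indicator ?Ts y * \<psi> y) = s i ^ ?d * (LINT w|lborel. indicator T w * \<psi> (sc i w))"
      by simp
    have part: "indicator {y \<in> T. depth y < 1 / real (n i)} y * \<psi> y = indicator T y * \<psi> y - indicator ?Ts y * \<psi> y" for y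
      by (simp add: indicator_def)
    have "integrable lborel (\<lambda>y. indicator ?Ts y *\<^sub>R (indicator T y * \<psi> y))"
      using Ts by (intro integrable_mult_indicator int1) simp
    moreover have "(\<lambda>y. indicator ?Ts y *\<^sub>R (indicator T y * \<psi> y)) = (\<lambda>y. indicator ?Ts y * \<psi> y)"
      by (auto simp: indicator_def fun_eq_iff)
    ultimately have intTs: "integrable lborel (\<lambda>y. indicator ?Ts y * \<psi> y)" by simp
    have "(LINT y|lborel. indicator {y \<in> T. depth y < 1 / real (n i)} y * \<psi> y) =
        (LINT y|lborel. indicator T y * \<psi> y) - s i ^ ?d * (LINT w|lborel. indicator T w * \<psi> (sc i w))"
      unfolding part using int1 intTs Ts_int by simp
    also have "\<dots> = (LINT w|lborel. indicator T w * \<psi> w - s i ^ ?d * (indicator T w * \<psi> (sc i w)))"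
      using int1 int2[of i] by simp
    finally have eq: "(LINT y|lborel. indicator {y \<in> T. depth y < 1 / real (n i)} y * \<psi> y) =
        (LINT w|lborel. indicator T w * \<psi> w - s i ^ ?d * (indicator T w * \<psi> (sc i w)))" .
    have "q i w = real (n i) * (indicator T w * \<psi> w - s i ^ ?d * (indicator T w * \<psi> (sc i w)))" for w
      by (simp add: q_def algebra_simps)
    then show ?thesis by (simp only: eq integral_mult_right_zero)
  qed
  have "(\<lambda>i. LINT w|lborel. q i w) \<longlonglongrightarrow> fint \<psi>"
    unfolding layer n_def using LIMSEQ_ignore_initial_segment[OF layer_limit[OF assms], of N0] .
  moreover have "(\<lambda>i. LINT w|lborel. q i w) \<longlonglongrightarrow> (LINT w|lborel. indicator T w * ((1 / ?h) * X w))"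
  proof (rule integral_dominated_convergence[where w = "\<lambda>w. (1 / ?h) * (real ?d * M + L * D) * indicator T w"])
    show "(\<lambda>w. indicator T w * ((1 / ?h) * X w)) \<in> borel_measurable lborel" by measurable
    show "q i \<in> borel_measurable lborel" for i unfolding q_def by measurable
    have "integrable lborel (indicator T :: real^'n \<Rightarrow> real)"
      using LINT_compact(2)[OF compact_T, of "\<lambda>_. 1::real"] by simp
    then show "integrable lborel (\<lambda>w. (1 / ?h) * (real ?d * M + L * D) * indicator T w :: real)" by simp
    have n1s: "real (n i) = 1 / ?h * (1 / (1 - s i))" for i
      using npos[of i] h by (simp add: s_def)
    show "AE w in lborel. (\<lambda>i. q i w) \<longlonglongrightarrow> indicator T w * ((1 / ?h) * X w)"
    proof (rule AE_I2)
      fix w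
      \<comment> \<open>The derivative at 1 is \<open>X w\<close>: the power contributes the
        dimension, the chain rule the radial derivative.\<close>
      define \<theta> where "\<theta> t = t ^ ?d * \<psi> (a + t *\<^sub>R (w - a))" for t :: real
      have "(\<theta> has_derivative (\<lambda>v. X w * v)) (at 1)"
      proof -
        have "((\<lambda>t. a + t *\<^sub>R (w - a)) has_derivative (\<lambda>v. v *\<^sub>R (w - a))) (at 1)"
          by (auto intro!: derivative_eq_intros)
        moreover have "(\<psi> has_derivative (\<lambda>v. grad \<psi> w \<bullet> v)) (at (a + 1 *\<^sub>R (w - a)))"
          using C1_derivative[OF assms, of w] by simp
        ultimately have "((\<lambda>t. \<psi> (a + t *\<^sub>R (w - a))) has_derivative (\<lambda>v. grad \<psi> w \<bullet> (v *\<^sub>R (w - a)))) (at 1)"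
          by (rule has_derivative_compose)
        then show ?thesis
          unfolding \<theta>_def X_def by (auto intro!: derivative_eq_intros simp: fun_eq_iff algebra_simps)
      qed
      then have "(\<theta> has_field_derivative X w) (at 1)" by (simp add: has_field_derivative_def)
      then have "((\<lambda>t. (\<theta> t - \<theta> 1) / (t - 1)) \<longlongrightarrow> X w) (at 1)"
        by (simp add: has_field_derivative_iff)
      moreover have "filterlim s (at 1) sequentially"
      proof (rule filterlim_atI)
        have "(\<lambda>i. 1 / ?h * (1 / real (i + N0))) \<longlonglongrightarrow> 1 / ?h * 0"
          by (intro tendsto_mult tendsto_const LIMSEQ_ignore_initial_segment[OF lim_const_over_n])
        then have "(\<lambda>i. 1 - 1 / ?h * (1 / real (i + N0))) \<longlonglongrightarrow> 1 - 1 / ?h * 0"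
          by (intro tendsto_diff tendsto_const)
        then show "s \<longlonglongrightarrow> 1" unfolding s_def[abs_def] n_def by (simp add: mult.commute)
        show "\<forall>\<^sub>F i in sequentially. s i \<noteq> 1" using s(2) by (auto intro!: always_eventually simp: less_imp_neq)
      qed
      ultimately have "(\<lambda>i. (\<theta> (s i) - \<theta> 1) / (s i - 1)) \<longlonglongrightarrow> X w"
        by (rule filterlim_compose)
      then have "(\<lambda>i. indicator T w * (1 / ?h * ((\<theta> (s i) - \<theta> 1) / (s i - 1)))) \<longlonglongrightarrow> indicator T w * (1 / ?h * X w)"
        by (intro tendsto_intros)
      moreover have "indicator T w * (1 / ?h * ((\<theta> (s i) - \<theta> 1) / (s i - 1))) = q i w" for i
      proof -
        have "(\<theta> (s i) - \<theta> 1) / (s i - 1) = (\<theta> 1 - \<theta> (s i)) / (1 - s i)"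
          using s(2)[of i] by (simp add: divide_simps) (simp add: algebra_simps)
        then show ?thesis unfolding q_def n1s by (simp add: \<theta>_def sc_def)
      qed
      ultimately show "(\<lambda>i. q i w) \<longlonglongrightarrow> indicator T w * ((1 / ?h) * X w)" by simp
    qed
    show "AE w in lborel. norm (q i w) \<le> (1 / ?h) * (real ?d * M + L * D) * indicator T w" for i
    proof (rule AE_I2)
      fix w
      show "norm (q i w) \<le> (1 / ?h) * (real ?d * M + L * D) * indicator T w"
      proof (cases "w \<in> T")
        case True
        have sT: "sc i w \<in> T" using scaled_in_T[OF s, of i w] True by (simp add: sc_def)
        \<comment> \<open>Bernoulli's inequality bounds the change of the power linearly in
          \<open>1 - s i\<close>, which compensates the growing factor \<open>n i\<close>.\<close>
        have bern: "1 - s i ^ ?d \<le> real ?d * (1 - s i)"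
          using Bernoulli_inequality[of "s i - 1" ?d] s[of i] by (simp add: algebra_simps)
        have pw: "s i ^ ?d \<le> 1" using s[of i] by (intro power_le_one) auto
        have "\<psi> w - s i ^ ?d * \<psi> (sc i w) = (1 - s i ^ ?d) * \<psi> (sc i w) + (\<psi> w - \<psi> (sc i w))"
          by (simp add: algebra_simps)
        then have "\<bar>\<psi> w - s i ^ ?d * \<psi> (sc i w)\<bar> \<le> (1 - s i ^ ?d) * \<bar>\<psi> (sc i w)\<bar> + \<bar>\<psi> w - \<psi> (sc i w)\<bar>"
          using pw by (metis abs_ge_zero abs_mult abs_of_nonneg abs_triangle_ineq diff_ge_0_iff_ge)
        also have "(1 - s i ^ ?d) * \<bar>\<psi> (sc i w)\<bar> \<le> (real ?d * (1 - s i)) * M"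
          using bern M(2)[OF sT] s(2)[of i] by (intro mult_mono) auto
        also have "\<bar>\<psi> w - \<psi> (sc i w)\<bar> \<le> L * norm (w - sc i w)" by (rule L(2)[OF sT True])
        also have "w - sc i w = (1 - s i) *\<^sub>R (w - a)" by (simp add: sc_def algebra_simps)
        also have "L * norm ((1 - s i) *\<^sub>R (w - a)) \<le> L * ((1 - s i) * D)"
          using D(2)[OF True] s(2)[of i] L(1) by (auto intro!: mult_left_mono)
        finally have "\<bar>\<psi> w - s i ^ ?d * \<psi> (sc i w)\<bar> \<le> (real ?d * M + L * D) * (1 - s i)"
          by (simp add: algebra_simps)
        then have "real (n i) * \<bar>\<psi> w - s i ^ ?d * \<psi> (sc i w)\<bar> \<le> real (n i) * ((real ?d * M + L * D) * (1 - s i))"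
          using npos[of i] by (intro mult_left_mono) auto
        also have "\<dots> = (1 / ?h) * (real ?d * M + L * D)"
          using s(2)[of i] unfolding n1s by simp
        finally show ?thesis using True npos[of i] by (simp add: q_def abs_mult)
      qed (simp add: q_def)
    qed
  qed
  ultimately have "fint \<psi> = (LINT w|lborel. indicator T w * ((1 / ?h) * X w))"
    by (rule LIMSEQ_unique)
  also have "\<dots> = (1 / ?h) * (LINT w|lborel. indicator T w *\<^sub>R X w)"
    by (simp add: mult.left_commute)
  also have "(LINT w|lborel. indicator T w *\<^sub>R X w) = (LINT w|lebesgue_on T. X w)"
    by (rule LINT_compact(1)[OF compact_T contX, symmetric])
  finally show ?thesis using h by (simp add: X_def)
qed

lemma fint_add:
  assumes "continuous_on (facet a) \<phi>" "continuous_on (facet a) \<psi>"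
  shows "fint (\<lambda>x. \<phi> x + \<psi> x) = fint \<phi> + fint \<psi>"
  using prism_integral(2)[OF assms(1)] prism_integral(2)[OF assms(2)]
  by (simp add: fint_def distrib_left)

lemma fint_scale: "fint (\<lambda>x. c * \<psi> x) = c * fint \<psi>"
  by (simp add: fint_def mult.left_commute)

lemma fint_cong: "(\<And>x. x \<in> facet a \<Longrightarrow> \<phi> x = \<psi> x) \<Longrightarrow> fint \<phi> = fint \<psi>"
  unfolding fint_def by (intro Bochner_Integration.integral_cong refl) (simp add: indicator_def)


lemma convex_prism: "convex {y. foot y \<in> facet a \<and> 0 \<le> depth y \<and> depth y \<le> 1}"
proof (rule convexI)
  fix x y and u v :: real
  assume "x \<in> {y. foot y \<in> facet a \<and> 0 \<le> depth y \<and> depth y \<le> 1}"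
    "y \<in> {y. foot y \<in> facet a \<and> 0 \<le> depth y \<and> depth y \<le> 1}" and uv: "0 \<le> u" "0 \<le> v" "u + v = 1"
  then have *: "foot x \<in> facet a" "0 \<le> depth x" "depth x \<le> 1"
    "foot y \<in> facet a" "0 \<le> depth y" "depth y \<le> 1" by auto
  have u: "u = 1 - v" using uv by simp
  have foot: "foot (u *\<^sub>R x + v *\<^sub>R y) = u *\<^sub>R foot x + v *\<^sub>R foot y"
    and depth: "depth (u *\<^sub>R x + v *\<^sub>R y) = u * depth x + v * depth y"
    unfolding u by (simp_all add: foot_def depth_def bl_def algebra_simps)
  have "u *\<^sub>R foot x + v *\<^sub>R foot y \<in> facet a"
    by (rule convexD[OF convex_convex_hull *(1,4) uv])
  moreover have "u * depth x + v * depth y \<le> u * 1 + v * 1"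
    using * uv by (intro add_mono mult_left_mono) auto
  moreover have "0 \<le> u * depth x + v * depth y" using * uv by simp
  ultimately show "u *\<^sub>R x + v *\<^sub>R y \<in> {y. foot y \<in> facet a \<and> 0 \<le> depth y \<and> depth y \<le> 1}"
    unfolding mem_Collect_eq foot depth using uv by simp
qed

lemma interior_prism_nonempty: "interior {y. foot y \<in> facet a \<and> 0 \<le> depth y \<and> depth y \<le> 1} \<noteq> {}"
proof -
  let ?U = "(\<Inter>b\<in>C - {a}. {y. 0 < bl b (foot y)}) \<inter> {y. 0 < depth y} \<inter> {y. depth y < 1}"
  have cb: "continuous_on UNIV (\<lambda>y. bl b (foot y))" for b
    by (rule continuous_on_compose2[OF continuous_bl[of UNIV] continuous_foot]) auto
  have "open ?U"
    using finite_C by (intro open_Int open_INT ballI open_Collect_less cb continuous_depth continuous_intros) auto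
  then have "?U \<subseteq> interior {y. foot y \<in> facet a \<and> 0 \<le> depth y \<and> depth y \<le> 1}"
  proof (rule interior_maximal[rotated], intro subsetI CollectI conjI)
    fix y assume y: "y \<in> ?U"
    then have "\<forall>b\<in>C - {a}. 0 < bl b (foot y)" by blast
    then show "foot y \<in> facet a" unfolding foot_in_facet using less_imp_le by blast
    show "0 \<le> depth y" "depth y \<le> 1" using y by auto
  qed
  moreover have "\<exists>y. y \<in> ?U"
  proof -
    have "rel_interior (facet a) \<noteq> {}"
      using rel_interior_eq_empty[of "facet a"] facet_nonempty by simp
    then obtain x where x: "x \<in> rel_interior (facet a)" by blast
    then have "x \<in> facet a" using rel_interior_subset by blast
    then have fx: "foot (x + (- (1/2)) *\<^sub>R nrm a) = x" "depth (x + (- (1/2)) *\<^sub>R nrm a) = 1/2"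
      unfolding foot_translate depth_translate by (simp_all add: foot_facet depth_def bl_facet_convex[OF a])
    have "x + (- (1/2)) *\<^sub>R nrm a \<in> ?U"
      using x unfolding in_rel_interior_facet[OF a] by (simp only: fx Int_iff INT_iff mem_Collect_eq) simp
    then show ?thesis by blast
  qed
  ultimately show ?thesis by blast
qed

end

text \<open>The function vanishes almost everywhere, hence on the interior by continuity, since
  nonempty open sets are not negligible; by convexity \<open>D\<close> is the closure of its
  interior.\<close>

lemma zero_integral_imp_zero:
  fixes f :: "'a::euclidean_space \<Rightarrow> real"
  assumes "compact D" "convex D" "interior D \<noteq> {}" "continuous_on D f" "\<And>x. x \<in> D \<Longrightarrow> 0 \<le> f x"
    and "(LINT x|lebesgue_on D. f x) = 0" "x \<in> D"
  shows "f x = 0"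
proof -
  note L = LINT_compact[OF assms(1,4)]
  have "AE x in lborel. indicator D x *\<^sub>R f x = 0"
    using integral_nonneg_eq_0_iff_AE[OF L(2)] L(1) assms(5,6) by (auto simp: indicator_def)
  then obtain N where N: "{x. indicator D x *\<^sub>R f x \<noteq> 0} \<subseteq> N" "N \<in> null_sets lborel"
    by (auto elim!: AE_E simp: null_sets_def)
  have zero: "f y = 0" if y: "y \<in> interior D" for y
  proof (rule ccontr)
    assume "f y \<noteq> 0"
    have "open {z \<in> interior D. f z \<in> - {0}}"
      using continuous_on_subset[OF assms(4) interior_subset] by (intro continuous_open_preimage[unfolded vimage_def Int_def mem_Collect_eq]) auto
    moreover have "negligible N"
      using N(2) by (simp add: negligible_iff_null_sets null_sets_completionI)
    then have "negligible {z \<in> interior D. f z \<in> - {0}}"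
      using N(1) interior_subset by (elim negligible_subset) (force simp: indicator_def)
    ultimately have "{z \<in> interior D. f z \<in> - {0}} = {}"
      using open_not_negligible by blast
    then show False using y \<open>f y \<noteq> 0\<close> by blast
  qed
  have "closure (interior D) = D"
    using convex_closure_interior[OF assms(2,3)] assms(1) by (simp add: compact_imp_closed)
  then show ?thesis
    using continuous_constant_on_closure[of "interior D" f 0] assms(4,7) zero by auto
qed

context vertex_in
begin

text \<open>The prism over the facet is a convex body, so the volume statement applies to the
  extension of \<open>\<psi>\<close> that is constant along the normal.\<close>

lemma fint_nonneg_eq_0:
  assumes "continuous_on (facet a) \<psi>" "\<And>x. x \<in> facet a \<Longrightarrow> 0 \<le> \<psi> x" "fint \<psi> = 0" "x \<in> facet a"
  shows "\<psi> x = 0"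
proof -
  let ?P = "{y. foot y \<in> facet a \<and> 0 \<le> depth y \<and> depth y \<le> 1}"
  have "\<psi> (foot x) = 0"
  proof (rule zero_integral_imp_zero[OF compact_prism convex_prism interior_prism_nonempty,
      where f = "\<lambda>y. \<psi> (foot y)"])
    show "continuous_on ?P (\<lambda>y. \<psi> (foot y))"
      by (rule continuous_on_compose2[OF assms(1) continuous_foot]) auto
    show "0 \<le> \<psi> (foot y)" if "y \<in> ?P" for y using that assms(2) by blast
    show "(LINT y|lebesgue_on ?P. \<psi> (foot y)) = 0" using prism_integral(1)[OF assms(1)] assms(3) by simp
    show "x \<in> ?P" using assms(4) by (simp add: foot_facet depth_def bl_facet_convex[OF a])
  qed
  then show ?thesis using assms(4) by (simp add: foot_facet)
qed

lemma fint_nonneg: "(\<And>x. x \<in> facet a \<Longrightarrow> 0 \<le> \<psi> x) \<Longrightarrow> 0 \<le> fint \<psi>"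
  unfolding fint_def by (intro Bochner_Integration.integral_nonneg) (simp add: indicator_def)

lemma fint_1_pos: "0 < fint (\<lambda>x. 1)"
proof -
  obtain x where "x \<in> facet a" using facet_nonempty by blast
  then have "fint (\<lambda>x. 1) \<noteq> 0" using fint_nonneg_eq_0[of "\<lambda>x. 1" x] by auto
  moreover have "0 \<le> fint (\<lambda>x. 1)" by (rule fint_nonneg) simp
  ultimately show ?thesis by simp
qed

end

context vertices
begin

lemma vertex_in: "a \<in> C \<Longrightarrow> vertex_in C a"
  by unfold_locales

text \<open>A constant vector \<open>e\<close> is the combination of the fields \<open>x - a\<close> with coefficients \<open>- (bg a \<bullet> e)\<close>.\<close>

lemma gradient_theorem:
  assumes "C1 \<psi>"
  shows "(LINT x|lebesgue_on T. grad \<psi> x \<bullet> e) = (\<Sum>a\<in>C. (nrm a \<bullet> e) * vertex_in.fint C a \<psi>)"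
proof -
  let ?d = "CARD('n)"
  define X where "X a x = real ?d * \<psi> x + grad \<psi> x \<bullet> (x - a)" for a x
  have cX: "continuous_on T (X a)" for a
    unfolding X_def by (intro continuous_intros C1_continuous C1_grad_continuous assms)
  have "(\<Sum>a\<in>C. - (bg a \<bullet> e) * X a x) = grad \<psi> x \<bullet> e" for x
  proof -
    have s0: "(\<Sum>a\<in>C. bg a \<bullet> e) = 0" using bg_sum by (simp flip: inner_sum_left)
    have "(\<Sum>a\<in>C. - (bg a \<bullet> e) * X a x) = - (\<Sum>a\<in>C. bg a \<bullet> e) * (real ?d * \<psi> x + grad \<psi> x \<bullet> x) + (\<Sum>a\<in>C. (bg a \<bullet> e) * (grad \<psi> x \<bullet> a))"
      by (simp add: X_def inner_diff_right sum_distrib_right sum_negf[symmetric] flip: sum.distrib) (simp add: algebra_simps)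
    also have "(\<Sum>a\<in>C. (bg a \<bullet> e) * (grad \<psi> x \<bullet> a)) = grad \<psi> x \<bullet> (\<Sum>a\<in>C. (bg a \<bullet> e) *\<^sub>R a)"
      by (simp add: inner_sum_right)
    finally show ?thesis by (simp add: s0 bg_repr)
  qed
  then have "(LINT x|lebesgue_on T. grad \<psi> x \<bullet> e) = (LINT x|lebesgue_on T. (\<Sum>a\<in>C. - (bg a \<bullet> e) * X a x))" by simp
  also have "\<dots> = (\<Sum>a\<in>C. LINT x|lebesgue_on T. - (bg a \<bullet> e) * X a x)"
    using LINT_compact(3)[OF compact_T cX] by (intro Bochner_Integration.integral_sum) auto
  also have "\<dots> = (\<Sum>a\<in>C. - (bg a \<bullet> e) * (LINT x|lebesgue_on T. X a x))"
    by simp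
  also have "\<dots> = (\<Sum>a\<in>C. (nrm a \<bullet> e) * vertex_in.fint C a \<psi>)"
  proof (intro sum.cong refl)
    fix a assume a: "a \<in> C"
    interpret vertex_in C a by (rule vertex_in[OF a])
    have "(LINT x|lebesgue_on T. X a x) = height a * fint \<psi>"
      unfolding X_def by (rule cone_formula[OF assms])
    moreover have "bg a \<bullet> e * height a = - (nrm a \<bullet> e)" by (simp add: nrm_def height_def)
    ultimately show "- (bg a \<bullet> e) * (LINT x|lebesgue_on T. X a x) = (nrm a \<bullet> e) * fint \<psi>"
      by (simp add: mult.assoc[symmetric])
  qed
  finally show ?thesis .
qed

lemma fint_eq_face_integral:
  assumes "a \<in> C" "continuous_on (facet a) \<psi>" "n = nrm a \<or> n = - nrm a"
  shows "face_integral (facet a) n \<psi> = vertex_in.fint C a \<psi>"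
  using vertex_in.face_integral_eq[OF vertex_in[OF assms(1)] assms(2,3)] .

theorem divergence_theorem:
  assumes "\<And>i. C1 (\<lambda>x. V x $ i)"
  shows "(LINT x|lebesgue_on T. (\<Sum>i\<in>UNIV. partial i (\<lambda>x. V x $ i) x)) =
    (\<Sum>F | F facet_of T. face_integral F (outward_normal T F) (\<lambda>x. outward_normal T F \<bullet> V x))"
proof -
  have cp: "continuous_on T (partial i (\<lambda>x. V x $ i))" for i using C1_partial_continuous[OF assms] .
  have "(LINT x|lebesgue_on T. (\<Sum>i\<in>UNIV. partial i (\<lambda>x. V x $ i) x)) =
      (\<Sum>i\<in>UNIV. LINT x|lebesgue_on T. partial i (\<lambda>x. V x $ i) x)"
    using LINT_compact(3)[OF compact_T cp] by (intro Bochner_Integration.integral_sum) auto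
  also have "\<dots> = (\<Sum>i\<in>UNIV. \<Sum>a\<in>C. nrm a $ i * vertex_in.fint C a (\<lambda>x. V x $ i))"
  proof (intro sum.cong refl)
    fix i
    have "partial i (\<lambda>x. V x $ i) x = grad (\<lambda>x. V x $ i) x \<bullet> axis i 1" for x
      by (simp add: grad_def inner_axis)
    then show "(LINT x|lebesgue_on T. partial i (\<lambda>x. V x $ i) x) = (\<Sum>a\<in>C. nrm a $ i * vertex_in.fint C a (\<lambda>x. V x $ i))"
      using gradient_theorem[OF assms[of i], of "axis i 1"] by (simp add: inner_axis)
  qed
  also have "\<dots> = (\<Sum>a\<in>C. \<Sum>i\<in>UNIV. nrm a $ i * vertex_in.fint C a (\<lambda>x. V x $ i))" by (rule sum.swap)
  also have "\<dots> = (\<Sum>a\<in>C. vertex_in.fint C a (\<lambda>x. nrm a \<bullet> V x))"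
  proof (intro sum.cong refl)
    fix a assume a: "a \<in> C"
    interpret vertex_in C a by (rule vertex_in[OF a])
    have c: "continuous_on S (\<lambda>x. V x $ i)" for S i using C1_continuous[OF assms] .
    have "fint (\<lambda>x. \<Sum>i\<in>J. nrm a $ i * V x $ i) = (\<Sum>i\<in>J. nrm a $ i * fint (\<lambda>x. V x $ i))" if "finite J" for J
      using that
    proof (induction J rule: finite_induct)
      case empty
      then show ?case by (simp add: fint_def)
    next
      case (insert i J)
      then show ?case
        by (simp add: fint_scale fint_add continuous_intros c)
    qed
    then show "(\<Sum>i\<in>UNIV. nrm a $ i * fint (\<lambda>x. V x $ i)) = fint (\<lambda>x. nrm a \<bullet> V x)"
      by (simp add: inner_vec_def)
  qed
  also have "\<dots> = (\<Sum>a\<in>C. face_integral (facet a) (outward_normal T (facet a)) (\<lambda>x. outward_normal T (facet a) \<bullet> V x))"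
  proof (intro sum.cong refl)
    fix a assume a: "a \<in> C"
    have "continuous_on (facet a) V"
      using C1_continuous[OF assms] continuous_on_vec_lambda[of "facet a" "\<lambda>i x. V x $ i"] by simp
    then show "vertex_in.fint C a (\<lambda>x. nrm a \<bullet> V x) =
        face_integral (facet a) (outward_normal T (facet a)) (\<lambda>x. outward_normal T (facet a) \<bullet> V x)"
      unfolding outward_normal_eq[OF a]
      by (intro fint_eq_face_integral[symmetric] a continuous_intros) auto
  qed
  finally show ?thesis by (simp add: sum_facets)
qed

end

section \<open>Bump functions\<close>

text \<open>The extra denominator makes the family closed under differentiation up to linear
  combinations, so all derivatives of \<open>exp (- 1 / t)\<close> are handled at once.\<close>

definition flat :: "nat \<Rightarrow> real \<Rightarrow> real" where
  "flat m t = (if 0 < t then exp (- 1 / t) / t ^ m else 0)"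

lemma flat_derivative:
  "(flat m has_field_derivative flat (m + 2) t - real m * flat (m + 1) t) (at t)"
proof -
  consider "t > 0" | "t < 0" | "t = 0" by linarith
  then show ?thesis
  proof cases
    case 1
    have "((\<lambda>t. exp (- 1 / t) / t ^ m) has_field_derivative flat (m + 2) t - real m * flat (m + 1) t) (at t)"
    proof -
      have A: "((\<lambda>t. exp (- 1 / t)) has_field_derivative exp (- 1 / t) * (1 / t\<^sup>2)) (at t)"
        using 1 by (auto intro!: derivative_eq_intros simp: power2_eq_square)
      have "((\<lambda>t. t ^ m) has_field_derivative real m * t ^ (m - Suc 0)) (at t)"
        by (rule DERIV_pow)
      from DERIV_divide[OF A this] have D: "((\<lambda>t. exp (- 1 / t) / t ^ m) has_field_derivative
          (exp (- 1 / t) * (1 / t\<^sup>2) * t ^ m - exp (- 1 / t) * (real m * t ^ (m - Suc 0))) / (t ^ m * t ^ m)) (at t)"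
        using 1 by simp
      have "(exp (- 1 / t) * (1 / t\<^sup>2) * t ^ m - exp (- 1 / t) * (real m * t ^ (m - Suc 0))) / (t ^ m * t ^ m) =
          flat (m + 2) t - real m * flat (m + 1) t"
        using 1 by (cases m) (simp_all add: flat_def field_simps power2_eq_square)
      with D show ?thesis by simp
    qed
    then show ?thesis
      by (rule DERIV_cong_ev[THEN iffD1, rotated 3])
        (use 1 in \<open>auto simp: flat_def eventually_nhds intro!: exI[of _ "{0<..}"]\<close>)
  next
    case 2
    have "((\<lambda>t. 0) has_field_derivative flat (m + 2) t - real m * flat (m + 1) t) (at t)"
      using 2 by (simp add: flat_def)
    then show ?thesis
      by (rule DERIV_cong_ev[THEN iffD1, rotated 3])
        (use 2 in \<open>auto simp: flat_def eventually_nhds intro!: exI[of _ "{..<0}"]\<close>)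
  next
    case 3
    \<comment> \<open>At the origin the quotient from the left is 0. From the right the reciprocal
      is taken as variable, and an exponential beats every power.\<close>
    have "((\<lambda>t. (inverse t) ^ (m + 1) / exp (inverse t)) \<longlongrightarrow> 0) (at_right (0::real))"
      by (rule filterlim_compose[OF tendsto_power_div_exp_0 filterlim_inverse_at_top_right])
    moreover have "\<forall>\<^sub>F t in at_right (0::real). (inverse t) ^ (m + 1) / exp (inverse t) = flat m t / t"
    proof -
      have "(inverse t) ^ (m + 1) / exp (inverse t) = flat m t / t" if "t > 0" for t :: real
        using that by (simp add: flat_def exp_minus divide_simps)
      then show ?thesis by (simp add: eventually_at_right_less eventually_at_filter)
    qed
    ultimately have "((\<lambda>t. flat m t / t) \<longlongrightarrow> 0) (at_right 0)"
      by (rule Lim_transform_eventually)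
    moreover have "((\<lambda>t. flat m t / t) \<longlongrightarrow> 0) (at_left 0)"
    proof (rule Lim_transform_eventually[OF tendsto_const])
      show "\<forall>\<^sub>F t in at_left 0. 0 = flat m t / t"
        by (simp add: flat_def eventually_at_filter)
    qed
    ultimately have "((\<lambda>t. flat m t / t) \<longlongrightarrow> 0) (at 0)"
      by (simp add: filterlim_at_split)
    then show ?thesis
      unfolding 3 has_field_derivative_iff by (simp add: flat_def)
  qed
qed

lemma flat_bounds: "0 \<le> flat 0 t" "flat 0 t \<le> 1" "t \<le> 0 \<Longrightarrow> flat 0 t = 0" "0 < t \<Longrightarrow> 0 < flat 0 t"
  by (auto simp: flat_def)

text \<open>The invariant for the coinductive proof of smoothness: with a polynomial
  \<open>s\<close> the set is closed under partial derivatives, because the derivative of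
  \<open>flat m (s x)\<close> is a combination of polynomials times functions of the same
  kind.\<close>

inductive_set flat_span :: "(real^'n \<Rightarrow> real) \<Rightarrow> (real^'n \<Rightarrow> real) set" for s where
  base: "Q \<in> Pol k UNIV \<Longrightarrow> (\<lambda>x. Q x * flat m (s x)) \<in> flat_span s"
| add: "f \<in> flat_span s \<Longrightarrow> g \<in> flat_span s \<Longrightarrow> (\<lambda>x. f x + g x) \<in> flat_span s"

lemma flat_span_partial:
  assumes s: "s \<in> Pol k UNIV" and f: "f \<in> flat_span s"
  shows "(\<forall>x. f differentiable (at x)) \<and> (\<forall>j. partial j f \<in> flat_span s)"
  using f
proof induction
  case (base Q k' m)
  have ds: "s differentiable (at x)" and dQ: "Q differentiable (at x)" for x
    using s base Pol_differentiable by blast+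
  have fl: "((\<lambda>x. flat m (s x)) has_derivative
      (\<lambda>h. (\<Sum>j\<in>UNIV. h $ j *\<^sub>R partial j s x) * (flat (m + 2) (s x) - real m * flat (m + 1) (s x)))) (at x)" for x
    by (rule DERIV_compose_FDERIV[OF flat_derivative partial_has_derivative[OF ds]])
  have dfl: "(\<lambda>x. flat m (s x)) differentiable (at x)" for x
    using fl differentiable_def by blast
  have "partial j (\<lambda>x. Q x * flat m (s x)) \<in> flat_span s" for j
  proof -
    have pf: "partial j (\<lambda>x. flat m (s x)) x = partial j s x * (flat (m + 2) (s x) - real m * flat (m + 1) (s x))" for x
      using partial_eq[OF fl, of j x] partial_eq[OF partial_has_derivative[OF ds], of j x] by simp
    have eq: "partial j (\<lambda>x. Q x * flat m (s x)) = (\<lambda>x. (partial j Q x * flat m (s x) +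
        (Q x * partial j s x) * flat (m + 2) (s x)) + ((- real m) *\<^sub>R (Q x * partial j s x)) * flat (m + 1) (s x))"
      by (intro ext) (simp only: partial_mult[OF dQ dfl] pf, simp add: algebra_simps)
    have b1: "partial j Q \<in> Pol (k' - 1) UNIV" using Pol_partial[OF base] by simp
    have b2: "(\<lambda>x. Q x * partial j s x) \<in> Pol (k' + (k - 1)) UNIV"
      using Pol_times[OF base Pol_partial[OF s]] by simp
    show ?thesis
      unfolding eq by (rule flat_span.add[OF flat_span.add[OF flat_span.base[OF b1] flat_span.base[OF b2]]
            flat_span.base[OF Pol_scale[OF b2]]])
  qed
  then show ?case using dQ dfl by (auto intro: differentiable_mult)
next
  case (add f g)
  then have "partial j (\<lambda>x. f x + g x) = (\<lambda>x. partial j f x + partial j g x)" for j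
    by (intro ext partial_add) auto
  then show ?case using add by (auto intro: flat_span.add)
qed

lemma flat_span_C_infinity:
  assumes "s \<in> Pol k UNIV" "f \<in> flat_span s"
  shows "C_infinity f"
  using assms(2)
proof (coinduction arbitrary: f rule: C_infinity.coinduct)
  case C_infinity
  then show ?case using flat_span_partial[OF assms(1)] by blast
qed

lemma C_infinity_C1: "C_infinity \<phi> \<Longrightarrow> C1 \<phi>"
proof -
  assume \<phi>: "C_infinity \<phi>"
  have d: "\<phi> differentiable (at x)" "C_infinity (partial j \<phi>)" for x j
    using \<phi> by (auto elim: C_infinity.cases)
  have "continuous_on UNIV (partial j \<phi>)" for j
    using d(2)[of j] by (auto elim!: C_infinity.cases intro!: continuous_at_imp_continuous_on differentiable_imp_continuous_within)
  then show ?thesis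
    unfolding C1_def grad_def[abs_def] using d(1) by (auto intro!: continuous_on_vec_lambda)
qed

text \<open>Bump functions that become thin in the direction \<open>n\<close> as \<open>M\<close> grows but keep their values on the
  hyperplane through \<open>x0\<close> orthogonal to \<open>n\<close>.\<close>

definition bump :: "real^'n \<Rightarrow> real \<Rightarrow> real^'n \<Rightarrow> real \<Rightarrow> real^'n \<Rightarrow> real" where
  "bump x0 r n M x = flat 0 (r\<^sup>2 - (norm (x - x0))\<^sup>2 - M * (n \<bullet> (x - x0))\<^sup>2)"

text \<open>The argument of \<open>flat 0\<close> is a quadratic polynomial which is positive only
  inside the ball, because the penalty in the direction \<open>n\<close> is nonnegative.\<close>

lemma bump_test_function:
  fixes \<Omega> :: "(real^'n) set"
  assumes "cball x0 r \<subseteq> \<Omega>" "0 < r" "0 \<le> M"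
  shows "bump x0 r n M \<in> test_functions \<Omega>"
proof -
  define s where "s x = r\<^sup>2 - (norm (x - x0))\<^sup>2 - M * (n \<bullet> (x - x0))\<^sup>2" for x :: "real^'n"
  have lin: "(\<lambda>x::real^'n. n \<bullet> x + (- (n \<bullet> x0))) \<in> Pol 1 UNIV" by (rule Pol_affine) simp
  have comp: "(\<lambda>x::real^'n. x $ i + (- x0 $ i)) \<in> Pol 1 UNIV" for i
    by (intro Pol_add Pol_component Pol_const) auto
  have c0: "(\<lambda>x::real^'n. r\<^sup>2) \<in> Pol (1 + 1) UNIV" by (rule Pol_const) auto
  have c1: "(\<lambda>x::real^'n. \<Sum>i\<in>UNIV. (x $ i + (- x0 $ i)) * (x $ i + (- x0 $ i))) \<in> Pol (1 + 1) UNIV"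
    by (intro Pol_sum Pol_times comp)
  have c2: "(\<lambda>x::real^'n. M *\<^sub>R ((n \<bullet> x + (- (n \<bullet> x0))) * (n \<bullet> x + (- (n \<bullet> x0))))) \<in> Pol (1 + 1) UNIV"
    by (intro Pol_scale Pol_times lin)
  have "s = (\<lambda>x. r\<^sup>2 - (\<Sum>i\<in>UNIV. (x $ i + (- x0 $ i)) * (x $ i + (- x0 $ i))) - M *\<^sub>R ((n \<bullet> x + (- (n \<bullet> x0))) * (n \<bullet> x + (- (n \<bullet> x0)))))"
  proof
    fix x :: "real^'n"
    have "(norm (x - x0))\<^sup>2 = (\<Sum>i\<in>UNIV. (x $ i + (- x0 $ i)) * (x $ i + (- x0 $ i)))"
      by (simp add: power2_norm_eq_inner inner_vec_def)
    moreover have "n \<bullet> (x - x0) = n \<bullet> x + (- (n \<bullet> x0))" by (simp add: inner_diff_right)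
    ultimately show "s x = r\<^sup>2 - (\<Sum>i\<in>UNIV. (x $ i + (- x0 $ i)) * (x $ i + (- x0 $ i))) - M *\<^sub>R ((n \<bullet> x + (- (n \<bullet> x0))) * (n \<bullet> x + (- (n \<bullet> x0))))"
      by (simp add: s_def power2_eq_square)
  qed
  then have s: "s \<in> Pol 2 UNIV" using Pol_diff[OF Pol_diff[OF c0 c1] c2] by simp
  have "(\<lambda>x. 1 * flat 0 (s x)) \<in> flat_span s"
    by (rule flat_span.base[of _ 0]) (rule Pol_const, auto)
  then have smooth: "C_infinity (bump x0 r n M)"
    using flat_span_C_infinity[OF s] by (simp add: bump_def[abs_def] s_def)
  have "x \<in> cball x0 r" if "bump x0 r n M x \<noteq> 0" for x
  proof -
    have "0 < s x" using that flat_bounds(3)[of "s x"] by (fastforce simp: bump_def s_def not_less[symmetric])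
    moreover have "0 \<le> M * (n \<bullet> (x - x0))\<^sup>2" using assms(3) by simp
    ultimately have "(norm (x - x0))\<^sup>2 < r\<^sup>2" by (simp add: s_def)
    then have "norm (x - x0) < r" using assms(2) by (simp add: power2_less_imp_less)
    then show ?thesis by (simp add: dist_norm norm_minus_commute)
  qed
  then have "closure {x. bump x0 r n M x \<noteq> 0} \<subseteq> cball x0 r"
    by (intro closure_minimal) auto
  moreover from this have "compact (closure {x. bump x0 r n M x \<noteq> 0})"
    unfolding compact_eq_bounded_closed using bounded_subset[OF bounded_cball] closed_closure by blast
  ultimately show ?thesis
    unfolding test_functions_def using smooth assms(1) by blast
qed

lemma bump_bounds: "0 \<le> bump x0 r n M x" "bump x0 r n M x \<le> 1"
  by (simp_all add: bump_def flat_bounds)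

lemma bump_center: "0 < r \<Longrightarrow> 0 < bump x0 r n M x0"
  by (simp add: bump_def flat_bounds)

lemma bump_outside: "0 < r \<Longrightarrow> 0 \<le> M \<Longrightarrow> r \<le> dist x0 x \<Longrightarrow> bump x0 r n M x = 0"
proof -
  assume r: "0 < r" "0 \<le> M" "r \<le> dist x0 x"
  have "r\<^sup>2 \<le> (norm (x - x0))\<^sup>2" using r by (intro power_mono) (auto simp: dist_norm norm_minus_commute)
  moreover have "0 \<le> M * (n \<bullet> (x - x0))\<^sup>2" using r by simp
  ultimately show ?thesis unfolding bump_def by (intro flat_bounds(3)) linarith
qed

lemma bump_on_plane: "n \<bullet> (x - x0) = 0 \<Longrightarrow> bump x0 r n M x = bump x0 r n 0 x"
  by (simp add: bump_def)

lemma bump_limit: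
  assumes "n \<bullet> (x - x0) \<noteq> 0"
  shows "(\<lambda>M. bump x0 r n (real M) x) \<longlonglongrightarrow> 0"
proof -
  obtain N :: nat where N: "r\<^sup>2 / (n \<bullet> (x - x0))\<^sup>2 < real N" using reals_Archimedean2 by blast
  have "bump x0 r n (real M) x = 0" if "N \<le> M" for M
  proof -
    have "r\<^sup>2 / (n \<bullet> (x - x0))\<^sup>2 \<le> real M" using N that by linarith
    then have "r\<^sup>2 \<le> real M * (n \<bullet> (x - x0))\<^sup>2" using assms by (simp add: divide_le_eq)
    moreover have "0 \<le> (norm (x - x0))\<^sup>2" by simp
    ultimately show ?thesis unfolding bump_def by (intro flat_bounds(3)) linarith
  qed
  then show ?thesis by (intro tendsto_eventually) (auto simp: eventually_sequentially)
qed

section \<open>Meshes\<close>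

lemma aff_dim_T:
  fixes C :: "(real^'n) set"
  assumes "vertices C"
  shows "aff_dim (convex hull C) = int CARD('n)"
  using aff_dim_affine_independent[OF vertices.independent_C[OF assms]] vertices.card_C[OF assms]
  by (simp add: aff_dim_convex_hull)

lemma neg_eq_self: "v = - v \<Longrightarrow> v = (0 :: 'a::real_vector)"
proof -
  assume "v = - v"
  then have "2 *\<^sub>R v = 0" by (metis add.right_inverse scaleR_2)
  then show ?thesis by simp
qed

locale mesh =
  fixes \<Omega> :: "(real^'n) set" and Th :: "(real^'n) set set" and nF :: "(real^'n) set \<Rightarrow> real^'n"
  assumes domain: "polytopal_domain \<Omega>" and mesh: "simplicial_mesh \<Omega> Th"
    and normals: "face_normals \<Omega> Th nF"
begin

definition verts :: "(real^'n) set \<Rightarrow> (real^'n) set" where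
  "verts T = (SOME C. vertices C \<and> T = convex hull C)"

lemma verts: assumes "T \<in> Th" shows "vertices (verts T)" "convex hull (verts T) = T"
proof -
  have "int CARD('n) simplex T" using mesh assms by (simp add: simplicial_mesh_def)
  then have "\<exists>C. vertices C \<and> T = convex hull C" using vertices_exist by metis
  from someI_ex[OF this] show "vertices (verts T)" "convex hull (verts T) = T"
    unfolding verts_def by simp_all
qed

lemma open_domain: "open \<Omega>" and bounded_domain: "bounded \<Omega>" and connected_domain: "connected \<Omega>"
  and interior_closure: "interior (closure \<Omega>) = \<Omega>" and nonempty_domain: "\<Omega> \<noteq> {}"
  using domain by (auto simp: polytopal_domain_def)

lemma finite_Th: "finite Th" and Union_Th: "\<Union>Th = closure \<Omega>"
  and Int_face: "S \<in> Th \<Longrightarrow> T \<in> Th \<Longrightarrow> S \<inter> T face_of S"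
  using mesh by (auto simp: simplicial_mesh_def triangulation_def)

lemma compact_elem: "T \<in> Th \<Longrightarrow> compact T" and convex_elem: "T \<in> Th \<Longrightarrow> convex T"
  using vertices.compact_T[OF verts(1)] verts(2) convex_convex_hull by metis+

lemma interior_elem_nonempty: "T \<in> Th \<Longrightarrow> interior T \<noteq> {}"
  using vertices.interior_T_nonempty[OF verts(1)] verts(2) by metis

lemma elem_subset: "T \<in> Th \<Longrightarrow> T \<subseteq> closure \<Omega>"
  using Union_Th by blast

lemma interior_elem_subset: "T \<in> Th \<Longrightarrow> interior T \<subseteq> \<Omega>"
  using interior_mono[OF elem_subset] interior_closure by blast

lemma frontier_disjoint: "frontier \<Omega> \<inter> \<Omega> = {}"
  using open_domain frontier_disjoint_eq by blast

text \<open>The intersection of two elements is a face of each, and a face that contains an interior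
  point is the whole element. If an interior point of one lay in the other, each would contain the
  other.\<close>

lemma interior_disjoint:
  assumes "S \<in> Th" "T \<in> Th" "S \<noteq> T"
  shows "interior S \<inter> T = {}"
proof -
  have *: "A \<subseteq> B" if "A \<in> Th" "B \<in> Th" "interior A \<inter> B \<noteq> {}" for A B
  proof -
    have "A \<inter> B = A"
      using face_of_disjoint_interior[OF Int_face[OF that(1,2)]] that(3) interior_subset by blast
    then show ?thesis by blast
  qed
  show ?thesis
  proof (rule ccontr)
    assume "interior S \<inter> T \<noteq> {}"
    then have ST: "S \<subseteq> T" using * assms by blast
    then have "interior T \<inter> S \<noteq> {}" using interior_mono[OF ST] interior_elem_nonempty[OF assms(1)] interior_subset by blast
    then have "T \<subseteq> S" using * assms by blast
    then show False using ST assms by blast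
  qed
qed

section \<open>Facets shared by two elements\<close>

lemma facetE:
  assumes "T \<in> Th" "F facet_of T"
  obtains a where "a \<in> verts T" "F = convex hull (verts T - {a})"
    "outward_normal T F = vertices.nrm (verts T) a"
proof -
  interpret vertices "verts T" by (rule verts[OF assms(1)])
  have eq: "convex hull (verts T) = T" by (rule verts[OF assms(1)])
  obtain a where "a \<in> verts T" "F = facet a" using facet_of_T assms(2) unfolding eq by blast
  then show ?thesis using that outward_normal_eq[of a] unfolding eq by blast
qed

lemma facet_subset_elem: "F facet_of T \<Longrightarrow> F \<subseteq> T"
  by (rule facet_of_imp_subset)

lemma finite_facets: "T \<in> Th \<Longrightarrow> finite {F. F facet_of T}"
  using vertices.finite_facets[OF verts(1)] verts(2) by metis

lemma outward_normal_norm: "T \<in> Th \<Longrightarrow> F facet_of T \<Longrightarrow> norm (outward_normal T F) = 1"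
  by (metis facetE vertices.norm_nrm verts(1))

lemma outward_normal_perp:
  "T \<in> Th \<Longrightarrow> F facet_of T \<Longrightarrow> x \<in> F \<Longrightarrow> y \<in> F \<Longrightarrow> outward_normal T F \<bullet> (y - x) = 0"
  by (metis facetE vertices.nrm_perp verts(1))

lemma normal_pm:
  assumes "T \<in> Th" "F facet_of T" "norm n = 1" "\<And>x y. x \<in> F \<Longrightarrow> y \<in> F \<Longrightarrow> n \<bullet> (y - x) = 0"
  shows "n = outward_normal T F \<or> n = - outward_normal T F"
  by (metis assms facetE vertices.normal_cases verts(1))

lemma compact_facet: "T \<in> Th \<Longrightarrow> F facet_of T \<Longrightarrow> compact F"
  by (metis facetE vertices.compact_facet verts(1))

lemma convex_facet: "T \<in> Th \<Longrightarrow> F facet_of T \<Longrightarrow> convex F"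
  by (metis facetE convex_convex_hull)

text \<open>The common face of the two elements contains \<open>F\<close> and is proper; being the
  hull of a subset of the vertices, it must be \<open>F\<close>. With equal outward normals both
  elements would lie on the same side of \<open>F\<close> near \<open>x\<close>, and the interior of
  one would meet the other.\<close>

lemma shared_facet:
  assumes T: "T \<in> Th" "F facet_of T" and x: "x \<in> rel_interior F" and T': "T' \<in> Th" "x \<in> T'" "T' \<noteq> T"
  shows "F facet_of T'" "outward_normal T' F = - outward_normal T F"
proof -
  interpret V: vertices "verts T" by (rule verts[OF T(1)])
  interpret V': vertices "verts T'" by (rule verts[OF T'(1)])
  have eq: "convex hull (verts T) = T" "convex hull (verts T') = T'" using verts T T' by auto
  obtain a where a: "a \<in> verts T" "F = V.facet a" "outward_normal T F = V.nrm a"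
    by (rule facetE[OF T])
  have xF: "x \<in> F" using x rel_interior_subset by blast
  have FT: "F \<subseteq> T" using facet_subset_elem[OF T(2)] .
  have "F \<subseteq> T \<inter> T'"
    by (rule subset_of_face_of[OF Int_face[OF T(1) T'(1)] FT]) (use x xF FT T'(2) in blast)
  obtain c where c: "c \<subseteq> verts T" "T \<inter> T' = convex hull c"
    using Int_face[OF T(1) T'(1)] face_of_convex_hull_affine_independent[OF V.independent_C] unfolding eq by blast
  have "b \<in> c" if b: "b \<in> verts T" "b \<noteq> a" for b
  proof (rule ccontr)
    assume "b \<notin> c"
    then have "c \<subseteq> verts T - {b}" using c by blast
    then have "T \<inter> T' \<subseteq> V.facet b" unfolding c(2) by (rule hull_mono)
    moreover have "b \<in> F" using V.vertex_in_facet[OF a(1) b(1)] b a(2) by blast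
    ultimately have "b \<in> V.facet b" using \<open>F \<subseteq> T \<inter> T'\<close> by blast
    then show False using V.vertex_in_facet[OF b(1) b(1)] by blast
  qed
  then have sub: "verts T - {a} \<subseteq> c" by blast
  have "a \<notin> c"
  proof
    assume "a \<in> c"
    then have "c = verts T" using sub c(1) by blast
    then have "T \<subseteq> T'" using c(2) eq(1) by blast
    then have "interior T \<inter> T' \<noteq> {}" using interior_elem_nonempty[OF T(1)] interior_subset by blast
    then show False using interior_disjoint[OF T(1) T'(1)] T'(3) by blast
  qed
  then have "c = verts T - {a}" using sub c(1) by blast
  then have "T \<inter> T' = F" using c(2) a(2) by simp
  then have "F face_of T'" using Int_face[OF T'(1) T(1)] by (simp add: Int_commute)
  moreover have "F \<noteq> {}" using xF by blast
  moreover have "aff_dim T = aff_dim T'"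
    using aff_dim_T[OF V.vertices_axioms] aff_dim_T[OF V'.vertices_axioms] unfolding eq by simp
  ultimately show F': "F facet_of T'" using T(2) unfolding facet_of_def by simp
  obtain a' where a': "a' \<in> verts T'" "F = V'.facet a'" "outward_normal T' F = V'.nrm a'"
    by (rule facetE[OF T'(1) F'])
  have "outward_normal T' F = outward_normal T F \<or> outward_normal T' F = - outward_normal T F"
    by (rule normal_pm[OF T outward_normal_norm[OF T'(1) F'] outward_normal_perp[OF T'(1) F']])
  moreover have "outward_normal T' F \<noteq> outward_normal T F"
  proof
    assume "outward_normal T' F = outward_normal T F"
    then have nn: "V'.nrm a' = V.nrm a" using a a' by simp
    obtain e where e: "0 < e" "\<And>y. y \<in> ball x e \<Longrightarrow> 0 \<le> V'.bl a' y \<Longrightarrow> y \<in> T'"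
      using V'.half_ball[OF a'(1)] x a'(2) unfolding eq by metis
    have "open (\<Inter>b\<in>verts T - {a}. {x. 0 < V.bl b x})"
      using V.finite_C by (intro open_INT ballI open_Collect_less V.continuous_bl continuous_intros) auto
    moreover have "x \<in> (\<Inter>b\<in>verts T - {a}. {x. 0 < V.bl b x})"
      using x V.in_rel_interior_facet[OF a(1)] a(2) by blast
    ultimately obtain d where d: "0 < d" "ball x d \<subseteq> (\<Inter>b\<in>verts T - {a}. {x. 0 < V.bl b x})"
      using open_contains_ball by blast
    define r where "r = min d e / 2"
    have r: "0 < r" "r < d" "r < e" using d(1) e(1) by (auto simp: r_def)
    \<comment> \<open>A point slightly below \<open>x\<close> in the interior of \<open>T\<close>;
      the equality of the two normals puts it in \<open>T'\<close> as well.\<close>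
    define y where "y = x + (- r) *\<^sub>R V.nrm a"
    have dy: "dist x y = r" using r V.norm_nrm[OF a(1)] by (simp add: y_def dist_norm)
    have neg: "V.bg a \<bullet> V.nrm a = - norm (V.bg a)" "V'.bg a' \<bullet> V'.nrm a' = - norm (V'.bg a')"
      using V.bg_nonzero[OF a(1)] V'.bg_nonzero[OF a'(1)]
      by (simp_all add: V.nrm_def V'.nrm_def power2_norm_eq_inner[symmetric] power2_eq_square)
    have bl0: "V.bl a x = 0" "V'.bl a' x = 0"
    proof -
      have "x \<in> rel_interior (V.facet a)" "x \<in> rel_interior (V'.facet a')"
        by (subst a(2)[symmetric], rule x) (subst a'(2)[symmetric], rule x)
      then show "V.bl a x = 0" "V'.bl a' x = 0"
        unfolding V.in_rel_interior_facet[OF a(1)] V'.in_rel_interior_facet[OF a'(1)] by simp_all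
    qed
    have nb: "0 < norm (V.bg a)" "0 < norm (V'.bg a')"
      using V.bg_nonzero[OF a(1)] V'.bg_nonzero[OF a'(1)] by auto
    have "V.bl a y = r * norm (V.bg a)" unfolding y_def V.bl_add bl0 inner_scaleR_right neg by simp
    then have "0 < V.bl a y" using r nb by simp
    moreover have "0 < V.bl b y" if "b \<in> verts T - {a}" for b
      using d(2) dy r that by (auto simp: subset_iff)
    ultimately have "y \<in> interior T" using V.interior_T unfolding eq by blast
    moreover have "V'.bl a' y = r * norm (V'.bg a')"
      unfolding y_def nn[symmetric] V'.bl_add bl0 inner_scaleR_right neg by simp
    then have "0 \<le> V'.bl a' y" using r nb by simp
    then have "y \<in> T'" using e(2) dy r by simp
    ultimately show False using interior_disjoint[OF T(1) T'(1)] T'(3) by blast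
  qed
  ultimately show "outward_normal T' F = - outward_normal T F" by blast
qed

text \<open>The remaining elements form a closed set. If it missed \<open>x\<close>, a neighbourhood
  of \<open>x\<close> would lie in \<open>T\<close>, although a barycentric coordinate of
  \<open>T\<close> vanishes at \<open>x\<close>.\<close>

lemma other_element:
  assumes T: "T \<in> Th" "F facet_of T" and x: "x \<in> rel_interior F" "x \<in> \<Omega>"
  obtains T' where "T' \<in> Th" "T' \<noteq> T" "x \<in> T'"
proof (rule ccontr)
  assume no: "\<not> thesis"
  interpret V: vertices "verts T" by (rule verts[OF T(1)])
  have eq: "convex hull (verts T) = T" using verts T by auto
  obtain a where a: "a \<in> verts T" "F = V.facet a" by (rule facetE[OF T])
  let ?U = "\<Union>(Th - {T})"
  have "closed ?U" using finite_Th compact_elem by (intro closed_Union) (auto intro: compact_imp_closed)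
  moreover have "x \<notin> ?U" using no that by blast
  ultimately have "open (\<Omega> - ?U)" "x \<in> \<Omega> - ?U" using open_domain x by auto
  moreover have "\<Omega> - ?U \<subseteq> T" using Union_Th closure_subset by blast
  ultimately have "x \<in> interior T" by (meson interiorI)
  then have "0 < V.bl a x" using V.interior_T a(1) unfolding eq by blast
  then show False using x(1) V.in_rel_interior_facet[OF a(1)] a(2) by simp
qed

lemma mesh_facesI: "T \<in> Th \<Longrightarrow> F facet_of T \<Longrightarrow> F \<in> mesh_faces Th"
  by (auto simp: mesh_faces_def)

lemma finite_mesh_faces: "finite (mesh_faces Th)"
proof -
  have "mesh_faces Th = (\<Union>T\<in>Th. {F. F facet_of T})" by (auto simp: mesh_faces_def)
  then show ?thesis using finite_Th finite_facets by simp
qed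

lemma finite_interior_faces: "finite (interior_faces \<Omega> Th)" and finite_boundary_faces: "finite (boundary_faces \<Omega> Th)"
  using finite_mesh_faces by (auto simp: interior_faces_def boundary_faces_def)

text \<open>A face that is not contained in the frontier has a relative interior point in
  \<open>\<Omega>\<close>, and there a second element exists. A third one would have a normal
  opposite to two opposite vectors.\<close>

lemma interior_face_elements:
  assumes F: "F \<in> interior_faces \<Omega> Th" and T: "T \<in> Th" "F facet_of T"
  obtains T' where "T' \<in> Th" "T' \<noteq> T" "F facet_of T'" "outward_normal T' F = - outward_normal T F"
    "{S \<in> Th. F facet_of S} = {T, T'}" "rel_interior F \<subseteq> \<Omega>"
proof -
  have FT: "F \<subseteq> T" using facet_subset_elem[OF T(2)] .
  have "\<not> F \<subseteq> frontier \<Omega>" using F by (simp add: interior_faces_def boundary_faces_def)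
  then obtain x0 where "x0 \<in> F" "x0 \<notin> frontier \<Omega>" by blast
  then have x0: "x0 \<in> \<Omega>"
    using FT elem_subset[OF T(1)] interior_open[OF open_domain] by (auto simp: frontier_def)
  have "closure (rel_interior F) = closure F"
    using convex_closure_rel_interior[OF convex_facet[OF T]] .
  then have "x0 \<in> closure (rel_interior F)" using \<open>x0 \<in> F\<close> closure_subset by blast
  then have "\<Omega> \<inter> rel_interior F \<noteq> {}"
    using open_Int_closure_eq_empty[OF open_domain] x0 by blast
  then obtain x where x: "x \<in> rel_interior F" "x \<in> \<Omega>" by blast
  obtain T' where T': "T' \<in> Th" "T' \<noteq> T" "x \<in> T'" by (rule other_element[OF T x])
  note s = shared_facet[OF T x(1) T'(1,3,2)]
  have nz: "outward_normal T F \<noteq> 0" using outward_normal_norm[OF T] by auto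
  have only: "S = T \<or> S = T'" if S: "S \<in> Th" "F facet_of S" for S
  proof (rule ccontr)
    assume ne: "\<not> (S = T \<or> S = T')"
    have xS: "x \<in> S" using x(1) rel_interior_subset facet_subset_elem[OF S(2)] by blast
    have "outward_normal S F = - outward_normal T F"
      using shared_facet(2)[OF T x(1) S(1) xS] ne by blast
    moreover have "outward_normal S F = - outward_normal T' F"
      using shared_facet(2)[OF T'(1) s(1) x(1) S(1) xS] ne by blast
    ultimately have "outward_normal T F = - outward_normal T F" using s(2) by simp
    then show False using nz neg_eq_self by metis
  qed
  \<comment> \<open>The half balls of the two elements on opposite sides of \<open>F\<close> fill a
    ball in the closure of \<open>\<Omega>\<close>; since \<open>\<Omega>\<close> is the interior of
    its closure, the point belongs to \<open>\<Omega>\<close>.\<close>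
  have sub: "rel_interior F \<subseteq> \<Omega>"
  proof
    fix y assume y: "y \<in> rel_interior F"
    interpret V: vertices "verts T" by (rule verts[OF T(1)])
    interpret V': vertices "verts T'" by (rule verts[OF T'(1)])
    have eq: "convex hull (verts T) = T" "convex hull (verts T') = T'" using verts T T' by auto
    obtain a where a: "a \<in> verts T" "F = V.facet a" "outward_normal T F = V.nrm a" by (rule facetE[OF T])
    obtain a' where a': "a' \<in> verts T'" "F = V'.facet a'" "outward_normal T' F = V'.nrm a'"
      by (rule facetE[OF T'(1) s(1)])
    obtain e where e: "0 < e" "\<And>z. z \<in> ball y e \<Longrightarrow> 0 \<le> V.bl a z \<Longrightarrow> z \<in> T"
      using V.half_ball[OF a(1)] y a(2) unfolding eq by metis
    obtain e' where e': "0 < e'" "\<And>z. z \<in> ball y e' \<Longrightarrow> 0 \<le> V'.bl a' z \<Longrightarrow> z \<in> T'"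
      using V'.half_ball[OF a'(1)] y a'(2) unfolding eq by metis
    have bl0: "V.bl a y = 0" "V'.bl a' y = 0"
    proof -
      have "y \<in> rel_interior (V.facet a)" "y \<in> rel_interior (V'.facet a')"
        by (subst a(2)[symmetric], rule y) (subst a'(2)[symmetric], rule y)
      then show "V.bl a y = 0" "V'.bl a' y = 0"
        unfolding V.in_rel_interior_facet[OF a(1)] V'.in_rel_interior_facet[OF a'(1)] by simp_all
    qed
    have "ball y (min e e') \<subseteq> closure \<Omega>"
    proof
      fix z assume z: "z \<in> ball y (min e e')"
      have n': "V'.nrm a' = - V.nrm a" using s(2) a a' by simp
      have zl: "V.bl a z = - (1 / V.height a) * (V.nrm a \<bullet> (z - y))"
        using V.bl_diff[of a z y] bl0 V.bg_nrm[OF a(1)] by simp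
      have zl': "V'.bl a' z = (1 / V'.height a') * (V.nrm a \<bullet> (z - y))"
        using V'.bl_diff[of a' z y] bl0 V'.bg_nrm[OF a'(1)] n' by simp
      have h: "0 < V.height a" "0 < V'.height a'" using V.height_pos[OF a(1)] V'.height_pos[OF a'(1)] .
      consider "V.nrm a \<bullet> (z - y) \<le> 0" | "0 \<le> V.nrm a \<bullet> (z - y)" by linarith
      then have "z \<in> T \<or> z \<in> T'"
      proof cases
        case 1
        then have "0 \<le> V.bl a z" using h zl by (simp add: divide_le_0_iff)
        then show ?thesis using e z by simp
      next
        case 2
        then have "0 \<le> V'.bl a' z" using h zl' by simp
        then show ?thesis using e' z by simp
      qed
      then show "z \<in> closure \<Omega>" using elem_subset T(1) T'(1) by blast
    qed
    then have "y \<in> interior (closure \<Omega>)"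
      using e(1) e'(1) by (intro interiorI[of "ball y (min e e')"]) auto
    then show "y \<in> \<Omega>" using interior_closure by simp
  qed
  show ?thesis
    using that[OF T'(1,2) s _ sub] only T T'(1) s(1) by blast
qed

lemma nF_unit: "F \<in> mesh_faces Th \<Longrightarrow> norm (nF F) = 1"
  and nF_perp: "F \<in> mesh_faces Th \<Longrightarrow> x \<in> F \<Longrightarrow> y \<in> F \<Longrightarrow> nF F \<bullet> (y - x) = 0"
  and nF_boundary: "F \<in> boundary_faces \<Omega> Th \<Longrightarrow> T \<in> Th \<Longrightarrow> F facet_of T \<Longrightarrow> nF F = outward_normal T F"
  using normals by (auto simp: face_normals_def)

abbreviation "posT F \<equiv> plus_elem Th nF F"
abbreviation "negT F \<equiv> minus_elem Th nF F"

lemma interior_face_mesh: "F \<in> interior_faces \<Omega> Th \<Longrightarrow> F \<in> mesh_faces Th"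
  by (simp add: interior_faces_def)

text \<open>Makes the descriptions in \<open>plus_elem\<close> and \<open>minus_elem\<close>
  definite: of the two elements at an interior face exactly one has \<open>nF F\<close> as its
  outward normal.\<close>

lemma plus_minus:
  assumes F: "F \<in> interior_faces \<Omega> Th"
  shows "posT F \<in> Th" "F facet_of posT F" "outward_normal (posT F) F = nF F"
    "negT F \<in> Th" "F facet_of negT F" "outward_normal (negT F) F = - nF F"
    "posT F \<noteq> negT F" "{T \<in> Th. F facet_of T} = {posT F, negT F}" "rel_interior F \<subseteq> \<Omega>"
proof -
  have m: "F \<in> mesh_faces Th" by (rule interior_face_mesh[OF F])
  then obtain T where T: "T \<in> Th" "F facet_of T" by (auto simp: mesh_faces_def)
  obtain T' where T': "T' \<in> Th" "T' \<noteq> T" "F facet_of T'" "outward_normal T' F = - outward_normal T F"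
    "{S \<in> Th. F facet_of S} = {T, T'}" "rel_interior F \<subseteq> \<Omega>"
    by (rule interior_face_elements[OF F T])
  have pm: "nF F = outward_normal T F \<or> nF F = - outward_normal T F"
    by (rule normal_pm[OF T nF_unit[OF m] nF_perp[OF m]])
  have "\<exists>P M. {P, M} = {T, T'} \<and> P \<noteq> M \<and> outward_normal P F = nF F \<and> outward_normal M F = - nF F"
    using pm
  proof
    assume "nF F = outward_normal T F"
    then have "{T, T'} = {T, T'} \<and> T \<noteq> T' \<and> outward_normal T F = nF F \<and> outward_normal T' F = - nF F"
      using T'(2,4) by simp
    then show ?thesis by (intro exI)
  next
    assume "nF F = - outward_normal T F"
    then have "{T', T} = {T, T'} \<and> T' \<noteq> T \<and> outward_normal T' F = nF F \<and> outward_normal T F = - nF F"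
      using T'(2,4) by (simp add: insert_commute)
    then show ?thesis by (intro exI)
  qed
  then obtain P M where PM: "{P, M} = {T, T'}" "P \<noteq> M" "outward_normal P F = nF F" "outward_normal M F = - nF F"
    by (elim exE conjE) (rule that)
  have nF0: "nF F \<noteq> - nF F" using nF_unit[OF m] neg_eq_self[of "nF F"] by (metis norm_zero zero_neq_one)
  have set: "{S \<in> Th. F facet_of S} = {P, M}" using T'(5) PM(1) by simp
  have pm: "P \<in> Th" "F facet_of P" "M \<in> Th" "F facet_of M"
  proof -
    have "P \<in> {S \<in> Th. F facet_of S}" "M \<in> {S \<in> Th. F facet_of S}" unfolding set by simp_all
    then show "P \<in> Th" "F facet_of P" "M \<in> Th" "F facet_of M" by simp_all
  qed
  have pP: "posT F = P"
    unfolding plus_elem_def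
  proof (rule the_equality)
    show "P \<in> Th \<and> F facet_of P \<and> outward_normal P F = nF F" using pm PM(3) by simp
    fix S assume S: "S \<in> Th \<and> F facet_of S \<and> outward_normal S F = nF F"
    then have "S \<in> {P, M}" unfolding set[symmetric] by simp
    then show "S = P" using S PM(4) nF0 by (metis insertE singletonD)
  qed
  have pM: "negT F = M"
    unfolding minus_elem_def
  proof (rule the_equality)
    show "M \<in> Th \<and> F facet_of M \<and> outward_normal M F = - nF F" using pm PM(4) by simp
    fix S assume S: "S \<in> Th \<and> F facet_of S \<and> outward_normal S F = - nF F"
    then have "S \<in> {P, M}" unfolding set[symmetric] by simp
    then show "S = M" using S PM(3) nF0 by (metis insertE singletonD)
  qed
  show "posT F \<in> Th" "F facet_of posT F" "outward_normal (posT F) F = nF F"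
    "negT F \<in> Th" "F facet_of negT F" "outward_normal (negT F) F = - nF F"
    "posT F \<noteq> negT F" "{T \<in> Th. F facet_of T} = {posT F, negT F}" "rel_interior F \<subseteq> \<Omega>"
    unfolding pP pM by (fact pm PM set T')+
qed

text \<open>Exchange of the order of summation. The inner sum at a boundary face is left as it
  stands because in all applications each of its terms vanishes.\<close>

lemma sum_over_facets:
  fixes \<Phi> :: "(real^'n) set \<Rightarrow> (real^'n) set \<Rightarrow> 'v::comm_monoid_add"
  shows "(\<Sum>T\<in>Th. \<Sum>F | F facet_of T. \<Phi> T F) =
    (\<Sum>F\<in>interior_faces \<Omega> Th. \<Phi> (posT F) F + \<Phi> (negT F) F) +
    (\<Sum>F\<in>boundary_faces \<Omega> Th. \<Sum>T | T \<in> Th \<and> F facet_of T. \<Phi> T F)"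
proof -
  have "(\<Sum>T\<in>Th. \<Sum>F | F facet_of T. \<Phi> T F) = (\<Sum>T\<in>Th. \<Sum>F | F \<in> mesh_faces Th \<and> F facet_of T. \<Phi> T F)"
    by (intro sum.cong refl) (auto simp: mesh_faces_def)
  also have "\<dots> = (\<Sum>F\<in>mesh_faces Th. \<Sum>T | T \<in> Th \<and> F facet_of T. \<Phi> T F)"
    by (rule sum.swap_restrict[OF finite_Th finite_mesh_faces])
  also have "mesh_faces Th = interior_faces \<Omega> Th \<union> boundary_faces \<Omega> Th"
    by (auto simp: interior_faces_def boundary_faces_def)
  also have "(\<Sum>F\<in>interior_faces \<Omega> Th \<union> boundary_faces \<Omega> Th. \<Sum>T | T \<in> Th \<and> F facet_of T. \<Phi> T F) =
      (\<Sum>F\<in>interior_faces \<Omega> Th. \<Sum>T | T \<in> Th \<and> F facet_of T. \<Phi> T F) +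
      (\<Sum>F\<in>boundary_faces \<Omega> Th. \<Sum>T | T \<in> Th \<and> F facet_of T. \<Phi> T F)"
    using finite_interior_faces finite_boundary_faces
    by (intro sum.union_disjoint) (auto simp: interior_faces_def)
  also have "(\<Sum>F\<in>interior_faces \<Omega> Th. \<Sum>T | T \<in> Th \<and> F facet_of T. \<Phi> T F) =
      (\<Sum>F\<in>interior_faces \<Omega> Th. \<Phi> (posT F) F + \<Phi> (negT F) F)"
    by (intro sum.cong refl) (simp add: plus_minus(7,8))
  finally show ?thesis .
qed

section \<open>Crossing interior faces outside a set of codimension two\<close>

abbreviation "bl T \<equiv> vertices.bl (verts T)"

text \<open>The whole affine planes of codimension two through the faces where two coordinates of an
  element vanish, instead of these faces themselves; membership then consists of two linear
  equations.\<close>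

definition skeleton :: "(real^'n) set" where
  "skeleton = {x. \<exists>T\<in>Th. \<exists>a\<in>verts T. \<exists>b\<in>verts T. a \<noteq> b \<and> bl T a x = 0 \<and> bl T b x = 0}"

text \<open>Evaluation at the vertices \<open>a\<close> and \<open>b\<close> shows that the affine
  combination is not identically zero.\<close>

lemma AE_bl:
  assumes "T \<in> Th" "a \<in> verts T" "b \<in> verts T" "a \<noteq> b" "r \<noteq> 0 \<or> s \<noteq> 0"
  shows "AE z in lborel. r * bl T a z + s * bl T b z \<noteq> 0"
proof -
  interpret V: vertices "verts T" by (rule verts[OF assms(1)])
  let ?g = "r *\<^sub>R V.bg a + s *\<^sub>R V.bg b"
  define c where "c = - (r * V.bl a 0 + s * V.bl b 0)"
  have eq: "r * V.bl a z + s * V.bl b z = ?g \<bullet> z - c" for z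
    by (simp add: V.bl_def c_def algebra_simps)
  have "?g \<noteq> 0 \<or> c \<noteq> 0"
  proof (rule ccontr)
    assume "\<not> ?thesis"
    then have "r * V.bl a z + s * V.bl b z = 0" for z unfolding eq by simp
    from this[of a] this[of b] show False
      using V.bl_vertex[OF assms(2,2)] V.bl_vertex[OF assms(2,3)] V.bl_vertex[OF assms(3,2)] V.bl_vertex[OF assms(3,3)] assms(4,5)
      by simp
  qed
  then have "AE z in lborel. ?g \<bullet> z \<noteq> c" by (rule AE_hyperplane)
  moreover have "?g \<bullet> z \<noteq> c \<Longrightarrow> r * V.bl a z + s * V.bl b z \<noteq> 0" for z unfolding eq by simp
  ultimately show ?thesis by (rule eventually_mono)
qed

lemma finite_verts: "T \<in> Th \<Longrightarrow> finite (verts T)"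
  using vertices.finite_C verts(1) by blast

lemma AE_skeleton: "AE z in lborel. z \<notin> skeleton"
proof -
  have "AE z in lborel. \<forall>T\<in>Th. \<forall>a\<in>verts T. \<forall>b\<in>verts T - {a}. 1 * bl T a z + 0 * bl T b z \<noteq> 0"
    by (intro AE_finite_allI finite_Th finite_verts finite_Diff AE_bl) auto
  then show ?thesis by (rule eventually_mono) (force simp: skeleton_def)
qed

text \<open>If \<open>bl b x * bl a z \<noteq> bl a x * bl b z\<close>, the segment from \<open>x\<close> to \<open>z\<close> can meet the set
  \<open>bl a = bl b = 0\<close> only in \<open>x\<close>.\<close>

lemma AE_segment:
  assumes "x \<notin> skeleton"
  shows "AE z in lborel. closed_segment x z \<inter> skeleton = {}"
proof -
  have "AE z in lborel. \<forall>T\<in>Th. \<forall>a\<in>verts T. \<forall>b\<in>verts T - {a}. bl T b x * bl T a z + (- bl T a x) * bl T b z \<noteq> 0"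
    using assms by (intro AE_finite_allI finite_Th finite_verts finite_Diff AE_bl) (auto simp: skeleton_def)
  then show ?thesis
  proof (rule eventually_mono)
    fix z assume z: "\<forall>T\<in>Th. \<forall>a\<in>verts T. \<forall>b\<in>verts T - {a}. bl T b x * bl T a z + (- bl T a x) * bl T b z \<noteq> 0"
    show "closed_segment x z \<inter> skeleton = {}"
    proof (rule ccontr)
      assume "\<not> ?thesis"
      then obtain w where w: "w \<in> closed_segment x z" "w \<in> skeleton" by blast
      then obtain T a b where T: "T \<in> Th" "a \<in> verts T" "b \<in> verts T" "a \<noteq> b" "bl T a w = 0" "bl T b w = 0"
        by (auto simp: skeleton_def)
      interpret V: vertices "verts T" by (rule verts[OF T(1)])
      obtain u where u: "0 \<le> u" "u \<le> 1" "w = (1 - u) *\<^sub>R x + u *\<^sub>R z"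
        using w(1) by (auto simp: in_segment)
      have lin: "V.bl c w = (1 - u) * V.bl c x + u * V.bl c z" for c
        unfolding u(3) by (simp add: V.bl_def algebra_simps)
      \<comment> \<open>The affine combination on the left vanishes at \<open>x\<close>, so its
        value at the point \<open>w\<close> of the segment is \<open>u\<close> times its nonzero
        value at \<open>z\<close>; as it also vanishes at \<open>w\<close>, \<open>u\<close> must be
        0.\<close>
      have "u * (V.bl b x * V.bl a z + (- V.bl a x) * V.bl b z) = V.bl b x * V.bl a w - V.bl a x * V.bl b w"
        unfolding lin by (simp add: algebra_simps)
      also have "\<dots> = 0" using T by simp
      finally have "u = 0" using z T by auto
      then have "w = x" using u(3) by simp
      then show False using w(2) assms by blast
    qed
  qed
qed

lemma open_AE_exists:
  assumes "open U" "U \<noteq> {}" "AE z in lborel. P (z :: 'a::euclidean_space)"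
  shows "\<exists>z\<in>U. P z"
proof (rule ccontr)
  assume "\<not> ?thesis"
  moreover obtain N where N: "{z. \<not> P z} \<subseteq> N" "N \<in> null_sets lborel"
    using assms(3) by (auto elim!: AE_E simp: null_sets_def)
  ultimately have "U \<subseteq> N" by blast
  moreover have "negligible N" using N(2) by (simp add: negligible_iff_null_sets null_sets_completionI)
  ultimately show False using assms(1,2) open_not_negligible negligible_subset by blast
qed

text \<open>A boundary point of the element has a vanishing coordinate, and off the skeleton it has
  only one.\<close>

lemma single_zero:
  assumes "T \<in> Th" "x \<in> T" "x \<notin> interior T" "x \<notin> skeleton"
  obtains F where "F facet_of T" "x \<in> rel_interior F"
proof -
  interpret V: vertices "verts T" by (rule verts[OF assms(1)])
  have eq: "convex hull (verts T) = T" by (rule verts[OF assms(1)])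
  obtain a where a: "a \<in> verts T" "\<not> 0 < V.bl a x"
    using V.interior_T assms(3) unfolding eq by blast
  have pos: "\<forall>b\<in>verts T. 0 \<le> V.bl b x" using V.in_T assms(2) unfolding eq by blast
  then have a0: "V.bl a x = 0" using a by force
  have "0 < V.bl b x" if b: "b \<in> verts T - {a}" for b
  proof -
    have "V.bl b x \<noteq> 0" using b a a0 assms(1,4) by (auto simp: skeleton_def)
    then show ?thesis using pos b by force
  qed
  then have "x \<in> rel_interior (V.facet a)" using V.in_rel_interior_facet[OF a(1)] a0 by blast
  moreover have "V.facet a facet_of T" using V.facet_of_T a(1) unfolding eq by blast
  ultimately show ?thesis using that by blast
qed

text \<open>Off the skeleton two distinct elements at \<open>x\<close> share a facet with
  \<open>x\<close> in its relative interior, and this is an interior face because \<open>x\<close>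
  lies in \<open>\<Omega>\<close>.\<close>

lemma piecewise_constant_at:
  assumes \<phi>: "\<And>F. F \<in> interior_faces \<Omega> Th \<Longrightarrow> \<phi> (posT F) = \<phi> (negT F)"
    and x: "x \<in> \<Omega>" "x \<notin> skeleton" and T: "T \<in> Th" "x \<in> T" and T': "T' \<in> Th" "x \<in> T'"
  shows "\<phi> T = \<phi> T'"
proof (cases "T = T'")
  case False
  then have "x \<notin> interior T" using interior_disjoint T T' by blast
  then obtain F where F: "F facet_of T" "x \<in> rel_interior F"
    using single_zero T x(2) by metis
  have "F facet_of T'" using shared_facet(1)[OF T(1) F T'] False by blast
  moreover have "F \<in> interior_faces \<Omega> Th"
  proof -
    have "x \<in> F" using F rel_interior_subset by blast
    then show ?thesis
      using x(1) frontier_disjoint mesh_facesI[OF T(1) F(1)] by (auto simp: interior_faces_def boundary_faces_def)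
  qed
  ultimately have F': "T \<in> {S \<in> Th. F facet_of S}" "T' \<in> {S \<in> Th. F facet_of S}" "F \<in> interior_faces \<Omega> Th"
    using T(1) T'(1) F(1) by auto
  then have "T \<in> {posT F, negT F}" "T' \<in> {posT F, negT F}"
    unfolding plus_minus(8)[OF F'(3)] by auto
  then show ?thesis using \<phi>[OF F'(3)] by auto
qed simp

text \<open>The skeleton has codimension two, so it does not disconnect balls.\<close>

lemma piecewise_constant:
  assumes \<phi>: "\<And>F. F \<in> interior_faces \<Omega> Th \<Longrightarrow> \<phi> (posT F) = \<phi> (negT F)"
    and T: "T \<in> Th" "T' \<in> Th"
  shows "\<phi> T = \<phi> T'"
proof -
  \<comment> \<open>Independent of the chosen element at points of \<open>\<Omega>\<close> off the
    skeleton, by \<open>piecewise_constant_at\<close>; only these values are used.\<close>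
  define val where "val x = \<phi> (SOME T. T \<in> Th \<and> x \<in> T)" for x
  have ex: "\<exists>T. T \<in> Th \<and> x \<in> T" if "x \<in> \<Omega>" for x
    using that Union_Th closure_subset by blast
  have val: "val x = \<phi> T" if "x \<in> \<Omega>" "x \<notin> skeleton" "T \<in> Th" "x \<in> T" for x T
    unfolding val_def using someI_ex[OF ex[OF that(1)]] piecewise_constant_at[OF \<phi> that(1,2)] that(3,4) by blast
  have local: "\<forall>\<^sub>F y in at x within S. val x = val y"
    if x: "x \<in> S" and S: "S \<subseteq> \<Omega> - skeleton" for x S
  proof -
    \<comment> \<open>The elements that miss \<open>x\<close> form a closed set, so any element
      through a point near \<open>x\<close> contains \<open>x\<close> itself.\<close>
    let ?U = "\<Union>{T\<in>Th. x \<notin> T}"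
    have "closed ?U" using finite_Th compact_elem by (intro closed_Union) (auto intro: compact_imp_closed)
    then have "open (- ?U)" "x \<in> - ?U" by auto
    moreover have "val x = val y" if y: "y \<in> - ?U" "y \<in> S" for y
    proof -
      obtain T where T: "T \<in> Th" "y \<in> T" using ex y S by blast
      then have "x \<in> T" using y by blast
      then show ?thesis using val T x y S by (metis DiffD1 DiffD2 subsetD)
    qed
    ultimately show ?thesis unfolding eventually_at_topological by blast
  qed
  have seg: "val x = val z" if "closed_segment x z \<subseteq> \<Omega> - skeleton" for x z
    by (rule connected_local_const[OF connected_segment(1), of _ x z]) (use local that in auto)
  have ball: "val x = val y" if B: "ball c e \<subseteq> \<Omega>" "x \<in> ball c e - skeleton" "y \<in> ball c e - skeleton" for c e x y
  proof -
    \<comment> \<open>Almost every \<open>z\<close> is joined to both \<open>x\<close> and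
      \<open>y\<close> by segments that avoid the skeleton; a path of two segments inside the ball
      then connects them.\<close>
    have "AE z in lborel. closed_segment x z \<inter> skeleton = {} \<and> closed_segment y z \<inter> skeleton = {}"
      using AE_segment B by (intro AE_conjI) auto
    then obtain z where z: "z \<in> ball c e" "closed_segment x z \<inter> skeleton = {}" "closed_segment y z \<inter> skeleton = {}"
      using open_AE_exists[OF open_ball, of c e] B by blast
    have "closed_segment x z \<subseteq> ball c e" "closed_segment y z \<subseteq> ball c e"
      by (intro closed_segment_subset convex_ball z(1); use B in blast)+
    then have "val x = val z" "val y = val z" using seg z B(1) by blast+
    then show ?thesis by simp
  qed
  define near where "near x v \<longleftrightarrow> (\<exists>e>0. ball x e \<subseteq> \<Omega> \<and> (\<forall>y\<in>ball x e - skeleton. val y = v))" for x v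
  have nearby: "\<exists>y. y \<in> U \<and> y \<notin> skeleton" if "open U" "U \<noteq> {}" for U
    using open_AE_exists[OF that AE_skeleton] by blast
  have near_ex: "\<exists>v. near x v" if x: "x \<in> \<Omega>" for x
  proof -
    obtain e where e: "e > 0" "ball x e \<subseteq> \<Omega>" using open_domain x open_contains_ball by blast
    then have "ball x e \<noteq> {}" by simp
    then obtain y where "y \<in> ball x e - skeleton" using nearby[OF open_ball] by blast
    then have "near x (val y)" unfolding near_def using e ball[OF e(2)] by blast
    then show ?thesis by blast
  qed
  \<comment> \<open>Extends \<open>val\<close> over the skeleton by its constant value nearby. The
    extension is locally constant on all of \<open>\<Omega>\<close>, so connectedness applies to
    it.\<close>
  define f where "f x = (SOME v. near x v)" for x
  have f: "near x (f x)" if "x \<in> \<Omega>" for x unfolding f_def using someI_ex[OF near_ex[OF that]] .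
  have const: "f x = f y" if "x \<in> \<Omega>" "y \<in> \<Omega>" for x y
  proof (rule connected_local_const[OF connected_domain that], rule ballI)
    fix x assume x: "x \<in> \<Omega>"
    obtain e where e: "e > 0" "ball x e \<subseteq> \<Omega>" "\<forall>z\<in>ball x e - skeleton. val z = f x" using f[OF x] near_def by blast
    have "f x = f y" if y: "y \<in> ball x e" for y
    proof -
      obtain d where d: "d > 0" "\<forall>z\<in>ball y d - skeleton. val z = f y" using f[of y] e y near_def by blast
      have "y \<in> ball x e \<inter> ball y d" using y d by simp
      then obtain z where "z \<in> ball x e \<inter> ball y d" "z \<notin> skeleton" using nearby[of "ball x e \<inter> ball y d"] by blast
      then have "val z = f x" "val z = f y" using e(3) d(2) by blast+
      then show ?thesis by simp
    qed
    then show "\<forall>\<^sub>F y in at x within \<Omega>. f x = f y"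
      using e(1) by (auto simp: eventually_at_topological intro!: exI[of _ "ball x e"])
  qed
  have fT: "\<exists>x\<in>\<Omega>. f x = \<phi> T" if T: "T \<in> Th" for T
  proof -
    obtain x where x: "x \<in> interior T" using interior_elem_nonempty[OF T] by blast
    then have xO: "x \<in> \<Omega>" using interior_elem_subset[OF T] by blast
    obtain e where e: "e > 0" "ball x e \<subseteq> \<Omega>" "\<forall>z\<in>ball x e - skeleton. val z = f x" using f[OF xO] near_def by blast
    have "x \<in> ball x e \<inter> interior T" using e(1) x by simp
    then have "ball x e \<inter> interior T \<noteq> {}" by blast
    then obtain z where z: "z \<in> ball x e \<inter> interior T" "z \<notin> skeleton"
      using nearby[OF open_Int[OF open_ball open_interior]] by blast
    then have "val z = \<phi> T" using val[of z T] interior_subset e(2) T by blast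
    then show ?thesis using e(3) z xO by auto
  qed
  show ?thesis using fT[OF T(1)] fT[OF T(2)] const by metis
qed

text \<open>A segment from \<open>\<Omega>\<close> to a point outside its closure, chosen to miss
  the skeleton, meets the frontier at a relative interior point of a facet. That facet cannot be
  interior, since the relative interior of an interior face lies in \<open>\<Omega>\<close>.\<close>

lemma boundary_face_exists: "boundary_faces \<Omega> Th \<noteq> {}"
proof -
  obtain x0 where x0: "x0 \<in> \<Omega>" using nonempty_domain by blast
  obtain x where x: "x \<in> \<Omega>" "x \<notin> skeleton" using open_AE_exists[OF open_domain nonempty_domain AE_skeleton] by blast
  have "bounded (closure \<Omega>)" using bounded_domain by (rule bounded_closure)
  then have "closure \<Omega> \<noteq> UNIV" using not_bounded_UNIV by metis
  then obtain z where z: "z \<in> - closure \<Omega>" "closed_segment x z \<inter> skeleton = {}"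
    using open_AE_exists[of "- closure \<Omega>", OF _ _ AE_segment[OF x(2)]] by auto
  have "closed_segment x z \<inter> frontier \<Omega> \<noteq> {}"
  proof (rule connected_Int_frontier)
    show "closed_segment x z \<inter> \<Omega> \<noteq> {}" using x by auto
    show "closed_segment x z - \<Omega> \<noteq> {}" using z closure_subset by auto
  qed simp
  then obtain w where w: "w \<in> closed_segment x z" "w \<in> frontier \<Omega>" by blast
  then have "w \<in> closure \<Omega>" by (simp add: frontier_def)
  then obtain T where T: "T \<in> Th" "w \<in> T" using Union_Th by blast
  have "w \<notin> \<Omega>" using w frontier_disjoint by blast
  then have "w \<notin> interior T" using interior_elem_subset[OF T(1)] by blast
  then obtain F where F: "F facet_of T" "w \<in> rel_interior F"
    using single_zero[OF T] w z by blast
  then have "F \<notin> interior_faces \<Omega> Th" using plus_minus(9) \<open>w \<notin> \<Omega>\<close> by blast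
  then show ?thesis using mesh_facesI[OF T(1) F(1)] by (auto simp: interior_faces_def)
qed

end

section \<open>Integration by parts on a mesh and normal traces\<close>

lemma linear_component: "linear (\<lambda>v :: 'v::real_vector^'n. v $ i)"
  by (intro linearI) auto

lemma Pol_nth: "p \<in> Pol k UNIV \<Longrightarrow> (\<lambda>x. (p x :: 'v::real_vector^'m) $ i) \<in> Pol k UNIV"
  by (rule Pol_linear_image[where f = "\<lambda>v. v $ i" and V = UNIV]) (auto intro: linear_component)

lemma partial_nth: "f differentiable (at x) \<Longrightarrow> partial j (\<lambda>x. (f x :: 'v::real_normed_vector^'m) $ i) x = partial j f x $ i"
  by (rule partial_linear) (auto intro: bounded_linear_vec_nth)

lemma divg_Pol: "p \<in> Pol k UNIV \<Longrightarrow> divg p \<in> Pol (k - 1) UNIV"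
  unfolding divg_def[abs_def] by (intro Pol_sum Pol_nth Pol_partial) auto

lemma divg_mult:
  assumes "\<phi> differentiable (at x)" "p differentiable (at x)"
  shows "(\<Sum>i\<in>UNIV. partial i (\<lambda>x. \<phi> x * p x $ i) x) = \<phi> x * divg p x + grad \<phi> x \<bullet> (p x :: real^'n)"
proof -
  have "(\<lambda>x. p x $ i) differentiable (at x)" for i
    using differentiable_compose[OF _ assms(2), of "\<lambda>v. v $ i"]
    by (simp add: bounded_linear_imp_differentiable bounded_linear_vec_nth)
  then show ?thesis
    by (simp add: partial_mult assms partial_nth divg_def grad_def inner_vec_def sum.distrib sum_distrib_left)
qed

context mesh
begin

lemma AE_mesh: "AE x in lebesgue. \<forall>T\<in>Th. x \<notin> frontier T"
proof -
  have "AE x in lebesgue. x \<notin> frontier T" if "T \<in> Th" for T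
  proof -
    have "negligible (frontier T)" using convex_elem[OF that] by (rule negligible_convex_frontier)
    then have "frontier T \<in> null_sets lebesgue" by (simp add: negligible_iff_null_sets)
    then show ?thesis by (rule AE_not_in)
  qed
  then show ?thesis using finite_Th by (intro AE_finite_allI) auto
qed

text \<open>Elements overlap in null sets and cover \<open>\<Omega>\<close>, so prescribing
  \<open>g\<close> in the interiors of the elements determines its integral.\<close>

lemma mesh_integral:
  fixes h :: "(real^'n) set \<Rightarrow> real^'n \<Rightarrow> real"
  assumes h: "\<And>T. T \<in> Th \<Longrightarrow> continuous_on T (h T)"
    and g: "\<And>T x. T \<in> Th \<Longrightarrow> x \<in> interior T \<Longrightarrow> g x = h T x"
  shows "integrable (lebesgue_on \<Omega>) g"
    and "(LINT x|lebesgue_on \<Omega>. g x) = (\<Sum>T\<in>Th. LINT x|lebesgue_on T. h T x)"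
proof -
  define s where "s x = (\<Sum>T\<in>Th. indicator T x *\<^sub>R h T x)" for x
  note L = LINT_compact[OF compact_elem h]
  have sl: "integrable lborel s" unfolding s_def using L(2) by (intro Bochner_Integration.integrable_sum) auto
  have si: "integrable lebesgue s"
    using sl by (simp add: integrable_completion borel_measurable_integrable)
  have ae: "AE x in lebesgue. s x = indicator \<Omega> x *\<^sub>R g x"
    using AE_mesh
  proof (rule eventually_mono)
    fix x assume x: "\<forall>T\<in>Th. x \<notin> frontier T"
    have int: "x \<in> interior T" if "T \<in> Th" "x \<in> T" for T
      using x that closure_subset by (fastforce simp: frontier_def)
    show "s x = indicator \<Omega> x *\<^sub>R g x"
    proof (cases "\<exists>T\<in>Th. x \<in> T")
      case True
      then obtain T where T: "T \<in> Th" "x \<in> T" by blast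
      have "x \<notin> S" if "S \<in> Th - {T}" for S
        using interior_disjoint[OF T(1), of S] int[OF T] that by blast
      then have "s x = h T x"
        unfolding s_def using T finite_Th by (subst sum.remove[of Th T]) (auto intro!: sum.neutral)
      moreover have "x \<in> \<Omega>" using int[OF T] interior_elem_subset[OF T(1)] by blast
      ultimately show ?thesis using g[OF T(1) int[OF T]] by simp
    next
      case False
      then have "x \<notin> \<Omega>" using Union_Th closure_subset by blast
      moreover have "s x = 0" unfolding s_def using False by (intro sum.neutral) auto
      ultimately show ?thesis by simp
    qed
  qed
  have m: "(\<lambda>x. indicator \<Omega> x *\<^sub>R g x) \<in> borel_measurable lebesgue"
    using borel_measurable_AE[OF borel_measurable_integrable[OF si] ae] .
  have O: "\<Omega> \<inter> space lebesgue \<in> sets lebesgue" using open_domain by auto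
  have "integrable lebesgue (\<lambda>x. indicator \<Omega> x *\<^sub>R g x)"
    using si by (rule integrable_cong_AE_imp[OF _ m]) (use ae in auto)
  then show "integrable (lebesgue_on \<Omega>) g" by (simp add: integrable_restrict_space[OF O])
  have "(LINT x|lebesgue_on \<Omega>. g x) = (LINT x|lebesgue. indicator \<Omega> x *\<^sub>R g x)"
    by (rule integral_restrict_space[OF O])
  also have "\<dots> = (LINT x|lebesgue. s x)"
    using si m ae by (intro integral_cong_AE) auto
  also have "\<dots> = (LINT x|lborel. s x)" using sl by (intro integral_completion) auto
  also have "\<dots> = (\<Sum>T\<in>Th. LINT x|lborel. indicator T x *\<^sub>R h T x)"
    unfolding s_def using L(2) by (intro Bochner_Integration.integral_sum) auto
  also have "\<dots> = (\<Sum>T\<in>Th. LINT x|lebesgue_on T. h T x)"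
    using L(1) by (intro sum.cong) auto
  finally show "(LINT x|lebesgue_on \<Omega>. g x) = (\<Sum>T\<in>Th. LINT x|lebesgue_on T. h T x)" .
qed

lemma glue_interior:
  fixes v :: "(real^'n) set \<Rightarrow> real^'n \<Rightarrow> 'v::comm_monoid_add"
  assumes "T \<in> Th" "x \<in> interior T" "\<And>S. S \<in> Th \<Longrightarrow> x \<notin> S \<Longrightarrow> v S x = 0"
  shows "glue Th v x = v T x"
proof -
  have "v S x = 0" if "S \<in> Th - {T}" for S
    using interior_disjoint[OF assms(1), of S] assms that by blast
  then show ?thesis
    unfolding glue_def using assms(1) finite_Th by (subst sum.remove[of Th T]) (auto intro!: sum.neutral)
qed

lemma element_ibp:
  assumes T: "T \<in> Th" and p: "p \<in> Pol k UNIV" and \<phi>: "C1 \<phi>"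
  shows "(LINT x|lebesgue_on T. \<phi> x * divg p x) + (LINT x|lebesgue_on T. grad \<phi> x \<bullet> p x) =
    (\<Sum>F | F facet_of T. face_integral F (outward_normal T F) (\<lambda>x. \<phi> x * (outward_normal T F \<bullet> p x)))"
proof -
  interpret V: vertices "verts T" by (rule verts[OF T])
  have eq: "convex hull (verts T) = T" by (rule verts[OF T])
  have C1: "C1 (\<lambda>x. (\<phi> x *\<^sub>R p x) $ i)" for i
    using C1_mult[OF \<phi> C1_Pol[OF Pol_nth[OF p]]] by simp
  have c: "continuous_on T (\<lambda>x. \<phi> x * divg p x)" "continuous_on T (\<lambda>x. grad \<phi> x \<bullet> p x)"
    by (intro continuous_intros C1_continuous[OF \<phi>] C1_grad_continuous[OF \<phi>] Pol_continuous[OF divg_Pol[OF p]] Pol_continuous[OF p])+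
  have "(LINT x|lebesgue_on T. \<phi> x * divg p x) + (LINT x|lebesgue_on T. grad \<phi> x \<bullet> p x) =
      (LINT x|lebesgue_on T. \<phi> x * divg p x + grad \<phi> x \<bullet> p x)"
    by (rule Bochner_Integration.integral_add[symmetric, OF LINT_compact(3)[OF compact_elem[OF T] c(1)]
          LINT_compact(3)[OF compact_elem[OF T] c(2)]])
  also have "\<dots> = (LINT x|lebesgue_on T. (\<Sum>i\<in>UNIV. partial i (\<lambda>x. (\<phi> x *\<^sub>R p x) $ i) x))"
  proof (intro Bochner_Integration.integral_cong refl)
    fix x
    have "\<phi> differentiable (at x)" "p differentiable (at x)"
      using \<phi> Pol_differentiable[OF p] by (auto simp: C1_def)
    from divg_mult[OF this] show "\<phi> x * divg p x + grad \<phi> x \<bullet> p x = (\<Sum>i\<in>UNIV. partial i (\<lambda>x. (\<phi> x *\<^sub>R p x) $ i) x)"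
      by simp
  qed
  also have "\<dots> = (\<Sum>F | F facet_of T. face_integral F (outward_normal T F) (\<lambda>x. outward_normal T F \<bullet> (\<phi> x *\<^sub>R p x)))"
    using V.divergence_theorem[OF C1] unfolding eq .
  finally show ?thesis by simp
qed

lemma face_integral_normal:
  assumes "T \<in> Th" "F facet_of T" "n = outward_normal T F \<or> n = - outward_normal T F" "continuous_on F \<psi>"
  shows "face_integral F n \<psi> = face_integral F (outward_normal T F) \<psi>"
proof -
  obtain a where a: "a \<in> verts T" "F = convex hull (verts T - {a})" "outward_normal T F = vertices.nrm (verts T) a"
    by (rule facetE[OF assms(1,2)])
  interpret V: vertices "verts T" by (rule verts[OF assms(1)])
  have c: "continuous_on (V.facet a) \<psi>" using assms(4) unfolding a(2) .
  have n: "n = V.nrm a \<or> n = - V.nrm a" using assms(3) unfolding a(3) .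
  show ?thesis
    unfolding a(3) unfolding a(2) using V.fint_eq_face_integral[OF a(1) c n] V.fint_eq_face_integral[OF a(1) c, of "V.nrm a"] by simp
qed

text \<open>Collects linearity, congruence and positivity of facet integrals; in what follows the
  prisms behind them are no longer visible.\<close>

lemma facet_functional:
  assumes T: "T \<in> Th" "F facet_of T"
  shows "continuous_on F \<phi> \<Longrightarrow> continuous_on F \<psi> \<Longrightarrow> face_integral F (outward_normal T F) (\<lambda>x. \<phi> x + \<psi> x) =
      face_integral F (outward_normal T F) \<phi> + face_integral F (outward_normal T F) \<psi>"
    and "continuous_on F \<psi> \<Longrightarrow> face_integral F (outward_normal T F) (\<lambda>x. c * \<psi> x) = c * face_integral F (outward_normal T F) \<psi>"
    and "continuous_on F \<phi> \<Longrightarrow> (\<And>x. x \<in> F \<Longrightarrow> \<phi> x = \<psi> x) \<Longrightarrow>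
      face_integral F (outward_normal T F) \<phi> = face_integral F (outward_normal T F) \<psi>"
    and "continuous_on F \<psi> \<Longrightarrow> (\<And>x. x \<in> F \<Longrightarrow> 0 \<le> \<psi> x) \<Longrightarrow> face_integral F (outward_normal T F) \<psi> = 0 \<Longrightarrow> x \<in> F \<Longrightarrow> \<psi> x = 0"
    and "0 < face_integral F (outward_normal T F) (\<lambda>x. 1)"
    and "continuous_on F \<psi> \<Longrightarrow> (\<And>x. x \<in> F \<Longrightarrow> 0 \<le> \<psi> x) \<Longrightarrow> 0 \<le> face_integral F (outward_normal T F) \<psi>"
proof -
  obtain a where a: "a \<in> verts T" "F = convex hull (verts T - {a})" "outward_normal T F = vertices.nrm (verts T) a"
    by (rule facetE[OF T])
  interpret V: vertices "verts T" by (rule verts[OF T(1)])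
  interpret A: vertex_in "verts T" a by (rule V.vertex_in[OF a(1)])
  have fi: "face_integral F (outward_normal T F) \<psi> = A.fint \<psi>" if "continuous_on F \<psi>" for \<psi>
    using that unfolding a(3) unfolding a(2) by (intro A.face_integral_eq) auto
  show "continuous_on F \<phi> \<Longrightarrow> continuous_on F \<psi> \<Longrightarrow> face_integral F (outward_normal T F) (\<lambda>x. \<phi> x + \<psi> x) =
      face_integral F (outward_normal T F) \<phi> + face_integral F (outward_normal T F) \<psi>"
    using A.fint_add[of \<phi> \<psi>] by (simp add: fi continuous_on_add a(2)[symmetric])
  show "continuous_on F \<psi> \<Longrightarrow> face_integral F (outward_normal T F) (\<lambda>x. c * \<psi> x) = c * face_integral F (outward_normal T F) \<psi>"
    by (simp add: fi continuous_on_mult_left A.fint_scale)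
  show "face_integral F (outward_normal T F) \<phi> = face_integral F (outward_normal T F) \<psi>"
    if c: "continuous_on F \<phi>" and e: "\<And>x. x \<in> F \<Longrightarrow> \<phi> x = \<psi> x"
  proof -
    have "continuous_on F \<psi>" using c e by (metis continuous_on_cong)
    moreover have "A.fint \<phi> = A.fint \<psi>" using e unfolding a(2) by (rule A.fint_cong)
    ultimately show ?thesis using fi c by metis
  qed
  show "\<psi> x = 0" if "continuous_on F \<psi>" "\<And>x. x \<in> F \<Longrightarrow> 0 \<le> \<psi> x" "face_integral F (outward_normal T F) \<psi> = 0" "x \<in> F"
  proof (rule A.fint_nonneg_eq_0)
    show "continuous_on (V.facet a) \<psi>" using that(1) unfolding a(2) .
    show "0 \<le> \<psi> y" if "y \<in> V.facet a" for y using that \<open>\<And>x. x \<in> F \<Longrightarrow> 0 \<le> \<psi> x\<close> unfolding a(2) by blast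
    show "A.fint \<psi> = 0" using fi that by metis
    show "x \<in> V.facet a" using that(4) unfolding a(2) .
  qed
  show "0 < face_integral F (outward_normal T F) (\<lambda>x. 1)"
    using A.fint_1_pos by (simp add: fi)
  show "0 \<le> face_integral F (outward_normal T F) \<psi>" if "continuous_on F \<psi>" "\<And>x. x \<in> F \<Longrightarrow> 0 \<le> \<psi> x"
    using A.fint_nonneg[of \<psi>] that unfolding fi[OF that(1)] unfolding a(2) by blast
qed

lemma nF_cases:
  assumes "T \<in> Th" "F facet_of T"
  shows "nF F = outward_normal T F \<or> nF F = - outward_normal T F"
  by (rule normal_pm[OF assms nF_unit nF_perp]) (auto intro: mesh_facesI assms)

lemma face_integral_nF:
  assumes "T \<in> Th" "F facet_of T" "continuous_on F \<psi>"
  shows "face_integral F (outward_normal T F) \<psi> = face_integral F (nF F) \<psi>"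
  using face_integral_normal[OF assms(1,2) nF_cases[OF assms(1,2)] assms(3)] by simp

lemma mesh_faceE:
  assumes "F \<in> mesh_faces Th"
  obtains T where "T \<in> Th" "F facet_of T"
  using assms by (auto simp: mesh_faces_def)

lemma face_functional:
  assumes F: "F \<in> mesh_faces Th"
  shows "continuous_on F \<phi> \<Longrightarrow> continuous_on F \<psi> \<Longrightarrow> face_integral F (nF F) (\<lambda>x. \<phi> x + \<psi> x) =
      face_integral F (nF F) \<phi> + face_integral F (nF F) \<psi>"
    and "continuous_on F \<psi> \<Longrightarrow> face_integral F (nF F) (\<lambda>x. c * \<psi> x) = c * face_integral F (nF F) \<psi>"
    and "continuous_on F \<phi> \<Longrightarrow> (\<And>x. x \<in> F \<Longrightarrow> \<phi> x = \<psi> x) \<Longrightarrow> face_integral F (nF F) \<phi> = face_integral F (nF F) \<psi>"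
    and "continuous_on F \<psi> \<Longrightarrow> (\<And>x. x \<in> F \<Longrightarrow> 0 \<le> \<psi> x) \<Longrightarrow> face_integral F (nF F) \<psi> = 0 \<Longrightarrow> x \<in> F \<Longrightarrow> \<psi> x = 0"
    and "0 < face_integral F (nF F) (\<lambda>x. 1)"
    and "continuous_on F \<psi> \<Longrightarrow> (\<And>x. x \<in> F \<Longrightarrow> 0 \<le> \<psi> x) \<Longrightarrow> 0 \<le> face_integral F (nF F) \<psi>"
proof -
  obtain T where T: "T \<in> Th" "F facet_of T" by (rule mesh_faceE[OF F])
  note fn = face_integral_nF[OF T, symmetric] and ff = facet_functional[OF T]
  show "continuous_on F \<phi> \<Longrightarrow> continuous_on F \<psi> \<Longrightarrow> face_integral F (nF F) (\<lambda>x. \<phi> x + \<psi> x) =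
      face_integral F (nF F) \<phi> + face_integral F (nF F) \<psi>"
    by (simp add: fn ff(1) continuous_on_add)
  show "continuous_on F \<psi> \<Longrightarrow> face_integral F (nF F) (\<lambda>x. c * \<psi> x) = c * face_integral F (nF F) \<psi>"
    by (simp add: fn ff(2) continuous_on_mult_left)
  show "face_integral F (nF F) \<phi> = face_integral F (nF F) \<psi>"
    if c: "continuous_on F \<phi>" and e: "\<And>x. x \<in> F \<Longrightarrow> \<phi> x = \<psi> x"
  proof -
    have "continuous_on F \<psi>" using c e by (metis continuous_on_cong)
    then show ?thesis using ff(3)[OF c e] fn c by metis
  qed
  show "\<psi> x = 0" if "continuous_on F \<psi>" "\<And>x. x \<in> F \<Longrightarrow> 0 \<le> \<psi> x" "face_integral F (nF F) \<psi> = 0" "x \<in> F"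
    using ff(4)[OF that(1,2) _ that(4)] that(3) fn[OF that(1)] by simp
  show "0 < face_integral F (nF F) (\<lambda>x. 1)" using ff(5) by (simp add: fn)
  show "0 \<le> face_integral F (nF F) \<psi>" if "continuous_on F \<psi>" "\<And>x. x \<in> F \<Longrightarrow> 0 \<le> \<psi> x"
    using ff(6)[OF that] fn[OF that(1)] by simp
qed

text \<open>The two outward normals at an interior face are opposite, which turns the two element
  contributions into one jump with respect to \<open>nF F\<close>.\<close>

lemma element_ibp_sum:
  assumes P: "\<And>T. T \<in> Th \<Longrightarrow> P T \<in> Pol k UNIV" and \<phi>: "C1 \<phi>"
  shows "(\<Sum>T\<in>Th. LINT x|lebesgue_on T. \<phi> x * divg (P T) x) + (\<Sum>T\<in>Th. LINT x|lebesgue_on T. grad \<phi> x \<bullet> P T x) =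
    (\<Sum>F\<in>interior_faces \<Omega> Th. face_integral F (nF F) (\<lambda>x. \<phi> x * (nF F \<bullet> (P (posT F) x - P (negT F) x)))) +
    (\<Sum>F\<in>boundary_faces \<Omega> Th. \<Sum>T | T \<in> Th \<and> F facet_of T. face_integral F (nF F) (\<lambda>x. \<phi> x * (nF F \<bullet> P T x)))"
proof -
  let ?\<Phi> = "\<lambda>T F. face_integral F (outward_normal T F) (\<lambda>x. \<phi> x * (outward_normal T F \<bullet> P T x))"
  have c: "continuous_on S (\<lambda>x. \<phi> x * (n \<bullet> P T x))" if "T \<in> Th" for S n T
    by (intro continuous_intros C1_continuous[OF \<phi>] Pol_continuous[OF P[OF that]])
  have "(\<Sum>T\<in>Th. LINT x|lebesgue_on T. \<phi> x * divg (P T) x) + (\<Sum>T\<in>Th. LINT x|lebesgue_on T. grad \<phi> x \<bullet> P T x) =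
      (\<Sum>T\<in>Th. \<Sum>F | F facet_of T. ?\<Phi> T F)"
    unfolding sum.distrib[symmetric] by (intro sum.cong refl) (rule element_ibp[OF _ P \<phi>])
  also have "\<dots> = (\<Sum>F\<in>interior_faces \<Omega> Th. ?\<Phi> (posT F) F + ?\<Phi> (negT F) F) +
      (\<Sum>F\<in>boundary_faces \<Omega> Th. \<Sum>T | T \<in> Th \<and> F facet_of T. ?\<Phi> T F)"
    by (rule sum_over_facets)
  also have "(\<Sum>F\<in>interior_faces \<Omega> Th. ?\<Phi> (posT F) F + ?\<Phi> (negT F) F) =
      (\<Sum>F\<in>interior_faces \<Omega> Th. face_integral F (nF F) (\<lambda>x. \<phi> x * (nF F \<bullet> (P (posT F) x - P (negT F) x))))"
  proof (intro sum.cong refl)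
    fix F assume F: "F \<in> interior_faces \<Omega> Th"
    note pm = plus_minus[OF F] and ff = face_functional[OF interior_face_mesh[OF F]]
    have "?\<Phi> (negT F) F = face_integral F (nF F) (\<lambda>x. - 1 * (\<phi> x * (nF F \<bullet> P (negT F) x)))"
      using face_integral_nF[OF pm(4,5) c[OF pm(4)], of "outward_normal (negT F) F"] by (simp add: pm(6))
    moreover have "?\<Phi> (posT F) F = face_integral F (nF F) (\<lambda>x. \<phi> x * (nF F \<bullet> P (posT F) x))"
      by (simp add: pm(3))
    ultimately have "?\<Phi> (posT F) F + ?\<Phi> (negT F) F =
        face_integral F (nF F) (\<lambda>x. \<phi> x * (nF F \<bullet> P (posT F) x) + - 1 * (\<phi> x * (nF F \<bullet> P (negT F) x)))"
      using ff(1)[OF c[OF pm(1), of F "nF F"] continuous_on_mult_left[OF c[OF pm(4), of F "nF F"], of "-1"]] by simp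
    then show "?\<Phi> (posT F) F + ?\<Phi> (negT F) F = face_integral F (nF F) (\<lambda>x. \<phi> x * (nF F \<bullet> (P (posT F) x - P (negT F) x)))"
      by (simp add: inner_diff_right right_diff_distrib)
  qed
  also have "(\<Sum>F\<in>boundary_faces \<Omega> Th. \<Sum>T | T \<in> Th \<and> F facet_of T. ?\<Phi> T F) =
      (\<Sum>F\<in>boundary_faces \<Omega> Th. \<Sum>T | T \<in> Th \<and> F facet_of T. face_integral F (nF F) (\<lambda>x. \<phi> x * (nF F \<bullet> P T x)))"
    by (intro sum.cong refl) (simp add: nF_boundary[symmetric])
  finally show ?thesis .
qed

section \<open>Normal continuity of fields in H(div)\<close>

lemma interior_face_isolated:
  assumes F: "F \<in> interior_faces \<Omega> Th" and x: "x \<in> rel_interior F" and G: "G \<in> mesh_faces Th" "x \<in> G"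
  shows "G = F"
proof -
  obtain S where S: "S \<in> Th" "G facet_of S" by (rule mesh_faceE[OF G(1)])
  note pm = plus_minus[OF F]
  have "x \<in> S" using facet_subset_elem[OF S(2)] G(2) by blast
  then have FS: "F facet_of S"
    using shared_facet(1)[OF pm(1,2) x S(1)] pm(2) by (cases "S = posT F") auto
  interpret V: vertices "verts S" by (rule verts[OF S(1)])
  obtain a where a: "a \<in> verts S" "F = V.facet a" by (rule facetE[OF S(1) FS])
  obtain b where b: "b \<in> verts S" "G = V.facet b" by (rule facetE[OF S])
  \<comment> \<open>At a relative interior point of the facet opposite \<open>a\<close> only the
    coordinate of \<open>a\<close> vanishes, so a second facet through the point has the same
    opposite vertex.\<close>
  have "V.bl b x = 0" using G(2) V.bl_facet_convex[OF b(1)] unfolding b(2) by blast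
  moreover have "\<forall>c\<in>verts S - {a}. 0 < V.bl c x" using x V.in_rel_interior_facet[OF a(1)] unfolding a(2) by blast
  ultimately have "b = a" using b(1) by force
  then show ?thesis using a b by simp
qed

lemma lmeasurable_domain: "\<Omega> \<in> lmeasurable"
  using lmeasurable_open[OF bounded_domain open_domain] .

lemma glue_trunc_interior:
  assumes "T \<in> Th" "x \<in> interior T" "\<And>S. S \<in> Th \<Longrightarrow> v S = trunc S (P S)"
  shows "glue Th v x = (P T x :: 'v::comm_monoid_add)"
proof -
  have "glue Th v x = v T x" by (rule glue_interior[OF assms(1,2)]) (simp add: assms(3))
  then show ?thesis using assms interior_subset by (metis subsetD trunc_in)
qed

lemma glue_L2:
  fixes P :: "(real^'n) set \<Rightarrow> real^'n \<Rightarrow> 'v::euclidean_space"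
  assumes P: "\<And>T. T \<in> Th \<Longrightarrow> continuous_on UNIV (P T)" and v: "\<And>T. T \<in> Th \<Longrightarrow> v T = trunc T (P T)"
  shows "glue Th v \<in> L2 \<Omega>"
proof -
  have "glue Th v = (\<lambda>x. \<Sum>T\<in>Th. indicator T x *\<^sub>R P T x)"
    unfolding glue_def by (intro ext sum.cong refl) (simp add: v trunc_def indicator_def)
  moreover have "(\<lambda>x. \<Sum>T\<in>Th. indicator T x *\<^sub>R P T x) \<in> borel_measurable borel"
    using P compact_elem by (intro borel_measurable_sum borel_measurable_continuous_on_indicator)
      (auto intro: borel_compact continuous_on_subset)
  ultimately have m: "glue Th v \<in> borel_measurable borel" by simp
  have "integrable (lebesgue_on \<Omega>) (\<lambda>x. (norm (glue Th v x))\<^sup>2)"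
  proof (rule mesh_integral(1))
    show "continuous_on T (\<lambda>x. (norm (P T x))\<^sup>2)" if "T \<in> Th" for T
      by (intro continuous_intros continuous_on_subset[OF P[OF that]]) auto
    show "(norm (glue Th v x))\<^sup>2 = (norm (P T x))\<^sup>2" if "T \<in> Th" "x \<in> interior T" for T x
      using glue_trunc_interior[where P = P and v = v, OF that v] by simp
  qed
  moreover have "glue Th v \<in> borel_measurable (lebesgue_on \<Omega>)"
    using measurable_lborel1 by (intro measurable_restrict_space1 measurable_completion) (simp add: m)
  ultimately show ?thesis by (simp add: L2_def)
qed

lemma test_function_C1: "\<phi> \<in> test_functions \<Omega> \<Longrightarrow> C1 \<phi>"
  by (simp add: test_functions_def C_infinity_C1)

lemma test_function_boundary:
  assumes "\<phi> \<in> test_functions \<Omega>" "F \<in> boundary_faces \<Omega> Th" "x \<in> F"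
  shows "\<phi> x = 0"
proof (rule ccontr)
  assume "\<phi> x \<noteq> 0"
  then have "x \<in> \<Omega>" using assms(1) closure_subset by (fastforce simp: test_functions_def)
  then show False using assms(2,3) frontier_disjoint by (auto simp: boundary_faces_def)
qed

text \<open>The distributional divergence of a piecewise polynomial consists of the elementwise
  divergence and of the normal jumps on interior faces; boundary faces drop out because test
  functions vanish there.\<close>

lemma ip_glue_grad:
  assumes P: "\<And>T. T \<in> Th \<Longrightarrow> P T \<in> Pol k UNIV" and v: "\<And>T. T \<in> Th \<Longrightarrow> v T = trunc T (P T)"
    and \<phi>: "\<phi> \<in> test_functions \<Omega>"
  shows "ip \<Omega> (glue Th v) (grad \<phi>) = - (\<Sum>T\<in>Th. LINT x|lebesgue_on T. \<phi> x * divg (P T) x) +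
    (\<Sum>F\<in>interior_faces \<Omega> Th. face_integral F (nF F) (\<lambda>x. \<phi> x * (nF F \<bullet> (P (posT F) x - P (negT F) x))))"
proof -
  note C = test_function_C1[OF \<phi>]
  have "ip \<Omega> (glue Th v) (grad \<phi>) = (\<Sum>T\<in>Th. LINT x|lebesgue_on T. grad \<phi> x \<bullet> P T x)"
    unfolding ip_def
  proof (rule mesh_integral(2))
    show "continuous_on T (\<lambda>x. grad \<phi> x \<bullet> P T x)" if "T \<in> Th" for T
      by (intro continuous_intros C1_grad_continuous[OF C] Pol_continuous[OF P[OF that]])
    show "glue Th v x \<bullet> grad \<phi> x = grad \<phi> x \<bullet> P T x" if "T \<in> Th" "x \<in> interior T" for T x
      using glue_trunc_interior[where P = P and v = v, OF that v] by (simp add: inner_commute)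
  qed
  moreover have "(\<Sum>F\<in>boundary_faces \<Omega> Th. \<Sum>T | T \<in> Th \<and> F facet_of T. face_integral F (nF F) (\<lambda>x. \<phi> x * (nF F \<bullet> P T x))) = 0"
  proof (intro sum.neutral ballI)
    fix F T assume F: "F \<in> boundary_faces \<Omega> Th" and T: "T \<in> {T. T \<in> Th \<and> F facet_of T}"
    then have m: "F \<in> mesh_faces Th" using mesh_facesI by blast
    have "face_integral F (nF F) (\<lambda>x. \<phi> x * (nF F \<bullet> P T x)) = face_integral F (nF F) (\<lambda>x. 0 * 1)"
      using T by (intro face_functional(3)[OF m] continuous_intros C1_continuous[OF C] Pol_continuous[OF P])
        (auto simp: test_function_boundary[OF \<phi> F])
    also have "\<dots> = 0" by (subst face_functional(2)[OF m]) auto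
    finally show "face_integral F (nF F) (\<lambda>x. \<phi> x * (nF F \<bullet> P T x)) = 0" .
  qed
  ultimately show ?thesis using element_ibp_sum[where P = P, OF P C] by simp
qed

lemma H_divI:
  assumes P: "\<And>T. T \<in> Th \<Longrightarrow> P T \<in> Pol k UNIV" and v: "\<And>T. T \<in> Th \<Longrightarrow> v T = trunc T (P T)"
    and cont: "\<And>F x. F \<in> interior_faces \<Omega> Th \<Longrightarrow> x \<in> F \<Longrightarrow> nF F \<bullet> (P (posT F) x - P (negT F) x) = 0"
  shows "glue Th v \<in> H_div \<Omega>"
proof -
  define d where "d T = trunc T (divg (P T))" for T
  have "ip \<Omega> (glue Th v) (grad \<phi>) = - ip \<Omega> (glue Th d) \<phi>" if \<phi>: "\<phi> \<in> test_functions \<Omega>" for \<phi>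
  proof -
    note C = test_function_C1[OF \<phi>]
    have "ip \<Omega> (glue Th d) \<phi> = (\<Sum>T\<in>Th. LINT x|lebesgue_on T. \<phi> x * divg (P T) x)"
      unfolding ip_def
    proof (rule mesh_integral(2))
      show "continuous_on T (\<lambda>x. \<phi> x * divg (P T) x)" if "T \<in> Th" for T
        by (intro continuous_intros C1_continuous[OF C] Pol_continuous[OF divg_Pol[OF P[OF that]]])
      show "glue Th d x \<bullet> \<phi> x = \<phi> x * divg (P T) x" if "T \<in> Th" "x \<in> interior T" for T x
        using glue_trunc_interior[OF that, of d "\<lambda>T. divg (P T)"] by (simp add: d_def)
    qed
    moreover have "face_integral F (nF F) (\<lambda>x. \<phi> x * (nF F \<bullet> (P (posT F) x - P (negT F) x))) = 0"
      if F: "F \<in> interior_faces \<Omega> Th" for F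
    proof -
      note m = interior_face_mesh[OF F] and pm = plus_minus[OF F]
      have "face_integral F (nF F) (\<lambda>x. \<phi> x * (nF F \<bullet> (P (posT F) x - P (negT F) x))) = face_integral F (nF F) (\<lambda>x. 0 * 1)"
        by (intro face_functional(3)[OF m] continuous_intros C1_continuous[OF C] Pol_continuous[OF P] pm)
          (simp add: cont[OF F])
      also have "\<dots> = 0" by (subst face_functional(2)[OF m]) auto
      finally show ?thesis .
    qed
    ultimately show ?thesis using ip_glue_grad[where P = P and v = v, OF P v \<phi>] by simp
  qed
  moreover have "glue Th v \<in> L2 \<Omega>" using v by (intro glue_L2[of P]) (auto intro: Pol_continuous[OF P])
  moreover have "glue Th d \<in> L2 \<Omega>"
    by (intro glue_L2[of "\<lambda>T. divg (P T)"]) (auto simp: d_def intro: Pol_continuous[OF divg_Pol[OF P]])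
  ultimately show ?thesis unfolding H_div_def by blast
qed

text \<open>The bumps are bounded by 1 and eventually 0 off the hyperplane through \<open>x0\<close>
  orthogonal to \<open>n\<close>, which is null.\<close>

lemma bump_integral_limit:
  assumes g: "integrable (lebesgue_on D) g" and D: "D \<in> sets lebesgue" and n: "n \<noteq> 0"
  shows "(\<lambda>M. LINT x|lebesgue_on D. g x * bump x0 r n (real M) x) \<longlonglongrightarrow> 0"
proof -
  have bm: "bump x0 r n (real M) \<in> borel_measurable (lebesgue_on D)" for M
  proof -
    have "continuous_on UNIV (flat 0)"
      using flat_derivative[of 0] by (intro continuous_at_imp_continuous_on ballI DERIV_isCont) auto
    then have "continuous_on UNIV (bump x0 r n (real M))"
      unfolding bump_def by (rule continuous_on_compose2) (auto intro!: continuous_intros)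
    then have "bump x0 r n (real M) \<in> borel_measurable borel" by (rule borel_measurable_continuous_onI)
    then show ?thesis
      using measurable_lborel1 by (intro measurable_restrict_space1 measurable_completion) simp
  qed
  have "(\<lambda>M. LINT x|lebesgue_on D. g x * bump x0 r n (real M) x) \<longlonglongrightarrow> (LINT x|lebesgue_on D. 0)"
  proof (rule integral_dominated_convergence[where w = "\<lambda>x. \<bar>g x\<bar>"])
    show "(\<lambda>x. g x * bump x0 r n (real M) x) \<in> borel_measurable (lebesgue_on D)" for M
      using g bm by measurable
    show "integrable (lebesgue_on D) (\<lambda>x. \<bar>g x\<bar>)" using g by simp
    have "AE x in lborel. n \<bullet> x \<noteq> n \<bullet> x0" using n by (intro AE_hyperplane) simp
    then have "AE x in lebesgue. n \<bullet> x \<noteq> n \<bullet> x0" by (rule AE_completion)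
    then have "AE x in lebesgue. x \<in> D \<longrightarrow> n \<bullet> x \<noteq> n \<bullet> x0" by (rule eventually_mono) simp
    then have "AE x in lebesgue_on D. n \<bullet> x \<noteq> n \<bullet> x0" using D by (simp add: AE_restrict_space_iff)
    then show "AE x in lebesgue_on D. (\<lambda>M. g x * bump x0 r n (real M) x) \<longlonglongrightarrow> 0"
    proof (rule eventually_mono)
      fix x assume "n \<bullet> x \<noteq> n \<bullet> x0"
      then have "(\<lambda>M. bump x0 r n (real M) x) \<longlonglongrightarrow> 0" by (intro bump_limit) (simp add: inner_diff_right)
      from tendsto_mult_left[OF this, of "g x"] show "(\<lambda>M. g x * bump x0 r n (real M) x) \<longlonglongrightarrow> 0" by simp
    qed
    show "AE x in lebesgue_on D. norm (g x * bump x0 r n (real M) x) \<le> \<bar>g x\<bar>" for M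
      using bump_bounds[of x0 r n "real M"] by (intro AE_I2) (simp add: abs_mult mult_left_le)
  qed simp
  then show ?thesis by simp
qed

text \<open>A nonzero jump at a relative interior point \<open>x0\<close> is tested with bumps that
  become thin across the face. The face term is the same for all of them, while all volume integrals
  tend to 0; hence the face term is 0, contrary to the constant sign of the jump near
  \<open>x0\<close>.\<close>

lemma H_divD:
  assumes P: "\<And>T. T \<in> Th \<Longrightarrow> P T \<in> Pol k UNIV" and v: "\<And>T. T \<in> Th \<Longrightarrow> v T = trunc T (P T)"
    and H: "glue Th v \<in> H_div \<Omega>" and F: "F \<in> interior_faces \<Omega> Th" and x: "x \<in> F"
  shows "nF F \<bullet> (P (posT F) x - P (negT F) x) = 0"
proof -
  note m = interior_face_mesh[OF F] and pm = plus_minus[OF F]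
  define j where "j y = nF F \<bullet> (P (posT F) y - P (negT F) y)" for y
  have cj: "continuous_on S j" for S
    unfolding j_def by (intro continuous_intros Pol_continuous[OF P] pm)
  obtain g where g: "g \<in> L2 \<Omega>" "\<And>\<phi>. \<phi> \<in> test_functions \<Omega> \<Longrightarrow> ip \<Omega> (glue Th v) (grad \<phi>) = - ip \<Omega> g \<phi>"
    using H unfolding H_div_def by blast
  have gi: "integrable (lebesgue_on \<Omega>) g"
  proof -
    interpret finite_measure "lebesgue_on \<Omega>" by (rule finite_measure_lebesgue_on[OF lmeasurable_domain])
    \<comment> \<open>On a domain of finite measure an \<open>L2\<close> function is integrable, by
      comparison with \<open>1 + (norm (g x))\<^sup>2\<close>.\<close>
    have a1: "integrable (lebesgue_on \<Omega>) (\<lambda>x. 1 + (norm (g x))\<^sup>2)"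
      using g(1) by (simp add: L2_def)
    have a2: "norm (g x) \<le> norm (1 + (norm (g x))\<^sup>2)" for x
    proof -
      have "0 \<le> (norm (g x) - 1)\<^sup>2" by (rule zero_le_power2)
      also have "\<dots> = 1 + (norm (g x))\<^sup>2 - 2 * norm (g x)" by (simp add: power2_eq_square algebra_simps)
      finally have "norm (g x) \<le> 1 + (norm (g x))\<^sup>2" using norm_ge_zero[of "g x"] by linarith
      then show ?thesis unfolding real_norm_def by linarith
    qed
    have a3: "g \<in> borel_measurable (lebesgue_on \<Omega>)" using g(1) by (simp add: L2_def)
    show ?thesis by (rule Bochner_Integration.integrable_bound[OF a1 a3 AE_I2[OF a2]])
  qed
  have zero: "j x0 = 0" if x0: "x0 \<in> rel_interior F" for x0
  proof (rule ccontr)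
    assume j0: "j x0 \<noteq> 0"
    have x0F: "x0 \<in> F" using x0 rel_interior_subset by blast
    have "open {y. 0 < j x0 * j y}"
      by (intro open_Collect_less continuous_intros cj)
    moreover have "x0 \<in> {y. 0 < j x0 * j y}" using j0 by (auto simp: zero_less_mult_iff)
    moreover have "closed (\<Union>(mesh_faces Th - {F}))"
      using finite_mesh_faces compact_facet by (intro closed_Union) (auto simp: mesh_faces_def intro: compact_imp_closed)
    moreover have "x0 \<notin> \<Union>(mesh_faces Th - {F})" using interior_face_isolated[OF F x0] by blast
    moreover have "x0 \<in> \<Omega>" using pm(9) x0 by blast
    ultimately have "open ({y. 0 < j x0 * j y} \<inter> \<Omega> \<inter> - \<Union>(mesh_faces Th - {F}))"
      "x0 \<in> {y. 0 < j x0 * j y} \<inter> \<Omega> \<inter> - \<Union>(mesh_faces Th - {F})"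
      using open_domain by (auto intro!: open_Int)
    \<comment> \<open>The ball lies in \<open>\<Omega>\<close>, touches no other face, and on it the
      jump has the sign of \<open>j x0\<close>.\<close>
    then obtain r where r: "0 < r" "cball x0 r \<subseteq> {y. 0 < j x0 * j y} \<inter> \<Omega> \<inter> - \<Union>(mesh_faces Th - {F})"
      using open_contains_cball by blast
    let ?b = "\<lambda>M::nat. bump x0 r (nF F) (real M)"
    have test: "?b M \<in> test_functions \<Omega>" for M using r by (intro bump_test_function) auto
    have bC: "continuous_on S (?b M)" for S M by (rule C1_continuous[OF test_function_C1[OF test]])
    have outside: "?b M y = 0" if "y \<notin> {y. 0 < j x0 * j y} \<inter> \<Omega> \<inter> - \<Union>(mesh_faces Th - {F})" for y M
    proof -
      have "y \<notin> cball x0 r" using that r(2) by blast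
      then show ?thesis using r(1) by (intro bump_outside) auto
    qed
    define J where "J = face_integral F (nF F) (\<lambda>y. ?b 0 y * j y)"
    \<comment> \<open>The left side does not depend on \<open>M\<close>: on \<open>F\<close> itself,
      which lies in the hyperplane through \<open>x0\<close> orthogonal to \<open>nF F\<close>, all
      bumps agree, and on the other faces they vanish.\<close>
    have J: "J = (\<Sum>T\<in>Th. LINT x|lebesgue_on T. divg (P T) x * ?b M x) - (LINT x|lebesgue_on \<Omega>. g x * ?b M x)" for M
    proof -
      have "face_integral G (nF G) (\<lambda>x. ?b M x * (nF G \<bullet> (P (posT G) x - P (negT G) x))) = (if G = F then J else 0)"
        if G: "G \<in> interior_faces \<Omega> Th" for G
      proof (cases "G = F")
        case True
        have "nF F \<bullet> (y - x0) = 0" if "y \<in> F" for y using nF_perp[OF m x0F that] .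
        then have "?b M y = ?b 0 y" if "y \<in> F" for y
          using bump_on_plane[of "nF F" y x0 r "real M"] that by simp
        then show ?thesis
          unfolding True J_def j_def by (simp, intro face_functional(3)[OF m] continuous_intros bC Pol_continuous[OF P] pm) simp
      next
        case False
        note mG = interior_face_mesh[OF G] and pmG = plus_minus[OF G]
        have "face_integral G (nF G) (\<lambda>x. ?b M x * (nF G \<bullet> (P (posT G) x - P (negT G) x))) = face_integral G (nF G) (\<lambda>x. 0 * 1)"
        proof (intro face_functional(3)[OF mG] continuous_intros bC Pol_continuous[OF P] pmG)
          fix y assume "y \<in> G"
          then have "?b M y = 0" using False mG by (intro outside) blast
          then show "?b M y * (nF G \<bullet> (P (posT G) y - P (negT G) y)) = 0 * 1" by simp
        qed
        also have "\<dots> = 0" by (subst face_functional(2)[OF mG]) auto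
        finally show ?thesis using False by simp
      qed
      then have "(\<Sum>G\<in>interior_faces \<Omega> Th. face_integral G (nF G) (\<lambda>x. ?b M x * (nF G \<bullet> (P (posT G) x - P (negT G) x)))) = J"
        using F finite_interior_faces by simp
      then show ?thesis
        using ip_glue_grad[where P = P and v = v, OF P v test[of M]] g(2)[OF test[of M]] by (simp add: ip_def mult.commute)
    qed
    have n0: "nF F \<noteq> 0" using nF_unit[OF m] by auto
    have "(\<lambda>M. (\<Sum>T\<in>Th. LINT x|lebesgue_on T. divg (P T) x * ?b M x) - (LINT x|lebesgue_on \<Omega>. g x * ?b M x))
        \<longlonglongrightarrow> (\<Sum>T\<in>Th. 0) - 0"
    proof (intro tendsto_diff tendsto_sum bump_integral_limit gi n0)
      show "\<Omega> \<in> sets lebesgue" using open_domain by auto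
      fix T assume T: "T \<in> Th"
      show "T \<in> sets lebesgue" using borel_compact[OF compact_elem[OF T]] by auto
      show "integrable (lebesgue_on T) (divg (P T))"
        by (rule LINT_compact(3)[OF compact_elem[OF T] Pol_continuous[OF divg_Pol[OF P[OF T]]]])
    qed
    then have "(\<lambda>M::nat. J) \<longlonglongrightarrow> 0" unfolding J[symmetric] by simp
    then have J0: "J = 0" using LIMSEQ_const_iff by blast
    \<comment> \<open>The additional factor \<open>j x0\<close> makes the integrand nonnegative on
      \<open>F\<close>, so that its zero integral forces it to vanish at \<open>x0\<close>.\<close>
    have "?b 0 x0 * j x0 * j x0 = 0"
    proof (rule face_functional(4)[OF m, of "\<lambda>y. ?b 0 y * j y * j x0"])
      show "continuous_on F (\<lambda>y. ?b 0 y * j y * j x0)" by (intro continuous_intros bC cj)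
      show "0 \<le> ?b 0 y * j y * j x0" if "y \<in> F" for y
      proof (cases "y \<in> {y. 0 < j x0 * j y} \<inter> \<Omega> \<inter> - \<Union>(mesh_faces Th - {F})")
        case True
        then have "0 \<le> j x0 * j y" by simp
        then have "0 \<le> ?b 0 y * (j x0 * j y)" by (rule mult_nonneg_nonneg[OF bump_bounds(1)])
        then show ?thesis by (simp add: mult_ac)
      next
        case False
        then show ?thesis using outside[of y 0] by simp
      qed
      have "face_integral F (nF F) (\<lambda>y. j x0 * (?b 0 y * j y)) = j x0 * J"
        unfolding J_def by (rule face_functional(2)[OF m]) (intro continuous_intros bC cj)
      then show "face_integral F (nF F) (\<lambda>y. ?b 0 y * j y * j x0) = 0" by (simp add: J0 mult_ac)
    qed (rule x0F)
    then show False using j0 bump_center[OF r(1), of x0 "nF F" "real 0"] by simp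
  qed
  have "x \<in> closure (rel_interior F)"
    using convex_closure_rel_interior[OF convex_facet[OF pm(1,2)]] x closure_subset by blast
  then have "j x = 0"
    using continuous_constant_on_closure[of "rel_interior F" j 0 x] cj zero by auto
  then show ?thesis by (simp add: j_def)
qed

end

section \<open>The weak deviatoric gradient\<close>

lemma continuous_on_trunc: "continuous_on T p \<Longrightarrow> continuous_on T (trunc T p)"
  by (rule continuous_on_eq) auto

lemma trunc_add: "trunc D p + trunc D q = trunc D (\<lambda>x. p x + (q x :: 'v::real_vector))"
  by (simp add: fun_eq_iff trunc_def)

lemma trunc_scale: "r *\<^sub>R trunc D p = trunc D (\<lambda>x. r *\<^sub>R (p x :: 'v::real_vector))"
  by (simp add: fun_eq_iff trunc_def)

lemma P_spaceE:
  assumes "\<tau> \<in> P_space k T W" "subspace W"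
  obtains t where "t \<in> Pol k W" "\<tau> = trunc T t"
  using assms by (auto simp: P_space_eq)

lemma subspace_P_space: "subspace W \<Longrightarrow> subspace (P_space k T W)"
  unfolding P_space_eq by (intro linear_subspace_image linear_trunc subspace_Pol)

lemma findim_P_space:
  fixes W :: "'v::euclidean_space set"
  assumes "subspace W"
  shows "findim (P_space k (T :: (real^'n) set) W)"
proof -
  have "findim (trunc T ` Pol k (UNIV :: 'v set))"
    by (intro findim_linear_image linear_trunc findim_Pol)
  then show ?thesis
    by (rule findim_subset) (use Pol_mono[of k k W UNIV] in \<open>auto simp: P_space_eq[OF assms]\<close>)
qed

lemma P_space_continuous:
  fixes W :: "'v::euclidean_space set"
  assumes "\<tau> \<in> P_space k T W" "subspace W"
  shows "continuous_on T \<tau>"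
  using assms by (metis P_spaceE continuous_on_trunc Pol_continuous)

lemma subspace_family_space:
  "(\<And>i. i \<in> I \<Longrightarrow> subspace (S i)) \<Longrightarrow> subspace (family_space I S)"
  unfolding subspace_def family_space_def by (auto simp: zero_fun_def plus_fun_def scaleR_fun_def)

lemma findim_family_space:
  fixes S :: "'i \<Rightarrow> ('a \<Rightarrow> 'v::real_vector) set"
  assumes "finite I" "\<And>i. i \<in> I \<Longrightarrow> findim (S i)"
  shows "findim (family_space I S)"
proof -
  let ?e = "\<lambda>i (x :: 'a \<Rightarrow> 'v) j. if j = i then x else 0"
  have lin: "linear (?e i)" for i by (intro linearI) (auto simp: fun_eq_iff)
  have "findim {\<Sum>i\<in>I. x i |x. \<forall>i\<in>I. x i \<in> ?e i ` S i}"
    by (intro findim_finite_sum findim_linear_image assms lin)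
  then show ?thesis
  proof (rule findim_subset, intro subsetI)
    fix v assume v: "v \<in> family_space I S"
    have "v = (\<Sum>i\<in>I. ?e i (v i))"
    proof
      fix j
      have "(\<Sum>i\<in>I. ?e i (v i)) j = (\<Sum>i\<in>I. if j = i then v i else 0)" by (simp add: sum_fun_apply)
      also have "\<dots> = (if j \<in> I then v j else 0)" using assms(1) by simp
      also have "\<dots> = v j" using v by (auto simp: family_space_def zero_fun_def)
      finally show "v j = (\<Sum>i\<in>I. ?e i (v i)) j" ..
    qed
    moreover have "\<forall>i\<in>I. ?e i (v i) \<in> ?e i ` S i" using v by (auto simp: family_space_def)
    ultimately show "v \<in> {\<Sum>i\<in>I. x i |x. \<forall>i\<in>I. x i \<in> ?e i ` S i}"
      unfolding mem_Collect_eq by (intro exI[of _ "\<lambda>i. ?e i (v i)"] conjI)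
  qed
qed

lemma subspace_traceless: "subspace (traceless :: (real^'n^'n) set)"
  by (auto simp: subspace_def traceless_def trace_def sum.distrib sum_distrib_left[symmetric])

lemma tangential_add: "tangential n (v + w) = tangential n v + tangential n w"
  and tangential_scale: "tangential n (r *\<^sub>R v) = r *\<^sub>R tangential n v"
  and tangential_diff: "tangential n (v - w) = tangential n v - tangential n w"
  and tangential_minus_normal: "tangential (- n) v = tangential n v"
  by (simp_all add: tangential_def algebra_simps)

lemma matrix_vector_scaleR: "(r *\<^sub>R A) *v x = r *\<^sub>R (A *v (x :: real^'n))"
  by (simp add: matrix_vector_mult_def vec_eq_iff sum_distrib_left mult.assoc)

lemma matrix_vector_minus: "A *v (- x) = - (A *v (x :: real^'n))"
  by (simp add: matrix_vector_mult_def vec_eq_iff sum_negf)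

lemma continuous_on_matrix_vector:
  "continuous_on S f \<Longrightarrow> continuous_on S (\<lambda>x. f x *v (n :: real^'n))"
  unfolding matrix_vector_mult_def by (intro continuous_on_vec_lambda continuous_intros continuous_on_component)

lemma continuous_on_tangential: "continuous_on S f \<Longrightarrow> continuous_on S (\<lambda>x. tangential n (f x))"
  unfolding tangential_def by (intro continuous_intros)

lemma row_div_Pol: "t \<in> Pol k UNIV \<Longrightarrow> row_div t \<in> Pol (k - 1) UNIV"
proof -
  assume t: "t \<in> Pol k UNIV"
  have "(\<lambda>x. \<Sum>i\<in>UNIV. (\<Sum>j\<in>UNIV. partial j t x $ i $ j) *\<^sub>R axis i 1) \<in> Pol (k - 1) UNIV"
  proof (intro Pol_sum)
    fix i
    have "(\<lambda>x. (\<Sum>j\<in>UNIV. partial j t x $ i $ j)) \<in> Pol (k - 1) UNIV"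
      by (intro Pol_sum Pol_nth Pol_partial t) auto
    then show "(\<lambda>x. (\<Sum>j\<in>UNIV. partial j t x $ i $ j) *\<^sub>R axis i 1) \<in> Pol (k - 1) UNIV"
      by (rule Pol_linear_image[where f = "\<lambda>r. r *\<^sub>R axis i 1" and V = UNIV, rotated 2])
        (auto intro!: linearI simp: scaleR_left_distrib)
  qed
  also have "(\<lambda>x. \<Sum>i\<in>UNIV. (\<Sum>j\<in>UNIV. partial j t x $ i $ j) *\<^sub>R axis i 1) = row_div t"
  proof
    fix x
    show "(\<Sum>i\<in>UNIV. (\<Sum>j\<in>UNIV. partial j t x $ i $ j) *\<^sub>R axis i 1) = row_div t x"
      using basis_expansion[of "row_div t x"] by (simp add: row_div_def scalar_mult_eq_scaleR)
  qed
  finally show ?thesis .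
qed

lemma row_div_add: "s differentiable (at x) \<Longrightarrow> t differentiable (at x) \<Longrightarrow>
    row_div (\<lambda>x. s x + t x) x = row_div s x + row_div t x"
  by (simp add: row_div_def vec_eq_iff partial_add sum.distrib)

lemma row_div_scale: "t differentiable (at x) \<Longrightarrow> row_div (\<lambda>x. r *\<^sub>R t x) x = r *\<^sub>R row_div t x"
  by (simp add: row_div_def vec_eq_iff partial_scaleR sum_distrib_left)

lemma divg_add: "s differentiable (at x) \<Longrightarrow> t differentiable (at x) \<Longrightarrow>
    divg (\<lambda>x. s x + t x) x = divg s x + divg t x"
  by (simp add: divg_def partial_add sum.distrib)

lemma divg_scale: "t differentiable (at x) \<Longrightarrow> divg (\<lambda>x. r *\<^sub>R t x) x = r * divg t x"
  by (simp add: divg_def partial_scaleR sum_distrib_left)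

text \<open>On the boundary of \<open>T\<close> the truncated field need not be differentiable and
  \<open>frechet_derivative\<close> gives no information, so derivatives are identified in the
  interior.\<close>

lemma partial_trunc:
  assumes "x \<in> interior T" "p differentiable (at x)"
  shows "partial j (trunc T p) x = partial j p x"
  by (rule partial_cong_open[OF open_interior assms(1) _ assms(2)]) (use interior_subset in \<open>auto simp: trunc_def\<close>)

lemma row_div_trunc: "x \<in> interior T \<Longrightarrow> t differentiable (at x) \<Longrightarrow> row_div (trunc T t) x = row_div t x"
  by (simp add: row_div_def partial_trunc)

lemma divg_trunc: "x \<in> interior T \<Longrightarrow> t differentiable (at x) \<Longrightarrow> divg (trunc T t) x = divg t x"
  by (simp add: divg_def partial_trunc)

lemma ip_add_left:
  fixes f g h :: "real^'n \<Rightarrow> 'v::euclidean_space"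
  assumes "compact T" "continuous_on T f" "continuous_on T g" "continuous_on T h"
  shows "ip T (f + g) h = ip T f h + ip T g h"
  unfolding ip_def plus_fun_apply inner_add_left
  by (rule Bochner_Integration.integral_add; rule LINT_compact(3)[OF assms(1)]) (intro continuous_intros assms)+

lemma ip_scale_left: "ip T (r *\<^sub>R f) h = r * ip T f h"
  by (simp add: ip_def)

lemma ip_commute: "ip T f h = ip T h f"
  by (simp add: ip_def inner_commute)

lemma ip_cong: "(\<And>x. x \<in> T \<Longrightarrow> f x = f' x) \<Longrightarrow> (\<And>x. x \<in> T \<Longrightarrow> g x = g' x) \<Longrightarrow> ip T f g = ip T f' g'"
  unfolding ip_def by (intro Bochner_Integration.integral_cong refl) simp

lemma ip_zero_left: "ip T (\<lambda>x. 0) g = 0" and ip_zero_right: "ip T g (\<lambda>x. 0) = 0"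
  by (simp_all add: ip_def)

context mesh
begin

text \<open>Element boundaries are null. This is how \<open>divg\<close> and \<open>row_div\<close>
  of truncated fields, known in the interior only, are replaced by those of the underlying
  polynomials inside an integral.\<close>

lemma ip_interior_cong:
  fixes f f' g g' :: "real^'n \<Rightarrow> 'v::euclidean_space"
  assumes "T \<in> Th" "continuous_on T f'" "continuous_on T g'"
    and "\<And>x. x \<in> interior T \<Longrightarrow> f x = f' x" "\<And>x. x \<in> interior T \<Longrightarrow> g x = g' x"
  shows "ip T f g = ip T f' g'"
proof -
  let ?h = "\<lambda>x. f' x \<bullet> g' x" and ?g = "\<lambda>x. f x \<bullet> g x"
  have "continuous_on T ?h" using assms(2,3) by (rule continuous_on_inner)
  note L = LINT_compact[OF compact_elem[OF assms(1)] this]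
  have si: "integrable lebesgue (\<lambda>x. indicator T x *\<^sub>R ?h x)"
    using L(2) by (simp add: integrable_completion borel_measurable_integrable)
  have ae: "AE x in lebesgue. indicator T x *\<^sub>R ?h x = indicator T x *\<^sub>R ?g x"
    using AE_mesh
  proof (rule eventually_mono)
    fix x assume x: "\<forall>T\<in>Th. x \<notin> frontier T"
    then have "x \<in> T \<Longrightarrow> x \<in> interior T"
      using assms(1) closure_subset by (fastforce simp: frontier_def)
    then show "indicator T x *\<^sub>R ?h x = indicator T x *\<^sub>R ?g x"
      using assms(4,5) by (cases "x \<in> T") auto
  qed
  have m: "(\<lambda>x. indicator T x *\<^sub>R ?g x) \<in> borel_measurable lebesgue"
    using borel_measurable_AE[OF borel_measurable_integrable[OF si] ae] .
  have O: "T \<inter> space lebesgue \<in> sets lebesgue" using borel_compact[OF compact_elem[OF assms(1)]] by auto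
  show ?thesis
    unfolding ip_def integral_restrict_space[OF O] using si m ae by (intro integral_cong_AE) auto
qed

lemma ip_self_eq_0:
  fixes f :: "real^'n \<Rightarrow> 'v::euclidean_space"
  assumes "T \<in> Th" "continuous_on T f" "ip T f f = 0" "x \<in> T"
  shows "f x = 0"
proof -
  have "f x \<bullet> f x = 0"
  proof (rule zero_integral_imp_zero[where f = "\<lambda>x. f x \<bullet> f x"])
    show "compact T" "convex T" "interior T \<noteq> {}" using compact_elem convex_elem interior_elem_nonempty assms(1) by auto
    show "continuous_on T (\<lambda>x. f x \<bullet> f x)" by (intro continuous_intros assms(2))
    show "(LINT x|lebesgue_on T. f x \<bullet> f x) = 0" using assms(3) by (simp add: ip_def)
  qed (use assms(4) in auto)
  then show ?thesis by simp
qed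

lemma ip_self_nonneg: "0 \<le> ip T f f"
  unfolding ip_def by (rule Bochner_Integration.integral_nonneg) simp

definition nint :: "(real^'n) set \<Rightarrow> (real^'n) set \<Rightarrow> (real^'n \<Rightarrow> real) \<Rightarrow> real" where
  "nint T F \<psi> = face_integral F (outward_normal T F) \<psi>"

definition normal_part :: "(real^'n) set \<Rightarrow> (real^'n) set \<Rightarrow> (real^'n \<Rightarrow> real^'n) \<Rightarrow> (real^'n \<Rightarrow> real^'n^'n) \<Rightarrow> real" where
  "normal_part T F w \<tau> = nint T F (\<lambda>x. (outward_normal T F \<bullet> w x) * (outward_normal T F \<bullet> (\<tau> x *v outward_normal T F)))"

definition tangential_part :: "(real^'n) set \<Rightarrow> (real^'n) set \<Rightarrow> (real^'n \<Rightarrow> real^'n) \<Rightarrow> (real^'n \<Rightarrow> real^'n^'n) \<Rightarrow> real" where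
  "tangential_part T F m \<tau> = nint T F (\<lambda>x. m x \<bullet> tangential (outward_normal T F) (\<tau> x *v outward_normal T F))"

text \<open>The functional on one element whose Riesz representative among the traceless polynomial
  matrices is the weak gradient.\<close>

definition rhs :: "((real^'n) set \<Rightarrow> real^'n \<Rightarrow> real^'n) \<Rightarrow> ((real^'n) set \<Rightarrow> real^'n \<Rightarrow> real^'n)
    \<Rightarrow> (real^'n) set \<Rightarrow> (real^'n \<Rightarrow> real^'n^'n) \<Rightarrow> real" where
  "rhs v \<mu> T \<tau> = - ip T (v T) (row_div \<tau>) + (\<Sum>F | F facet_of T. normal_part T F (v T) \<tau>)
    + (\<Sum>F | F facet_of T. tangential_part T F (\<mu> F) \<tau>)"

lemma dev_grad_w_eq:
  "dev_grad_w Th k v \<mu> = (THE \<sigma>. \<sigma> \<in> Sigma_disc Th k \<and>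
     (\<forall>T\<in>Th. \<forall>\<tau>\<in>P_space k T traceless. ip T (\<sigma> T) \<tau> = rhs v \<mu> T \<tau>))"
  unfolding dev_grad_w_def rhs_def normal_part_def tangential_part_def nint_def Let_def ..

text \<open>Continuity of the data makes the integrals in \<open>rhs\<close> additive, so that
  \<open>rhs\<close> is linear in the pair and in the test matrix.\<close>

definition admissible :: "((real^'n) set \<Rightarrow> real^'n \<Rightarrow> real^'n) \<Rightarrow> ((real^'n) set \<Rightarrow> real^'n \<Rightarrow> real^'n) \<Rightarrow> bool" where
  "admissible v \<mu> \<longleftrightarrow> (\<forall>T\<in>Th. continuous_on T (v T)) \<and> (\<forall>F. continuous_on F (\<mu> F))"

lemma ip_row_div:
  assumes "T \<in> Th" "continuous_on T w" "t \<in> Pol k W"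
  shows "ip T w (row_div (trunc T t)) = ip T w (row_div t)"
proof -
  have t: "t \<in> Pol k UNIV" using assms(3) Pol_mono[of k k W UNIV] by auto
  show ?thesis
    by (rule ip_interior_cong[OF assms(1,2) Pol_continuous[OF row_div_Pol[OF t]]])
      (auto intro!: row_div_trunc Pol_differentiable[OF t])
qed

lemma nint_linear:
  assumes "T \<in> Th" "F facet_of T"
  shows "continuous_on F \<phi> \<Longrightarrow> continuous_on F \<psi> \<Longrightarrow> nint T F (\<lambda>x. \<phi> x + \<psi> x) = nint T F \<phi> + nint T F \<psi>"
    and "continuous_on F \<psi> \<Longrightarrow> nint T F (\<lambda>x. c * \<psi> x) = c * nint T F \<psi>"
    and "continuous_on F \<phi> \<Longrightarrow> (\<And>x. x \<in> F \<Longrightarrow> \<phi> x = \<psi> x) \<Longrightarrow> nint T F \<phi> = nint T F \<psi>"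
  unfolding nint_def by (rule facet_functional[OF assms]; assumption)+

lemma face_parts_linear:
  assumes T: "T \<in> Th" "F facet_of T"
    and c: "continuous_on F w" "continuous_on F w'" "continuous_on F \<tau>" "continuous_on F \<upsilon>"
  shows "normal_part T F w (\<tau> + \<upsilon>) = normal_part T F w \<tau> + normal_part T F w \<upsilon>"
    and "normal_part T F w (r *\<^sub>R \<tau>) = r * normal_part T F w \<tau>"
    and "normal_part T F (w + w') \<tau> = normal_part T F w \<tau> + normal_part T F w' \<tau>"
    and "normal_part T F (r *\<^sub>R w) \<tau> = r * normal_part T F w \<tau>"
    and "tangential_part T F w (\<tau> + \<upsilon>) = tangential_part T F w \<tau> + tangential_part T F w \<upsilon>"
    and "tangential_part T F w (r *\<^sub>R \<tau>) = r * tangential_part T F w \<tau>"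
    and "tangential_part T F (w + w') \<tau> = tangential_part T F w \<tau> + tangential_part T F w' \<tau>"
    and "tangential_part T F (r *\<^sub>R w) \<tau> = r * tangential_part T F w \<tau>"
proof -
  let ?n = "outward_normal T F"
  have cn: "continuous_on F (\<lambda>x. (?n \<bullet> u x) * (?n \<bullet> (\<rho> x *v ?n)))" and
    ct: "continuous_on F (\<lambda>x. u x \<bullet> tangential ?n (\<rho> x *v ?n))"
    if "continuous_on F u" "continuous_on F \<rho>" for u \<rho>
    by (intro continuous_intros continuous_on_matrix_vector continuous_on_tangential that)+
  note add = nint_linear(1)[OF T] and scale = nint_linear(2)[OF T]
  note simps = matrix_vector_mult_add_rdistrib matrix_vector_scaleR inner_add_right inner_add_left
    tangential_add tangential_scale algebra_simps
  show "normal_part T F w (\<tau> + \<upsilon>) = normal_part T F w \<tau> + normal_part T F w \<upsilon>"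
    unfolding normal_part_def add[OF cn[OF c(1,3)] cn[OF c(1,4)], symmetric] by (simp add: simps)
  show "normal_part T F w (r *\<^sub>R \<tau>) = r * normal_part T F w \<tau>"
    unfolding normal_part_def scale[OF cn[OF c(1,3)], symmetric] by (simp add: simps)
  show "normal_part T F (w + w') \<tau> = normal_part T F w \<tau> + normal_part T F w' \<tau>"
    unfolding normal_part_def add[OF cn[OF c(1,3)] cn[OF c(2,3)], symmetric] by (simp add: simps)
  show "normal_part T F (r *\<^sub>R w) \<tau> = r * normal_part T F w \<tau>"
    unfolding normal_part_def scale[OF cn[OF c(1,3)], symmetric] by (simp add: simps)
  show "tangential_part T F w (\<tau> + \<upsilon>) = tangential_part T F w \<tau> + tangential_part T F w \<upsilon>"
    unfolding tangential_part_def add[OF ct[OF c(1,3)] ct[OF c(1,4)], symmetric] by (simp add: simps)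
  show "tangential_part T F w (r *\<^sub>R \<tau>) = r * tangential_part T F w \<tau>"
    unfolding tangential_part_def scale[OF ct[OF c(1,3)], symmetric] by (simp add: simps)
  show "tangential_part T F (w + w') \<tau> = tangential_part T F w \<tau> + tangential_part T F w' \<tau>"
    unfolding tangential_part_def add[OF ct[OF c(1,3)] ct[OF c(2,3)], symmetric] by (simp add: simps)
  show "tangential_part T F (r *\<^sub>R w) \<tau> = r * tangential_part T F w \<tau>"
    unfolding tangential_part_def scale[OF ct[OF c(1,3)], symmetric] by (simp add: simps)
qed

lemma rhs_right:
  assumes T: "T \<in> Th" and a: "admissible v \<mu>"
    and t: "\<tau> \<in> P_space k T traceless" "\<upsilon> \<in> P_space k T traceless"
  shows "rhs v \<mu> T (\<tau> + \<upsilon>) = rhs v \<mu> T \<tau> + rhs v \<mu> T \<upsilon>" "rhs v \<mu> T (r *\<^sub>R \<tau>) = r * rhs v \<mu> T \<tau>"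
proof -
  have cv: "continuous_on T (v T)" and cm: "continuous_on F (\<mu> F)" for F using a T by (auto simp: admissible_def)
  have cF: "continuous_on F \<tau>" "continuous_on F \<upsilon>" "continuous_on F (v T)" if "F facet_of T" for F
    using P_space_continuous[OF t(1) subspace_traceless] P_space_continuous[OF t(2) subspace_traceless]
      facet_subset_elem[OF that] cv continuous_on_subset by blast+
  obtain p where p: "p \<in> Pol k traceless" "\<tau> = trunc T p" by (rule P_spaceE[OF t(1) subspace_traceless])
  obtain q where q: "q \<in> Pol k traceless" "\<upsilon> = trunc T q" by (rule P_spaceE[OF t(2) subspace_traceless])
  have d: "p differentiable (at x)" "q differentiable (at x)" for x
    using p q Pol_differentiable by blast+
  have pu: "p \<in> Pol k UNIV" "q \<in> Pol k UNIV" using p q Pol_mono[of k k traceless UNIV] by auto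
  note rp = Pol_continuous[OF row_div_Pol[OF pu(1)]] and rq = Pol_continuous[OF row_div_Pol[OF pu(2)]]
  have i1: "ip T (v T) (row_div (\<tau> + \<upsilon>)) = ip T (v T) (row_div \<tau>) + ip T (v T) (row_div \<upsilon>)"
  proof -
    have "row_div (\<lambda>x. p x + q x) = row_div p + row_div q" by (rule ext) (simp add: row_div_add d)
    then show ?thesis
      unfolding p(2) q(2) trunc_add ip_row_div[OF T cv p(1)] ip_row_div[OF T cv q(1)] ip_row_div[OF T cv Pol_add[OF p(1) q(1)]]
      using ip_add_left[OF compact_elem[OF T] rp rq cv] by (simp add: ip_commute[of T "v T"])
  qed
  have i2: "ip T (v T) (row_div (r *\<^sub>R \<tau>)) = r * ip T (v T) (row_div \<tau>)"
  proof -
    have "row_div (\<lambda>x. r *\<^sub>R p x) = r *\<^sub>R row_div p" by (rule ext) (simp add: row_div_scale d)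
    then show ?thesis
      unfolding p(2) trunc_scale ip_row_div[OF T cv p(1)] ip_row_div[OF T cv Pol_scale[OF p(1)]]
      by (simp add: ip_commute[of T "v T"] ip_scale_left)
  qed
  note nl = face_parts_linear[OF T _ cF(3) cF(3) cF(1,2)] and tl = face_parts_linear[OF T _ cm cm cF(1,2)]
  have "(\<Sum>F | F facet_of T. normal_part T F (v T) (\<tau> + \<upsilon>)) = (\<Sum>F | F facet_of T. normal_part T F (v T) \<tau> + normal_part T F (v T) \<upsilon>)"
    "(\<Sum>F | F facet_of T. tangential_part T F (\<mu> F) (\<tau> + \<upsilon>)) = (\<Sum>F | F facet_of T. tangential_part T F (\<mu> F) \<tau> + tangential_part T F (\<mu> F) \<upsilon>)"
    "(\<Sum>F | F facet_of T. normal_part T F (v T) (r *\<^sub>R \<tau>)) = (\<Sum>F | F facet_of T. r * normal_part T F (v T) \<tau>)"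
    "(\<Sum>F | F facet_of T. tangential_part T F (\<mu> F) (r *\<^sub>R \<tau>)) = (\<Sum>F | F facet_of T. r * tangential_part T F (\<mu> F) \<tau>)"
    by (intro sum.cong refl nl(1,2) tl(5,6); simp)+
  note s = this
  show "rhs v \<mu> T (\<tau> + \<upsilon>) = rhs v \<mu> T \<tau> + rhs v \<mu> T \<upsilon>" "rhs v \<mu> T (r *\<^sub>R \<tau>) = r * rhs v \<mu> T \<tau>"
    unfolding rhs_def i1 i2 s by (simp_all add: sum.distrib sum_distrib_left[symmetric] algebra_simps)
qed

lemma rhs_left:
  assumes T: "T \<in> Th" and a: "admissible v \<mu>" "admissible w \<nu>" and t: "\<tau> \<in> P_space k T traceless"
  shows "rhs (v + w) (\<mu> + \<nu>) T \<tau> = rhs v \<mu> T \<tau> + rhs w \<nu> T \<tau>" "rhs (r *\<^sub>R v) (r *\<^sub>R \<mu>) T \<tau> = r * rhs v \<mu> T \<tau>"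
proof -
  have cv: "continuous_on T (v T)" "continuous_on T (w T)" and cm: "continuous_on F (\<mu> F)" "continuous_on F (\<nu> F)" for F
    using a T by (auto simp: admissible_def)
  have cF: "continuous_on F \<tau>" "continuous_on F (v T)" "continuous_on F (w T)" if "F facet_of T" for F
    using P_space_continuous[OF t(1) subspace_traceless] facet_subset_elem[OF that] cv continuous_on_subset by blast+
  obtain p where p: "p \<in> Pol k traceless" "\<tau> = trunc T p" by (rule P_spaceE[OF t(1) subspace_traceless])
  have pu: "p \<in> Pol k UNIV" using p Pol_mono[of k k traceless UNIV] by auto
  note rp = Pol_continuous[OF row_div_Pol[OF pu]]
  have cs: "continuous_on T (v T + w T)"
    using cv by (auto simp: plus_fun_def intro!: continuous_intros)
  have i1: "ip T (v T + w T) (row_div \<tau>) = ip T (v T) (row_div \<tau>) + ip T (w T) (row_div \<tau>)"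
    unfolding p(2) ip_row_div[OF T cs(1) p(1)] ip_row_div[OF T cv(1) p(1)] ip_row_div[OF T cv(2) p(1)]
    using ip_add_left[OF compact_elem[OF T] cv rp] by simp
  note nl = face_parts_linear[OF T _ cF(2,3) cF(1) cF(1)] and tl = face_parts_linear[OF T _ cm cF(1) cF(1)]
  have "(\<Sum>F | F facet_of T. normal_part T F (v T + w T) \<tau>) = (\<Sum>F | F facet_of T. normal_part T F (v T) \<tau> + normal_part T F (w T) \<tau>)"
    "(\<Sum>F | F facet_of T. tangential_part T F (\<mu> F + \<nu> F) \<tau>) = (\<Sum>F | F facet_of T. tangential_part T F (\<mu> F) \<tau> + tangential_part T F (\<nu> F) \<tau>)"
    "(\<Sum>F | F facet_of T. normal_part T F (r *\<^sub>R v T) \<tau>) = (\<Sum>F | F facet_of T. r * normal_part T F (v T) \<tau>)"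
    "(\<Sum>F | F facet_of T. tangential_part T F (r *\<^sub>R \<mu> F) \<tau>) = (\<Sum>F | F facet_of T. r * tangential_part T F (\<mu> F) \<tau>)"
    by (intro sum.cong refl nl(3,4) tl(7,8); simp)+
  note s = this
  show "rhs (v + w) (\<mu> + \<nu>) T \<tau> = rhs v \<mu> T \<tau> + rhs w \<nu> T \<tau>" "rhs (r *\<^sub>R v) (r *\<^sub>R \<mu>) T \<tau> = r * rhs v \<mu> T \<tau>"
    unfolding rhs_def plus_fun_apply[of v w] plus_fun_apply[of \<mu> \<nu>] scaleR_fun_apply[of r v] scaleR_fun_apply[of r \<mu>]
      i1 s by (simp_all add: sum.distrib sum_distrib_left[symmetric] ip_scale_left algebra_simps)
qed

text \<open>The product is positive definite because members of the space are continuous on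
  \<open>T\<close> and vanish outside it.\<close>

lemma element_form:
  assumes "T \<in> Th"
  shows "nondegenerate_form (P_space k T (traceless :: (real^'n^'n) set)) (ip T)"
proof unfold_locales
  let ?S = "P_space k T traceless :: (real^'n \<Rightarrow> real^'n^'n) set"
  note c = P_space_continuous[OF _ subspace_traceless] and K = compact_elem[OF assms]
  show "subspace ?S" by (rule subspace_P_space[OF subspace_traceless])
  show "findim ?S" by (rule findim_P_space[OF subspace_traceless])
  show "ip T (x + y) z = ip T x z + ip T y z" if "x \<in> ?S" "y \<in> ?S" "z \<in> ?S" for x y z
    using that by (intro ip_add_left K c)
  show "ip T z (x + y) = ip T z x + ip T z y" if "x \<in> ?S" "y \<in> ?S" "z \<in> ?S" for x y z
    using ip_add_left[OF K c[OF that(1)] c[OF that(2)] c[OF that(3)]] by (simp add: ip_commute[of T z])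
  show "ip T (r *\<^sub>R x) z = r * ip T x z" for x z r by (rule ip_scale_left)
  show "ip T z (r *\<^sub>R x) = r * ip T z x" for x z r by (simp add: ip_commute[of T z] ip_scale_left)
  show "x = 0" if x: "x \<in> ?S" "\<And>y. y \<in> ?S \<Longrightarrow> ip T x y = 0" for x
  proof
    fix y
    obtain t where t: "t \<in> Pol k traceless" "x = trunc T t" by (rule P_spaceE[OF x(1) subspace_traceless])
    show "x y = 0 y"
      using ip_self_eq_0[OF assms c[OF x(1)] x(2)[OF x(1)], of y] by (cases "y \<in> T") (auto simp: t(2))
  qed
qed

text \<open>The Riesz representation is applied on each element separately; off the mesh the family
  is zero by convention, which makes it unique as a family.\<close>

lemma dev_grad_w_exists_unique:
  assumes a: "admissible v \<mu>"
  shows "\<exists>!\<sigma>. \<sigma> \<in> Sigma_disc Th k \<and> (\<forall>T\<in>Th. \<forall>\<tau>\<in>P_space k T traceless. ip T (\<sigma> T) \<tau> = rhs v \<mu> T \<tau>)"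
proof -
  have ex: "\<exists>!s. s \<in> P_space k T traceless \<and> (\<forall>\<tau>\<in>P_space k T traceless. ip T s \<tau> = rhs v \<mu> T \<tau>)" if "T \<in> Th" for T
    by (rule nondegenerate_form.solution_exists[OF element_form[OF that]]) (rule rhs_right[OF that a]; assumption)+
  define \<sigma> where "\<sigma> T = (if T \<in> Th then (THE s. s \<in> P_space k T traceless \<and> (\<forall>\<tau>\<in>P_space k T traceless. ip T s \<tau> = rhs v \<mu> T \<tau>)) else (\<lambda>_. 0))" for T
  have s: "\<sigma> T \<in> P_space k T traceless \<and> (\<forall>\<tau>\<in>P_space k T traceless. ip T (\<sigma> T) \<tau> = rhs v \<mu> T \<tau>)" if "T \<in> Th" for T
    using theI'[OF ex[OF that]] that by (simp add: \<sigma>_def)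
  show ?thesis
  proof (rule ex1I[of _ \<sigma>])
    show "\<sigma> \<in> Sigma_disc Th k \<and> (\<forall>T\<in>Th. \<forall>\<tau>\<in>P_space k T traceless. ip T (\<sigma> T) \<tau> = rhs v \<mu> T \<tau>)"
      using s by (auto simp: Sigma_disc_def family_space_def) (simp add: \<sigma>_def)
    fix \<rho> assume r: "\<rho> \<in> Sigma_disc Th k \<and> (\<forall>T\<in>Th. \<forall>\<tau>\<in>P_space k T traceless. ip T (\<rho> T) \<tau> = rhs v \<mu> T \<tau>)"
    show "\<rho> = \<sigma>"
    proof
      fix T
      show "\<rho> T = \<sigma> T"
      proof (cases "T \<in> Th")
        case True
        then show ?thesis using ex[OF True] s[OF True] r by (auto simp: Sigma_disc_def family_space_def)
      next
        case False
        then show ?thesis using r by (auto simp: Sigma_disc_def family_space_def \<sigma>_def)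
      qed
    qed
  qed
qed

lemma dev_grad_w_char:
  assumes "admissible v \<mu>"
  shows "dev_grad_w Th k v \<mu> \<in> Sigma_disc Th k"
    and "T \<in> Th \<Longrightarrow> \<tau> \<in> P_space k T traceless \<Longrightarrow> ip T (dev_grad_w Th k v \<mu> T) \<tau> = rhs v \<mu> T \<tau>"
  using theI'[OF dev_grad_w_exists_unique[OF assms, where k = k]] unfolding dev_grad_w_eq by blast+

lemma dev_grad_w_unique:
  assumes "admissible v \<mu>" "\<sigma> \<in> Sigma_disc Th k"
    "\<And>T \<tau>. T \<in> Th \<Longrightarrow> \<tau> \<in> P_space k T traceless \<Longrightarrow> ip T (\<sigma> T) \<tau> = rhs v \<mu> T \<tau>"
  shows "dev_grad_w Th k v \<mu> = \<sigma>"
  using dev_grad_w_exists_unique[OF assms(1), where k = k] dev_grad_w_char[OF assms(1), where k = k] assms(2,3) by metis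

lemma Sigma_disc_mem: "\<sigma> \<in> Sigma_disc Th k \<Longrightarrow> T \<in> Th \<Longrightarrow> \<sigma> T \<in> P_space k T traceless"
  by (simp add: Sigma_disc_def family_space_def)

lemma Sigma_disc_continuous: "\<sigma> \<in> Sigma_disc Th k \<Longrightarrow> T \<in> Th \<Longrightarrow> continuous_on T (\<sigma> T)"
  by (rule P_space_continuous[OF Sigma_disc_mem subspace_traceless])

lemma subspace_Sigma_disc: "subspace (Sigma_disc Th k)"
  unfolding Sigma_disc_def by (intro subspace_family_space subspace_P_space subspace_traceless)

lemma admissible_add: "admissible v \<mu> \<Longrightarrow> admissible w \<nu> \<Longrightarrow> admissible (v + w) (\<mu> + \<nu>)"
  and admissible_scale: "admissible v \<mu> \<Longrightarrow> admissible (r *\<^sub>R v) (r *\<^sub>R \<mu>)"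
  unfolding admissible_def by (auto simp: plus_fun_def scaleR_fun_def intro!: continuous_intros)

lemma dev_grad_w_add:
  assumes a: "admissible v \<mu>" "admissible w \<nu>"
  shows "dev_grad_w Th k (v + w) (\<mu> + \<nu>) = dev_grad_w Th k v \<mu> + dev_grad_w Th k w \<nu>"
proof (rule dev_grad_w_unique[OF admissible_add[OF a]])
  note c = dev_grad_w_char[OF a(1), where k = k] dev_grad_w_char[OF a(2), where k = k]
  show "dev_grad_w Th k v \<mu> + dev_grad_w Th k w \<nu> \<in> Sigma_disc Th k"
    using c subspace_add[OF subspace_Sigma_disc] by blast
  fix T and \<tau> :: "real^'n \<Rightarrow> real^'n^'n" assume T: "T \<in> Th" "\<tau> \<in> P_space k T traceless"
  show "ip T ((dev_grad_w Th k v \<mu> + dev_grad_w Th k w \<nu>) T) \<tau> = rhs (v + w) (\<mu> + \<nu>) T \<tau>"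
    using ip_add_left[OF compact_elem[OF T(1)] Sigma_disc_continuous[OF c(1) T(1)] Sigma_disc_continuous[OF c(3) T(1)]
        P_space_continuous[OF T(2) subspace_traceless]] c(2,4) T rhs_left(1)[OF T(1) a T(2)] by simp
qed

lemma dev_grad_w_scale:
  assumes a: "admissible v \<mu>"
  shows "dev_grad_w Th k (r *\<^sub>R v) (r *\<^sub>R \<mu>) = r *\<^sub>R dev_grad_w Th k v \<mu>"
proof (rule dev_grad_w_unique[OF admissible_scale[OF a]])
  note c = dev_grad_w_char[OF a, where k = k]
  show "r *\<^sub>R dev_grad_w Th k v \<mu> \<in> Sigma_disc Th k"
    using c subspace_scale[OF subspace_Sigma_disc] by blast
  fix T and \<tau> :: "real^'n \<Rightarrow> real^'n^'n" assume T: "T \<in> Th" "\<tau> \<in> P_space k T traceless"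
  show "ip T ((r *\<^sub>R dev_grad_w Th k v \<mu>) T) \<tau> = rhs (r *\<^sub>R v) (r *\<^sub>R \<mu>) T \<tau>"
    using c(2) T rhs_left(2)[OF T(1) a a T(2)] by (simp add: ip_scale_left)
qed

definition econt :: "((real^'n) set \<Rightarrow> real^'n \<Rightarrow> 'v::euclidean_space) \<Rightarrow> bool" where
  "econt f \<longleftrightarrow> (\<forall>T\<in>Th. continuous_on T (f T))"

lemma mesh_ip_add_left: "econt f \<Longrightarrow> econt g \<Longrightarrow> econt h \<Longrightarrow> mesh_ip Th (f + g) h = mesh_ip Th f h + mesh_ip Th g h"
  unfolding mesh_ip_def sum.distrib[symmetric] econt_def
  by (intro sum.cong refl) (simp add: ip_add_left compact_elem)

lemma mesh_ip_scale_left: "mesh_ip Th (r *\<^sub>R f) h = r * mesh_ip Th f h"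
  by (simp add: mesh_ip_def ip_scale_left sum_distrib_left)

lemma mesh_ip_commute: "mesh_ip Th f h = mesh_ip Th h f"
  by (simp add: mesh_ip_def ip_commute)

lemma mesh_ip_self_nonneg: "0 \<le> mesh_ip Th f f"
  unfolding mesh_ip_def by (intro sum_nonneg ip_self_nonneg)

lemma mesh_ip_self_eq_0:
  assumes "econt f" "mesh_ip Th f f = 0" "T \<in> Th" "x \<in> T"
  shows "f T x = 0"
proof -
  have "ip T (f T) (f T) = 0"
    using assms(2,3) sum_nonneg_eq_0_iff[OF finite_Th, of "\<lambda>T. ip T (f T) (f T)"] ip_self_nonneg unfolding mesh_ip_def by blast
  then show ?thesis using ip_self_eq_0 assms econt_def by blast
qed

lemma econt_Sigma_disc: "\<sigma> \<in> Sigma_disc Th k \<Longrightarrow> econt \<sigma>"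
  unfolding econt_def using Sigma_disc_continuous by blast

end

section \<open>Velocity and pressure spaces\<close>

locale fem = mesh \<Omega> Th nF for \<Omega> :: "(real^'n) set" and Th nF +
  fixes k :: nat and l :: int
  assumes deg: "l = int k \<or> l = int k - 1"
begin

abbreviation "V \<equiv> V_div0 \<Omega> Th nF (int k) l"
abbreviation "Lam \<equiv> Lambda_space \<Omega> Th nF (int k)"
abbreviation "Q \<equiv> Q_space Th l"

definition Vp :: "(real^'n \<Rightarrow> real^'n) set" where
  "Vp = {\<lambda>x. p x + h x *\<^sub>R x |p h. p \<in> Pol (int k) UNIV \<and> h \<in> Hom l}"

lemma V_loc_eq: "V_loc (int k) l T = trunc T ` Vp"
proof (intro set_eqI iffI)
  fix v assume "v \<in> V_loc (int k) l T"
  then obtain p h where "p \<in> Pol (int k) UNIV" "h \<in> Hom l" "v = (\<lambda>x. trunc T p x + trunc T h x *\<^sub>R x)"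
    unfolding V_loc_def by (auto simp: P_space_eq H_space_eq)
  moreover from this have "v = trunc T (\<lambda>x. p x + h x *\<^sub>R x)" by (auto simp: trunc_def)
  ultimately show "v \<in> trunc T ` Vp" unfolding Vp_def by blast
next
  fix v assume "v \<in> trunc T ` Vp"
  then obtain p h where ph: "p \<in> Pol (int k) UNIV" "h \<in> Hom l" "v = trunc T (\<lambda>x. p x + h x *\<^sub>R x)"
    unfolding Vp_def by blast
  then have "v = (\<lambda>x. trunc T p x + trunc T h x *\<^sub>R x)" by (auto simp: trunc_def)
  moreover have "trunc T p \<in> P_space (int k) T UNIV" "trunc T h \<in> H_space l T"
    using ph by (auto simp: P_space_eq H_space_eq)
  ultimately show "v \<in> V_loc (int k) l T" unfolding V_loc_def by blast
qed

lemma subspace_Vp: "subspace Vp"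
  unfolding subspace_def
proof (intro conjI ballI allI)
  show "0 \<in> Vp" unfolding Vp_def
    using Pol_0 subspace_0[OF subspace_Hom]
    by (intro CollectI exI[of _ "\<lambda>x. 0"] exI[of _ "0"]) (auto simp: fun_eq_iff)
  fix u v assume "u \<in> Vp" "v \<in> Vp"
  then obtain p h q g where "u = (\<lambda>x. p x + h x *\<^sub>R x)" "p \<in> Pol (int k) UNIV" "h \<in> Hom l"
    "v = (\<lambda>x. q x + g x *\<^sub>R x)" "q \<in> Pol (int k) UNIV" "g \<in> Hom l" unfolding Vp_def by blast
  then show "u + v \<in> Vp" unfolding Vp_def
    by (intro CollectI, intro exI[of _ "\<lambda>x. p x + q x"], intro exI[of _ "h + g"])
      (auto simp: fun_eq_iff algebra_simps intro: Pol_add subspace_add[OF subspace_Hom])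
next
  fix r u assume "u \<in> Vp"
  then obtain p h where "u = (\<lambda>x. p x + h x *\<^sub>R x)" "p \<in> Pol (int k) UNIV" "h \<in> Hom l" unfolding Vp_def by blast
  then show "r *\<^sub>R u \<in> Vp" unfolding Vp_def
    by (intro CollectI, intro exI[of _ "\<lambda>x. r *\<^sub>R p x"], intro exI[of _ "r *\<^sub>R h"])
      (auto simp: fun_eq_iff algebra_simps intro: Pol_scale subspace_scale[OF subspace_Hom])
qed

lemma Vp_Pol: "P \<in> Vp \<Longrightarrow> P \<in> Pol (int k + 1) UNIV"
proof -
  assume "P \<in> Vp"
  then obtain p h where ph: "P = (\<lambda>x. p x + h x *\<^sub>R x)" "p \<in> Pol (int k) UNIV" "h \<in> Hom l" unfolding Vp_def by blast
  have "(\<lambda>x. h x *\<^sub>R x) \<in> Pol (l + 1) UNIV"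
    by (intro Pol_mult Hom_subset_Pol ph Pol_id) auto
  moreover have "Pol (l + 1) (UNIV :: (real^'n) set) \<subseteq> Pol (int k + 1) UNIV" using deg by (intro Pol_mono) auto
  moreover have "p \<in> Pol (int k + 1) UNIV" using ph(2) Pol_mono[of "int k" "int k + 1" UNIV UNIV] by auto
  ultimately show ?thesis unfolding ph(1) by (intro Pol_add) auto
qed

lemma findim_V_loc: "findim (V_loc (int k) l (T :: (real^'n) set))"
proof -
  have "findim Vp" by (rule findim_subset[OF findim_Pol[of "int k + 1"]]) (use Vp_Pol in blast)
  then show ?thesis unfolding V_loc_eq by (rule findim_linear_image[rotated]) (rule linear_trunc)
qed

lemma subspace_V_loc: "subspace (V_loc (int k) l (T :: (real^'n) set))"
  unfolding V_loc_eq by (rule linear_subspace_image[OF linear_trunc subspace_Vp])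

text \<open>The polynomial behind a truncated shape function; unlike \<open>v T\<close> it is
  differentiable up to and across the boundary of the element.\<close>

definition vrep :: "((real^'n) set \<Rightarrow> real^'n \<Rightarrow> real^'n) \<Rightarrow> (real^'n) set \<Rightarrow> real^'n \<Rightarrow> real^'n" where
  "vrep v T = (SOME P. P \<in> Vp \<and> v T = trunc T P)"

lemma vrep:
  assumes "v \<in> family_space Th (V_loc (int k) l)" "T \<in> Th"
  shows "vrep v T \<in> Vp" "v T = trunc T (vrep v T)" "vrep v T \<in> Pol (int k + 1) UNIV"
proof -
  have "v T \<in> trunc T ` Vp" using assms by (simp add: family_space_def V_loc_eq)
  then have "\<exists>P. P \<in> Vp \<and> v T = trunc T P" by blast
  from someI_ex[OF this] show "vrep v T \<in> Vp" "v T = trunc T (vrep v T)" unfolding vrep_def by simp_all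
  then show "vrep v T \<in> Pol (int k + 1) UNIV" using Vp_Pol by blast
qed

text \<open>Replaces H(div) by agreement of the normal components on interior faces, so that the
  remaining argument concerns piecewise polynomials only.\<close>

lemma V_iff:
  "v \<in> V \<longleftrightarrow> v \<in> family_space Th (V_loc (int k) l) \<and>
    (\<forall>F\<in>interior_faces \<Omega> Th. \<forall>x\<in>F. nF F \<bullet> v (posT F) x = nF F \<bullet> v (negT F) x) \<and>
    (\<forall>F\<in>boundary_faces \<Omega> Th. \<forall>T\<in>Th. F facet_of T \<longrightarrow> (\<forall>x\<in>F. nF F \<bullet> v T x = 0))"
proof -
  have "glue Th v \<in> H_div \<Omega> \<longleftrightarrow> (\<forall>F\<in>interior_faces \<Omega> Th. \<forall>x\<in>F. nF F \<bullet> v (posT F) x = nF F \<bullet> v (negT F) x)"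
    if v: "v \<in> family_space Th (V_loc (int k) l)"
  proof -
    have eq: "nF F \<bullet> (vrep v (posT F) x - vrep v (negT F) x) = nF F \<bullet> v (posT F) x - nF F \<bullet> v (negT F) x"
      if "F \<in> interior_faces \<Omega> Th" "x \<in> F" for F x
    proof -
      note pm = plus_minus[OF that(1)]
      have "x \<in> posT F" "x \<in> negT F" using facet_subset_elem pm that(2) by blast+
      then show ?thesis using vrep(2)[OF v pm(1)] vrep(2)[OF v pm(4)] by (simp add: inner_diff_right)
    qed
    show ?thesis
      using H_divI[where P = "vrep v" and v = v, OF vrep(3)[OF v] vrep(2)[OF v]]
        H_divD[where P = "vrep v" and v = v, OF vrep(3)[OF v] vrep(2)[OF v]] eq
      by (metis eq_iff_diff_eq_0)
  qed
  then show ?thesis unfolding V_div0_def by (auto simp: inner_commute)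
qed

lemma V_family: "v \<in> V \<Longrightarrow> v \<in> family_space Th (V_loc (int k) l)" by (simp add: V_iff)

lemma subspace_V: "subspace V"
proof -
  note f = subspace_family_space[of Th "V_loc (int k) l", OF subspace_V_loc]
  have z: "0 \<in> V" by (rule iffD2[OF V_iff]) (use subspace_0[OF f] in simp)
  have a: "u + v \<in> V" if "u \<in> V" "v \<in> V" for u v
    by (rule iffD2[OF V_iff])
      (use iffD1[OF V_iff that(1)] iffD1[OF V_iff that(2)] subspace_add[OF f, of u v] in \<open>simp add: inner_add_right\<close>)
  have m: "r *\<^sub>R u \<in> V" if "u \<in> V" for r u
    by (rule iffD2[OF V_iff]) (use iffD1[OF V_iff that] subspace_scale[OF f, of u r] in simp)
  show ?thesis unfolding subspace_def using z a m by blast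
qed

lemma findim_V: "findim V"
  by (rule findim_subset[OF findim_family_space[OF finite_Th, of "\<lambda>T. V_loc (int k) l T"]])
    (rule findim_V_loc, use V_family in blast)

lemma econt_V: "v \<in> V \<Longrightarrow> econt v"
  unfolding econt_def
proof
  fix T assume v: "v \<in> V" and T: "T \<in> Th"
  show "continuous_on T (v T)"
    unfolding vrep(2)[OF V_family[OF v] T]
    by (intro continuous_on_trunc Pol_continuous[OF vrep(3)[OF V_family[OF v] T]])
qed

lemma divg_id: "divg (\<lambda>x::real^'n. x) x = real CARD('n)"
proof -
  have "partial j (\<lambda>x::real^'n. x) x = axis j 1" for j by (rule partial_eq) simp
  then show ?thesis by (simp add: divg_def axis_def)
qed

text \<open>The factor of \<open>h x\<close> is the divergence of the identity plus the degree from
  Euler's identity. For \<open>l = -1\<close> the function \<open>h\<close> is 0 and the formula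
  still holds.\<close>

lemma divg_Vp:
  assumes "P \<in> Vp"
  obtains p h where "p \<in> Pol (int k) UNIV" "h \<in> Hom l" "P = (\<lambda>x. p x + h x *\<^sub>R x)"
    "\<And>x. divg P x = divg p x + (real CARD('n) + real_of_int l) * h x"
proof -
  obtain p h where ph: "P = (\<lambda>x. p x + h x *\<^sub>R x)" "p \<in> Pol (int k) UNIV" "h \<in> Hom l"
    using assms unfolding Vp_def by blast
  have hd: "h differentiable (at x)" for x using Pol_differentiable[OF Hom_subset_Pol[OF ph(3)]] .
  have "divg P x = divg p x + (real CARD('n) + real_of_int l) * h x" for x
  proof -
    have "(\<lambda>x. h x *\<^sub>R x) \<in> Pol (l + 1) UNIV" by (intro Pol_mult Hom_subset_Pol ph Pol_id) auto
    then have d: "(\<lambda>x. h x *\<^sub>R x) differentiable (at x)" by (rule Pol_differentiable)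
    have "divg (\<lambda>x. h x *\<^sub>R x) x = (\<Sum>i\<in>UNIV. partial i (\<lambda>x. h x * x $ i) x)"
      unfolding divg_def using partial_nth[OF d] by simp
    also have "\<dots> = h x * real CARD('n) + grad h x \<bullet> x"
      using divg_mult[OF hd, of "\<lambda>x. x" x] by (simp add: divg_id)
    also have "grad h x \<bullet> x = real_of_int l * h x"
    proof (cases "l < 0")
      case True
      then have "h = (\<lambda>x. 0)" using Pol_neg_degree Hom_subset_Pol[OF ph(3)] by blast
      moreover have "grad (\<lambda>x. 0) x = 0" by (simp add: grad_def vec_eq_iff) (auto intro!: partial_eq[THEN trans])
      ultimately show ?thesis by simp
    next
      case False
      then have "h \<in> Hom (int (nat l))" using ph(3) by simp
      from Hom_euler[OF this, of x] False show ?thesis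
        by (simp add: grad_def inner_vec_def mult.commute)
    qed
    finally have "divg (\<lambda>x. h x *\<^sub>R x) x = (real CARD('n) + real_of_int l) * h x" by (simp add: algebra_simps)
    then show ?thesis unfolding ph(1) using divg_add[OF Pol_differentiable[OF ph(2)] d] by simp
  qed
  then show ?thesis using that ph by blast
qed

lemma divg_Vp_Pol: "P \<in> Vp \<Longrightarrow> divg P \<in> Pol l UNIV"
proof -
  assume "P \<in> Vp"
  then obtain p h where ph: "p \<in> Pol (int k) UNIV" "h \<in> Hom l"
    "\<And>x. divg P x = divg p x + (real CARD('n) + real_of_int l) * h x" by (rule divg_Vp) blast
  have "divg p \<in> Pol l UNIV" using divg_Pol[OF ph(1)] Pol_mono[of "int k - 1" l UNIV UNIV] deg by auto
  moreover have "(\<lambda>x. (real CARD('n) + real_of_int l) *\<^sub>R h x) \<in> Pol l UNIV"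
    by (intro Pol_scale Hom_subset_Pol ph)
  ultimately have "(\<lambda>x. divg p x + (real CARD('n) + real_of_int l) *\<^sub>R h x) \<in> Pol l UNIV" by (rule Pol_add)
  moreover have "divg P = (\<lambda>x. divg p x + (real CARD('n) + real_of_int l) *\<^sub>R h x)" using ph(3) by auto
  ultimately show ?thesis by simp
qed

text \<open>If \<open>l = k\<close>, the part of degree \<open>k\<close> of the divergence is a
  positive multiple of \<open>h\<close>, so \<open>h\<close> vanishes with the divergence. If
  \<open>l = k - 1\<close>, the enriched part has degree \<open>k\<close> anyway.\<close>

lemma divg_zero_degree:
  assumes "P \<in> Vp" "\<And>x. divg P x = 0"
  shows "P \<in> Pol (int k) UNIV"
proof -
  obtain p h where ph: "p \<in> Pol (int k) UNIV" "h \<in> Hom l" "P = (\<lambda>x. p x + h x *\<^sub>R x)"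
    "\<And>x. divg P x = divg p x + (real CARD('n) + real_of_int l) * h x" by (rule divg_Vp[OF assms(1)]) blast
  show ?thesis
  proof (cases "l = int k")
    case True
    have "h x = 0" for x
    proof -
      have "((real CARD('n) + real_of_int l) *\<^sub>R h) x = 0"
      proof (rule Hom_Pol_independent[where p = "divg p" and k = k])
        show "divg p \<in> Pol (int k - 1) UNIV" by (rule divg_Pol[OF ph(1)])
        show "(real CARD('n) + real_of_int l) *\<^sub>R h \<in> Hom (int k)"
          using subspace_scale[OF subspace_Hom ph(2)] True by simp
        show "divg p x + ((real CARD('n) + real_of_int l) *\<^sub>R h) x = 0" for x
          using ph(4)[of x] assms(2)[of x] by simp
      qed
      moreover have "real CARD('n) + real_of_int l > 0" using True by (simp add: add_pos_nonneg)
      ultimately show ?thesis by simp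
    qed
    then have "P = p" using ph(3) by auto
    then show ?thesis using ph(1) by simp
  next
    case False
    then have l: "l + 1 = int k" using deg by auto
    have "(\<lambda>x. h x *\<^sub>R x) \<in> Pol (l + 1) UNIV" by (intro Pol_mult Hom_subset_Pol ph Pol_id) auto
    then show ?thesis unfolding ph(3) using ph(1) by (intro Pol_add) (auto simp: l)
  qed
qed

text \<open>Of \<open>r x *\<^sub>R (x - a)\<close> only the top homogeneous part of
  \<open>r\<close> times \<open>x\<close> can exceed degree \<open>k\<close>, and this is the shape
  of the enrichment; moving the centre from 0 to \<open>a\<close> changes terms of degree at most
  \<open>k\<close> only.\<close>

lemma Vp_radial:
  assumes "r \<in> Pol l UNIV"
  shows "(\<lambda>x. r x *\<^sub>R (x - a)) \<in> Vp"
proof -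
  obtain q h where qh: "q \<in> Pol (l - 1) UNIV" "h \<in> Hom l" "r = (\<lambda>x. q x + h x)" by (rule Pol_split[OF assms])
  have "(\<lambda>x. q x *\<^sub>R x) \<in> Pol (l - 1 + 1) UNIV" by (intro Pol_mult qh Pol_id) auto
  then have 1: "(\<lambda>x. q x *\<^sub>R x) \<in> Pol (int k) UNIV" using Pol_mono[of l "int k" UNIV UNIV] deg by auto
  have "(\<lambda>x. r x *\<^sub>R a) \<in> Pol (l + 0) UNIV" by (intro Pol_mult assms Pol_const) auto
  then have 2: "(\<lambda>x. r x *\<^sub>R a) \<in> Pol (int k) UNIV" using Pol_mono[of l "int k" UNIV UNIV] deg by auto
  have "(\<lambda>x. r x *\<^sub>R (x - a)) = (\<lambda>x. (q x *\<^sub>R x - r x *\<^sub>R a) + h x *\<^sub>R x)"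
    by (simp add: fun_eq_iff qh(3) algebra_simps)
  then show ?thesis unfolding Vp_def using Pol_diff[OF 1 2] qh(2)
    by - (rule CollectI, rule exI[of _ "\<lambda>x. q x *\<^sub>R x - r x *\<^sub>R a"], rule exI[of _ h], rule conjI, assumption, rule conjI, assumption+)
qed

lemma Vp_sum: "(\<And>i. i \<in> I \<Longrightarrow> f i \<in> Vp) \<Longrightarrow> (\<lambda>x. \<Sum>i\<in>I. f i x) \<in> Vp"
proof -
  assume "\<And>i. i \<in> I \<Longrightarrow> f i \<in> Vp"
  then have "(\<Sum>i\<in>I. f i) \<in> Vp" by (rule subspace_sum[OF subspace_Vp])
  moreover have "(\<Sum>i\<in>I. f i) = (\<lambda>x. \<Sum>i\<in>I. f i x)" by (rule ext) (simp add: sum_fun_apply)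
  ultimately show ?thesis by simp
qed

lemma Q_mem: "q \<in> Q \<Longrightarrow> T \<in> Th \<Longrightarrow> q T \<in> P_space l T UNIV"
  by (simp add: Q_space_def family_space_def)

lemma econt_Q: "q \<in> Q \<Longrightarrow> econt q"
  unfolding econt_def using P_space_continuous[OF Q_mem subspace_UNIV] by blast

lemma subspace_Q: "subspace Q"
proof -
  note f = subspace_family_space[of Th "\<lambda>T. P_space l T (UNIV :: real set)", OF subspace_P_space[OF subspace_UNIV]]
  have int: "integrable (lebesgue_on T) (q T)" if "q \<in> family_space Th (\<lambda>T. P_space l T UNIV)" "T \<in> Th"
    for q :: "(real^'n) set \<Rightarrow> real^'n \<Rightarrow> real" and T
  proof (rule LINT_compact(3)[OF compact_elem[OF that(2)]])
    show "continuous_on T (q T)" using that by (intro P_space_continuous[OF _ subspace_UNIV]) (auto simp: family_space_def)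
  qed
  have z: "0 \<in> Q" using subspace_0[OF f] by (simp add: Q_space_def zero_fun_def)
  have a: "u + v \<in> Q" if "u \<in> Q" "v \<in> Q" for u v
  proof -
    have uv: "u \<in> family_space Th (\<lambda>T. P_space l T UNIV)" "v \<in> family_space Th (\<lambda>T. P_space l T UNIV)"
      "(\<Sum>T\<in>Th. LINT x|lebesgue_on T. u T x) = 0" "(\<Sum>T\<in>Th. LINT x|lebesgue_on T. v T x) = 0"
      using that by (simp_all add: Q_space_def)
    have "(\<Sum>T\<in>Th. LINT x|lebesgue_on T. (u + v) T x) =
        (\<Sum>T\<in>Th. (LINT x|lebesgue_on T. u T x) + (LINT x|lebesgue_on T. v T x))"
      unfolding plus_fun_apply by (intro sum.cong refl Bochner_Integration.integral_add int uv)
    also have "\<dots> = 0" unfolding sum.distrib uv by simp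
    finally show ?thesis unfolding Q_space_def by (intro CollectI conjI subspace_add[OF f uv(1,2)])
  qed
  have m: "r *\<^sub>R u \<in> Q" if "u \<in> Q" for r u
  proof -
    have u: "u \<in> family_space Th (\<lambda>T. P_space l T UNIV)" "(\<Sum>T\<in>Th. LINT x|lebesgue_on T. u T x) = 0"
      using that by (simp_all add: Q_space_def)
    have "(\<Sum>T\<in>Th. LINT x|lebesgue_on T. (r *\<^sub>R u) T x) = r * (\<Sum>T\<in>Th. LINT x|lebesgue_on T. u T x)"
      unfolding sum_distrib_left scaleR_fun_apply real_scaleR_def by (intro sum.cong refl integral_mult_right_zero)
    also have "\<dots> = 0" unfolding u(2) by simp
    finally show ?thesis unfolding Q_space_def by (intro CollectI conjI subspace_scale[OF f u(1)])
  qed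
  show ?thesis unfolding subspace_def using z a m by blast
qed

lemma findim_Q: "findim Q"
  by (rule findim_subset[OF findim_family_space[OF finite_Th findim_P_space[OF subspace_UNIV]]]) (auto simp: Q_space_def)

lemma mesh_ip_divg:
  assumes "v \<in> V" "econt q"
  shows "mesh_ip Th (\<lambda>T. divg (v T)) q = (\<Sum>T\<in>Th. LINT x|lebesgue_on T. divg (vrep v T) x * q T x)"
  unfolding mesh_ip_def
proof (intro sum.cong refl)
  fix T assume T: "T \<in> Th"
  note r = vrep[OF V_family[OF assms(1)] T]
  have "ip T (divg (v T)) (q T) = ip T (divg (vrep v T)) (q T)"
  proof (rule ip_interior_cong[OF T Pol_continuous[OF divg_Pol[OF r(3)]]])
    show "continuous_on T (q T)" using assms(2) T by (simp add: econt_def)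
    show "divg (v T) x = divg (vrep v T) x" if "x \<in> interior T" for x
      by (subst r(2)) (rule divg_trunc[OF that Pol_differentiable[OF r(3)]])
  qed simp
  then show "ip T (divg (v T)) (q T) = (LINT x|lebesgue_on T. divg (vrep v T) x * q T x)" by (simp add: ip_def)
qed

text \<open>The zero mean is the divergence theorem with the constant test function 1: normal
  components cancel on interior faces and vanish on the boundary. So the divergence of a velocity is
  itself an admissible pressure.\<close>

lemma divg_vrep_in_Q:
  assumes v: "v \<in> V"
  shows "(\<lambda>T. if T \<in> Th then trunc T (divg (vrep v T)) else (\<lambda>_. 0)) \<in> Q"
proof -
  let ?q = "\<lambda>T. if T \<in> Th then trunc T (divg (vrep v T)) else (\<lambda>_. 0)"
  note r = vrep[OF V_family[OF v]]
  have "?q \<in> family_space Th (\<lambda>T. P_space l T UNIV)"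
    using divg_Vp_Pol[OF r(1)] by (auto simp: family_space_def P_space_eq)
  moreover have "(\<Sum>T\<in>Th. LINT x|lebesgue_on T. ?q T x) = 0"
  proof -
    have C: "C1 (\<lambda>x::real^'n. 1)" by (rule C1_Pol[OF Pol_const[of 0]]) auto
    have g0: "grad (\<lambda>x::real^'n. 1) x = 0" for x by (simp add: grad_def vec_eq_iff) (auto intro!: partial_eq[THEN trans])
    have z: "face_integral F (nF F) (\<lambda>x. 0) = 0" if "F \<in> mesh_faces Th" for F
      using face_functional(2)[OF that continuous_on_const, of 0 0] by simp
    have pol: "vrep v T \<in> Pol (int k + 1) UNIV" if "T \<in> Th" for T by (rule r(3)[OF that])
    have "(\<Sum>F\<in>interior_faces \<Omega> Th. face_integral F (nF F) (\<lambda>x. 1 * (nF F \<bullet> (vrep v (posT F) x - vrep v (negT F) x)))) = 0"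
    proof (intro sum.neutral ballI)
      fix F assume F: "F \<in> interior_faces \<Omega> Th"
      note pm = plus_minus[OF F]
      have "face_integral F (nF F) (\<lambda>x. 1 * (nF F \<bullet> (vrep v (posT F) x - vrep v (negT F) x))) = face_integral F (nF F) (\<lambda>x. 0)"
      proof (intro face_functional(3)[OF interior_face_mesh[OF F]] continuous_intros Pol_continuous[OF pol] pm)
        fix x assume x: "x \<in> F"
        then have "x \<in> posT F" "x \<in> negT F" using facet_subset_elem pm by blast+
        moreover have "nF F \<bullet> v (posT F) x = nF F \<bullet> v (negT F) x" using v F x V_iff by blast
        ultimately show "1 * (nF F \<bullet> (vrep v (posT F) x - vrep v (negT F) x)) = 0"
          using r(2)[OF pm(1)] r(2)[OF pm(4)] by (simp add: inner_diff_right)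
      qed
      then show "face_integral F (nF F) (\<lambda>x. 1 * (nF F \<bullet> (vrep v (posT F) x - vrep v (negT F) x))) = 0"
        using z[OF interior_face_mesh[OF F]] by simp
    qed
    moreover have "(\<Sum>F\<in>boundary_faces \<Omega> Th. \<Sum>T | T \<in> Th \<and> F facet_of T. face_integral F (nF F) (\<lambda>x. 1 * (nF F \<bullet> vrep v T x))) = 0"
    proof (intro sum.neutral ballI)
      fix F T assume F: "F \<in> boundary_faces \<Omega> Th" and T: "T \<in> {T. T \<in> Th \<and> F facet_of T}"
      then have m: "F \<in> mesh_faces Th" using mesh_facesI by blast
      have T': "T \<in> Th" "F facet_of T" using T by auto
      have "face_integral F (nF F) (\<lambda>x. 1 * (nF F \<bullet> vrep v T x)) = face_integral F (nF F) (\<lambda>x. 0)"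
      proof (intro face_functional(3)[OF m] continuous_intros Pol_continuous[OF pol] T')
        fix x assume x: "x \<in> F"
        then have "x \<in> T" using facet_subset_elem[OF T'(2)] by blast
        moreover have "nF F \<bullet> v T x = 0" using v F T' x V_iff by blast
        ultimately show "1 * (nF F \<bullet> vrep v T x) = 0" using r(2)[OF T'(1)] by simp
      qed
      then show "face_integral F (nF F) (\<lambda>x. 1 * (nF F \<bullet> vrep v T x)) = 0" using z[OF m] by simp
    qed
    ultimately have "(\<Sum>T\<in>Th. LINT x|lebesgue_on T. 1 * divg (vrep v T) x) = 0"
      using element_ibp_sum[where P = "vrep v", OF pol C] by (simp add: g0)
    moreover have "(\<Sum>T\<in>Th. LINT x|lebesgue_on T. ?q T x) = (\<Sum>T\<in>Th. LINT x|lebesgue_on T. 1 * divg (vrep v T) x)"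
      by (intro sum.cong refl Bochner_Integration.integral_cong) auto
    ultimately show ?thesis by simp
  qed
  ultimately show ?thesis by (simp add: Q_space_def)
qed

text \<open>The divergence is tested with itself, and the vanishing on the element extends to the
  whole polynomial.\<close>

lemma divg_zero:
  assumes v: "v \<in> V" and z: "\<And>q. q \<in> Q \<Longrightarrow> mesh_ip Th (\<lambda>T. divg (v T)) q = 0" and T: "T \<in> Th"
  shows "divg (vrep v T) x = 0"
proof -
  define q where "q T = (if T \<in> Th then trunc T (divg (vrep v T)) else (\<lambda>_. 0))" for T
  have q: "q \<in> Q" unfolding q_def by (rule divg_vrep_in_Q[OF v])
  note r = vrep[OF V_family[OF v]]
  have "mesh_ip Th q q = mesh_ip Th (\<lambda>T. divg (v T)) q"
    unfolding mesh_ip_divg[OF v econt_Q[OF q]] unfolding mesh_ip_def ip_def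
    by (intro sum.cong refl Bochner_Integration.integral_cong) (auto simp: q_def)
  then have "mesh_ip Th q q = 0" using z[OF q] by simp
  then have "q T y = 0" if "y \<in> T" for y by (rule mesh_ip_self_eq_0[OF econt_Q[OF q] _ T that])
  then have "divg (vrep v T) y = 0" if "y \<in> interior T" for y
    using that interior_subset T by (fastforce simp: q_def)
  then show ?thesis
    by (rule Pol_identity[OF divg_Pol[OF r(3)[OF T]] open_interior interior_elem_nonempty[OF T]])
qed

lemma divg_zero_ker:
  assumes v: "v \<in> V" and z: "\<And>q. q \<in> Q \<Longrightarrow> mesh_ip Th (\<lambda>T. divg (v T)) q = 0"
  shows "v \<in> ker_div Th"
  unfolding ker_div_def
proof (intro CollectI ballI)
  fix T x assume T: "T \<in> Th" and x: "x \<in> interior T"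
  note r = vrep[OF V_family[OF v] T]
  show "divg (v T) x = 0"
    by (subst r(2)) (simp add: divg_trunc[OF x Pol_differentiable[OF r(3)]] divg_zero[OF v z T])
qed

section \<open>Test velocities that determine the pressure\<close>

definition field :: "((real^'n) set \<Rightarrow> real^'n \<Rightarrow> real^'n) \<Rightarrow> (real^'n) set \<Rightarrow> real^'n \<Rightarrow> real^'n" where
  "field P T = (if T \<in> Th then trunc T (P T) else (\<lambda>_. 0))"

text \<open>The number \<open>g F\<close> is a constant normal component with respect to
  \<open>nF F\<close>, the same from every element at \<open>F\<close>, which gives normal
  continuity.\<close>

lemma field_in_V:
  assumes P: "\<And>T. T \<in> Th \<Longrightarrow> P T \<in> Vp"
    and tr: "\<And>T F x. T \<in> Th \<Longrightarrow> F facet_of T \<Longrightarrow> x \<in> F \<Longrightarrow> nF F \<bullet> P T x = g F"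
    and bd: "\<And>F. F \<in> boundary_faces \<Omega> Th \<Longrightarrow> g F = 0"
  shows "field P \<in> V"
  unfolding V_iff
proof (intro conjI ballI allI impI)
  show "field P \<in> family_space Th (V_loc (int k) l)"
    using P by (auto simp: family_space_def V_loc_eq field_def)
  fix F x assume F: "F \<in> interior_faces \<Omega> Th" and x: "x \<in> F"
  note pm = plus_minus[OF F]
  have "x \<in> posT F" "x \<in> negT F" using facet_subset_elem pm x by blast+
  then show "nF F \<bullet> field P (posT F) x = nF F \<bullet> field P (negT F) x"
    using tr[OF pm(1,2) x] tr[OF pm(4,5) x] pm(1,4) by (simp add: field_def)
next
  fix F T x assume F: "F \<in> boundary_faces \<Omega> Th" and T: "T \<in> Th" "F facet_of T" and x: "x \<in> F"
  have "x \<in> T" using facet_subset_elem[OF T(2)] x by blast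
  then show "nF F \<bullet> field P T x = 0" using tr[OF T x] bd[OF F] T(1) by (simp add: field_def)
qed

lemma vrep_field:
  assumes "field P \<in> V" "\<And>T. T \<in> Th \<Longrightarrow> P T \<in> Vp" "T \<in> Th"
  shows "vrep (field P) T = P T"
proof
  fix x
  note r = vrep[OF V_family[OF assms(1)] assms(3)]
  have P: "P T \<in> Pol (int k + 1) UNIV" by (rule Vp_Pol[OF assms(2)[OF assms(3)]])
  have "vrep (field P) T x - P T x = 0"
  proof (rule Pol_identity[OF Pol_diff[OF r(3) P] open_interior interior_elem_nonempty[OF assms(3)]])
    fix y assume "y \<in> interior T"
    then have "y \<in> T" using interior_subset by blast
    then show "vrep (field P) T y - P T y = 0"
      using r(2) assms(3) by (simp add: field_def fun_eq_iff) (metis right_minus_eq trunc_in)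
  qed
  then show "vrep (field P) T x = P T x" by simp
qed

text \<open>The bubble \<open>\<Sum>\<^sub>a bl a ((c - a) \<bullet> grad \<pi>) (x - a)\<close>: with \<open>E a = (x - a) \<bullet> grad \<pi>\<close> its product with
  \<open>grad \<pi>\<close> is \<open>\<Sum>\<^sub>a bl a (E a)\<^sup>2\<close> because \<open>\<Sum>\<^sub>a bl a (E a) = 0\<close>.\<close>

lemma pressure_constant:
  assumes p: "p \<in> Q" and z: "\<And>v. v \<in> V \<Longrightarrow> mesh_ip Th (\<lambda>T. divg (v T)) p = 0" and T: "T \<in> Th"
  obtains c where "\<And>x. x \<in> T \<Longrightarrow> p T x = c"
proof -
  interpret V: vertices "verts T" by (rule verts[OF T])
  have eq: "convex hull (verts T) = T" by (rule verts[OF T])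
  obtain \<pi> where \<pi>: "\<pi> \<in> Pol l UNIV" "p T = trunc T \<pi>" by (rule P_spaceE[OF Q_mem[OF p T] subspace_UNIV])
  obtain c where c: "c \<in> verts T" using V.other_vertex by blast
  have C1: "C1 \<pi>" by (rule C1_Pol[OF \<pi>(1)])
  \<comment> \<open>One degree from the coordinate and \<open>l - 1\<close> from the gradient give
    degree \<open>l\<close>, as \<open>Vp_radial\<close> requires.\<close>
  define r where "r a x = V.bl a x * ((c - a) \<bullet> grad \<pi> x)" for a x
  define b where "b x = (\<Sum>a\<in>verts T. r a x *\<^sub>R (x - a))" for x
  have rp: "r a \<in> Pol l UNIV" for a
  proof -
    have "(\<lambda>x. \<Sum>i\<in>UNIV. (c - a) $ i *\<^sub>R partial i \<pi> x) \<in> Pol (l - 1) UNIV"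
      by (intro Pol_sum Pol_scale Pol_partial \<pi>) auto
    then have "(\<lambda>x. (c - a) \<bullet> grad \<pi> x) \<in> Pol (l - 1) UNIV" by (simp add: inner_vec_def grad_def)
    from Pol_times[OF V.Pol_bl this, of a] show ?thesis unfolding r_def by simp
  qed
  have bV: "b \<in> Vp" unfolding b_def by (intro Vp_sum Vp_radial rp)
  define P where "P S = (if S = T then b else (\<lambda>_. 0))" for S
  have PV: "P S \<in> Vp" for S using bV subspace_0[OF subspace_Vp] by (simp add: P_def zero_fun_def)
  \<comment> \<open>On the facet opposite \<open>d\<close> the term of \<open>d\<close> vanishes
    with its coordinate, and for every other vertex \<open>a\<close> the vector \<open>x - a\<close>
    is tangent to the facet.\<close>
  have btr: "nF F \<bullet> b x = 0" if F: "F facet_of T" and x: "x \<in> F" for F x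
  proof -
    obtain d where d: "d \<in> verts T" "F = V.facet d" "outward_normal T F = V.nrm d" by (rule facetE[OF T F])
    have xd: "x \<in> V.facet d" using x d(2) by simp
    have "r a x * (V.nrm d \<bullet> (x - a)) = 0" if a: "a \<in> verts T" for a
    proof (cases "a = d")
      case True
      then show ?thesis using xd V.bl_facet_convex[OF d(1)] by (simp add: r_def)
    next
      case False
      then have "a \<in> V.facet d" using V.vertex_in_facet[OF d(1) a] by simp
      then show ?thesis using V.nrm_perp[OF d(1) _ xd] by simp
    qed
    then have "V.nrm d \<bullet> b x = 0" unfolding b_def inner_sum_right inner_scaleR_right by (intro sum.neutral ballI)
    then show ?thesis using nF_cases[OF T F] d(3) by auto
  qed
  have fV: "field P \<in> V"
    by (rule field_in_V[where g = "\<lambda>_. 0", OF PV]) (auto simp: P_def intro: btr)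
  have "0 = mesh_ip Th (\<lambda>T. divg (field P T)) p" using z[OF fV] by simp
  also have "\<dots> = (\<Sum>S\<in>Th. LINT x|lebesgue_on S. divg (P S) x * p S x)"
    unfolding mesh_ip_divg[OF fV econt_Q[OF p]] by (intro sum.cong refl) (simp add: vrep_field[OF fV PV])
  also have "\<dots> = (LINT x|lebesgue_on T. divg b x * p T x)"
  proof -
    have d0: "divg (\<lambda>_::real^'n. 0) x = 0" for x
      by (simp add: divg_def) (auto intro!: sum.neutral simp: partial_eq[where f' = "\<lambda>_. 0"])
    have "(LINT x|lebesgue_on S. divg (P S) x * p S x) = (if S = T then LINT x|lebesgue_on T. divg b x * p T x else 0)" for S
      by (simp add: P_def d0)
    then show ?thesis using T finite_Th by simp
  qed
  also have "\<dots> = (LINT x|lebesgue_on T. \<pi> x * divg b x)"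
    by (intro Bochner_Integration.integral_cong refl) (simp add: \<pi>(2))
  finally have "(LINT x|lebesgue_on T. \<pi> x * divg b x) = 0" by simp
  moreover have "(\<Sum>F | F facet_of T. face_integral F (outward_normal T F) (\<lambda>x. \<pi> x * (outward_normal T F \<bullet> b x))) = 0"
  proof (intro sum.neutral ballI)
    fix F assume "F \<in> {F. F facet_of T}"
    then have F: "F facet_of T" by simp
    have "face_integral F (outward_normal T F) (\<lambda>x. \<pi> x * (outward_normal T F \<bullet> b x)) = face_integral F (outward_normal T F) (\<lambda>x. 0 * 1)"
      using btr[OF F] nF_cases[OF T F]
      by (intro facet_functional(3)[OF T F] continuous_intros C1_continuous[OF C1] Pol_continuous[OF Vp_Pol[OF bV]]) auto
    also have "\<dots> = 0" by (subst facet_functional(2)[OF T F]) auto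
    finally show "face_integral F (outward_normal T F) (\<lambda>x. \<pi> x * (outward_normal T F \<bullet> b x)) = 0" .
  qed
  ultimately have gb: "(LINT x|lebesgue_on T. grad \<pi> x \<bullet> b x) = 0"
    using element_ibp[OF T Vp_Pol[OF bV] C1] by simp
  have form: "grad \<pi> x \<bullet> b x = (\<Sum>a\<in>verts T. V.bl a x * (grad \<pi> x \<bullet> (x - a))\<^sup>2)" for x
  proof -
    have "(\<Sum>a\<in>verts T. V.bl a x *\<^sub>R (x - a)) = 0"
      by (simp add: scaleR_right_diff_distrib sum_subtractf V.bl_repr V.bl_sum flip: scaleR_sum_left)
    then have z: "(\<Sum>a\<in>verts T. V.bl a x * (grad \<pi> x \<bullet> (x - a))) = 0"
      by (metis (no_types, lifting) inner_scaleR_right inner_sum_right inner_zero_right sum.cong)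
    have "grad \<pi> x \<bullet> b x = (\<Sum>a\<in>verts T. V.bl a x * ((grad \<pi> x \<bullet> (x - a)) - (grad \<pi> x \<bullet> (x - c))) * (grad \<pi> x \<bullet> (x - a)))"
      unfolding b_def r_def inner_sum_right by (intro sum.cong refl) (simp add: inner_commute inner_diff_right inner_diff_left algebra_simps)
    also have "\<dots> = (\<Sum>a\<in>verts T. V.bl a x * (grad \<pi> x \<bullet> (x - a))\<^sup>2) - (grad \<pi> x \<bullet> (x - c)) * (\<Sum>a\<in>verts T. V.bl a x * (grad \<pi> x \<bullet> (x - a)))"
      by (simp add: sum_distrib_left sum_subtractf[symmetric] power2_eq_square algebra_simps)
    finally show ?thesis by (simp add: z)
  qed
  have zero: "grad \<pi> x \<bullet> b x = 0" if x: "x \<in> T" for x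
  proof (rule zero_integral_imp_zero[where f = "\<lambda>x. grad \<pi> x \<bullet> b x", OF compact_elem[OF T] convex_elem[OF T] interior_elem_nonempty[OF T]])
    show "continuous_on T (\<lambda>x. grad \<pi> x \<bullet> b x)"
      by (intro continuous_intros C1_grad_continuous[OF C1] Pol_continuous[OF Vp_Pol[OF bV]])
    show "0 \<le> grad \<pi> y \<bullet> b y" if "y \<in> T" for y
      unfolding form using that V.in_T unfolding eq by (intro sum_nonneg mult_nonneg_nonneg) auto
  qed (use gb x in auto)
  \<comment> \<open>In the interior all weights are positive, so the gradient is orthogonal to every
    \<open>x - a\<close> and hence to all edges from \<open>c\<close>.\<close>
  have gz: "grad \<pi> x = 0" if x: "x \<in> interior T" for x
  proof -
    have pos: "0 < V.bl a x" if "a \<in> verts T" for a using x that V.interior_T unfolding eq by blast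
    have "x \<in> T" using x interior_subset by blast
    from zero[OF this] have s0: "(\<Sum>a\<in>verts T. V.bl a x * (grad \<pi> x \<bullet> (x - a))\<^sup>2) = 0" unfolding form .
    have nn: "0 \<le> V.bl a x * (grad \<pi> x \<bullet> (x - a))\<^sup>2" if "a \<in> verts T" for a
      using less_imp_le[OF pos[OF that]] by (intro mult_nonneg_nonneg) auto
    have E: "grad \<pi> x \<bullet> (x - a) = 0" if a: "a \<in> verts T" for a
    proof -
      have "V.bl a x * (grad \<pi> x \<bullet> (x - a))\<^sup>2 = 0"
        by (rule iffD1[OF sum_nonneg_eq_0_iff[OF V.finite_C nn] s0, THEN bspec, OF _ a])
      then show ?thesis using pos[OF a] by simp
    qed
    show ?thesis
    proof (rule V.edges_span[OF c])
      fix a assume "a \<in> verts T"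
      from E[OF this] E[OF c] show "grad \<pi> x \<bullet> (c - a) = 0" by (simp add: inner_diff_right)
    qed
  qed
  have pz: "partial j \<pi> x = 0" for j x
  proof (rule Pol_identity[OF Pol_partial[OF \<pi>(1) subspace_UNIV] open_interior interior_elem_nonempty[OF T]])
    fix y assume "y \<in> interior T"
    from gz[OF this] show "partial j \<pi> y = 0" by (simp add: grad_def vec_eq_iff)
  qed
  have "(\<pi> has_derivative (\<lambda>h. 0)) (at x within UNIV)" for x
    using partial_has_derivative[OF Pol_differentiable[OF \<pi>(1)], of x] by (simp add: pz)
  then obtain e where "\<And>x. \<pi> x = e" using has_derivative_zero_constant[OF convex_UNIV, of \<pi>] by auto
  then show ?thesis using that \<pi>(2) by auto
qed

text \<open>The lowest order Raviart-Thomas field: \<open>x - a\<close> is tangent to the facets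
  through \<open>a\<close>, and its product with the normal of the opposite facet is the height. The
  condition on \<open>l\<close> makes the constant coefficient available.\<close>

lemma face_bubble:
  assumes T: "T \<in> Th" and F: "F facet_of T" and l: "0 \<le> l"
  obtains b where "b \<in> Vp" "\<And>x. x \<in> F \<Longrightarrow> outward_normal T F \<bullet> b x = 1"
    "\<And>G x. G facet_of T \<Longrightarrow> G \<noteq> F \<Longrightarrow> x \<in> G \<Longrightarrow> outward_normal T G \<bullet> b x = 0"
    "(LINT x|lebesgue_on T. divg b x) = face_integral F (nF F) (\<lambda>x. 1)"
proof -
  interpret V: vertices "verts T" by (rule verts[OF T])
  obtain a where a: "a \<in> verts T" "F = V.facet a" "outward_normal T F = V.nrm a" by (rule facetE[OF T F])
  define b where "b x = (1 / V.height a) *\<^sub>R (x - a)" for x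
  have "(\<lambda>x. 1 / V.height a) \<in> Pol l (UNIV :: real set)" using Pol_const[of l "1 / V.height a" UNIV] l by simp
  then have bV: "b \<in> Vp" unfolding b_def by (rule Vp_radial)
  have 1: "outward_normal T F \<bullet> b x = 1" if x: "x \<in> F" for x
  proof -
    have "V.bl a x = 0" using x a V.bl_facet_convex[OF a(1)] by blast
    then have "V.bg a \<bullet> (x - a) = - 1" using V.bl_diff[of a x a] V.bl_vertex[OF a(1) a(1)] by simp
    then have "- (1 / V.height a) * (V.nrm a \<bullet> (x - a)) = - 1" unfolding V.bg_nrm[OF a(1)] by simp
    then show ?thesis unfolding a(3) b_def by simp
  qed
  have 0: "outward_normal T G \<bullet> b x = 0" if G: "G facet_of T" "G \<noteq> F" and x: "x \<in> G" for G x
  proof -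
    obtain d where d: "d \<in> verts T" "G = V.facet d" "outward_normal T G = V.nrm d" by (rule facetE[OF T G(1)])
    have "a \<noteq> d" using G(2) a(2) d(2) by blast
    then have "a \<in> V.facet d" using V.vertex_in_facet[OF d(1) a(1)] by simp
    then have "V.nrm d \<bullet> (x - a) = 0" using V.nrm_perp[OF d(1)] x d(2) by blast
    then show ?thesis unfolding d(3) b_def by simp
  qed
  have C: "C1 (\<lambda>x::real^'n. 1)" by (rule C1_Pol[OF Pol_const[of 0]]) auto
  have g0: "grad (\<lambda>x::real^'n. 1) x = 0" for x by (simp add: grad_def vec_eq_iff) (auto intro!: partial_eq[THEN trans])
  have cb: "continuous_on S (\<lambda>x. 1 * (n \<bullet> b x))" for S n
    by (intro continuous_intros Pol_continuous[OF Vp_Pol[OF bV]])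
  have "(LINT x|lebesgue_on T. divg b x) =
      (\<Sum>G | G facet_of T. face_integral G (outward_normal T G) (\<lambda>x. 1 * (outward_normal T G \<bullet> b x)))"
    using element_ibp[OF T Vp_Pol[OF bV] C] by (simp add: g0)
  also have "\<dots> = (\<Sum>G | G facet_of T. if G = F then face_integral F (nF F) (\<lambda>x. 1) else 0)"
  proof (intro sum.cong refl)
    fix G assume "G \<in> {G. G facet_of T}"
    then have G: "G facet_of T" by simp
    have c: "face_integral G (outward_normal T G) (\<lambda>x. 1 * (outward_normal T G \<bullet> b x)) =
        face_integral G (outward_normal T G) (\<lambda>x. (if G = F then 1 else 0) * 1)"
      using 1 0[OF G] by (intro facet_functional(3)[OF T G cb]) auto
    show "face_integral G (outward_normal T G) (\<lambda>x. 1 * (outward_normal T G \<bullet> b x)) =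
        (if G = F then face_integral F (nF F) (\<lambda>x. 1) else 0)"
      unfolding c facet_functional(2)[OF T G continuous_on_const] face_integral_nF[OF T G continuous_on_const] by simp
  qed
  also have "\<dots> = face_integral F (nF F) (\<lambda>x. 1)" using F finite_facets[OF T] by simp
  finally show ?thesis using that bV 1 0 by blast
qed

text \<open>On each element the pressure is constant, the constants agree across interior faces, and
  the zero mean removes the common value. This is the inf-sup condition without a quantitative
  constant.\<close>

lemma inf_sup:
  assumes p: "p \<in> Q" and z: "\<And>v. v \<in> V \<Longrightarrow> mesh_ip Th (\<lambda>T. divg (v T)) p = 0"
  shows "p = 0"
proof -
  define c where "c T = (SOME c. \<forall>x\<in>T. p T x = c)" for T
  have c: "p T x = c T" if T: "T \<in> Th" and x: "x \<in> T" for T x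
  proof -
    have "\<exists>c. \<forall>x\<in>T. p T x = c"
    proof (rule pressure_constant[OF p z T])
      fix d assume "\<And>x. x \<in> T \<Longrightarrow> p T x = d"
      then show ?thesis by blast
    qed
    from someI_ex[OF this] show ?thesis using x unfolding c_def by blast
  qed
  have p0: "p T x = 0" if "T \<notin> Th \<or> x \<notin> T" for T x
  proof (cases "T \<in> Th")
    case True
    obtain \<pi> where "p T = trunc T \<pi>" by (rule P_spaceE[OF Q_mem[OF p True] subspace_UNIV])
    then show ?thesis using True that by simp
  next
    case False
    then show ?thesis using p by (simp add: Q_space_def family_space_def)
  qed
  have cc: "c (posT F) = c (negT F)" if F: "F \<in> interior_faces \<Omega> Th" and l: "0 \<le> l" for F
  proof -
    note pm = plus_minus[OF F]
    obtain b where b: "b \<in> Vp" "\<And>x. x \<in> F \<Longrightarrow> outward_normal (posT F) F \<bullet> b x = 1"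
      "\<And>G x. G facet_of posT F \<Longrightarrow> G \<noteq> F \<Longrightarrow> x \<in> G \<Longrightarrow> outward_normal (posT F) G \<bullet> b x = 0"
      "(LINT x|lebesgue_on (posT F). divg b x) = face_integral F (nF F) (\<lambda>x. 1)"
      by (rule face_bubble[OF pm(1,2) l]) blast
    obtain d where d: "d \<in> Vp" "\<And>x. x \<in> F \<Longrightarrow> outward_normal (negT F) F \<bullet> d x = 1"
      "\<And>G x. G facet_of negT F \<Longrightarrow> G \<noteq> F \<Longrightarrow> x \<in> G \<Longrightarrow> outward_normal (negT F) G \<bullet> d x = 0"
      "(LINT x|lebesgue_on (negT F). divg d x) = face_integral F (nF F) (\<lambda>x. 1)"
      by (rule face_bubble[OF pm(4,5) l]) blast
    \<comment> \<open>The outward normals of the two elements are opposite, so the sign change on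
      the minus side makes the normal components agree: unit flux density passes through
      \<open>F\<close> and none through any other face.\<close>
    define P where "P S = (if S = posT F then b else if S = negT F then (-1) *\<^sub>R d else 0)" for S
    have PV: "P S \<in> Vp" for S
      using b(1) subspace_scale[OF subspace_Vp d(1), of "-1"] subspace_0[OF subspace_Vp] unfolding P_def by (simp split: if_split)
    have tr: "nF G \<bullet> P S x = (if G = F then 1 else 0)" if S: "S \<in> Th" and G: "G facet_of S" and x: "x \<in> G" for S G x
    proof (cases "S = posT F \<or> S = negT F")
      case True
      consider "S = posT F" "G = F" | "S = negT F" "G = F" | "S = posT F" "G \<noteq> F" | "S = negT F" "G \<noteq> F" using True by blast
      then show ?thesis
      proof cases
        case 1
        then show ?thesis using b(2) x pm(3) by (simp add: P_def)
      next
        case 2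
        then show ?thesis using d(2) x pm(6,7) by (simp add: P_def)
      next
        case 3
        then have "outward_normal S G \<bullet> P S x = 0" using b(3) G x by (simp add: P_def)
        then show ?thesis using nF_cases[OF S G] 3 by auto
      next
        case 4
        then have "outward_normal S G \<bullet> P S x = 0" using d(3) G x pm(7) by (simp add: P_def)
        then show ?thesis using nF_cases[OF S G] 4 by auto
      qed
    next
      case False
      then have "G \<noteq> F" using pm(8) S G by blast
      then show ?thesis using False by (simp add: P_def)
    qed
    have fV: "field P \<in> V"
    proof (rule field_in_V[OF PV tr])
      fix G assume "G \<in> boundary_faces \<Omega> Th"
      then have "G \<noteq> F" using F by (auto simp: interior_faces_def)
      then show "(if G = F then 1 else 0) = (0::real)" by simp
    qed
    let ?A = "face_integral F (nF F) (\<lambda>x. 1)"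
    have "0 = mesh_ip Th (\<lambda>T. divg (field P T)) p" using z[OF fV] by simp
    also have "\<dots> = (\<Sum>S\<in>Th. LINT x|lebesgue_on S. divg (P S) x * p S x)"
      unfolding mesh_ip_divg[OF fV econt_Q[OF p]] by (intro sum.cong refl) (simp add: vrep_field[OF fV PV])
    also have "\<dots> = (\<Sum>S\<in>Th. (LINT x|lebesgue_on S. divg (P S) x) * c S)"
    proof (intro sum.cong refl)
      fix S assume S: "S \<in> Th"
      have "(LINT x|lebesgue_on S. divg (P S) x * p S x) = (LINT x|lebesgue_on S. divg (P S) x * c S)"
        by (intro Bochner_Integration.integral_cong refl) (simp add: c[OF S])
      then show "(LINT x|lebesgue_on S. divg (P S) x * p S x) = (LINT x|lebesgue_on S. divg (P S) x) * c S" by simp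
    qed
    also have "\<dots> = (\<Sum>S\<in>{posT F, negT F}. (LINT x|lebesgue_on S. divg (P S) x) * c S)"
    proof (rule sum.mono_neutral_right[OF finite_Th])
      have d0: "divg 0 x = 0" for x :: "real^'n"
        unfolding zero_fun_def by (simp add: divg_def) (auto intro!: sum.neutral simp: partial_eq[where f' = "\<lambda>_. 0"])
      show "\<forall>S\<in>Th - {posT F, negT F}. (LINT x|lebesgue_on S. divg (P S) x) * c S = 0"
        by (simp add: P_def d0)
    qed (use pm in auto)
    also have "\<dots> = ?A * c (posT F) - ?A * c (negT F)"
    proof -
      have "divg ((-1) *\<^sub>R d) x = - divg d x" for x
        using divg_scale[OF Pol_differentiable[OF Vp_Pol[OF d(1)]], of "-1" x] by (simp add: scaleR_fun_def)
      then have "(LINT x|lebesgue_on (negT F). divg (P (negT F)) x) = - ?A"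
        using pm(7) d(4) by (simp add: P_def)
      moreover have "(LINT x|lebesgue_on (posT F). divg (P (posT F)) x) = ?A" using b(4) by (simp add: P_def)
      ultimately show ?thesis using pm(7) by simp
    qed
    finally have "?A * (c (posT F) - c (negT F)) = 0" by (simp only: right_diff_distrib)
    then show ?thesis using face_functional(5)[OF interior_face_mesh[OF F]]
      by (metis eq_iff_diff_eq_0 less_irrefl mult_eq_0_iff)
  qed
  have "p T x = 0" if T: "T \<in> Th" and x: "x \<in> T" for T x
  proof (cases "0 \<le> l")
    case False
    obtain \<pi> where \<pi>: "\<pi> \<in> Pol l UNIV" "p T = trunc T \<pi>" by (rule P_spaceE[OF Q_mem[OF p T] subspace_UNIV])
    have "\<pi> = (\<lambda>x. 0)" using Pol_neg_degree[of l \<pi> UNIV] \<pi>(1) False by auto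
    then show ?thesis unfolding \<pi>(2) by (simp add: trunc_def)
  next
    case True
    let ?m = "\<lambda>S. LINT x|lebesgue_on S. (1::real)"
    have same: "c S = c T" if "S \<in> Th" for S by (rule piecewise_constant[OF cc[OF _ True] that T])
    have nn: "0 \<le> ?m S" for S :: "(real^'n) set" by (rule Bochner_Integration.integral_nonneg) simp
    have "0 = (\<Sum>S\<in>Th. LINT x|lebesgue_on S. p S x)" using p by (simp add: Q_space_def)
    also have "\<dots> = (\<Sum>S\<in>Th. c T * ?m S)"
    proof (intro sum.cong refl)
      fix S assume S: "S \<in> Th"
      have "(LINT x|lebesgue_on S. p S x) = (LINT x|lebesgue_on S. c T * 1)"
        by (intro Bochner_Integration.integral_cong refl) (simp add: c[OF S] same[OF S])
      then show "(LINT x|lebesgue_on S. p S x) = c T * ?m S" by simp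
    qed
    finally have "c T * (\<Sum>S\<in>Th. ?m S) = 0" by (simp add: sum_distrib_left)
    moreover have "(\<Sum>S\<in>Th. ?m S) \<noteq> 0"
    proof
      assume "(\<Sum>S\<in>Th. ?m S) = 0"
      then have m0: "?m T = 0" using sum_nonneg_eq_0_iff[OF finite_Th, of ?m] nn T by blast
      have "(1::real) = 0"
        by (rule zero_integral_imp_zero[OF compact_elem[OF T] convex_elem[OF T] interior_elem_nonempty[OF T] _ _ m0 x]) auto
      then show False by simp
    qed
    ultimately show ?thesis using c[OF T x] by simp
  qed
  then show "p = 0" using p0 by (intro ext) (metis zero_fun_apply)
qed

end

section \<open>The kernel of the weak deviatoric gradient\<close>

definition outer :: "real^'n \<Rightarrow> real^'n \<Rightarrow> real^'n^'n" where
  "outer u v = (\<chi> r s. u $ r * v $ s)"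

lemma inner_outer: "A \<bullet> outer u v = u \<bullet> (A *v v)"
  by (simp add: inner_vec_def outer_def matrix_vector_mult_def sum_distrib_left mult_ac)

lemma outer_apply: "outer u v *v w = (v \<bullet> w) *\<^sub>R u"
  by (simp add: vec_eq_iff inner_vec_def outer_def matrix_vector_mult_def sum_distrib_left mult_ac)

lemma trace_outer: "trace (outer u v) = u \<bullet> v"
  by (simp add: inner_vec_def outer_def trace_def)

context vertices
begin

text \<open>The vector \<open>j - i\<close> is orthogonal to all facet normals but those opposite
  \<open>i\<close> and \<open>j\<close>, and \<open>bg j\<close> is normal to the facet opposite
  \<open>j\<close>. The tangential-normal component of either term therefore lives on the facet
  opposite \<open>i\<close> only; each term has trace 1, so the difference is traceless.\<close>

definition edge_matrix :: "real^'n \<Rightarrow> real^'n \<Rightarrow> real^'n \<Rightarrow> real^'n^'n" where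
  "edge_matrix i j m = outer (bg j) (j - i) - outer (bg m) (m - i)"

lemma edge_matrix_traceless:
  assumes "i \<in> C" "j \<in> C" "m \<in> C" "i \<noteq> j" "i \<noteq> m"
  shows "edge_matrix i j m \<in> traceless"
proof -
  have "trace (edge_matrix i j m) = bg j \<bullet> (j - i) - bg m \<bullet> (m - i)"
    unfolding edge_matrix_def trace_outer[symmetric] by (simp add: trace_def sum_subtractf)
  then show ?thesis using bg_edge[OF assms(2,2,1)] bg_edge[OF assms(3,3,1)] assms by (simp add: traceless_def)
qed

lemma edge_nrm:
  assumes "i \<in> C" "j \<in> C" "c \<in> C" "i \<noteq> j"
  shows "(j - i) \<bullet> nrm c = (if c = i then height i else if c = j then - height j else 0)"
proof -
  have h: "0 < height c" by (rule height_pos[OF assms(3)])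
  have "bg c \<bullet> (j - i) = - (1 / height c) * (nrm c \<bullet> (j - i))"
    using arg_cong[OF bg_nrm[OF assms(3)], of "\<lambda>v. v \<bullet> (j - i)"] unfolding inner_scaleR_left .
  then have "(j - i) \<bullet> nrm c = - height c * (bg c \<bullet> (j - i))" using h by (simp add: field_simps inner_commute)
  then show ?thesis using bg_edge[OF assms(3,2,1)] assms(4) by auto
qed

lemma edge_matrix_apply:
  "edge_matrix i j m *v n = ((j - i) \<bullet> n) *\<^sub>R bg j - ((m - i) \<bullet> n) *\<^sub>R bg m"
  unfolding edge_matrix_def matrix_vector_mult_diff_rdistrib outer_apply ..

lemma tangential_bg: "c \<in> C \<Longrightarrow> tangential (nrm c) (bg c) = 0"
  using norm_nrm[of c] bg_nrm[of c] by (simp add: tangential_def dot_square_norm)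

lemma tangential_edge_matrix:
  assumes "i \<in> C" "j \<in> C" "m \<in> C" "i \<noteq> j" "i \<noteq> m" "c \<in> C"
  shows "c \<noteq> i \<Longrightarrow> tangential (nrm c) (edge_matrix i j m *v nrm c) = 0"
    and "edge_matrix i j m *v nrm i = height i *\<^sub>R (bg j - bg m)"
  unfolding edge_matrix_apply edge_nrm[OF assms(1,2,6,4)] edge_nrm[OF assms(1,3,6,5)]
    edge_nrm[OF assms(1,2,1,4)] edge_nrm[OF assms(1,3,1,5)]
  using tangential_bg[OF assms(2)] tangential_bg[OF assms(3)]
  by (auto simp: tangential_diff tangential_scale scaleR_diff_right tangential_def[of _ 0])

text \<open>The products with the gradients of the vertices other than \<open>i\<close> are equal,
  and since all gradients sum to 0 and the product with \<open>bg i\<close> vanishes, their sum is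
  0.\<close>

lemma normal_determined:
  assumes i: "i \<in> C" and w: "w \<bullet> bg i = 0" "\<And>j m. j \<in> C - {i} \<Longrightarrow> m \<in> C - {i} \<Longrightarrow> j \<noteq> m \<Longrightarrow> w \<bullet> bg j = w \<bullet> bg m"
  shows "w = 0"
proof -
  obtain m where m: "m \<in> C" "m \<noteq> i" by (rule other_vertex)
  have "0 = (\<Sum>j\<in>C. w \<bullet> bg j)" by (simp add: bg_sum flip: inner_sum_right)
  also have "\<dots> = (\<Sum>j\<in>C - {i}. w \<bullet> bg j)" using i finite_C w(1) by (simp add: sum.remove)
  also have "\<dots> = (\<Sum>j\<in>C - {i}. w \<bullet> bg m)" using w(2)[of _ m] m by (intro sum.cong refl) blast
  also have "\<dots> = real (card (C - {i})) * (w \<bullet> bg m)" by simp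
  finally have "real (card (C - {i})) * (w \<bullet> bg m) = 0" ..
  moreover have "card (C - {i}) \<noteq> 0" using m finite_C by auto
  ultimately have wm: "w \<bullet> bg m = 0" by simp
  have "bg j \<bullet> w = 0" if "j \<in> C" for j
    using w wm m that by (cases "j = i \<or> j = m") (auto simp: inner_commute)
  then show ?thesis using bg_repr[of w] by simp
qed

text \<open>Orthogonality makes \<open>bg j \<bullet> (A *v (j - i))\<close> independent of
  \<open>j\<close>. Together with the vanishing sum of the gradients this determines the action of
  \<open>A\<close> on all edges: it is multiplication by one number.\<close>

lemma edge_matrices_span:
  assumes tr: "trace A = 0"
    and A: "\<And>i j m. i \<in> C \<Longrightarrow> j \<in> C \<Longrightarrow> m \<in> C \<Longrightarrow> i \<noteq> j \<Longrightarrow> i \<noteq> m \<Longrightarrow> j \<noteq> m \<Longrightarrow> A \<bullet> edge_matrix i j m = 0"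
  shows "A = 0"
proof -
  \<comment> \<open>The common value at the vertex \<open>i\<close>, read off at an arbitrary other
    vertex.\<close>
  define e where "e i = (let j = (SOME j. j \<in> C \<and> j \<noteq> i) in bg j \<bullet> (A *v (j - i)))" for i
  have e: "bg j \<bullet> (A *v (j - i)) = e i" if "i \<in> C" "j \<in> C" "j \<noteq> i" for i j
  proof -
    define m where "m = (SOME j. j \<in> C \<and> j \<noteq> i)"
    have m: "m \<in> C \<and> m \<noteq> i" unfolding m_def by (rule someI[of _ j]) (use that in blast)
    have "bg j \<bullet> (A *v (j - i)) = bg m \<bullet> (A *v (m - i))"
    proof (cases "j = m")
      case False
      then have "A \<bullet> edge_matrix i j m = 0" using A that m by blast
      then show ?thesis by (simp add: edge_matrix_def inner_diff_right inner_outer)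
    qed simp
    then show ?thesis unfolding e_def m_def Let_def .
  qed
  \<comment> \<open>An edge between two vertices is written as a difference of edges that start at
    them and end at \<open>j\<close>, which reduces all entries to the common values.\<close>
  have val: "bg j \<bullet> (A *v (m - i)) = (if j = i then - e m else if j = m then e i else e i - e m)"
    if "i \<in> C" "j \<in> C" "m \<in> C" "i \<noteq> m" for i j m
  proof -
    have "A *v (m - i) = - (A *v (i - m))"
      by (simp flip: matrix_vector_minus)
    moreover have "A *v (m - i) = A *v (j - i) - A *v (j - m)"
      by (simp flip: matrix_vector_mult_diff_distrib)
    moreover have "bg m \<bullet> (A *v (m - i)) = e i" "bg i \<bullet> (A *v (i - m)) = e m" using e that by blast+
    moreover have "bg j \<bullet> (A *v (j - i)) = e i" "bg j \<bullet> (A *v (j - m)) = e m" if "j \<noteq> i" "j \<noteq> m"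
      using e \<open>j \<in> C\<close> \<open>i \<in> C\<close> \<open>m \<in> C\<close> that by blast+
    ultimately show ?thesis by (metis inner_diff_right inner_minus_right)
  qed
  \<comment> \<open>Summing the entries over \<open>j\<close> gives 0 on one side and a positive
    multiple of \<open>e i - e m\<close> on the other.\<close>
  have ee: "e m = e i" if im: "i \<in> C" "m \<in> C" "i \<noteq> m" for i m
  proof -
    have "0 = (\<Sum>j\<in>C. bg j \<bullet> (A *v (m - i)))" by (simp add: bg_sum flip: inner_sum_left)
    also have "\<dots> = (\<Sum>j\<in>C. if j = i then - e m else if j = m then e i else e i - e m)"
      by (intro sum.cong refl val im)
    also have "\<dots> = - e m + (e i + (\<Sum>j\<in>C - {i} - {m}. e i - e m))"
      using im finite_C by (simp add: sum.remove[of C i] sum.remove[of "C - {i}" m])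
    also have "\<dots> = (1 + real (card (C - {i} - {m}))) * (e i - e m)" by (simp add: algebra_simps)
    finally show ?thesis by (metis add_nonneg_pos add.commute eq_iff_diff_eq_0 less_irrefl mult_eq_0_iff of_nat_0_le_iff zero_less_one)
  qed
  obtain i where i: "i \<in> C" using other_vertex by blast
  \<comment> \<open>On the edges at \<open>i\<close> the matrix acts as multiplication by
    \<open>e i\<close>; row by row it is then a multiple of the identity, and its trace forces the
    factor to be 0.\<close>
  have "A $ r = e i *\<^sub>R axis r 1" for r
  proof -
    have "(A $ r - e i *\<^sub>R axis r 1) = 0"
    proof (rule edges_span[OF i])
      fix m assume m: "m \<in> C"
      show "(A $ r - e i *\<^sub>R axis r 1) \<bullet> (i - m) = 0"
      proof (cases "m = i")
        case False
        let ?w = "A *v (i - m) - e i *\<^sub>R (i - m)"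
        have "bg j \<bullet> ?w = 0" if j: "j \<in> C" for j
          using val[of m j i] ee[of i m] bg_edge[OF j i m] i m j False by (auto simp: inner_diff_right)
        then have "?w = 0" using bg_repr[of ?w] by simp
        then have "?w $ r = 0" by simp
        then have "(A $ r) \<bullet> (i - m) = e i * (i - m) $ r"
          by (simp add: matrix_vector_mult_def inner_vec_def)
        then show ?thesis by (simp only: inner_diff_left inner_scaleR_left inner_axis' inner_real_def mult_1 diff_self)
      qed simp
    qed
    then show ?thesis by simp
  qed
  then have A: "A = e i *\<^sub>R mat 1" by (simp add: vec_eq_iff mat_def axis_def)
  have "e i * real CARD('n) = 0" using tr by (simp add: A trace_def mat_def)
  then show ?thesis using A by simp
qed

end

section \<open>The weak gradient tested with scalar multiples of a constant matrix\<close>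

definition jac :: "(real^'n \<Rightarrow> real^'n) \<Rightarrow> real^'n \<Rightarrow> real^'n^'n" where
  "jac P x = (\<chi> i j. partial j P x $ i)"

lemma jac_Pol: "P \<in> Pol k UNIV \<Longrightarrow> (\<lambda>x. jac P x \<bullet> M) \<in> Pol (k - 1) UNIV"
proof -
  assume P: "P \<in> Pol k UNIV"
  have "(\<lambda>x. \<Sum>i\<in>UNIV. \<Sum>j\<in>UNIV. (M $ i $ j) *\<^sub>R (partial j P x $ i)) \<in> Pol (k - 1) UNIV"
    by (intro Pol_sum Pol_scale Pol_nth Pol_partial P) auto
  then show ?thesis by (simp add: inner_vec_def jac_def mult.commute)
qed

lemma row_div_matrix:
  fixes q :: "real^'n \<Rightarrow> real" and M :: "real^'n^'n"
  assumes "q differentiable (at x)"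
  shows "row_div (\<lambda>x. q x *\<^sub>R M) x = M *v grad q x"
proof -
  have "partial j (\<lambda>x. q x *\<^sub>R M) x = partial j q x *\<^sub>R M" for j
    by (rule partial_linear[OF assms, of "\<lambda>r. r *\<^sub>R M"]) (rule bounded_linear_scaleR_left)
  then show ?thesis
    by (simp add: row_div_def matrix_vector_mult_def grad_def vec_eq_iff mult.commute)
qed

lemma linear_vector_matrix: "linear (\<lambda>v::real^'n. v v* (M :: real^'n^'n))"
  by (intro linearI) (simp_all add: vector_matrix_mult_def vec_eq_iff algebra_simps sum.distrib sum_distrib_left)

lemma divg_matrix:
  fixes P :: "real^'n \<Rightarrow> real^'n" and M :: "real^'n^'n"
  assumes "P differentiable (at x)"
  shows "divg (\<lambda>x. P x v* M) x = jac P x \<bullet> M"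
proof -
  have "partial j (\<lambda>x. P x v* M) x = partial j P x v* M" for j
    using partial_linear[OF assms, of "\<lambda>v. v v* M"] linear_vector_matrix linear_conv_bounded_linear by blast
  then have "divg (\<lambda>x. P x v* M) x = (\<Sum>j\<in>UNIV. \<Sum>i\<in>UNIV. M $ i $ j * partial j P x $ i)"
    by (simp add: divg_def vector_matrix_mult_def mult.commute)
  also have "\<dots> = jac P x \<bullet> M"
    unfolding inner_vec_def jac_def by (subst sum.swap) (simp add: mult.commute)
  finally show ?thesis .
qed

context mesh
begin

text \<open>Integration by parts of the volume term produces the full trace of \<open>P\<close> on
  the facets. Its normal component cancels against the normal part of \<open>rhs\<close>, and its
  tangential component joins the multiplier as the mismatch \<open>\<mu> F x - P x\<close>.\<close>

lemma rhs_scalar: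
  assumes T: "T \<in> Th" and a: "admissible v \<mu>" and P: "P \<in> Pol d UNIV" "v T = trunc T P" and q: "q \<in> Pol k UNIV"
  shows "rhs v \<mu> T (trunc T (\<lambda>x. q x *\<^sub>R M)) = (LINT x|lebesgue_on T. q x * (jac P x \<bullet> M)) +
    (\<Sum>F | F facet_of T. nint T F (\<lambda>x. q x * ((\<mu> F x - P x) \<bullet> tangential (outward_normal T F) (M *v outward_normal T F))))"
proof -
  let ?t = "\<lambda>x. q x *\<^sub>R M"
  have cm: "continuous_on F (\<mu> F)" for F using a by (simp add: admissible_def)
  have cv: "continuous_on T (v T)" using a T by (simp add: admissible_def)
  have tP: "?t \<in> Pol k UNIV"
    by (rule Pol_linear_image[OF _ _ q, of "\<lambda>r. r *\<^sub>R M"]) (auto intro!: linearI simp: scaleR_left_distrib)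
  have wP: "(\<lambda>x. P x v* M) \<in> Pol d UNIV" by (rule Pol_linear_image[OF linear_vector_matrix _ P(1)]) simp
  have cq: "continuous_on S q" "continuous_on S P" for S using Pol_continuous q P(1) by blast+
  have i1: "ip T (v T) (row_div (trunc T ?t)) = (LINT x|lebesgue_on T. grad q x \<bullet> (P x v* M))"
  proof -
    have "ip T (v T) (row_div (trunc T ?t)) = ip T (v T) (row_div ?t)" by (rule ip_row_div[OF T cv tP])
    also have "\<dots> = (LINT x|lebesgue_on T. grad q x \<bullet> (P x v* M))"
      unfolding ip_def
    proof (intro Bochner_Integration.integral_cong refl)
      fix x assume "x \<in> space (lebesgue_on T)"
      then have "v T x = P x" by (simp add: P(2))
      then show "v T x \<bullet> row_div ?t x = grad q x \<bullet> (P x v* M)"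
        unfolding row_div_matrix[OF Pol_differentiable[OF q]] by (simp add: dot_lmul_matrix inner_commute[of "grad q x"])
    qed
    finally show ?thesis .
  qed
  have ibp: "(LINT x|lebesgue_on T. q x * (jac P x \<bullet> M)) + (LINT x|lebesgue_on T. grad q x \<bullet> (P x v* M)) =
      (\<Sum>F | F facet_of T. nint T F (\<lambda>x. q x * (outward_normal T F \<bullet> (P x v* M))))"
    using element_ibp[OF T wP C1_Pol[OF q]] unfolding nint_def divg_matrix[OF Pol_differentiable[OF P(1)]] .
  have face: "normal_part T F (v T) (trunc T ?t) + tangential_part T F (\<mu> F) (trunc T ?t) =
      nint T F (\<lambda>x. q x * (outward_normal T F \<bullet> (P x v* M))) +
      nint T F (\<lambda>x. q x * ((\<mu> F x - P x) \<bullet> tangential (outward_normal T F) (M *v outward_normal T F)))"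
    if F: "F facet_of T" for F
  proof -
    let ?n = "outward_normal T F"
    note N = nint_linear[OF T F]
    have inT: "x \<in> T" if "x \<in> F" for x using facet_subset_elem[OF F] that by blast
    have c: "continuous_on F (\<lambda>x. q x * (?n \<bullet> (P x v* M)))" "continuous_on F (\<lambda>x. q x * ((\<mu> F x - P x) \<bullet> tangential ?n (M *v ?n)))"
      "continuous_on F (\<lambda>x. q x * ((?n \<bullet> P x) * (?n \<bullet> (M *v ?n))))" "continuous_on F (\<lambda>x. q x * (\<mu> F x \<bullet> tangential ?n (M *v ?n)))"
      by (intro continuous_intros cq cm Pol_continuous[OF wP])+
    have 1: "normal_part T F (v T) (trunc T ?t) = nint T F (\<lambda>x. q x * ((?n \<bullet> P x) * (?n \<bullet> (M *v ?n))))"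
      unfolding normal_part_def by (rule N(3)[symmetric, OF c(3)]) (simp add: P(2) inT matrix_vector_scaleR)
    have 2: "tangential_part T F (\<mu> F) (trunc T ?t) = nint T F (\<lambda>x. q x * (\<mu> F x \<bullet> tangential ?n (M *v ?n)))"
      unfolding tangential_part_def by (rule N(3)[symmetric, OF c(4)]) (simp add: inT matrix_vector_scaleR tangential_scale)
    \<comment> \<open>The vector \<open>M *v ?n\<close> is split into its normal and tangential
      components.\<close>
    have "?n \<bullet> (y v* M) = (?n \<bullet> y) * (?n \<bullet> (M *v ?n)) + y \<bullet> tangential ?n (M *v ?n)" for y
    proof -
      have "?n \<bullet> (y v* M) = y \<bullet> (M *v ?n)" by (metis dot_lmul_matrix inner_commute)
      then show ?thesis by (simp add: tangential_def inner_diff_right inner_commute[of ?n] mult.commute)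
    qed
    then have eq: "q x * ((?n \<bullet> P x) * (?n \<bullet> (M *v ?n))) + q x * (\<mu> F x \<bullet> tangential ?n (M *v ?n)) =
        q x * (?n \<bullet> (P x v* M)) + q x * ((\<mu> F x - P x) \<bullet> tangential ?n (M *v ?n))" for x
      by (simp add: algebra_simps)
    show ?thesis unfolding 1 2 N(1)[OF c(3,4), symmetric] N(1)[OF c(1,2), symmetric] eq ..
  qed
  have "(\<Sum>F | F facet_of T. normal_part T F (v T) (trunc T ?t)) + (\<Sum>F | F facet_of T. tangential_part T F (\<mu> F) (trunc T ?t)) =
      (\<Sum>F | F facet_of T. nint T F (\<lambda>x. q x * (outward_normal T F \<bullet> (P x v* M)))) +
      (\<Sum>F | F facet_of T. nint T F (\<lambda>x. q x * ((\<mu> F x - P x) \<bullet> tangential (outward_normal T F) (M *v outward_normal T F))))"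
    unfolding sum.distrib[symmetric] by (intro sum.cong refl face) simp
  then show ?thesis unfolding rhs_def i1 using ibp by linarith
qed

end

lemma Pol_values: "subspace W \<Longrightarrow> p \<in> Pol k W \<Longrightarrow> p x \<in> W"
  by (rotate_tac, induction rule: Pol_induct) (auto intro: subspace_0 subspace_add subspace_scale)

section \<open>The kernel on one element and on the mesh\<close>

context fem
begin

lemma subspace_normal: "subspace {w. w \<bullet> nF F = 0}"
  by (auto simp: subspace_def inner_add_left)

lemma Lam_poly:
  assumes "\<mu> \<in> Lam"
  obtains m where "m \<in> Pol (int k) UNIV" "\<And>x. x \<in> F \<Longrightarrow> \<mu> F x = m x"
proof (cases "F \<in> interior_faces \<Omega> Th")
  case True
  then have "\<mu> F \<in> P_space (int k) F {w. w \<bullet> nF F = 0}" using assms by (simp add: Lambda_space_def family_space_def)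
  then obtain m where m: "m \<in> Pol (int k) {w. w \<bullet> nF F = 0}" "\<mu> F = trunc F m" by (rule P_spaceE[OF _ subspace_normal])
  show ?thesis
    by (rule that[of m]) (use m Pol_mono[of "int k" "int k" "{w. w \<bullet> nF F = 0}" UNIV] in auto)
next
  case False
  then have "\<mu> F = (\<lambda>_. 0)" using assms by (simp add: Lambda_space_def family_space_def)
  then show ?thesis using that[of "\<lambda>_. 0"] Pol_0[of "int k" UNIV] by simp
qed

lemma Lam_normal:
  assumes "\<mu> \<in> Lam"
  shows "\<mu> F x \<bullet> nF F = 0"
proof (cases "F \<in> interior_faces \<Omega> Th")
  case True
  then have "\<mu> F \<in> P_space (int k) F {w. w \<bullet> nF F = 0}" using assms by (simp add: Lambda_space_def family_space_def)
  then obtain m where m: "m \<in> Pol (int k) {w. w \<bullet> nF F = 0}" "\<mu> F = trunc F m" by (rule P_spaceE[OF _ subspace_normal])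
  show ?thesis using Pol_values[OF subspace_normal m(1)] by (simp add: m(2) trunc_def)
next
  case False
  then show ?thesis using assms by (simp add: Lambda_space_def family_space_def)
qed

lemma Lam_outside: "\<mu> \<in> Lam \<Longrightarrow> F \<notin> interior_faces \<Omega> Th \<or> x \<notin> F \<Longrightarrow> \<mu> F x = 0"
  by (cases "F \<in> interior_faces \<Omega> Th") (auto simp: Lambda_space_def family_space_def P_space_def)

lemma Lam_continuous: "\<mu> \<in> Lam \<Longrightarrow> continuous_on F (\<mu> F)"
  by (rule Lam_poly[of \<mu> F], assumption) (metis Pol_continuous continuous_on_cong)

lemma admissible: "v \<in> V \<Longrightarrow> \<mu> \<in> Lam \<Longrightarrow> admissible v \<mu>"
  using econt_V Lam_continuous by (simp add: admissible_def econt_def)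

lemma scalar_matrix_P_space:
  assumes "q \<in> Pol (int k) UNIV" "M \<in> traceless"
  shows "trunc T (\<lambda>x::real^'n. q x *\<^sub>R (M :: real^'n^'n)) \<in> P_space (int k) T traceless"
proof -
  have "(\<lambda>x. q x *\<^sub>R M) \<in> Pol (int k) traceless"
    by (rule Pol_linear_image[OF _ _ assms(1), of "\<lambda>r. r *\<^sub>R M"])
      (auto intro!: linearI simp: scaleR_left_distrib subspace_scale[OF subspace_traceless assms(2)])
  then show ?thesis by (auto simp: P_space_eq[OF subspace_traceless])
qed

lemma kernel_element:
  assumes v: "v \<in> V" and \<mu>: "\<mu> \<in> Lam" and T: "T \<in> Th"
    and z: "\<And>\<tau>. \<tau> \<in> P_space (int k) T traceless \<Longrightarrow> rhs v \<mu> T \<tau> = 0"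
    and d: "\<And>x. divg (vrep v T) x = 0"
  obtains e where "\<And>x. vrep v T x = e" "\<And>F x. F facet_of T \<Longrightarrow> x \<in> F \<Longrightarrow> tangential (nF F) (\<mu> F x) = tangential (nF F) e"
proof -
  interpret V: vertices "verts T" by (rule verts[OF T])
  have eq: "convex hull (verts T) = T" by (rule verts[OF T])
  define P where "P = vrep v T"
  \<comment> \<open>The vanishing divergence removes the part of degree \<open>k + 1\<close>;
    \<open>jac P\<close> then has degree \<open>k - 1\<close> and may be multiplied by a barycentric
    coordinate.\<close>
  have P: "P \<in> Pol (int k) UNIV" unfolding P_def by (rule divg_zero_degree[OF vrep(1)[OF V_family[OF v] T] d])
  have vP: "v T = trunc T P" unfolding P_def by (rule vrep(2)[OF V_family[OF v] T])
  have formula: "(LINT x|lebesgue_on T. q x * (jac P x \<bullet> M)) +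
      (\<Sum>F | F facet_of T. nint T F (\<lambda>x. q x * ((\<mu> F x - P x) \<bullet> tangential (outward_normal T F) (M *v outward_normal T F)))) = 0"
    if "q \<in> Pol (int k) UNIV" "M \<in> traceless" for q M
    using rhs_scalar[OF T admissible[OF v \<mu>] P vP that(1), of M] z[OF scalar_matrix_P_space[OF that]] by simp
  have cP: "continuous_on S P" for S by (rule Pol_continuous[OF P])
  have cm: "continuous_on S (\<mu> S)" for S by (rule Lam_continuous[OF \<mu>])
  have nint0: "nint T F (\<lambda>x. 0) = 0" if "F facet_of T" for F
    using nint_linear(2)[OF T that, of "\<lambda>x. 0" 0] by simp
  have jM: "jac P x \<bullet> V.edge_matrix i j m = 0"
    if i: "i \<in> verts T" "j \<in> verts T" "m \<in> verts T" "i \<noteq> j" "i \<noteq> m" and x: "x \<in> interior T" for i j m x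
  proof -
    let ?M = "V.edge_matrix i j m"
    \<comment> \<open>The factor \<open>bl i\<close> vanishes on the facet opposite
      \<open>i\<close>, the only one where \<open>?M\<close> has a tangential-normal component, so
      no facet term remains; the volume term becomes a square with the weight
      \<open>bl i\<close>.\<close>
    define q where "q x = V.bl i x * (jac P x \<bullet> ?M)" for x
    have q: "q \<in> Pol (int k) UNIV" unfolding q_def using Pol_times[OF V.Pol_bl jac_Pol[OF P], of i ?M] by simp
    have "nint T F (\<lambda>x. q x * ((\<mu> F x - P x) \<bullet> tangential (outward_normal T F) (?M *v outward_normal T F))) = 0"
      if F: "F facet_of T" for F
    proof -
      obtain c where c: "c \<in> verts T" "F = V.facet c" "outward_normal T F = V.nrm c" by (rule facetE[OF T F])
      have "nint T F (\<lambda>x. q x * ((\<mu> F x - P x) \<bullet> tangential (outward_normal T F) (?M *v outward_normal T F))) = nint T F (\<lambda>x. 0)"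
      proof (rule nint_linear(3)[OF T F])
        show "continuous_on F (\<lambda>x. q x * ((\<mu> F x - P x) \<bullet> tangential (outward_normal T F) (?M *v outward_normal T F)))"
          by (intro continuous_intros cP cm Pol_continuous[OF q])
        fix x assume x: "x \<in> F"
        show "q x * ((\<mu> F x - P x) \<bullet> tangential (outward_normal T F) (?M *v outward_normal T F)) = 0"
        proof (cases "c = i")
          case True
          then have "V.bl i x = 0" using V.bl_facet_convex[OF i(1)] x c(2) by blast
          then show ?thesis by (simp add: q_def)
        next
          case False
          then show ?thesis using V.tangential_edge_matrix(1)[OF i c(1)] c(3) by simp
        qed
      qed
      then show ?thesis using nint0[OF F] by simp
    qed
    then have I: "(LINT x|lebesgue_on T. q x * (jac P x \<bullet> ?M)) = 0"
      using formula[OF q V.edge_matrix_traceless[OF i]] by simp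
    have "q x * (jac P x \<bullet> ?M) = 0"
    proof (rule zero_integral_imp_zero[where f = "\<lambda>x. q x * (jac P x \<bullet> ?M)", OF compact_elem[OF T] convex_elem[OF T] interior_elem_nonempty[OF T] _ _ I])
      show "continuous_on T (\<lambda>x. q x * (jac P x \<bullet> ?M))"
        by (intro continuous_on_mult Pol_continuous[OF q] Pol_continuous[OF jac_Pol[OF P]])
      show "0 \<le> q y * (jac P y \<bullet> ?M)" if "y \<in> T" for y
      proof -
        have "0 \<le> V.bl i y" using that V.in_T i(1) unfolding eq by blast
        then have "0 \<le> V.bl i y * ((jac P y \<bullet> ?M) * (jac P y \<bullet> ?M))" by (rule mult_nonneg_nonneg) simp
        then show ?thesis unfolding q_def mult.assoc .
      qed
      show "x \<in> T" using x interior_subset by blast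
    qed
    moreover have "0 < V.bl i x" using x i(1) V.interior_T unfolding eq by blast
    ultimately show ?thesis by (simp add: q_def)
  qed
  \<comment> \<open>The edge matrices exclude every trace-free part of the gradient; its trace is
    the divergence, which vanishes by hypothesis.\<close>
  have j0: "jac P x = 0" if "x \<in> interior T" for x
  proof (rule V.edge_matrices_span)
    show "trace (jac P x) = 0" using d[of x] by (simp add: trace_def jac_def divg_def P_def)
  qed (use jM that in blast)
  have p0: "partial j P x = 0" for j x
  proof (rule Pol_identity[OF Pol_partial[OF P subspace_UNIV] open_interior interior_elem_nonempty[OF T]])
    fix y assume "y \<in> interior T"
    from j0[OF this] show "partial j P y = 0" by (simp add: jac_def vec_eq_iff)
  qed
  have "(P has_derivative (\<lambda>h. 0)) (at x within UNIV)" for x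
    using partial_has_derivative[OF Pol_differentiable[OF P], of x] by (simp add: p0)
  then obtain e where e: "\<And>x. P x = e" using has_derivative_zero_constant[OF convex_UNIV, of P] by auto
  have "tangential (nF F) (\<mu> F x) = tangential (nF F) e" if F: "F facet_of T" and x: "x \<in> F" for F x
  proof -
    obtain i where i: "i \<in> verts T" "F = V.facet i" "outward_normal T F = V.nrm i" by (rule facetE[OF T F])
    let ?n = "V.nrm i"
    have tt: "w \<bullet> tangential ?n y = tangential ?n w \<bullet> y" for w y
      by (simp add: tangential_def inner_diff_left inner_diff_right inner_commute)
    obtain g where g: "g \<in> Pol (int k) UNIV" "\<And>x. x \<in> F \<Longrightarrow> \<mu> F x = g x" by (rule Lam_poly[OF \<mu>, of F]) blast
    have h: "tangential ?n (\<mu> F x - e) \<bullet> V.bg j = tangential ?n (\<mu> F x - e) \<bullet> V.bg m"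
      if jm: "j \<in> verts T - {i}" "m \<in> verts T - {i}" for j m
    proof -
      let ?M = "V.edge_matrix i j m"
      have jm': "j \<in> verts T" "m \<in> verts T" "i \<noteq> j" "i \<noteq> m" using jm by auto
      \<comment> \<open>With \<open>jac P = 0\<close> only the facet opposite \<open>i\<close>
        contributes. As the scalar the mismatch itself is taken, through the polynomial
        \<open>g\<close> that represents the multiplier on \<open>F\<close>, and the facet term
        becomes the integral of a square.\<close>
      define q where "q x = (g x - e) \<bullet> tangential ?n (?M *v ?n)" for x
      have q: "q \<in> Pol (int k) UNIV" unfolding q_def
        by (rule Pol_linear_image[of "\<lambda>y. y \<bullet> tangential ?n (?M *v ?n)" UNIV])
          (auto intro!: linearI Pol_diff g(1) Pol_const simp: inner_add_left)
      have c: "continuous_on S (\<lambda>x. q x * q x)" for S by (intro continuous_on_mult Pol_continuous[OF q])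
      have "nint T G (\<lambda>x. q x * ((\<mu> G x - P x) \<bullet> tangential (outward_normal T G) (?M *v outward_normal T G))) =
          (if G = F then nint T F (\<lambda>x. q x * q x) else 0)" if G: "G facet_of T" for G
      proof (cases "G = F")
        case True
        have "nint T F (\<lambda>x. q x * q x) = nint T F (\<lambda>x. q x * ((\<mu> F x - P x) \<bullet> tangential (outward_normal T F) (?M *v outward_normal T F)))"
          by (rule nint_linear(3)[OF T F c]) (simp only: g(2) e i(3) q_def)
        then show ?thesis using True by simp
      next
        case False
        obtain c where c: "c \<in> verts T" "G = V.facet c" "outward_normal T G = V.nrm c" by (rule facetE[OF T G])
        have "c \<noteq> i" using False c(2) i(2) by blast
        then have "tangential (outward_normal T G) (?M *v outward_normal T G) = 0"
          using V.tangential_edge_matrix(1)[OF i(1) jm' c(1)] c(3) by simp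
        then show ?thesis using False nint0[OF G] by simp
      qed
      then have "(\<Sum>G | G facet_of T. nint T G (\<lambda>x. q x * ((\<mu> G x - P x) \<bullet> tangential (outward_normal T G) (?M *v outward_normal T G)))) =
          (\<Sum>G | G facet_of T. if G = F then nint T F (\<lambda>x. q x * q x) else 0)" by (intro sum.cong refl) simp
      also have "\<dots> = nint T F (\<lambda>x. q x * q x)" using finite_facets[OF T] F by simp
      finally have sum: "(\<Sum>G | G facet_of T. nint T G (\<lambda>x. q x * ((\<mu> G x - P x) \<bullet> tangential (outward_normal T G) (?M *v outward_normal T G)))) =
          nint T F (\<lambda>x. q x * q x)" .
      have "jac P x = 0" for x by (simp add: jac_def p0 vec_eq_iff)
      then have "nint T F (\<lambda>x. q x * q x) = 0"
        using formula[OF q V.edge_matrix_traceless[OF i(1) jm']] unfolding sum by simp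
      then have "q x * q x = 0"
        unfolding nint_def by (rule facet_functional(4)[OF T F c, rotated]) (use x in auto)
      then have "(\<mu> F x - e) \<bullet> tangential ?n (?M *v ?n) = 0" unfolding q_def g(2)[OF x] by simp
      then have "V.height i * (tangential ?n (\<mu> F x - e) \<bullet> (V.bg j - V.bg m)) = 0"
        unfolding V.tangential_edge_matrix(2)[OF i(1) jm' i(1)] tt by simp
      then have "tangential ?n (\<mu> F x - e) \<bullet> (V.bg j - V.bg m) = 0" using V.height_pos[OF i(1)] by simp
      then show ?thesis by (simp add: inner_diff_right)
    qed
    \<comment> \<open>The gradient \<open>bg i\<close> is normal to this facet, which supplies the
      missing hypothesis of \<open>normal_determined\<close>.\<close>
    have "tangential ?n (\<mu> F x - e) \<bullet> V.bg i = 0"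
      unfolding tt[symmetric] V.tangential_bg[OF i(1)] by simp
    then have "tangential ?n (\<mu> F x - e) = 0" using V.normal_determined[OF i(1)] h by blast
    then have "tangential (nF F) (\<mu> F x - e) = 0" using nF_cases[OF T F] i(3) by (auto simp: tangential_minus_normal)
    then show ?thesis by (simp add: tangential_diff)
  qed
  then show ?thesis using that[of e] e unfolding P_def by blast
qed

lemma tangential_eq_imp_eq: "tangential n u = tangential n w \<Longrightarrow> n \<bullet> u = n \<bullet> w \<Longrightarrow> u = w"
  by (simp add: tangential_def inner_commute)

text \<open>Neighbouring constants have the same tangential component through the single-valued
  multiplier and the same normal component through H(div). At a boundary face both components are 0,
  because the multiplier is extended by zero.\<close>

lemma kernel_trivial:
  assumes v: "v \<in> V" and \<mu>: "\<mu> \<in> Lam" and z: "dev_grad_w Th (int k) v \<mu> = 0"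
    and d: "\<And>T x. T \<in> Th \<Longrightarrow> divg (vrep v T) x = 0"
  shows "v = 0" "\<mu> = 0"
proof -
  have rz: "rhs v \<mu> T \<tau> = 0" if "T \<in> Th" "\<tau> \<in> P_space (int k) T traceless" for T \<tau>
    using dev_grad_w_char(2)[OF admissible[OF v \<mu>] that] z by (simp add: ip_def)
  define \<phi> where "\<phi> T = vrep v T 0" for T
  have \<phi>: "vrep v T x = \<phi> T" "F facet_of T \<Longrightarrow> y \<in> F \<Longrightarrow> tangential (nF F) (\<mu> F y) = tangential (nF F) (\<phi> T)"
    if T: "T \<in> Th" for T x F y
  proof -
    have "\<exists>e. (\<forall>x. vrep v T x = e) \<and> (\<forall>F x. F facet_of T \<longrightarrow> x \<in> F \<longrightarrow> tangential (nF F) (\<mu> F x) = tangential (nF F) e)"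
      by (rule kernel_element[OF v \<mu> T rz[OF T] d[OF T]]) simp_all
    then obtain e where e: "\<And>x. vrep v T x = e" "\<And>F x. F facet_of T \<Longrightarrow> x \<in> F \<Longrightarrow> tangential (nF F) (\<mu> F x) = tangential (nF F) e"
      by blast
    show "vrep v T x = \<phi> T" unfolding \<phi>_def e(1) ..
    show "F facet_of T \<Longrightarrow> y \<in> F \<Longrightarrow> tangential (nF F) (\<mu> F y) = tangential (nF F) (\<phi> T)" unfolding \<phi>_def e(1) by (rule e(2))
  qed
  have vT: "v T x = \<phi> T" if "T \<in> Th" "x \<in> T" for T x
    by (subst vrep(2)[OF V_family[OF v] that(1)]) (simp add: that(2) \<phi>(1)[OF that(1)])
  have facet_point: "\<exists>x. x \<in> F \<and> x \<in> T" if "F facet_of T" for F T :: "(real^'n) set"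
    using facet_of_imp_subset[OF that] that by (auto simp: facet_of_def)
  have pn: "\<phi> (posT F) = \<phi> (negT F)" if F: "F \<in> interior_faces \<Omega> Th" for F
  proof -
    note pm = plus_minus[OF F]
    obtain x where x: "x \<in> F" using facet_point[OF pm(2)] by blast
    have xT: "x \<in> posT F" "x \<in> negT F" using facet_subset_elem pm x by blast+
    have n: "nF F \<bullet> v (posT F) x = nF F \<bullet> v (negT F) x" using iffD1[OF V_iff v] F x by blast
    show ?thesis
    proof (rule tangential_eq_imp_eq)
      show "tangential (nF F) (\<phi> (posT F)) = tangential (nF F) (\<phi> (negT F))"
        by (rule trans[OF \<phi>(2)[OF pm(1,2) x, symmetric] \<phi>(2)[OF pm(4,5) x]])
      show "nF F \<bullet> \<phi> (posT F) = nF F \<bullet> \<phi> (negT F)"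
        using n unfolding vT[OF pm(1) xT(1)] vT[OF pm(4) xT(2)] .
    qed
  qed
  obtain B where B: "B \<in> boundary_faces \<Omega> Th" using boundary_face_exists by blast
  then have "B \<in> mesh_faces Th" by (simp add: boundary_faces_def)
  then obtain S where S: "S \<in> Th" "B facet_of S" by (rule mesh_faceE)
  have S0: "\<phi> S = 0"
  proof -
    obtain x where x: "x \<in> B" "x \<in> S" using facet_point[OF S(2)] by blast
    have n: "nF B \<bullet> v S x = 0" using iffD1[OF V_iff v] B S x by blast
    have m: "\<mu> B x = 0" using Lam_outside[OF \<mu>, of B x] B by (simp add: interior_faces_def)
    show ?thesis
    proof (rule tangential_eq_imp_eq)
      show "tangential (nF B) (\<phi> S) = tangential (nF B) 0" using \<phi>(2)[OF S x(1)] unfolding m by (rule sym)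
      show "nF B \<bullet> \<phi> S = nF B \<bullet> 0" using n unfolding vT[OF S(1) x(2)] by simp
    qed
  qed
  have zero: "\<phi> T = 0" if "T \<in> Th" for T using piecewise_constant[of \<phi>, OF pn that S(1)] S0 by simp
  show "v = 0"
  proof (intro ext)
    fix T x
    show "v T x = 0 T x"
    proof (cases "T \<in> Th")
      case True
      show ?thesis by (subst vrep(2)[OF V_family[OF v] True]) (simp add: trunc_def \<phi>(1)[OF True] zero[OF True])
    next
      case False
      then show ?thesis using V_family[OF v] by (simp add: family_space_def)
    qed
  qed
  show "\<mu> = 0"
  proof (intro ext)
    fix F x
    show "\<mu> F x = 0 F x"
    proof (cases "F \<in> interior_faces \<Omega> Th \<and> x \<in> F")
      case True
      then have F: "F \<in> interior_faces \<Omega> Th" "x \<in> F" by auto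
      note pm = plus_minus[OF F(1)]
      have "tangential (nF F) (\<mu> F x) = tangential (nF F) 0" using \<phi>(2)[OF pm(1,2) F(2)] zero[OF pm(1)] by simp
      moreover have "nF F \<bullet> \<mu> F x = nF F \<bullet> 0" using Lam_normal[OF \<mu>] by (simp add: inner_commute)
      ultimately show ?thesis using tangential_eq_imp_eq by fastforce
    next
      case False
      then show ?thesis using Lam_outside[OF \<mu>] by auto
    qed
  qed
qed

end

section \<open>Well-posedness and the stress formulation\<close>

text \<open>Supplies the expansion that \<open>solution_bound\<close> asks of the quadratic form,
  from a symmetric form linear on \<open>S\<close>.\<close>

lemma form_sum:
  fixes s :: "'a::real_vector \<Rightarrow> 'a \<Rightarrow> real"
  assumes S: "subspace S" and sym: "\<And>x y. s x y = s y x"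
    and add: "\<And>x y z. x \<in> S \<Longrightarrow> y \<in> S \<Longrightarrow> z \<in> S \<Longrightarrow> s (x + y) z = s x z + s y z"
    and scale: "\<And>x z r. x \<in> S \<Longrightarrow> z \<in> S \<Longrightarrow> s (r *\<^sub>R x) z = r * s x z"
    and I: "finite I" and x: "\<And>i. i \<in> I \<Longrightarrow> x i \<in> S"
  shows "s (\<Sum>i\<in>I. c i *\<^sub>R x i) (\<Sum>i\<in>I. c i *\<^sub>R x i) = (\<Sum>i\<in>I. \<Sum>j\<in>I. c i * c j * s (x i) (x j))"
proof -
  have left: "s (\<Sum>i\<in>I. c i *\<^sub>R x i) z = (\<Sum>i\<in>I. c i * s (x i) z)" if "z \<in> S" for z
    using I x
  proof (induction I rule: finite_induct)
    case empty
    show ?case using scale[OF that that, of 0] by simp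
  next
    case (insert a J)
    have "(\<Sum>i\<in>J. c i *\<^sub>R x i) \<in> S" using insert.prems by (intro subspace_sum[OF S] subspace_scale[OF S]) auto
    moreover have "x a \<in> S" using insert.prems by simp
    ultimately have "s (c a *\<^sub>R x a + (\<Sum>i\<in>J. c i *\<^sub>R x i)) z = c a * s (x a) z + s (\<Sum>i\<in>J. c i *\<^sub>R x i) z"
      using add[OF subspace_scale[OF S] _ that] scale[OF _ that] by simp
    then show ?case using insert by simp
  qed
  have z: "(\<Sum>i\<in>I. c i *\<^sub>R x i) \<in> S" by (intro subspace_sum[OF S] subspace_scale[OF S] x)
  have "s (x i) (\<Sum>i\<in>I. c i *\<^sub>R x i) = (\<Sum>j\<in>I. c j * s (x i) (x j))" if "i \<in> I" for i
    unfolding sym[of "x i" "\<Sum>i\<in>I. c i *\<^sub>R x i"] left[OF x[OF that]] by (simp only: sym[of _ "x i"])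
  then have "(\<Sum>i\<in>I. c i * s (x i) (\<Sum>i\<in>I. c i *\<^sub>R x i)) = (\<Sum>i\<in>I. c i * (\<Sum>j\<in>I. c j * s (x i) (x j)))"
    by (intro sum.cong refl) simp
  then show ?thesis unfolding left[OF z] by (simp add: sum_distrib_left mult.assoc)
qed

section \<open>Square-integrable loads on single elements\<close>

context mesh
begin

text \<open>A closed element may reach outside \<open>\<Omega>\<close>, but its interior does not,
  and the two differ by a null set. Data given on \<open>\<Omega>\<close> are restricted to elements
  in this way.\<close>

lemma elem_AE:
  fixes g :: "real^'n \<Rightarrow> 'v::real_vector"
  assumes "T \<in> Th"
  shows "AE x in lebesgue. indicator (interior T) x *\<^sub>R (indicator \<Omega> x *\<^sub>R g x) = indicator T x *\<^sub>R g x"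
  using AE_mesh
proof (rule eventually_mono)
  fix x assume x: "\<forall>T\<in>Th. x \<notin> frontier T"
  have "x \<in> T \<longleftrightarrow> x \<in> interior T"
    using x assms interior_subset[of T] closure_subset[of T] by (auto simp: frontier_def)
  then show "indicator (interior T) x *\<^sub>R (indicator \<Omega> x *\<^sub>R g x) = indicator T x *\<^sub>R g x"
    using interior_elem_subset[OF assms] by (auto simp: indicator_def)
qed

lemma sets_elem: "T \<in> Th \<Longrightarrow> T \<inter> space lebesgue \<in> sets lebesgue" "interior T \<in> sets lebesgue" "\<Omega> \<inter> space lebesgue \<in> sets lebesgue"
  using borel_compact[OF compact_elem[of T]] lmeasurable_domain by (auto intro: fmeasurableD)

lemma measurable_elem:
  fixes f :: "real^'n \<Rightarrow> 'v::euclidean_space"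
  assumes "f \<in> borel_measurable (lebesgue_on \<Omega>)" "T \<in> Th"
  shows "f \<in> borel_measurable (lebesgue_on T)"
proof -
  have "(\<lambda>x. indicator \<Omega> x *\<^sub>R f x) \<in> borel_measurable lebesgue"
    using assms(1) borel_measurable_restrict_space_iff[OF sets_elem(3)] by blast
  then have "(\<lambda>x. indicator (interior T) x *\<^sub>R (indicator \<Omega> x *\<^sub>R f x)) \<in> borel_measurable lebesgue"
    by (rule borel_measurable_scaleR[OF borel_measurable_indicator[OF sets_elem(2)]])
  from borel_measurable_AE[OF this elem_AE[OF assms(2)]] show ?thesis
    using borel_measurable_restrict_space_iff[OF sets_elem(1)[OF assms(2)]] by blast
qed

lemma integral_elem:
  fixes g :: "real^'n \<Rightarrow> real"
  assumes "integrable (lebesgue_on \<Omega>) g" "T \<in> Th"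
  shows "integrable (lebesgue_on T) g"
    and "(\<And>x. 0 \<le> g x) \<Longrightarrow> (LINT x|lebesgue_on T. g x) \<le> (LINT x|lebesgue_on \<Omega>. g x)"
proof -
  have i: "integrable lebesgue (\<lambda>x. indicator \<Omega> x *\<^sub>R g x)"
    using assms(1) integrable_restrict_space[OF sets_elem(3)] by blast
  then have i2: "integrable lebesgue (\<lambda>x. indicator (interior T) x *\<^sub>R (indicator \<Omega> x *\<^sub>R g x))"
    by (rule integrable_mult_indicator[OF sets_elem(2)])
  have m: "(\<lambda>x. indicator T x *\<^sub>R g x) \<in> borel_measurable lebesgue"
    by (rule borel_measurable_AE[OF borel_measurable_integrable[OF i2] elem_AE[OF assms(2)]])
  have i3: "integrable lebesgue (\<lambda>x. indicator T x *\<^sub>R g x)"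
    using integrable_cong_AE[OF borel_measurable_integrable[OF i2] m elem_AE[OF assms(2)]] i2 by blast
  then show "integrable (lebesgue_on T) g" using integrable_restrict_space[OF sets_elem(1)[OF assms(2)]] by blast
  assume nn: "\<And>x. 0 \<le> g x"
  have "(LINT x|lebesgue. indicator T x *\<^sub>R g x) \<le> (LINT x|lebesgue. indicator \<Omega> x *\<^sub>R g x)"
  proof (rule integral_mono_AE[OF i3 i])
    show "AE x in lebesgue. indicator T x *\<^sub>R g x \<le> indicator \<Omega> x *\<^sub>R g x"
      using elem_AE[OF assms(2), of g]
    proof (rule eventually_mono)
      fix x assume e: "indicator (interior T) x *\<^sub>R (indicator \<Omega> x *\<^sub>R g x) = indicator T x *\<^sub>R g x"
      show "indicator T x *\<^sub>R g x \<le> indicator \<Omega> x *\<^sub>R g x"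
        unfolding e[symmetric] using nn[of x] by (simp add: indicator_def)
    qed
  qed
  then show "(LINT x|lebesgue_on T. g x) \<le> (LINT x|lebesgue_on \<Omega>. g x)"
    unfolding integral_restrict_space[OF sets_elem(1)[OF assms(2)]] integral_restrict_space[OF sets_elem(3)] .
qed

lemma load_integrable:
  fixes f w :: "real^'n \<Rightarrow> 'v::euclidean_space"
  assumes f: "f \<in> L2 \<Omega>" and T: "T \<in> Th" and w: "continuous_on T w"
  shows "integrable (lebesgue_on T) (\<lambda>x. f x \<bullet> w x)" "integrable (lebesgue_on T) (\<lambda>x. f x \<bullet> f x)"
proof -
  have ff: "integrable (lebesgue_on \<Omega>) (\<lambda>x. f x \<bullet> f x)" "f \<in> borel_measurable (lebesgue_on \<Omega>)"
    using f by (simp_all add: L2_def dot_square_norm)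
  show i: "integrable (lebesgue_on T) (\<lambda>x. f x \<bullet> f x)" by (rule integral_elem(1)[OF ff(1) T])
  have cw: "continuous_on T (\<lambda>x. w x \<bullet> w x)" by (intro continuous_intros w)
  have mw: "w \<in> borel_measurable (lebesgue_on T)"
    by (rule continuous_imp_measurable_on_sets_lebesgue[OF w]) (use sets_elem(1)[OF T] in simp)
  show "integrable (lebesgue_on T) (\<lambda>x. f x \<bullet> w x)"
  proof (rule Bochner_Integration.integrable_bound)
    show "integrable (lebesgue_on T) (\<lambda>x. f x \<bullet> f x + w x \<bullet> w x)"
      by (rule Bochner_Integration.integrable_add[OF i LINT_compact(3)[OF compact_elem[OF T] cw]])
    show "(\<lambda>x. f x \<bullet> w x) \<in> borel_measurable (lebesgue_on T)"
      by (intro borel_measurable_inner measurable_elem[OF ff(2) T] mw)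
    have "\<bar>a \<bullet> b\<bar> \<le> a \<bullet> a + b \<bullet> b" for a b :: 'v
    proof -
      have "2 * (norm a * norm b) \<le> (norm a)\<^sup>2 + (norm b)\<^sup>2"
        using sum_squares_bound[of "norm a" "norm b"] by (simp add: mult.assoc)
      moreover have "0 \<le> norm a * norm b" by simp
      ultimately show ?thesis using Cauchy_Schwarz_ineq2[of a b] unfolding dot_square_norm by linarith
    qed
    then show "AE x in lebesgue_on T. norm (f x \<bullet> w x) \<le> norm (f x \<bullet> f x + w x \<bullet> w x)"
      by (intro AE_I2) (smt (verit) real_norm_def inner_ge_zero)
  qed
qed

text \<open>Cauchy-Schwarz on the element, obtained from a nonnegative quadratic in \<open>t\<close>
  because \<open>f\<close> is only square integrable; the norm of \<open>f\<close> on
  \<open>T\<close> is then enlarged to that on \<open>\<Omega>\<close>.\<close>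

lemma load_bound:
  fixes f w :: "real^'n \<Rightarrow> 'v::euclidean_space"
  assumes f: "f \<in> L2 \<Omega>" and T: "T \<in> Th" and w: "continuous_on T w"
  shows "\<bar>ip T f w\<bar> \<le> sqrt (ip \<Omega> f f) * sqrt (ip T w w)"
proof -
  note i = load_integrable[OF f T w]
  have cw: "continuous_on T (\<lambda>x. w x \<bullet> w x)" by (intro continuous_intros w)
  note iw = LINT_compact(3)[OF compact_elem[OF T] cw]
  have le: "ip T f f \<le> ip \<Omega> f f"
    unfolding ip_def by (rule integral_elem(2)[OF _ T]) (use f in \<open>simp_all add: L2_def dot_square_norm\<close>)
  have quad: "0 \<le> ip T f f - 2 * t * ip T f w + t\<^sup>2 * ip T w w" for t
  proof -
    have "0 \<le> (LINT x|lebesgue_on T. (f x - t *\<^sub>R w x) \<bullet> (f x - t *\<^sub>R w x))"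
      by (rule Bochner_Integration.integral_nonneg) simp
    also have "\<dots> = (LINT x|lebesgue_on T. (f x \<bullet> f x - 2 * t * (f x \<bullet> w x)) + t\<^sup>2 * (w x \<bullet> w x))"
      by (intro Bochner_Integration.integral_cong refl)
        (simp add: inner_diff_left inner_diff_right inner_commute power2_eq_square algebra_simps)
    also have "\<dots> = ip T f f - 2 * t * ip T f w + t\<^sup>2 * ip T w w"
      unfolding ip_def using i iw by simp
    finally show ?thesis .
  qed
  have "(ip T f w)\<^sup>2 \<le> ip T f f * ip T w w"
  proof (cases "ip T w w = 0")
    case True
    have "ip T f w = ip T f (\<lambda>x. 0)" by (rule ip_cong) (simp_all add: ip_self_eq_0[OF T w True])
    then show ?thesis using True by (simp add: ip_zero_right)
  next
    case False
    then have b: "0 < ip T w w" using ip_self_nonneg[of T w] by simp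
    have "0 \<le> ip T f f - (ip T f w)\<^sup>2 / ip T w w"
      using quad[of "ip T f w / ip T w w"] b by (simp add: power2_eq_square)
    then show ?thesis using b by (simp add: field_simps)
  qed
  also have "\<dots> \<le> ip \<Omega> f f * ip T w w" by (intro mult_right_mono le ip_self_nonneg)
  finally have "sqrt ((ip T f w)\<^sup>2) \<le> sqrt (ip \<Omega> f f * ip T w w)" by (rule real_sqrt_le_mono)
  then show ?thesis by (simp add: real_sqrt_mult)
qed

end

context fem
begin

section \<open>Duality of the weak operators\<close>

abbreviation "D v \<mu> \<equiv> dev_grad_w Th (int k) v \<mu>"

text \<open>The normal enters the normal part three times; in the tangential part its two
  occurrences in the projection cancel and one is left. Either way the orientation contributes a
  single factor \<open>s\<close>.\<close>

lemma oriented: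
  assumes T: "T \<in> Th" and F: "F facet_of T" and s: "outward_normal T F = s *\<^sub>R nF F" "s * s = 1"
    and c: "continuous_on F w" "continuous_on F \<mu>" "continuous_on F \<tau>"
  shows "normal_part T F w \<tau> =
      s * face_integral F (nF F) (\<lambda>x. (nF F \<bullet> (\<tau> x *v nF F)) * (nF F \<bullet> w x))"
    and "tangential_part T F \<mu> \<tau> =
      s * face_integral F (nF F) (\<lambda>x. \<mu> x \<bullet> tangential (nF F) (\<tau> x *v nF F))"
proof -
  have mv: "A *v (s *\<^sub>R y) = s *\<^sub>R (A *v y)" for A :: "real^'n^'n" and y
    by (simp add: matrix_vector_mult_def vec_eq_iff sum_distrib_left mult_ac)
  have c1: "continuous_on F (\<lambda>x. (nF F \<bullet> (\<tau> x *v nF F)) * (nF F \<bullet> w x))"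
    "continuous_on F (\<lambda>x. \<mu> x \<bullet> tangential (nF F) (\<tau> x *v nF F))"
    by (intro continuous_intros continuous_on_matrix_vector continuous_on_tangential c)+
  have e1: "(outward_normal T F \<bullet> w x) * (outward_normal T F \<bullet> (\<tau> x *v outward_normal T F)) =
      s * ((nF F \<bullet> (\<tau> x *v nF F)) * (nF F \<bullet> w x))" for x
  proof -
    have "(outward_normal T F \<bullet> w x) * (outward_normal T F \<bullet> (\<tau> x *v outward_normal T F)) =
        (s * s) * (s * ((nF F \<bullet> (\<tau> x *v nF F)) * (nF F \<bullet> w x)))"
      unfolding s(1) mv by (simp add: mult_ac)
    then show ?thesis unfolding s(2) by simp
  qed
  have e2: "\<mu> x \<bullet> tangential (outward_normal T F) (\<tau> x *v outward_normal T F) =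
      s * (\<mu> x \<bullet> tangential (nF F) (\<tau> x *v nF F))" for x
  proof -
    have "tangential (s *\<^sub>R n) (s *\<^sub>R y) = s *\<^sub>R y - (s * s) *\<^sub>R ((s * (y \<bullet> n)) *\<^sub>R n)" for n y :: "real^'n"
      by (simp add: tangential_def mult_ac)
    then have "tangential (s *\<^sub>R n) (s *\<^sub>R y) = s *\<^sub>R tangential n y" for n y :: "real^'n"
      unfolding s(2) by (simp add: tangential_def scaleR_diff_right)
    then show ?thesis unfolding s(1) mv by simp
  qed
  show "normal_part T F w \<tau> =
      s * face_integral F (nF F) (\<lambda>x. (nF F \<bullet> (\<tau> x *v nF F)) * (nF F \<bullet> w x))"
    unfolding normal_part_def e1 nint_linear(2)[OF T F c1(1)] unfolding nint_def face_integral_nF[OF T F c1(1)] ..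
  show "tangential_part T F \<mu> \<tau> =
      s * face_integral F (nF F) (\<lambda>x. \<mu> x \<bullet> tangential (nF F) (\<tau> x *v nF F))"
    unfolding tangential_part_def e2 nint_linear(2)[OF T F c1(2)] unfolding nint_def face_integral_nF[OF T F c1(2)] ..
qed

text \<open>The element functionals are summed and regrouped by faces. The normal component of
  \<open>v\<close> and the multiplier are single valued there, so the traces of
  \<open>\<tau>\<close> combine to jumps; on boundary faces the normal component of \<open>v\<close>
  and the multiplier vanish.\<close>

lemma duality:
  assumes v: "v \<in> V" and \<mu>: "\<mu> \<in> Lam" and \<tau>: "\<tau> \<in> Sigma_disc Th (int k)"
  shows "mesh_ip Th (D v \<mu>) \<tau> = - div_w_pair \<Omega> Th nF \<tau> v +
    (\<Sum>F\<in>interior_faces \<Omega> Th. face_integral F (nF F)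
      (\<lambda>x. \<mu> F x \<bullet> jump Th nF (\<lambda>T y. tangential (nF F) (\<tau> T y *v nF F)) F x))"
proof -
  let ?A = "\<lambda>T F. normal_part T F (v T) (\<tau> T)"
  let ?B = "\<lambda>T F. tangential_part T F (\<mu> F) (\<tau> T)"
  have cF: "continuous_on F (v T)" "continuous_on F (\<tau> T)" "continuous_on F (\<mu> F)" if "T \<in> Th" "F facet_of T" for T F
    using econt_V[OF v] Sigma_disc_continuous[OF \<tau> that(1)] facet_subset_elem[OF that(2)] that(1) Lam_continuous[OF \<mu>]
    by (auto simp: econt_def intro: continuous_on_subset)
  have "mesh_ip Th (D v \<mu>) \<tau> = (\<Sum>T\<in>Th. rhs v \<mu> T (\<tau> T))"
    unfolding mesh_ip_def by (intro sum.cong refl dev_grad_w_char(2)[OF admissible[OF v \<mu>]] Sigma_disc_mem[OF \<tau>])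
  also have "\<dots> = (\<Sum>T\<in>Th. - ip T (row_div (\<tau> T)) (v T)) + (\<Sum>T\<in>Th. \<Sum>F | F facet_of T. ?A T F) + (\<Sum>T\<in>Th. \<Sum>F | F facet_of T. ?B T F)"
    unfolding rhs_def sum.distrib by (simp only: ip_commute)
  also have "(\<Sum>T\<in>Th. \<Sum>F | F facet_of T. ?A T F) = (\<Sum>F\<in>interior_faces \<Omega> Th. face_integral F (nF F)
      (\<lambda>x. jump Th nF (\<lambda>T y. nF F \<bullet> (\<tau> T y *v nF F)) F x * (nF F \<bullet> v (posT F) x)))"
  proof -
    have "?A (posT F) F + ?A (negT F) F = face_integral F (nF F)
        (\<lambda>x. jump Th nF (\<lambda>T y. nF F \<bullet> (\<tau> T y *v nF F)) F x * (nF F \<bullet> v (posT F) x))"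
      if F: "F \<in> interior_faces \<Omega> Th" for F
    proof -
      note pm = plus_minus[OF F] and m = interior_face_mesh[OF F]
      note cp = cF[OF pm(1,2)] and cn = cF[OF pm(4,5)]
      have c: "continuous_on F (\<lambda>x. (nF F \<bullet> (\<tau> (posT F) x *v nF F)) * (nF F \<bullet> v (posT F) x))"
        "continuous_on F (\<lambda>x. (-1) * ((nF F \<bullet> (\<tau> (negT F) x *v nF F)) * (nF F \<bullet> v (negT F) x)))"
        "continuous_on F (\<lambda>x. (nF F \<bullet> (\<tau> (negT F) x *v nF F)) * (nF F \<bullet> v (negT F) x))"
        by (intro continuous_intros continuous_on_matrix_vector cp cn)+
      have "?A (posT F) F = 1 * face_integral F (nF F) (\<lambda>x. (nF F \<bullet> (\<tau> (posT F) x *v nF F)) * (nF F \<bullet> v (posT F) x))"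
        by (rule oriented(1)[OF pm(1,2) _ _ cp(1,3,2)]) (simp_all add: pm(3))
      moreover have "?A (negT F) F = (-1) * face_integral F (nF F) (\<lambda>x. (nF F \<bullet> (\<tau> (negT F) x *v nF F)) * (nF F \<bullet> v (negT F) x))"
        by (rule oriented(1)[OF pm(4,5) _ _ cn(1,3,2)]) (simp_all add: pm(6))
      moreover have "face_integral F (nF F) (\<lambda>x. (nF F \<bullet> (\<tau> (posT F) x *v nF F)) * (nF F \<bullet> v (posT F) x) +
          (-1) * ((nF F \<bullet> (\<tau> (negT F) x *v nF F)) * (nF F \<bullet> v (negT F) x))) = face_integral F (nF F)
        (\<lambda>x. jump Th nF (\<lambda>T y. nF F \<bullet> (\<tau> T y *v nF F)) F x * (nF F \<bullet> v (posT F) x))"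
      proof (rule face_functional(3)[OF m continuous_on_add[OF c(1,2)]])
        fix x assume x: "x \<in> F"
        have "nF F \<bullet> v (posT F) x = nF F \<bullet> v (negT F) x" using iffD1[OF V_iff v] F x by blast
        then show "(nF F \<bullet> (\<tau> (posT F) x *v nF F)) * (nF F \<bullet> v (posT F) x) +
          (-1) * ((nF F \<bullet> (\<tau> (negT F) x *v nF F)) * (nF F \<bullet> v (negT F) x)) =
          jump Th nF (\<lambda>T y. nF F \<bullet> (\<tau> T y *v nF F)) F x * (nF F \<bullet> v (posT F) x)"
          unfolding jump_def by (simp add: left_diff_distrib)
      qed
      ultimately show ?thesis unfolding face_functional(1)[OF m c(1,2)] face_functional(2)[OF m c(3)] by (simp only: mult_1)
    qed
    moreover have "?A T F = 0" if F: "F \<in> boundary_faces \<Omega> Th" and T: "T \<in> Th" "F facet_of T" for T F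
    proof -
      have "?A T F = nint T F (\<lambda>x. 0 * 1)"
        unfolding normal_part_def
      proof (rule nint_linear(3)[OF T])
        show "continuous_on F (\<lambda>x. (outward_normal T F \<bullet> v T x) * (outward_normal T F \<bullet> (\<tau> T x *v outward_normal T F)))"
          by (intro continuous_intros continuous_on_matrix_vector cF T)
        fix x assume x: "x \<in> F"
        have "nF F \<bullet> v T x = 0" using iffD1[OF V_iff v] F T x by blast
        then show "(outward_normal T F \<bullet> v T x) * (outward_normal T F \<bullet> (\<tau> T x *v outward_normal T F)) = 0 * 1"
          unfolding nF_boundary[OF F T] by simp
      qed
      also have "\<dots> = 0" unfolding nint_linear(2)[OF T continuous_on_const] by simp
      finally show ?thesis .
    qed
    ultimately show ?thesis unfolding sum_over_facets by simp
  qed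
  also have "(\<Sum>T\<in>Th. \<Sum>F | F facet_of T. ?B T F) = (\<Sum>F\<in>interior_faces \<Omega> Th. face_integral F (nF F)
      (\<lambda>x. \<mu> F x \<bullet> jump Th nF (\<lambda>T y. tangential (nF F) (\<tau> T y *v nF F)) F x))"
  proof -
    have "?B (posT F) F + ?B (negT F) F = face_integral F (nF F)
        (\<lambda>x. \<mu> F x \<bullet> jump Th nF (\<lambda>T y. tangential (nF F) (\<tau> T y *v nF F)) F x)"
      if F: "F \<in> interior_faces \<Omega> Th" for F
    proof -
      note pm = plus_minus[OF F] and m = interior_face_mesh[OF F]
      note cp = cF[OF pm(1,2)] and cn = cF[OF pm(4,5)]
      have c: "continuous_on F (\<lambda>x. \<mu> F x \<bullet> tangential (nF F) (\<tau> (posT F) x *v nF F))"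
        "continuous_on F (\<lambda>x. (-1) * (\<mu> F x \<bullet> tangential (nF F) (\<tau> (negT F) x *v nF F)))"
        "continuous_on F (\<lambda>x. \<mu> F x \<bullet> tangential (nF F) (\<tau> (negT F) x *v nF F))"
        by (intro continuous_intros continuous_on_matrix_vector continuous_on_tangential cp cn)+
      have "?B (posT F) F = 1 * face_integral F (nF F) (\<lambda>x. \<mu> F x \<bullet> tangential (nF F) (\<tau> (posT F) x *v nF F))"
        by (rule oriented(2)[OF pm(1,2) _ _ cp(1,3,2)]) (simp_all add: pm(3))
      moreover have "?B (negT F) F = (-1) * face_integral F (nF F) (\<lambda>x. \<mu> F x \<bullet> tangential (nF F) (\<tau> (negT F) x *v nF F))"
        by (rule oriented(2)[OF pm(4,5) _ _ cn(1,3,2)]) (simp_all add: pm(6))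
      moreover have "(\<lambda>x. \<mu> F x \<bullet> jump Th nF (\<lambda>T y. tangential (nF F) (\<tau> T y *v nF F)) F x) =
          (\<lambda>x. \<mu> F x \<bullet> tangential (nF F) (\<tau> (posT F) x *v nF F) + (-1) * (\<mu> F x \<bullet> tangential (nF F) (\<tau> (negT F) x *v nF F)))"
        unfolding jump_def inner_diff_right by (rule ext) linarith
      ultimately show ?thesis
        by (simp only: face_functional(1)[OF m c(1,2)] face_functional(2)[OF m c(3)] mult_1)
    qed
    moreover have "?B T F = 0" if F: "F \<in> boundary_faces \<Omega> Th" and T: "T \<in> Th" "F facet_of T" for T F
    proof -
      have "F \<notin> interior_faces \<Omega> Th" using F by (simp add: interior_faces_def)
      then have "?B T F = nint T F (\<lambda>x. 0 * 1)" using Lam_outside[OF \<mu>] by (simp add: tangential_part_def)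
      also have "\<dots> = 0" unfolding nint_linear(2)[OF T continuous_on_const] by simp
      finally show ?thesis .
    qed
    ultimately show ?thesis unfolding sum_over_facets by simp
  qed
  finally show ?thesis unfolding div_w_pair_def sum_negf by linarith
qed

lemma subspace_Lam: "subspace Lam"
  unfolding Lambda_space_def by (intro subspace_family_space subspace_P_space subspace_normal)

lemma findim_Lam: "findim Lam"
  unfolding Lambda_space_def by (intro findim_family_space finite_interior_faces findim_P_space subspace_normal)

lemma vrep_unique:
  assumes "v \<in> V" "T \<in> Th" "P \<in> Pol (int k + 1) UNIV" "v T = trunc T P"
  shows "vrep v T = P"
proof
  fix x
  note r = vrep[OF V_family[OF assms(1)] assms(2)]
  have "vrep v T x - P x = 0"
  proof (rule Pol_identity[OF Pol_diff[OF r(3) assms(3)] open_interior interior_elem_nonempty[OF assms(2)]])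
    fix y assume "y \<in> interior T"
    then have "y \<in> T" using interior_subset by blast
    then have "v T y = vrep v T y" "v T y = P y" by (subst r(2), simp, subst assms(4), simp)
    then show "vrep v T y - P y = 0" by simp
  qed
  then show "vrep v T x = P x" by simp
qed

definition div_pair :: "((real^'n) set \<Rightarrow> real^'n \<Rightarrow> real^'n) \<Rightarrow> ((real^'n) set \<Rightarrow> real^'n \<Rightarrow> real) \<Rightarrow> real" where
  "div_pair v q = mesh_ip Th (\<lambda>T. divg (v T)) q"

lemma div_pair_eq:
  assumes "v \<in> V" "q \<in> Q"
  shows "div_pair v q = mesh_ip Th (\<lambda>T. divg (vrep v T)) q"
  unfolding div_pair_def mesh_ip_divg[OF assms(1) econt_Q[OF assms(2)]] by (simp add: mesh_ip_def ip_def)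

lemma econt_divg: "v \<in> V \<Longrightarrow> econt (\<lambda>T. divg (vrep v T))"
  unfolding econt_def using Pol_continuous[OF divg_Pol[OF vrep(3)[OF V_family]]] by blast

lemma mesh_ip_cong: "(\<And>T x. T \<in> Th \<Longrightarrow> x \<in> T \<Longrightarrow> f T x = g T x) \<Longrightarrow> mesh_ip Th f q = mesh_ip Th g q"
  unfolding mesh_ip_def by (intro sum.cong refl ip_cong) auto

text \<open>Linearity in the velocity is shown on polynomial representatives;
  \<open>vrep_unique\<close> identifies that of a sum or a multiple.\<close>

lemma div_pair_linear:
  assumes "u \<in> V" "v \<in> V" "p \<in> Q" "q \<in> Q"
  shows "div_pair (u + v) q = div_pair u q + div_pair v q" "div_pair (r *\<^sub>R u) q = r * div_pair u q"
    "div_pair u (p + q) = div_pair u p + div_pair u q" "div_pair u (r *\<^sub>R q) = r * div_pair u q"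
proof -
  note Vadd = subspace_add[OF subspace_V assms(1,2)] and Vsc = subspace_scale[OF subspace_V assms(1), of r]
  note Qadd = subspace_add[OF subspace_Q assms(3,4)]
  note ru = vrep[OF V_family[OF assms(1)]] and rv = vrep[OF V_family[OF assms(2)]]
  have "mesh_ip Th (\<lambda>T. divg (vrep (u + v) T)) q = mesh_ip Th ((\<lambda>T. divg (vrep u T)) + (\<lambda>T. divg (vrep v T))) q"
  proof (rule mesh_ip_cong)
    fix T x assume T: "T \<in> Th" and x: "x \<in> T"
    have "(u + v) T = trunc T (\<lambda>x. vrep u T x + vrep v T x)"
      unfolding plus_fun_apply[of u v] trunc_add[symmetric] by (subst ru(2)[OF T], subst rv(2)[OF T]) (rule refl)
    then have "vrep (u + v) T = (\<lambda>x. vrep u T x + vrep v T x)"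
      by (rule vrep_unique[OF Vadd T Pol_add[OF ru(3)[OF T] rv(3)[OF T]]])
    then show "divg (vrep (u + v) T) x = ((\<lambda>T. divg (vrep u T)) + (\<lambda>T. divg (vrep v T))) T x"
      using divg_add[OF Pol_differentiable[OF ru(3)[OF T]] Pol_differentiable[OF rv(3)[OF T]]] by simp
  qed
  then show "div_pair (u + v) q = div_pair u q + div_pair v q"
    unfolding div_pair_eq[OF Vadd assms(4)] div_pair_eq[OF assms(1,4)] div_pair_eq[OF assms(2,4)]
    by (simp only: mesh_ip_add_left econt_divg assms econt_Q)
  have "mesh_ip Th (\<lambda>T. divg (vrep (r *\<^sub>R u) T)) q = mesh_ip Th (r *\<^sub>R (\<lambda>T. divg (vrep u T))) q"
  proof (rule mesh_ip_cong)
    fix T x assume T: "T \<in> Th" and x: "x \<in> T"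
    have "(r *\<^sub>R u) T = trunc T (\<lambda>x. r *\<^sub>R vrep u T x)"
      unfolding scaleR_fun_apply[of r u] trunc_scale[symmetric] by (subst ru(2)[OF T]) (rule refl)
    then have "vrep (r *\<^sub>R u) T = (\<lambda>x. r *\<^sub>R vrep u T x)"
      by (rule vrep_unique[OF Vsc T Pol_scale[OF ru(3)[OF T]]])
    then show "divg (vrep (r *\<^sub>R u) T) x = (r *\<^sub>R (\<lambda>T. divg (vrep u T))) T x"
      using divg_scale[OF Pol_differentiable[OF ru(3)[OF T]]] by simp
  qed
  then show "div_pair (r *\<^sub>R u) q = r * div_pair u q"
    unfolding div_pair_eq[OF Vsc assms(4)] div_pair_eq[OF assms(1,4)] mesh_ip_scale_left .
  show "div_pair u (p + q) = div_pair u p + div_pair u q"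
    unfolding div_pair_eq[OF assms(1) Qadd] div_pair_eq[OF assms(1,3)] div_pair_eq[OF assms(1,4)]
    using mesh_ip_add_left[OF econt_Q[OF assms(3)] econt_Q[OF assms(4)] econt_divg[OF assms(1)]] by (simp only: mesh_ip_commute)
  show "div_pair u (r *\<^sub>R q) = r * div_pair u q"
    unfolding div_pair_def using mesh_ip_scale_left by (metis mesh_ip_commute)
qed

section \<open>The symmetric form on the product space\<close>

definition S :: "(((real^'n) set \<Rightarrow> real^'n \<Rightarrow> real^'n) \<times> ((real^'n) set \<Rightarrow> real^'n \<Rightarrow> real^'n) \<times> ((real^'n) set \<Rightarrow> real^'n \<Rightarrow> real)) set" where
  "S = V \<times> Lam \<times> Q"

abbreviation "stress x \<equiv> D (fst x) (fst (snd x))"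

text \<open>The sum of both equations of the mixed method, with the constraint tested by the
  pressure component of \<open>y\<close>. It is symmetric, so linearity in one argument gives the
  other.\<close>

definition form where
  "form x y = mesh_ip Th (stress x) (stress y) + div_pair (fst y) (snd (snd x)) + div_pair (fst x) (snd (snd y))"

lemma S_D: "x \<in> S \<Longrightarrow> fst x \<in> V" "x \<in> S \<Longrightarrow> fst (snd x) \<in> Lam" "x \<in> S \<Longrightarrow> snd (snd x) \<in> Q"
  by (auto simp: S_def)

lemma stress_add: "x \<in> S \<Longrightarrow> y \<in> S \<Longrightarrow> stress (x + y) = stress x + stress y"
  unfolding fst_add snd_add by (rule dev_grad_w_add) (auto intro: admissible dest: S_D)

lemma stress_scale: "x \<in> S \<Longrightarrow> stress (r *\<^sub>R x) = r *\<^sub>R stress x"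
  unfolding fst_scaleR snd_scaleR by (rule dev_grad_w_scale) (auto intro: admissible dest: S_D)

lemma stress_mem: "x \<in> S \<Longrightarrow> stress x \<in> Sigma_disc Th (int k)"
  by (rule dev_grad_w_char(1)) (auto intro: admissible dest: S_D)

lemma econt_stress: "x \<in> S \<Longrightarrow> econt (stress x)"
  by (rule econt_Sigma_disc[OF stress_mem])

lemma subspace_S: "subspace S"
  unfolding S_def by (intro subspace_Times subspace_V subspace_Lam subspace_Q)

lemma form_commute: "form x y = form y x"
  unfolding form_def by (simp add: mesh_ip_commute)

lemma mesh_ip_zero: "mesh_ip Th 0 f = 0" "mesh_ip Th f 0 = 0"
  by (simp_all add: mesh_ip_def ip_def)

lemma zero_mem: "0 \<in> V" "0 \<in> Lam" "0 \<in> Q"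
  using subspace_0 subspace_V subspace_Lam subspace_Q by blast+

lemma div_pair_zero: "q \<in> Q \<Longrightarrow> div_pair 0 q = 0" "v \<in> V \<Longrightarrow> div_pair v 0 = 0"
  using div_pair_linear(2)[OF zero_mem(1,1,3), of q 0] div_pair_linear(4)[OF _ zero_mem(1,3,3), of v 0] by simp_all

lemma dev_grad_zero: "D 0 0 = 0"
  using dev_grad_w_scale[OF admissible[OF zero_mem(1,2)], of "int k" 0] by simp

lemma nondegenerate: "nondegenerate_form S form"
proof unfold_locales
  show "subspace S" by (rule subspace_S)
  show "findim S" unfolding S_def by (intro findim_Times findim_V findim_Lam findim_Q)
  show al: "form (x + y) z = form x z + form y z" if "x \<in> S" "y \<in> S" "z \<in> S" for x y z
    unfolding form_def stress_add[OF that(1,2)]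
    unfolding mesh_ip_add_left[OF econt_stress[OF that(1)] econt_stress[OF that(2)] econt_stress[OF that(3)]]
      fst_add snd_add div_pair_linear(1)[OF S_D(1)[OF that(1)] S_D(1)[OF that(2)] S_D(3)[OF that(3)] S_D(3)[OF that(3)]]
      div_pair_linear(3)[OF S_D(1)[OF that(3)] S_D(1)[OF that(3)] S_D(3)[OF that(1)] S_D(3)[OF that(2)]] by simp
  show sl: "form (r *\<^sub>R x) z = r * form x z" if "x \<in> S" "z \<in> S" for x z r
    unfolding form_def stress_scale[OF that(1)] unfolding mesh_ip_scale_left
      fst_scaleR snd_scaleR div_pair_linear(2)[OF S_D(1)[OF that(1)] S_D(1)[OF that(1)] S_D(3)[OF that(2)] S_D(3)[OF that(2)]]
      div_pair_linear(4)[OF S_D(1)[OF that(2)] S_D(1)[OF that(2)] S_D(3)[OF that(1)] S_D(3)[OF that(1)]] by (simp add: algebra_simps)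
  show "form z (x + y) = form z x + form z y" if "x \<in> S" "y \<in> S" "z \<in> S" for x y z
    unfolding form_commute[of z] by (rule al[OF that])
  show "form z (r *\<^sub>R x) = r * form z x" if "x \<in> S" "z \<in> S" for x z r
    unfolding form_commute[of z] by (rule sl[OF that])
  fix x assume x: "x \<in> S" and z: "\<And>y. y \<in> S \<Longrightarrow> form x y = 0"
  obtain u lam p where xe: "x = (u, lam, p)" by (cases x)
  have m: "u \<in> V" "lam \<in> Lam" "p \<in> Q" using x by (auto simp: xe S_def)
  have D0: "D u lam = 0"
  proof -
    have np: "(-1) *\<^sub>R p \<in> Q" by (rule subspace_scale[OF subspace_Q m(3)])
    \<comment> \<open>With the opposite sign for the pressure the two divergence terms cancel and
      only the squared norm of the weak gradient remains.\<close>
    have "form x (u, lam, (-1) *\<^sub>R p) = mesh_ip Th (D u lam) (D u lam) + div_pair u p + (-1) * div_pair u p"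
      unfolding form_def xe fst_conv snd_conv div_pair_linear(4)[OF m(1,1,3,3)] ..
    moreover have "(u, lam, (-1) *\<^sub>R p) \<in> S" using m np by (simp add: S_def)
    ultimately have "mesh_ip Th (D u lam) (D u lam) = 0" using z by fastforce
    then have on: "D u lam T y = 0" if "T \<in> Th" "y \<in> T" for T y
      by (rule mesh_ip_self_eq_0[OF econt_stress[OF x, unfolded xe fst_conv snd_conv] _ that])
    have "D u lam \<in> Sigma_disc Th (int k)" using stress_mem[OF x] by (simp add: xe)
    then have off: "D u lam T y = 0" if "T \<notin> Th \<or> y \<notin> T" for T y
      using that by (cases "T \<in> Th") (auto simp: Sigma_disc_def family_space_def P_space_def)
    show ?thesis using on off by (intro ext) (metis zero_fun_apply)
  qed
  have zq: "mesh_ip Th (\<lambda>T. divg (u T)) q = 0" if q: "q \<in> Q" for q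
  proof -
    have "(0, 0, q) \<in> S" using zero_mem q by (simp add: S_def)
    from z[OF this] show ?thesis
      unfolding form_def xe fst_conv snd_conv D0 mesh_ip_zero div_pair_zero(1)[OF m(3)] by (simp add: div_pair_def)
  qed
  have u0: "u = 0" "lam = 0" using kernel_trivial[OF m(1,2) D0 divg_zero[OF m(1) zq]] by blast+
  have "p = 0"
  proof (rule inf_sup[OF m(3)])
    fix v assume v: "v \<in> V"
    have "(v, 0, 0) \<in> S" using zero_mem v by (simp add: S_def)
    from z[OF this] show "mesh_ip Th (\<lambda>T. divg (v T)) p = 0"
      unfolding form_def xe fst_conv snd_conv D0
      unfolding mesh_ip_zero u0(1) div_pair_zero(1)[OF zero_mem(3)] by (simp add: div_pair_def)
  qed
  then show "x = 0" using u0 by (simp add: xe zero_prod_def)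
qed

abbreviation "load f v \<equiv> mesh_ip Th (\<lambda>_. f) v"

lemma load_linear:
  assumes f: "f \<in> L2 \<Omega>" and v: "v \<in> V" "w \<in> V"
  shows "load f (v + w) = load f v + load f w" "load f (r *\<^sub>R v) = r * load f v"
proof -
  have c: "continuous_on T (v T)" "continuous_on T (w T)" if "T \<in> Th" for T
    using econt_V v that by (auto simp: econt_def)
  have "ip T f ((v + w) T) = ip T f (v T) + ip T f (w T)" if "T \<in> Th" for T
    unfolding ip_def plus_fun_apply inner_add_right
    by (rule Bochner_Integration.integral_add) (rule load_integrable(1)[OF f that] c[OF that])+
  then show "load f (v + w) = load f v + load f w" unfolding mesh_ip_def sum.distrib[symmetric] by (intro sum.cong refl)
  show "load f (r *\<^sub>R v) = r * load f v" unfolding mesh_ip_commute[of "\<lambda>_. f"] mesh_ip_scale_left ..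
qed

text \<open>The two equations are recovered from the sum by testing with vanishing pressure, or with
  vanishing velocity and multiplier.\<close>

lemma mixed_solution_iff:
  assumes f: "f \<in> L2 \<Omega>"
  shows "mixed_solution \<Omega> Th nF (int k) l f u lam p \<longleftrightarrow>
    (u, lam, p) \<in> S \<and> (\<forall>y\<in>S. form (u, lam, p) y = load f (fst y))"
proof (intro iffI conjI ballI)
  assume m: "mixed_solution \<Omega> Th nF (int k) l f u lam p"
  then show "(u, lam, p) \<in> S" by (simp add: mixed_solution_def S_def)
  fix y assume y: "y \<in> S"
  show "form (u, lam, p) y = load f (fst y)"
    using m S_D[OF y] unfolding mixed_solution_def form_def div_pair_def fst_conv snd_conv by (metis add.right_neutral)
next
  assume m: "(u, lam, p) \<in> S \<and> (\<forall>y\<in>S. form (u, lam, p) y = load f (fst y))"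
  then have mem: "u \<in> V" "lam \<in> Lam" "p \<in> Q" by (auto simp: S_def)
  show "mixed_solution \<Omega> Th nF (int k) l f u lam p"
    unfolding mixed_solution_def
  proof (intro conjI ballI mem)
    fix v \<mu> assume v: "v \<in> V" "\<mu> \<in> Lam"
    then have "(v, \<mu>, 0) \<in> S" using zero_mem by (simp add: S_def)
    then have "form (u, lam, p) (v, \<mu>, 0) = load f v" using m by fastforce
    then show "mesh_ip Th (D u lam) (D v \<mu>) + mesh_ip Th (\<lambda>T. divg (v T)) p = load f v"
      unfolding form_def fst_conv snd_conv div_pair_zero(2)[OF mem(1)] by (simp add: div_pair_def)
  next
    fix q assume q: "q \<in> Q"
    then have "(0, 0, q) \<in> S" using zero_mem by (simp add: S_def)
    then have "form (u, lam, p) (0, 0, q) = load f 0" using m by fastforce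
    then show "mesh_ip Th (\<lambda>T. divg (u T)) q = 0"
      unfolding form_def fst_conv snd_conv dev_grad_zero mesh_ip_zero div_pair_zero(1)[OF mem(3)] by (simp add: div_pair_def)
  qed
qed

lemma mixed_solution_exists:
  assumes f: "f \<in> L2 \<Omega>"
  shows "\<exists>!(u, lam, p). mixed_solution \<Omega> Th nF (int k) l f u lam p"
proof -
  have "\<exists>!x. x \<in> S \<and> (\<forall>y\<in>S. form x y = load f (fst y))"
    by (rule nondegenerate_form.solution_exists[OF nondegenerate])
      (simp_all add: load_linear[OF f S_D(1) S_D(1)])
  moreover have "(\<lambda>(u, lam, p). mixed_solution \<Omega> Th nF (int k) l f u lam p) =
      (\<lambda>x. x \<in> S \<and> (\<forall>y\<in>S. form x y = load f (fst y)))"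
  proof
    fix x :: "((real^'n) set \<Rightarrow> real^'n \<Rightarrow> real^'n) \<times> ((real^'n) set \<Rightarrow> real^'n \<Rightarrow> real^'n) \<times> ((real^'n) set \<Rightarrow> real^'n \<Rightarrow> real)"
    show "(case x of (u, lam, p) \<Rightarrow> mixed_solution \<Omega> Th nF (int k) l f u lam p) =
        (x \<in> S \<and> (\<forall>y\<in>S. form x y = load f (fst y)))"
      by (cases x) (simp only: prod.case mixed_solution_iff[OF f])
  qed
  ultimately show ?thesis by simp
qed

section \<open>Boundedness of the map from data to solution\<close>

definition face_ip where
  "face_ip \<mu> \<nu> = (\<Sum>F\<in>interior_faces \<Omega> Th. face_integral F (nF F) (\<lambda>x. \<mu> F x \<bullet> \<nu> F x))"

lemma face_ip_linear:
  assumes "\<mu> \<in> Lam" "\<nu> \<in> Lam" "\<xi> \<in> Lam"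
  shows "face_ip (\<mu> + \<nu>) \<xi> = face_ip \<mu> \<xi> + face_ip \<nu> \<xi>" "face_ip (r *\<^sub>R \<mu>) \<xi> = r * face_ip \<mu> \<xi>" "0 \<le> face_ip \<mu> \<mu>"
proof -
  have c: "continuous_on F (\<lambda>x. \<mu> F x \<bullet> \<xi> F x)" "continuous_on F (\<lambda>x. \<nu> F x \<bullet> \<xi> F x)" "continuous_on F (\<lambda>x. \<mu> F x \<bullet> \<mu> F x)" for F
    by (intro continuous_intros Lam_continuous assms)+
  note ff = face_functional[OF interior_face_mesh]
  show "face_ip (\<mu> + \<nu>) \<xi> = face_ip \<mu> \<xi> + face_ip \<nu> \<xi>"
    unfolding face_ip_def sum.distrib[symmetric] plus_fun_apply inner_add_left by (intro sum.cong refl ff(1) c)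
  show "face_ip (r *\<^sub>R \<mu>) \<xi> = r * face_ip \<mu> \<xi>"
    unfolding face_ip_def sum_distrib_left scaleR_fun_apply inner_scaleR_left by (intro sum.cong refl ff(2) c)
  show "0 \<le> face_ip \<mu> \<mu>" unfolding face_ip_def by (intro sum_nonneg ff(6) c) simp_all
qed

text \<open>The squares of the four norms in \<open>well_posed\<close>, as one symmetric form to
  which \<open>solution_bound\<close> applies.\<close>

definition energy where
  "energy x y = mesh_ip Th (stress x) (stress y) + mesh_ip Th (fst x) (fst y) + face_ip (fst (snd x)) (fst (snd y))
    + mesh_ip Th (snd (snd x)) (snd (snd y))"

lemma mixed_solution_bound:
  "\<exists>C. \<forall>f\<in>L2 \<Omega>. \<forall>u lam p. mixed_solution \<Omega> Th nF (int k) l f u lam p \<longrightarrow>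
    mesh_norm Th (D u lam) + mesh_norm Th u + face_norm \<Omega> Th nF lam + mesh_norm Th p \<le> C * sqrt (ip \<Omega> f f)"
proof -
  interpret B: nondegenerate_form S form by (rule nondegenerate)
  have sym: "energy x y = energy y x" for x y
    unfolding energy_def face_ip_def by (simp add: mesh_ip_commute inner_commute)
  have add: "energy (x + y) z = energy x z + energy y z" if "x \<in> S" "y \<in> S" "z \<in> S" for x y z
    unfolding energy_def stress_add[OF that(1,2)]
    unfolding fst_add snd_add
      mesh_ip_add_left[OF econt_stress[OF that(1)] econt_stress[OF that(2)] econt_stress[OF that(3)]]
      mesh_ip_add_left[OF econt_V[OF S_D(1)[OF that(1)]] econt_V[OF S_D(1)[OF that(2)]] econt_V[OF S_D(1)[OF that(3)]]]
      mesh_ip_add_left[OF econt_Q[OF S_D(3)[OF that(1)]] econt_Q[OF S_D(3)[OF that(2)]] econt_Q[OF S_D(3)[OF that(3)]]]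
      face_ip_linear(1)[OF S_D(2)[OF that(1)] S_D(2)[OF that(2)] S_D(2)[OF that(3)]] by simp
  have scale: "energy (r *\<^sub>R x) z = r * energy x z" if "x \<in> S" "z \<in> S" for x z r
    unfolding energy_def stress_scale[OF that(1)] unfolding fst_scaleR snd_scaleR mesh_ip_scale_left
      face_ip_linear(2)[OF S_D(2)[OF that(1)] S_D(2)[OF that(1)] S_D(2)[OF that(2)]] by (simp add: algebra_simps)
  \<comment> \<open>By Cauchy-Schwarz on each element the load is at most the norm of
    \<open>f\<close> times \<open>N y\<close>; as \<open>N\<close> does not involve
    \<open>f\<close>, neither does the resulting constant.\<close>
  define N where "N y = (\<Sum>T\<in>Th. sqrt (ip T (fst y T) (fst y T)))"
    for y :: "((real^'n) set \<Rightarrow> real^'n \<Rightarrow> real^'n) \<times> ((real^'n) set \<Rightarrow> real^'n \<Rightarrow> real^'n) \<times> ((real^'n) set \<Rightarrow> real^'n \<Rightarrow> real)"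
  have "\<exists>C. \<forall>F G w. w \<in> S \<longrightarrow> (\<forall>y\<in>S. form w y = F y) \<longrightarrow> 0 \<le> G \<longrightarrow>
      (\<forall>y\<in>S. \<bar>F y\<bar> \<le> G * N y) \<longrightarrow> energy w w \<le> C * G\<^sup>2"
    by (rule B.solution_bound[of "\<lambda>w. energy w w" energy N, OF form_sum[OF subspace_S sym add scale]]) blast+
  then obtain C where C: "\<And>F G w. w \<in> S \<Longrightarrow> \<forall>y\<in>S. form w y = F y \<Longrightarrow> 0 \<le> G \<Longrightarrow>
      \<forall>y\<in>S. \<bar>F y\<bar> \<le> G * N y \<Longrightarrow> energy w w \<le> C * G\<^sup>2" by blast
  \<comment> \<open>Each of the four norms is at most the square root of the energy, which explains
    the factor 4.\<close>
  have "mesh_norm Th (D u lam) + mesh_norm Th u + face_norm \<Omega> Th nF lam + mesh_norm Th p \<le> 4 * sqrt C * sqrt (ip \<Omega> f f)"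
    if f: "f \<in> L2 \<Omega>" and m: "mixed_solution \<Omega> Th nF (int k) l f u lam p" for f u lam p
  proof -
    have w: "(u, lam, p) \<in> S" "\<forall>y\<in>S. form (u, lam, p) y = load f (fst y)"
      using m mixed_solution_iff[OF f] by blast+
    have G: "0 \<le> ip \<Omega> f f" by (rule ip_self_nonneg)
    have "energy (u, lam, p) (u, lam, p) \<le> C * (sqrt (ip \<Omega> f f))\<^sup>2"
    proof (rule C[OF w], goal_cases)
      case 1
      show ?case using G by simp
    next
      case 2
      show ?case
      proof
      fix y assume y: "y \<in> S"
      have "\<bar>load f (fst y)\<bar> \<le> (\<Sum>T\<in>Th. \<bar>ip T f (fst y T)\<bar>)" unfolding mesh_ip_def by (rule sum_abs)
      also have "\<dots> \<le> (\<Sum>T\<in>Th. sqrt (ip \<Omega> f f) * sqrt (ip T (fst y T) (fst y T)))"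
        using econt_V[OF S_D(1)[OF y]] by (intro sum_mono load_bound[OF f]) (auto simp: econt_def)
      also have "\<dots> = sqrt (ip \<Omega> f f) * N y" unfolding N_def sum_distrib_left ..
      finally show "\<bar>load f (fst y)\<bar> \<le> sqrt (ip \<Omega> f f) * N y" .
      qed
    qed
    then have E: "mesh_ip Th (D u lam) (D u lam) + mesh_ip Th u u + face_ip lam lam + mesh_ip Th p p \<le> C * ip \<Omega> f f"
      using G unfolding energy_def by simp
    note nn = mesh_ip_self_nonneg[of "D u lam"] mesh_ip_self_nonneg[of u] mesh_ip_self_nonneg[of p]
      face_ip_linear(3)[OF S_D(2)[OF w(1)] S_D(2)[OF w(1)] S_D(2)[OF w(1)], unfolded fst_conv snd_conv]
    have "sqrt (mesh_ip Th (D u lam) (D u lam)) \<le> sqrt (C * ip \<Omega> f f)" "sqrt (mesh_ip Th u u) \<le> sqrt (C * ip \<Omega> f f)"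
      "sqrt (face_ip lam lam) \<le> sqrt (C * ip \<Omega> f f)" "sqrt (mesh_ip Th p p) \<le> sqrt (C * ip \<Omega> f f)"
      using E nn by (intro real_sqrt_le_mono; linarith)+
    then show ?thesis unfolding mesh_norm_def face_norm_def face_ip_def[symmetric] real_sqrt_mult by linarith
  qed
  then show ?thesis by (intro exI[of _ "4 * sqrt C"]) blast
qed

lemma well_posed: "well_posed \<Omega> Th nF (int k) l"
  unfolding well_posed_def using mixed_solution_exists mixed_solution_bound by blast

text \<open>The jump of the tangential-normal component is itself a tangential polynomial of degree
  \<open>k\<close> on each interior face, hence an admissible multiplier. Testing with it and zero
  velocity turns the duality into a vanishing sum of squares.\<close>

lemma stress_tangential_continuous:
  assumes \<sigma>: "\<sigma> \<in> Sigma_disc Th (int k)"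
    and z: "\<And>\<mu>. \<mu> \<in> Lam \<Longrightarrow> mesh_ip Th (D 0 \<mu>) \<sigma> = 0"
  shows "\<sigma> \<in> Sigma_tn \<Omega> Th nF (int k)"
proof -
  let ?j = "\<lambda>F x. jump Th nF (\<lambda>T y. tangential (nF F) (\<sigma> T y *v nF F)) F x"
  define \<mu> where "\<mu> F = (if F \<in> interior_faces \<Omega> Th then trunc F (?j F) else (\<lambda>_. 0))" for F
  have lin: "linear (\<lambda>A. tangential n (A *v n))" for n :: "real^'n"
    by (intro linearI) (simp_all add: matrix_vector_mult_add_rdistrib matrix_vector_scaleR tangential_add tangential_scale)
  have \<mu>L: "\<mu> \<in> Lam"
  proof -
    have "\<mu> F \<in> P_space (int k) F {w. w \<bullet> nF F = 0}" if F: "F \<in> interior_faces \<Omega> Th" for F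
    proof -
      note pm = plus_minus[OF F]
      have n1: "nF F \<bullet> nF F = 1" using nF_unit[OF interior_face_mesh[OF F]] by (simp add: dot_square_norm)
      have tn: "tangential (nF F) (A *v nF F) \<in> {w. w \<bullet> nF F = 0}" for A
        by (simp add: tangential_def inner_diff_left n1)
      obtain s where s: "s \<in> Pol (int k) traceless" "\<sigma> (posT F) = trunc (posT F) s"
        by (rule P_spaceE[OF Sigma_disc_mem[OF \<sigma> pm(1)] subspace_traceless])
      obtain t where t: "t \<in> Pol (int k) traceless" "\<sigma> (negT F) = trunc (negT F) t"
        by (rule P_spaceE[OF Sigma_disc_mem[OF \<sigma> pm(4)] subspace_traceless])
      let ?p = "\<lambda>x. tangential (nF F) (s x *v nF F) - tangential (nF F) (t x *v nF F)"
      have p: "?p \<in> Pol (int k) {w. w \<bullet> nF F = 0}"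
        by (rule Pol_diff[OF Pol_linear_image[OF lin tn s(1)] Pol_linear_image[OF lin tn t(1)]])
      have "trunc F (?j F) = trunc F ?p"
      proof
        fix x
        show "trunc F (?j F) x = trunc F ?p x"
        proof (cases "x \<in> F")
          case True
          then have "x \<in> posT F" "x \<in> negT F" using facet_subset_elem pm by blast+
          then show ?thesis using True by (simp add: jump_def s(2) t(2))
        qed simp
      qed
      then have "\<mu> F = trunc F ?p" using F by (simp add: \<mu>_def)
      then show ?thesis using p unfolding P_space_eq[OF subspace_normal] by blast
    qed
    then show ?thesis by (auto simp: Lambda_space_def family_space_def) (simp add: \<mu>_def)
  qed
  have c: "continuous_on F (\<lambda>x. \<mu> F x \<bullet> \<mu> F x)" for F by (intro continuous_intros Lam_continuous[OF \<mu>L])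
  have cj: "face_integral F (nF F) (\<lambda>x. \<mu> F x \<bullet> ?j F x) = face_integral F (nF F) (\<lambda>x. \<mu> F x \<bullet> \<mu> F x)"
    if F: "F \<in> interior_faces \<Omega> Th" for F
    by (rule face_functional(3)[OF interior_face_mesh[OF F] c, symmetric]) (simp add: \<mu>_def F)
  have d0: "div_w_pair \<Omega> Th nF \<sigma> 0 = 0"
  proof -
    have "face_integral F (nF F) (\<lambda>x. 0) = 0" if "F \<in> interior_faces \<Omega> Th" for F
      using face_functional(2)[OF interior_face_mesh[OF that] continuous_on_const, of 0 0] by simp
    then show ?thesis by (simp add: div_w_pair_def ip_def)
  qed
  have "(\<Sum>F\<in>interior_faces \<Omega> Th. face_integral F (nF F) (\<lambda>x. \<mu> F x \<bullet> ?j F x)) = 0"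
    using duality[OF zero_mem(1) \<mu>L \<sigma>] z[OF \<mu>L] d0 by linarith
  then have s0: "(\<Sum>F\<in>interior_faces \<Omega> Th. face_integral F (nF F) (\<lambda>x. \<mu> F x \<bullet> \<mu> F x)) = 0"
    by (simp only: cj cong: sum.cong)
  have nn: "0 \<le> face_integral F (nF F) (\<lambda>x. \<mu> F x \<bullet> \<mu> F x)" if "F \<in> interior_faces \<Omega> Th" for F
    by (rule face_functional(6)[OF interior_face_mesh[OF that] c]) simp
  have "?j F x = 0" if F: "F \<in> interior_faces \<Omega> Th" and x: "x \<in> F" for F x
  proof -
    have "face_integral F (nF F) (\<lambda>x. \<mu> F x \<bullet> \<mu> F x) = 0"
      by (rule iffD1[OF sum_nonneg_eq_0_iff[OF finite_interior_faces nn] s0, THEN bspec, OF _ F])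
    then have "\<mu> F x \<bullet> \<mu> F x = 0" by (rule face_functional(4)[OF interior_face_mesh[OF F] c _ _ x, rotated]) simp
    then show ?thesis using F x by (simp add: \<mu>_def)
  qed
  then show ?thesis using \<sigma> by (simp add: Sigma_tn_def)
qed

text \<open>For \<open>\<tau>\<close> in \<open>Sigma_tn\<close> the jump term in the duality
  vanishes, which gives the first relation. The second is the mixed equation for the pair of
  \<open>v\<close> and the zero multiplier.\<close>

lemma stress_formulation:
  assumes f: "f \<in> L2 \<Omega>" and m: "mixed_solution \<Omega> Th nF (int k) l f u lam p"
  shows "D u lam \<in> Sigma_tn \<Omega> Th nF (int k)" "u \<in> ker_div Th"
    and "\<tau> \<in> Sigma_tn \<Omega> Th nF (int k) \<Longrightarrow> mesh_ip Th (D u lam) \<tau> + div_w_pair \<Omega> Th nF \<tau> u = 0"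
    and "v \<in> V \<Longrightarrow> v \<in> ker_div Th \<Longrightarrow> div_w_pair \<Omega> Th nF (D u lam) v = - load f v"
proof -
  have mem: "u \<in> V" "lam \<in> Lam" "p \<in> Q" and
    eq1: "\<And>v \<mu>. v \<in> V \<Longrightarrow> \<mu> \<in> Lam \<Longrightarrow> mesh_ip Th (D u lam) (D v \<mu>) + mesh_ip Th (\<lambda>T. divg (v T)) p = load f v" and
    eq2: "\<And>q. q \<in> Q \<Longrightarrow> mesh_ip Th (\<lambda>T. divg (u T)) q = 0"
    using m by (auto simp: mixed_solution_def)
  have \<sigma>: "D u lam \<in> Sigma_disc Th (int k)" by (rule dev_grad_w_char(1)[OF admissible[OF mem(1,2)]])
  show "u \<in> ker_div Th" by (rule divg_zero_ker[OF mem(1) eq2])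
  show "D u lam \<in> Sigma_tn \<Omega> Th nF (int k)"
  proof (rule stress_tangential_continuous[OF \<sigma>])
    fix \<mu> assume "\<mu> \<in> Lam"
    from eq1[OF zero_mem(1) this] show "mesh_ip Th (D 0 \<mu>) (D u lam) = 0"
      using div_pair_zero(1)[OF mem(3)] unfolding mesh_ip_zero by (simp add: div_pair_def mesh_ip_commute)
  qed
  have jz: "face_integral F (nF F) (\<lambda>x. \<mu> F x \<bullet> g x) = 0" if "F \<in> interior_faces \<Omega> Th" "\<And>x. x \<in> F \<Longrightarrow> \<mu> F x \<bullet> g x = 0"
    for F g and \<mu> :: "(real^'n) set \<Rightarrow> real^'n \<Rightarrow> real^'n"
  proof -
    have "face_integral F (nF F) (\<lambda>x. \<mu> F x \<bullet> g x) = face_integral F (nF F) (\<lambda>x. 0 * 1)"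
      by (rule face_functional(3)[OF interior_face_mesh[OF that(1)], symmetric]) (simp_all add: that(2))
    then show ?thesis unfolding face_functional(2)[OF interior_face_mesh[OF that(1)] continuous_on_const] by simp
  qed
  show "mesh_ip Th (D u lam) \<tau> + div_w_pair \<Omega> Th nF \<tau> u = 0" if \<tau>: "\<tau> \<in> Sigma_tn \<Omega> Th nF (int k)"
  proof -
    have t: "\<tau> \<in> Sigma_disc Th (int k)" using \<tau> by (simp add: Sigma_tn_def)
    have "(\<Sum>F\<in>interior_faces \<Omega> Th. face_integral F (nF F)
        (\<lambda>x. lam F x \<bullet> jump Th nF (\<lambda>T y. tangential (nF F) (\<tau> T y *v nF F)) F x)) = 0"
      by (intro sum.neutral ballI jz) (use \<tau> in \<open>simp_all add: Sigma_tn_def\<close>)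
    then show ?thesis using duality[OF mem(1,2) t] by linarith
  qed
  show "div_w_pair \<Omega> Th nF (D u lam) v = - load f v" if v: "v \<in> V" "v \<in> ker_div Th"
  proof -
    have "(\<Sum>F\<in>interior_faces \<Omega> Th. face_integral F (nF F)
        (\<lambda>x. (0 :: (real^'n) set \<Rightarrow> real^'n \<Rightarrow> real^'n) F x \<bullet> jump Th nF (\<lambda>T y. tangential (nF F) (D u lam T y *v nF F)) F x)) = 0"
      by (intro sum.neutral ballI jz) simp_all
    then have "mesh_ip Th (D v 0) (D u lam) = - div_w_pair \<Omega> Th nF (D u lam) v"
      using duality[OF v(1) zero_mem(2) \<sigma>] by linarith
    \<comment> \<open>The pressure disappears because \<open>v\<close> is divergence free in the
      interior of each element, which suffices under the integral.\<close>
    moreover have "mesh_ip Th (\<lambda>T. divg (v T)) p = 0"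
    proof -
      have "ip T (divg (v T)) (p T) = ip T (\<lambda>x. 0) (p T)" if T: "T \<in> Th" for T
        by (rule ip_interior_cong[OF T continuous_on_const])
          (use econt_Q[OF mem(3)] v(2) T in \<open>auto simp: econt_def ker_div_def\<close>)
      then show ?thesis by (simp add: mesh_ip_def ip_zero_left)
    qed
    ultimately show ?thesis using eq1[OF v(1) zero_mem(2)] mesh_ip_commute[of "D u lam" "D v 0"] by linarith
  qed
qed

end

theorem theorem3p3:
  fixes \<Omega> :: "(real^'n) set" and \<M> :: "(real^'n) set set set" and Th :: "(real^'n) set set"
    and nF :: "(real^'n) set \<Rightarrow> real^'n" and k :: nat and l :: int
  assumes "CARD('n) \<ge> 2"
    and "polytopal_domain \<Omega>"
    and "shape_regular_family \<Omega> \<M>" and "Th \<in> \<M>"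
    and "face_normals \<Omega> Th nF"
    and "l = int k \<or> l = int k - 1"
  shows "well_posed \<Omega> Th nF (int k) l \<and>
    (\<forall>f\<in>L2 \<Omega>. \<forall>u lam p. mixed_solution \<Omega> Th nF (int k) l f u lam p \<longrightarrow>
      (let \<sigma> = dev_grad_w Th (int k) u lam in
         \<sigma> \<in> Sigma_tn \<Omega> Th nF (int k) \<and>
         u \<in> V_div0 \<Omega> Th nF (int k) l \<inter> ker_div Th \<and>
         (\<forall>\<tau>\<in>Sigma_tn \<Omega> Th nF (int k).
            mesh_ip Th \<sigma> \<tau> + div_w_pair \<Omega> Th nF \<tau> u = 0) \<and>
         (\<forall>v\<in>V_div0 \<Omega> Th nF (int k) l \<inter> ker_div Th.
            div_w_pair \<Omega> Th nF \<sigma> v = - mesh_ip Th (\<lambda>_. f) v)))"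
proof -
  interpret fem \<Omega> Th nF k l
    by unfold_locales (use assms in \<open>auto simp: shape_regular_family_def\<close>)
  show ?thesis
    unfolding Let_def
  proof (intro conjI ballI allI impI IntI)
    show "well_posed \<Omega> Th nF (int k) l" by (rule well_posed)
    fix f u lam p assume f: "f \<in> L2 \<Omega>" and m: "mixed_solution \<Omega> Th nF (int k) l f u lam p"
    note s = stress_formulation[OF f m]
    show "dev_grad_w Th (int k) u lam \<in> Sigma_tn \<Omega> Th nF (int k)" "u \<in> ker_div Th" by (rule s)+
    show "u \<in> V" using m by (simp add: mixed_solution_def)
    show "mesh_ip Th (dev_grad_w Th (int k) u lam) \<tau> + div_w_pair \<Omega> Th nF \<tau> u = 0"
      if "\<tau> \<in> Sigma_tn \<Omega> Th nF (int k)" for \<tau> by (rule s(3)[OF that])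
    show "div_w_pair \<Omega> Th nF (dev_grad_w Th (int k) u lam) v = - mesh_ip Th (\<lambda>_. f) v"
      if "v \<in> V \<inter> ker_div Th" for v using s(4) that by blast
  qed
qed

end
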